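(* Let $V(\cdot)$ denote either $V_0(\cdot)$ or $V_e(\cdot)$ (the same choice throughout), fix $k\ge1$, and let $I\subset(0,\pi)$ be an open interval such that $\lambda_k^\theta$ is a simple eigenvalue for every $\theta\in I$. Then $\theta\mapsto\lambda_k^\theta$ is differentiable on $I$ and \[ \frac{d\lambda_k^\theta}{d\theta}=-2\cot\theta\,\|u^\theta_y\|^2_{T^\theta}+2(u^\theta_x,u^\theta_y)_{T^\theta}\quad\text{for all }\theta\in I, \] where $u^\theta\in V(T^\theta)$ is an eigenfunction associated with $\lambda_k^\theta$ with $\|u^\theta\|_{T^\theta}=1$, and $u^\theta_x,u^\theta_y$ denote its partial derivatives.
   Context: For a triangle $T$ with edges $e_1,e_2,e_3$: $V_0(T):=\{v\in H^1(T): v=0 \text{ on } \partial T\}$, $V_e(T):=\{v\in H^1(T): \int_{e_i}v\,ds=0,\ i=1,2,3\}$. The eigenvalue problem: find $u\in V(T)\setminus\{0\}$, $\lambda>0$ with $(\nabla u,\nabla v)_T=\lambda(u,v)_T$ for all $v\in V(T)$, where $(\cdot,\cdot)_T$ and $\|\cdot\|_T$ are the $L^2(T)$ inner product and norm; eigenvalues $0<\lambda_1(T)\le\lambda_2(T)\le\cdots$ counted with multiplicity. For $\theta\in(0,\pi)$, $T^\theta$ is the triangle with vertices $(0,0)$, $(1,0)$, $(\cos\theta,\sin\theta)$ and $\lambda_k^\theta:=\lambda_k(T^\theta)$. *)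

theory Defs
  imports "HOL-Analysis.Analysis"
begin

type_synonym pt = "real \<times> real"

datatype bctype = Dirichlet | EdgeMean

definition tri :: "pt \<times> pt \<times> pt \<Rightarrow> pt set" where
  "tri V = convex hull {fst V, fst (snd V), snd (snd V)}"

definition Ttheta :: "real \<Rightarrow> pt \<times> pt \<times> pt" where
  "Ttheta \<theta> = ((0,0), (1,0), (cos \<theta>, sin \<theta>))"

definition C1_fun :: "(pt \<Rightarrow> real) \<Rightarrow> (pt \<Rightarrow> real) \<Rightarrow> (pt \<Rightarrow> real) \<Rightarrow> bool" where
  "C1_fun w wx wy \<longleftrightarrow>
     (\<forall>z. (w has_derivative (\<lambda>h. wx z * fst h + wy z * snd h)) (at z)) \<and>
     continuous_on UNIV wx \<and> continuous_on UNIV wy"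

definition L2 :: "pt set \<Rightarrow> (pt \<Rightarrow> real) \<Rightarrow> bool" where
  "L2 T u \<longleftrightarrow> u \<in> borel_measurable (lebesgue_on T) \<and> integrable (lebesgue_on T) (\<lambda>z. (u z)^2)"

definition ip :: "pt set \<Rightarrow> (pt \<Rightarrow> real) \<Rightarrow> (pt \<Rightarrow> real) \<Rightarrow> real" where
  "ip T u v = integral\<^sup>L (lebesgue_on T) (\<lambda>z. u z * v z)"

definition weak_grad :: "pt set \<Rightarrow> (pt \<Rightarrow> real) \<Rightarrow> (pt \<Rightarrow> real) \<Rightarrow> (pt \<Rightarrow> real) \<Rightarrow> bool" where
  "weak_grad T u ux uy \<longleftrightarrow> L2 T u \<and> L2 T ux \<and> L2 T uy \<and>
     (\<forall>\<phi> \<phi>x \<phi>y. C1_fun \<phi> \<phi>x \<phi>y \<and> compact (closure {z. \<phi> z \<noteq> 0}) \<and>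
        closure {z. \<phi> z \<noteq> 0} \<subseteq> interior T \<longrightarrow>
        ip T u \<phi>x = - ip T ux \<phi> \<and> ip T u \<phi>y = - ip T uy \<phi>)"

definition H1 :: "pt set \<Rightarrow> (pt \<Rightarrow> real) \<Rightarrow> bool" where
  "H1 T u \<longleftrightarrow> (\<exists>ux uy. weak_grad T u ux uy)"

definition h1dist2 :: "pt set \<Rightarrow> (pt \<Rightarrow> real) \<Rightarrow> (pt \<Rightarrow> real) \<Rightarrow> (pt \<Rightarrow> real)
    \<Rightarrow> (pt \<Rightarrow> real) \<Rightarrow> (pt \<Rightarrow> real) \<Rightarrow> (pt \<Rightarrow> real) \<Rightarrow> real" where
  "h1dist2 T u ux uy w wx wy =
     ip T (\<lambda>z. u z - w z) (\<lambda>z. u z - w z) + ip T (\<lambda>z. ux z - wx z) (\<lambda>z. ux z - wx z)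
     + ip T (\<lambda>z. uy z - wy z) (\<lambda>z. uy z - wy z)"

definition H1_approx :: "pt set \<Rightarrow> (pt \<Rightarrow> real) \<Rightarrow> (pt \<Rightarrow> real) \<Rightarrow> (pt \<Rightarrow> real)
    \<Rightarrow> (nat \<Rightarrow> pt \<Rightarrow> real) \<Rightarrow> (nat \<Rightarrow> pt \<Rightarrow> real) \<Rightarrow> (nat \<Rightarrow> pt \<Rightarrow> real) \<Rightarrow> bool" where
  "H1_approx T u ux uy w wx wy \<longleftrightarrow> (\<forall>n. C1_fun (w n) (wx n) (wy n)) \<and>
     (\<lambda>n. h1dist2 T u ux uy (w n) (wx n) (wy n)) \<longlonglongrightarrow> 0"

definition seg_int :: "pt \<Rightarrow> pt \<Rightarrow> (pt \<Rightarrow> real) \<Rightarrow> real" where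
  "seg_int p q f = integral\<^sup>L (lebesgue_on {0..1}) (\<lambda>t. f (p + t *\<^sub>R (q - p))) * norm (q - p)"

text \<open>Trace of u on edge [p,q] vanishes: the L^2(edge) norm of any H^1-approximating C^1 sequence
  tends to 0 (trace as continuous extension of restriction).\<close>
definition trace_zero :: "pt set \<Rightarrow> pt \<Rightarrow> pt \<Rightarrow> (pt \<Rightarrow> real) \<Rightarrow> bool" where
  "trace_zero T p q u \<longleftrightarrow> (\<exists>ux uy. weak_grad T u ux uy \<and>
     (\<forall>w wx wy. H1_approx T u ux uy w wx wy \<longrightarrow>
        (\<lambda>n. seg_int p q (\<lambda>z. (w n z)^2)) \<longlonglongrightarrow> 0))"

definition edge_int_zero :: "pt set \<Rightarrow> pt \<Rightarrow> pt \<Rightarrow> (pt \<Rightarrow> real) \<Rightarrow> bool" where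
  "edge_int_zero T p q u \<longleftrightarrow> (\<exists>ux uy. weak_grad T u ux uy \<and>
     (\<forall>w wx wy. H1_approx T u ux uy w wx wy \<longrightarrow>
        (\<lambda>n. seg_int p q (w n)) \<longlonglongrightarrow> 0))"

definition Vspace :: "bctype \<Rightarrow> pt \<times> pt \<times> pt \<Rightarrow> (pt \<Rightarrow> real) \<Rightarrow> bool" where
  "Vspace bc V u \<longleftrightarrow> (let A = fst V; B = fst (snd V); C = snd (snd V); T = tri V in
     H1 T u \<and>
     (case bc of
        Dirichlet \<Rightarrow> trace_zero T A B u \<and> trace_zero T B C u \<and> trace_zero T C A u
      | EdgeMean \<Rightarrow> edge_int_zero T A B u \<and> edge_int_zero T B C u \<and> edge_int_zero T C A u))"

definition eigenpair :: "bctype \<Rightarrow> pt \<times> pt \<times> pt \<Rightarrow> real \<Rightarrow> (pt \<Rightarrow> real) \<Rightarrow> bool" where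
  "eigenpair bc V lam u \<longleftrightarrow> (let T = tri V in
     lam > 0 \<and> Vspace bc V u \<and> ip T u u \<noteq> 0 \<and>
     (\<forall>ux uy v vx vy. weak_grad T u ux uy \<and> Vspace bc V v \<and> weak_grad T v vx vy \<longrightarrow>
        ip T ux vx + ip T uy vy = lam * ip T u v))"

text \<open>k-th eigenvalue counted with multiplicity: the least \<mu> such that there are k
  L^2-orthonormal eigenfunctions with eigenvalues \<le> \<mu>.\<close>
definition eig :: "bctype \<Rightarrow> pt \<times> pt \<times> pt \<Rightarrow> nat \<Rightarrow> real" where
  "eig bc V k = Inf {\<mu>. \<exists>S. finite S \<and> card S = k \<and>
     (\<forall>u\<in>S. \<exists>lam. lam \<le> \<mu> \<and> eigenpair bc V lam u) \<and>
     (\<forall>u\<in>S. \<forall>v\<in>S. ip (tri V) u v = (if u = v then 1 else 0))}"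

definition simple_eig :: "bctype \<Rightarrow> pt \<times> pt \<times> pt \<Rightarrow> real \<Rightarrow> bool" where
  "simple_eig bc V lam \<longleftrightarrow> (\<exists>u. eigenpair bc V lam u) \<and>
     \<not> (\<exists>u v. eigenpair bc V lam u \<and> eigenpair bc V lam v \<and>
           ip (tri V) u u = 1 \<and> ip (tri V) v v = 1 \<and> ip (tri V) u v = 0)"

end

theory Submission
  imports Defs "HOL-Complex_Analysis.Great_Picard" "HOL-Library.Diagonal_Subsequence"
begin

text \<open>
  The map \<open>(x, y) \<mapsto> (x + y cos \<theta>, y sin \<theta>)\<close> carries the reference triangle with vertices
  \<open>(0,0), (1,0), (0,1)\<close> onto the triangle of angle \<open>\<theta>\<close> and pulls the Dirichlet form, up to the constant
  Jacobian, back to \<open>D\<^sub>1 / (1 + cos \<theta>) + D\<^sub>2 / (1 - cos \<theta>)\<close>, where \<open>D\<^sub>1\<close> and \<open>D\<^sub>2\<close> are half the squared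
  norms of \<open>u\<^sub>x + u\<^sub>y\<close> and \<open>u\<^sub>x - u\<^sub>y\<close>; the space and the mass form no longer depend on \<open>\<theta>\<close>.
  Eigenfunctions are obtained by successive constrained minimisation, and the min-max principle bounds the
  quotient of \<open>k\<close>-th eigenvalues by the quotient of the forms, hence \<open>\<lambda>\<^sub>k\<close> is continuous. Testing the equations
  at \<open>t\<close> and \<open>\<theta>\<close> against each other's eigenfunctions gives
  \<open>(\<lambda>\<^sub>t - \<lambda>\<^sub>\<theta>) (u\<^sub>t, u\<^sub>\<theta>) = (a\<^sub>t - a\<^sub>\<theta>) (u\<^sub>t, u\<^sub>\<theta>)\<close>; by compactness and simplicity \<open>u\<^sub>t\<close> converges,
  along subsequences, to a multiple of \<open>u\<^sub>\<theta>\<close>, and the derivative of the form at \<open>u\<^sub>\<theta>\<close> is the derivative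
  of the eigenvalue.

  All the Sobolev theory (density of \<open>C\<^sup>1\<close> functions, uniqueness of weak gradients, Rellich compactness,
  constancy of functions with zero gradient) comes from one averaging operator,
  \<open>A\<^sub>e u (z) = \<integral> u ((1 - e) z + e y) k (y) dy\<close> with a smooth density \<open>k\<close> supported inside the convex set:
  it never leaves the set, commutes with the gradient up to the factor \<open>1 - e\<close>, and is within
  \<open>O(e)\<close> of the identity on \<open>H\<^sup>1\<close>.
\<close>

section \<open>Semi-inner products\<close>

text \<open>The two forms come from linear algebra. On the reference triangle the Dirichlet
  integrand of angle \<theta> is (u_x^2 - 2 cos \<theta> u_x u_y + u_y^2) / sin^2 \<theta>; its
  matrix has the eigenvectors (1,1) and (1,-1) for every \<theta>, with eigenvalues 1/(1 + cos
  \<theta>) and 1/(1 - cos \<theta>). Only these two weights move with \<theta>, so comparing the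
  forms at two angles means comparing two pairs of numbers. Two obstacles shape the proof.
  Compactness makes the eigenfunctions of nearby angles converge in L2 only; the eigenvalue equation
  itself, tested with their differences, upgrades this to convergence in energy, without which the
  limit would not be known to be an eigenfunction. And the definitions speak of all C1 sequences
  converging in H1 and of weak gradients that are determined only almost everywhere. The trace
  inequality turns the first into a closed linear condition; uniqueness of weak gradients makes the
  forms independent of the gradient chosen.\<close>

lemma discriminant_le:
  fixes p q r :: real
  assumes nonneg: "\<And>t. 0 \<le> p - 2 * t * q + t\<^sup>2 * r" and "0 \<le> r"
  shows "q\<^sup>2 \<le> p * r"
proof (cases "r = 0")
  case True
  have "q = 0"
  proof (rule ccontr)
    assume "q \<noteq> 0"
    \<comment> \<open>This \<open>t\<close> makes \<open>p - 2 * t * q\<close> equal to -1: without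
      a quadratic term a nonzero slope would produce negative values.\<close>
    then show False using nonneg[of "(p + 1) / (2 * q)"] True by (simp add: field_simps)
  qed
  then show ?thesis using True by simp
next
  case False
  then show ?thesis using nonneg[of "q / r"] \<open>0 \<le> r\<close> by (simp add: field_simps power2_eq_square)
qed

text \<open>Definiteness is left out on purpose: in the application, representatives of one
  almost-everywhere class are different vectors at distance zero.\<close>

locale semi_inner =
  fixes b :: "'a::real_vector \<Rightarrow> 'a \<Rightarrow> real"
  assumes linear_right: "linear (b x)"
    and commute: "b x y = b y x"
    and nonneg: "0 \<le> b x x"
begin

lemma add_right: "b x (y + z) = b x y + b x z"
  using linear_right by (rule linear_add)

lemma add_left: "b (y + z) x = b y x + b z x"
  by (metis add_right commute)

lemma diff_right: "b x (y - z) = b x y - b x z"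
  using linear_right by (rule linear_diff)

lemma diff_left: "b (y - z) x = b y x - b z x"
  by (metis diff_right commute)

lemma scale_right: "b x (c *\<^sub>R y) = c * b x y"
  using linear_right[of x] by (simp add: linear_scale)

lemma scale_left: "b (c *\<^sub>R y) x = c * b y x"
  by (metis scale_right commute)

lemma sum_right: "b x (\<Sum>i\<in>I. f i) = (\<Sum>i\<in>I. b x (f i))"
  using linear_right by (rule linear_sum)

lemma sum_left: "b (\<Sum>i\<in>I. f i) x = (\<Sum>i\<in>I. b (f i) x)"
  by (metis (mono_tags, lifting) sum_right commute sum.cong)

lemmas bilinear_simps = add_right add_left diff_right diff_left scale_right scale_left

lemma Cauchy_Schwarz: "(b x y)\<^sup>2 \<le> b x x * b y y"
proof (rule discriminant_le)
  fix t :: real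
  have "0 \<le> b (x - t *\<^sub>R y) (x - t *\<^sub>R y)" by (rule nonneg)
  then show "0 \<le> b x x - 2 * t * b x y + t\<^sup>2 * b y y"
    by (simp add: bilinear_simps commute[of y x] power2_eq_square algebra_simps)
qed (rule nonneg)

lemma Cauchy_Schwarz_sqrt: "\<bar>b x y\<bar> \<le> sqrt (b x x) * sqrt (b y y)"
  using real_sqrt_le_mono[OF Cauchy_Schwarz[of x y]] by (simp add: real_sqrt_mult)

lemma tendsto_left:
  assumes "(\<lambda>n. b (x n - x') (x n - x')) \<longlonglongrightarrow> 0"
  shows "(\<lambda>n. b (x n) y) \<longlonglongrightarrow> b x' y"
proof -
  have "(\<lambda>n. b (x n - x') y) \<longlonglongrightarrow> 0"
  proof (rule tendsto_rabs_zero_cancel, rule tendsto_sandwich[OF _ _ tendsto_const])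
    show "(\<lambda>n. sqrt (b (x n - x') (x n - x')) * sqrt (b y y)) \<longlonglongrightarrow> 0"
      using tendsto_mult_right[OF tendsto_real_sqrt[OF assms], of "sqrt (b y y)"] by simp
  qed (auto intro!: always_eventually Cauchy_Schwarz_sqrt)
  then have "(\<lambda>n. b (x n - x') y + b x' y) \<longlonglongrightarrow> 0 + b x' y"
    by (intro tendsto_intros)
  then show ?thesis by (simp add: diff_left)
qed

lemma tendsto_norm:
  assumes "(\<lambda>n. b (x n - x') (x n - x')) \<longlonglongrightarrow> 0"
  shows "(\<lambda>n. b (x n) (x n)) \<longlonglongrightarrow> b x' x'"
proof -
  have "(\<lambda>n. b (x n - x') (x n - x') + 2 * b (x n) x' - b x' x') \<longlonglongrightarrow> 0 + 2 * b x' x' - b x' x'"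
    by (intro tendsto_intros assms tendsto_left)
  then show ?thesis by (simp add: bilinear_simps commute[of x' "x _"])
qed

end

lemma semi_inner_lincomb:
  assumes "semi_inner d" "semi_inner e" "0 \<le> p" "0 \<le> q"
  shows "semi_inner (\<lambda>x y. p * d x y + q * e x y)"
proof -
  interpret d: semi_inner d by fact
  interpret e: semi_inner e by fact
  show ?thesis
  proof (rule semi_inner.intro)
    show "linear (\<lambda>y. p * d x y + q * e x y)" for x
      by (rule linearI) (simp_all add: d.bilinear_simps e.bilinear_simps algebra_simps)
    show "p * d x y + q * e x y = p * d y x + q * e y x" for x y
      by (simp add: d.commute[of x] e.commute[of x])
    show "0 \<le> p * d x x + q * e x x" for x
      using assms d.nonneg e.nonneg by simp
  qed
qed

text \<open>Gaussian elimination by induction on the number of equations: a pivot in the last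
  equation eliminates one unknown. This is the dimension count behind min-max: a span contains a
  nonzero element orthogonal to any smaller number of vectors than it has independent
  generators.\<close>

lemma nontrivial_kernel:
  fixes M :: "nat \<Rightarrow> 'j \<Rightarrow> real"
  assumes "finite J" "m < card J"
  shows "\<exists>c. (\<exists>j\<in>J. c j \<noteq> 0) \<and> (\<forall>i<m. (\<Sum>j\<in>J. M i j * c j) = 0)"
  using assms
proof (induction m arbitrary: J M)
  case 0
  then have "J \<noteq> {}" by auto
  then show ?case by (intro exI[of _ "\<lambda>_. 1"]) auto
next
  case (Suc m)
  show ?case
  proof (cases "\<forall>j\<in>J. M m j = 0")
    case True
    from Suc.IH[of J M] Suc.prems obtain c
      where "\<exists>j\<in>J. c j \<noteq> 0" "\<forall>i<m. (\<Sum>j\<in>J. M i j * c j) = 0" by auto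
    then show ?thesis using True by (intro exI[of _ c]) (auto simp: less_Suc_eq)
  next
    case False
    then obtain p where p: "p \<in> J" "M m p \<noteq> 0" by auto
    \<comment> \<open>Row \<open>i\<close> after subtracting the multiple of row \<open>m\<close>
      that clears column \<open>p\<close>.\<close>
    define N where "N i j = M i j - M i p * M m j / M m p" for i j
    have "finite (J - {p})" "m < card (J - {p})" using Suc.prems p by auto
    from Suc.IH[OF this, of N] obtain c
      where c: "\<exists>j\<in>J-{p}. c j \<noteq> 0" "\<forall>i<m. (\<Sum>j\<in>J-{p}. N i j * c j) = 0" by auto
    define S where "S = (\<Sum>j\<in>J-{p}. M m j * c j)"
    \<comment> \<open>Row \<open>m\<close> forces the value at the pivot; elimination makes it
      consistent with the other rows.\<close>
    define c' where "c' = c(p := - S / M m p)"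
    have split: "(\<Sum>j\<in>J. M i j * c' j) = (\<Sum>j\<in>J-{p}. M i j * c j) - M i p * S / M m p" for i
    proof -
      have "(\<Sum>j\<in>J. M i j * c' j) = M i p * c' p + (\<Sum>j\<in>J-{p}. M i j * c' j)"
        using Suc.prems p by (intro sum.remove) auto
      also have "(\<Sum>j\<in>J-{p}. M i j * c' j) = (\<Sum>j\<in>J-{p}. M i j * c j)"
        by (intro sum.cong) (auto simp: c'_def)
      finally show ?thesis by (simp add: c'_def)
    qed
    have "(\<Sum>j\<in>J. M i j * c' j) = 0" if "i < m" for i
    proof -
      have "0 = (\<Sum>j\<in>J-{p}. N i j * c j)" using c that by simp
      also have "\<dots> = (\<Sum>j\<in>J-{p}. M i j * c j) - M i p / M m p * S"
        unfolding S_def N_def sum_distrib_left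
        by (simp add: algebra_simps sum_subtractf)
      finally show ?thesis using split[of i] by simp
    qed
    moreover have "(\<Sum>j\<in>J. M m j * c' j) = 0"
      using split[of m] p by (simp add: S_def)
    moreover have "\<exists>j\<in>J. c' j \<noteq> 0" using c(1) by (auto simp: c'_def)
    ultimately show ?thesis by (intro exI[of _ c']) (auto simp: less_Suc_eq)
  qed
qed

section \<open>Eigenvalues of a compact pair of forms\<close>

definition orthonormal_family :: "('a \<Rightarrow> 'a \<Rightarrow> real) \<Rightarrow> 'a set \<Rightarrow> nat \<Rightarrow> (nat \<Rightarrow> 'a) \<Rightarrow> bool" where
  "orthonormal_family b V k u \<longleftrightarrow>
     (\<forall>i<k. u i \<in> V) \<and> (\<forall>i<k. \<forall>j<k. b (u i) (u j) = (if i = j then 1 else 0))"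

text \<open>The last clause, minimality of the Rayleigh quotient on the complement of the earlier
  vectors, makes \<open>\<mu> i\<close> the eigenvalue number \<open>i\<close> (counted from 0) and
  not merely some eigenvalue: none can be skipped.\<close>

definition eigen_family ::
    "('a \<Rightarrow> 'a \<Rightarrow> real) \<Rightarrow> ('a \<Rightarrow> 'a \<Rightarrow> real) \<Rightarrow> 'a set \<Rightarrow> nat \<Rightarrow> (nat \<Rightarrow> 'a) \<Rightarrow> (nat \<Rightarrow> real) \<Rightarrow> bool" where
  "eigen_family a b V k u \<mu> \<longleftrightarrow> orthonormal_family b V k u \<and>
     (\<forall>i<k. 0 < \<mu> i \<and> (\<forall>v\<in>V. a (u i) v = \<mu> i * b (u i) v) \<and>
        (\<forall>v\<in>V. (\<forall>j<i. b (u j) v = 0) \<longrightarrow> \<mu> i * b v v \<le> a v v))"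

lemma (in semi_inner) orthonormal_family_comb:
  assumes "orthonormal_family b V k e"
  shows "b (\<Sum>j<k. c j *\<^sub>R e j) (\<Sum>j<k. c j *\<^sub>R e j) = (\<Sum>j<k. (c j)\<^sup>2)"
proof -
  have "b (\<Sum>j<k. c j *\<^sub>R e j) (\<Sum>j<k. c j *\<^sub>R e j)
      = (\<Sum>i<k. \<Sum>j<k. c i * c j * b (e i) (e j))"
    unfolding sum_left unfolding sum_right by (simp add: bilinear_simps mult.assoc mult.left_commute)
  also have "\<dots> = (\<Sum>i<k. \<Sum>j<k. if i = j then c i * c j else 0)"
    using assms by (intro sum.cong refl) (auto simp: orthonormal_family_def)
  also have "\<dots> = (\<Sum>j<k. (c j)\<^sup>2)"
    by (simp add: power2_eq_square)
  finally show ?thesis .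
qed

lemma linear_term_zero:
  fixes p q :: real
  assumes "\<And>t. 0 \<le> 2 * t * p + t\<^sup>2 * q"
  shows "p = 0"
proof (rule ccontr)
  assume "p \<noteq> 0"
  \<comment> \<open>A positive upper bound of \<open>q\<close> whatever its sign; at
    \<open>t = - p / r\<close> the quadratic is at most -p^2 / r.\<close>
  define r where "r = \<bar>q\<bar> + 1"
  have r: "r > 0" "q \<le> r" by (auto simp: r_def)
  have "0 \<le> 2 * (- p / r) * p + (- p / r)\<^sup>2 * q" by (rule assms)
  also have "\<dots> \<le> 2 * (- p / r) * p + (- p / r)\<^sup>2 * r"
    using r by (intro add_left_mono mult_left_mono) auto
  also have "\<dots> = - p\<^sup>2 / r"
    using r by (simp add: power2_eq_square field_simps)
  finally show False using r \<open>p \<noteq> 0\<close> by (simp add: field_simps)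
qed

text \<open>A compact embedding expressed without a topology: \<open>compact\<close> extracts
  subsequences that are Cauchy for \<open>b\<close>, \<open>complete\<close> supplies limits for
  \<open>a + b\<close> inside \<open>V\<close>, \<open>definite\<close> makes the eigenvalues
  positive, and \<open>infinite_dim\<close> guarantees a k-th eigenvalue for each k.\<close>

locale compact_form_pair =
  A: semi_inner a + B: semi_inner b
  for a b :: "'a::real_vector \<Rightarrow> 'a \<Rightarrow> real" +
  fixes V :: "'a set"
  assumes subspace_V: "subspace V"
    and definite: "v \<in> V \<Longrightarrow> a v v = 0 \<Longrightarrow> b v v = 0"
    and compact: "(\<And>n. x n \<in> V) \<Longrightarrow> (\<And>n. a (x n) (x n) + b (x n) (x n) \<le> C) \<Longrightarrow>
      \<exists>r::nat \<Rightarrow> nat. strict_mono r \<and> (\<forall>e>0. \<exists>N::nat. \<forall>m\<ge>N. \<forall>n\<ge>N.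
        b (x (r m) - x (r n)) (x (r m) - x (r n)) < e)"
    and complete: "(\<And>n. x n \<in> V) \<Longrightarrow>
      (\<forall>e>0. \<exists>N::nat. \<forall>m\<ge>N. \<forall>n\<ge>N. a (x m - x n) (x m - x n) + b (x m - x n) (x m - x n) < e) \<Longrightarrow>
      \<exists>v\<in>V. (\<lambda>n. a (x n - v) (x n - v) + b (x n - v) (x n - v)) \<longlonglongrightarrow> 0"
    and infinite_dim: "\<exists>e. orthonormal_family b V k e"
begin

lemma comb_in_V: "(\<And>j. j < k \<Longrightarrow> u j \<in> V) \<Longrightarrow> (\<Sum>j<k. c j *\<^sub>R u j) \<in> V"
  by (intro subspace_sum subspace_V subspace_scale) auto

text \<open>\<open>k\<close> linear conditions on \<open>Suc k\<close> coefficients have a nonzero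
  solution; orthonormality of \<open>e\<close> makes the resulting vector nonzero, so it can be
  normalised.\<close>

lemma exists_orthogonal_comb:
  assumes "orthonormal_family b V (Suc k) e"
  shows "\<exists>c. b (\<Sum>j<Suc k. c j *\<^sub>R e j) (\<Sum>j<Suc k. c j *\<^sub>R e j) = 1 \<and>
    (\<forall>i<k. b (u i) (\<Sum>j<Suc k. c j *\<^sub>R e j) = 0)"
proof -
  obtain c where c: "\<exists>j\<in>{..<Suc k}. c j \<noteq> 0" "\<forall>i<k. (\<Sum>j\<in>{..<Suc k}. b (u i) (e j) * c j) = 0"
    using nontrivial_kernel[of "{..<Suc k}" k "\<lambda>i j. b (u i) (e j)"] by auto
  define S where "S = (\<Sum>j<Suc k. (c j)\<^sup>2)"
  have "S > 0" unfolding S_def using c(1) by (meson finite_lessThan sum_pos2 zero_le_power2 zero_less_power2)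
  define c' where "c' j = c j / sqrt S" for j
  have "b (\<Sum>j<Suc k. c' j *\<^sub>R e j) (\<Sum>j<Suc k. c' j *\<^sub>R e j) = (\<Sum>j<Suc k. (c' j)\<^sup>2)"
    by (rule B.orthonormal_family_comb[OF assms])
  also have "\<dots> = S / S"
  proof -
    have "(c' j)\<^sup>2 = (c j)\<^sup>2 / S" for j using \<open>S > 0\<close> by (simp add: c'_def power_divide)
    then show ?thesis unfolding S_def sum_divide_distrib by simp
  qed
  finally have 1: "b (\<Sum>j<Suc k. c' j *\<^sub>R e j) (\<Sum>j<Suc k. c' j *\<^sub>R e j) = 1" using \<open>S > 0\<close> by simp
  have 2: "b (u i) (\<Sum>j<Suc k. c' j *\<^sub>R e j) = 0" if "i < k" for i
  proof -
    have "b (u i) (\<Sum>j<Suc k. c' j *\<^sub>R e j) = (\<Sum>j\<in>{..<Suc k}. b (u i) (e j) * c j) / sqrt S"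
      unfolding B.sum_right sum_divide_distrib c'_def
      by (intro sum.cong) (auto simp: B.scale_right)
    then show ?thesis using c that by simp
  qed
  from 1 2 show ?thesis by blast
qed

text \<open>The direct method. Compactness makes a minimising sequence Cauchy for \<open>b\<close>,
  minimality then makes it Cauchy for \<open>a\<close>, and the limit still satisfies the
  constraints because these are continuous for \<open>b\<close>.\<close>

lemma exists_constrained_minimizer:
  fixes u :: "nat \<Rightarrow> 'a" and k :: nat
  defines "W \<equiv> {v \<in> V. \<forall>i<k. b (u i) v = 0}"
  shows "\<exists>w\<in>W. b w w = 1 \<and> (\<forall>v\<in>W. a w w * b v v \<le> a v v)"
proof -
  have W: "v \<in> W \<Longrightarrow> c *\<^sub>R v \<in> W" "v \<in> W \<Longrightarrow> v' \<in> W \<Longrightarrow> v + v' \<in> W" for v v' c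
    using subspace_V by (auto simp: W_def subspace_def B.bilinear_simps)
  define R where "R = (\<lambda>v. a v v) ` {v\<in>W. b v v = 1}"
  have "R \<noteq> {}"
  proof -
    obtain e where e: "orthonormal_family b V (Suc k) e" using infinite_dim by blast
    from exists_orthogonal_comb[OF e, of u] obtain c where
      "b (\<Sum>j<Suc k. c j *\<^sub>R e j) (\<Sum>j<Suc k. c j *\<^sub>R e j) = 1"
      "\<forall>i<k. b (u i) (\<Sum>j<Suc k. c j *\<^sub>R e j) = 0" by blast
    moreover have "(\<Sum>j<Suc k. c j *\<^sub>R e j) \<in> V"
      using e by (intro comb_in_V) (auto simp: orthonormal_family_def)
    ultimately show ?thesis unfolding R_def W_def by blast
  qed
  have bdd: "bdd_below R" by (auto simp: R_def intro!: bdd_belowI[of _ 0] A.nonneg)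
  define l where "l = Inf R"
  have l_le: "l * b v v \<le> a v v" if "v \<in> W" for v
  proof (cases "b v v = 0")
    case True then show ?thesis by (simp add: A.nonneg)
  next
    case False
    then have pos: "b v v > 0" using B.nonneg[of v] by simp
    let ?v = "(1 / sqrt (b v v)) *\<^sub>R v"
    have "b ?v ?v = 1" using pos by (simp add: B.bilinear_simps)
    then have "a ?v ?v \<in> R" using W that by (auto simp: R_def)
    then have "l \<le> a ?v ?v" unfolding l_def using bdd by (rule cInf_lower)
    also have "\<dots> = a v v / b v v" using pos by (simp add: A.bilinear_simps)
    finally show ?thesis using pos by (simp add: field_simps)
  qed
  have "\<exists>v\<in>W. b v v = 1 \<and> a v v < l + inverse (real (Suc n))" for n
  proof -
    have "Inf R < l + inverse (real (Suc n))" by (simp add: l_def)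
    then obtain r where "r \<in> R" "r < l + inverse (real (Suc n))"
      using \<open>R \<noteq> {}\<close> bdd by (meson cInf_less_iff)
    then show ?thesis by (auto simp: R_def)
  qed
  then obtain x where x: "\<And>n. x n \<in> W" "\<And>n. b (x n) (x n) = 1"
      "\<And>n. a (x n) (x n) < l + inverse (real (Suc n))" by metis
  have xV: "x n \<in> V" for n using x(1) by (simp add: W_def)
  have "a (x n) (x n) + b (x n) (x n) \<le> l + 2" for n
    using x(2,3)[of n] inverse_le_1_iff[of "real (Suc n)"] by simp
  from compact[of x, OF xV this] obtain r where r: "strict_mono r"
    "\<forall>e>0. \<exists>N::nat. \<forall>m\<ge>N. \<forall>n\<ge>N. b (x (r m) - x (r n)) (x (r m) - x (r n)) < e"
    by (elim exE conjE)
  define y where "y n = x (r n)" for n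
  have y: "\<And>n. y n \<in> W" "\<And>n. b (y n) (y n) = 1" "\<And>n. y n \<in> V" using x xV by (auto simp: y_def)
  have ay: "a (y n) (y n) < l + inverse (real (Suc n))" for n
  proof -
    have "inverse (real (Suc (r n))) \<le> inverse (real (Suc n))"
      using seq_suble[OF r(1), of n] by (simp add: field_simps)
    then show ?thesis using x(3)[of "r n"] unfolding y_def by linarith
  qed
  \<comment> \<open>Parallelogram identity: closeness in \<open>b\<close> forces closeness in \<open>a\<close> along a minimising sequence.\<close>
  have par: "a (y m - y n) (y m - y n) \<le> 2 * inverse (real (Suc m)) + 2 * inverse (real (Suc n))
      + \<bar>l\<bar> * b (y m - y n) (y m - y n)" for m n
  proof -
    have "a (y m - y n) (y m - y n) = 2 * a (y m) (y m) + 2 * a (y n) (y n) - a (y m + y n) (y m + y n)"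
      by (simp add: A.bilinear_simps A.commute[of "y n" "y m"])
    also have "\<dots> \<le> 2 * a (y m) (y m) + 2 * a (y n) (y n) - l * b (y m + y n) (y m + y n)"
      using l_le[of "y m + y n"] W y by simp
    also have "b (y m + y n) (y m + y n) = 4 - b (y m - y n) (y m - y n)"
      using y by (simp add: B.bilinear_simps B.commute[of "y n" "y m"])
    also have "2 * a (y m) (y m) + 2 * a (y n) (y n) - l * (4 - b (y m - y n) (y m - y n)) \<le>
       2 * inverse (real (Suc m)) + 2 * inverse (real (Suc n)) + l * b (y m - y n) (y m - y n)"
      using ay[of m] ay[of n] by (simp add: algebra_simps)
    also have "l * b (y m - y n) (y m - y n) \<le> \<bar>l\<bar> * b (y m - y n) (y m - y n)"
      by (intro mult_right_mono B.nonneg) auto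
    finally show ?thesis by simp
  qed
  have "\<forall>e>0. \<exists>N. \<forall>m\<ge>N. \<forall>n\<ge>N. a (y m - y n) (y m - y n) + b (y m - y n) (y m - y n) < e"
  proof (intro allI impI)
    fix e :: real assume e: "e > 0"
    \<comment> \<open>Half of \<open>e\<close> is for the \<open>b\<close>-term with its coefficient
      |l| + 1; the four reciprocals, each below \<open>e / 8\<close>, take the other half.\<close>
    define d where "d = e / (2 * (\<bar>l\<bar> + 1))"
    have d: "d > 0" "(\<bar>l\<bar> + 1) * d = e / 2" using e by (auto simp: d_def field_simps)
    obtain N1 where N1: "\<forall>m\<ge>N1. \<forall>n\<ge>N1. b (y m - y n) (y m - y n) < d"
      using r(2)[rule_format, OF d(1)] by (auto simp: y_def)
    obtain N2 where N2: "inverse (real (Suc N2)) < e / 8"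
      using reals_Archimedean[of "e/8"] e by auto
    have "a (y m - y n) (y m - y n) + b (y m - y n) (y m - y n) < e" if "m \<ge> max N1 N2" "n \<ge> max N1 N2" for m n
    proof -
      have i: "inverse (real (Suc j)) < e / 8" if "j \<ge> N2" for j
      proof -
        have "inverse (real (Suc j)) \<le> inverse (real (Suc N2))" using that by (simp add: field_simps)
        then show ?thesis using N2 by linarith
      qed
      have "a (y m - y n) (y m - y n) + b (y m - y n) (y m - y n) \<le>
         2 * inverse (real (Suc m)) + 2 * inverse (real (Suc n)) + (\<bar>l\<bar> + 1) * b (y m - y n) (y m - y n)"
        using par[of m n] by (simp add: algebra_simps)
      also have "\<dots> \<le> 2 * inverse (real (Suc m)) + 2 * inverse (real (Suc n)) + (\<bar>l\<bar> + 1) * d"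
        using N1 that by (intro add_left_mono mult_left_mono) (auto intro: less_imp_le)
      also have "\<dots> < e" using i[of m] i[of n] that d by linarith
      finally show ?thesis .
    qed
    then show "\<exists>N. \<forall>m\<ge>N. \<forall>n\<ge>N. a (y m - y n) (y m - y n) + b (y m - y n) (y m - y n) < e" by blast
  qed
  from complete[of y, OF y(3) this] obtain w where w: "w \<in> V"
    "(\<lambda>n. a (y n - w) (y n - w) + b (y n - w) (y n - w)) \<longlonglongrightarrow> 0" by blast
  have wa: "(\<lambda>n. a (y n - w) (y n - w)) \<longlonglongrightarrow> 0" and wb: "(\<lambda>n. b (y n - w) (y n - w)) \<longlonglongrightarrow> 0"
    by (rule tendsto_sandwich[OF _ _ tendsto_const w(2)]; simp add: A.nonneg B.nonneg)+
  have "(\<lambda>n. b (y n) (u i)) \<longlonglongrightarrow> b w (u i)" for i by (rule B.tendsto_left[OF wb])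
  moreover have "(\<lambda>n. b (y n) (u i)) = (\<lambda>n. 0)" if "i < k" for i
    using y(1) that by (auto simp: W_def B.commute[of _ "u i"])
  ultimately have "b w (u i) = 0" if "i < k" for i
    using that by (metis LIMSEQ_unique tendsto_const)
  then have wW: "w \<in> W" using w(1) by (auto simp: W_def B.commute[of "u _" w])
  have bw: "b w w = 1" using B.tendsto_norm[OF wb] y(2) by (simp add: LIMSEQ_const_iff)
  have "a w w \<le> l"
  proof (rule LIMSEQ_le[OF A.tendsto_norm[OF wa]])
    show "(\<lambda>n. l + inverse (real (Suc n))) \<longlonglongrightarrow> l"
      using LIMSEQ_inverse_real_of_nat_add[of l] by simp
  qed (use ay in \<open>auto intro: less_imp_le\<close>)
  then have "a w w * b v v \<le> a v v" if "v \<in> W" for v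
    using l_le[OF that] mult_right_mono[OF \<open>a w w \<le> l\<close> B.nonneg[of v]] by linarith
  then show ?thesis using wW bw by blast
qed

theorem exists_eigen_family: "\<exists>u \<mu>. eigen_family a b V k u \<mu>"
proof (induction k)
  case 0
  then show ?case by (simp add: eigen_family_def orthonormal_family_def)
next
  case (Suc k)
  then obtain u \<mu> where u: "eigen_family a b V k u \<mu>" by blast
  then have on: "\<And>i j. i < k \<Longrightarrow> j < k \<Longrightarrow> b (u i) (u j) = (if i = j then 1 else 0)"
    and uV: "\<And>i. i < k \<Longrightarrow> u i \<in> V"
    and eig: "\<And>i v. i < k \<Longrightarrow> v \<in> V \<Longrightarrow> a (u i) v = \<mu> i * b (u i) v"
    by (auto simp: eigen_family_def orthonormal_family_def)
  from exists_constrained_minimizer[of k u] obtain w where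
    w: "w \<in> V" "\<And>i. i < k \<Longrightarrow> b (u i) w = 0" "b w w = 1" and
    min: "\<And>v. v \<in> V \<Longrightarrow> \<forall>i<k. b (u i) v = 0 \<Longrightarrow> a w w * b v v \<le> a v v" by auto
  define l where "l = a w w"
  have "l > 0" using definite[OF w(1)] w(3) A.nonneg[of w] by (auto simp: l_def less_le)
  \<comment> \<open>First variation at the minimiser, in the directions that respect the
    constraints.\<close>
  have crit: "a w v = l * b w v" if v: "v \<in> V" "\<forall>i<k. b (u i) v = 0" for v
  proof -
    have "a w v - l * b w v = 0"
    proof (rule linear_term_zero)
      fix t :: real
      have "l * b (w + t *\<^sub>R v) (w + t *\<^sub>R v) \<le> a (w + t *\<^sub>R v) (w + t *\<^sub>R v)"
        unfolding l_def using subspace_V v w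
        by (intro min subspace_add subspace_scale) (auto simp: B.bilinear_simps)
      then show "0 \<le> 2 * t * (a w v - l * b w v) + t\<^sup>2 * (a v v - l * b v v)"
        using w(3) by (simp add: A.bilinear_simps B.bilinear_simps A.commute[of v w] B.commute[of v w] l_def
            power2_eq_square algebra_simps)
    qed
    then show ?thesis by simp
  qed
  \<comment> \<open>Minimality gives the equation only against vectors orthogonal to the earlier
    \<open>u j\<close>. The projection \<open>s\<close> covers the rest: the earlier vectors are
    eigenvectors and orthogonal to \<open>w\<close>, so both sides vanish on
    \<open>s\<close>.\<close>
  have eigw: "a w v = l * b w v" if "v \<in> V" for v
  proof -
    define s where "s = (\<Sum>j<k. b (u j) v *\<^sub>R u j)"
    have sV: "s \<in> V" unfolding s_def using uV by (rule comb_in_V)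
    have "b (u i) s = b (u i) v" if "i < k" for i
    proof -
      have "b (u i) s = (\<Sum>j<k. b (u j) v * b (u i) (u j))"
        by (simp add: s_def B.sum_right B.scale_right)
      also have "\<dots> = (\<Sum>j<k. if i = j then b (u j) v else 0)"
        using on that by (intro sum.cong) auto
      finally show ?thesis using that by simp
    qed
    then have "a w (v - s) = l * b w (v - s)"
      using that sV by (intro crit subspace_diff subspace_V) (auto simp: B.diff_right)
    moreover have "a w s = 0" "b w s = 0"
      using w eig by (simp_all add: s_def A.sum_right A.scale_right B.sum_right B.scale_right
          A.commute[of w "u _"] B.commute[of w "u _"])
    ultimately show ?thesis by (simp add: A.diff_right B.diff_right)
  qed
  let ?u = "u(k := w)" and ?\<mu> = "\<mu>(k := l)"
  have "orthonormal_family b V (Suc k) ?u"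
    unfolding orthonormal_family_def
  proof (intro conjI allI impI)
    show "?u i \<in> V" if "i < Suc k" for i using that uV w(1) by (auto simp: less_Suc_eq)
    show "b (?u i) (?u j) = (if i = j then 1 else 0)" if "i < Suc k" "j < Suc k" for i j
      using that on w(2,3) B.commute[of w "u j"] by (auto simp: less_Suc_eq)
  qed
  moreover have "0 < ?\<mu> i \<and> (\<forall>v\<in>V. a (?u i) v = ?\<mu> i * b (?u i) v) \<and>
        (\<forall>v\<in>V. (\<forall>j<i. b (?u j) v = 0) \<longrightarrow> ?\<mu> i * b v v \<le> a v v)" if "i < Suc k" for i
  proof (cases "i = k")
    case True
    have "\<forall>v\<in>V. (\<forall>j<k. b (?u j) v = 0) \<longrightarrow> l * b v v \<le> a v v"
      using min by (auto simp: l_def)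
    then show ?thesis using True \<open>l > 0\<close> eigw by simp
  next
    case False
    then have "i < k" using that by simp
    moreover have "(\<forall>j<i. b (?u j) v = 0) \<longleftrightarrow> (\<forall>j<i. b (u j) v = 0)" for v
      using \<open>i < k\<close> by auto
    ultimately show ?thesis using u False unfolding eigen_family_def by simp
  qed
  ultimately have "eigen_family a b V (Suc k) ?u ?\<mu>" unfolding eigen_family_def by blast
  then show ?case by blast
qed

text \<open>One half of the Courant-Fischer principle: the span of \<open>Suc k\<close> orthonormal
  vectors contains a unit vector orthogonal to the first \<open>k\<close> eigenvectors, and on that
  complement the Rayleigh quotient is at least \<open>\<mu> k\<close>.\<close>

lemma eigen_family_minmax_lower:
  assumes u: "eigen_family a b V (Suc k) u \<mu>"
    and e: "orthonormal_family b V (Suc k) e"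
    and le: "\<And>c. a (\<Sum>j<Suc k. c j *\<^sub>R e j) (\<Sum>j<Suc k. c j *\<^sub>R e j)
       \<le> M * b (\<Sum>j<Suc k. c j *\<^sub>R e j) (\<Sum>j<Suc k. c j *\<^sub>R e j)"
  shows "\<mu> k \<le> M"
proof -
  from exists_orthogonal_comb[OF e, of u] obtain c where c:
    "b (\<Sum>j<Suc k. c j *\<^sub>R e j) (\<Sum>j<Suc k. c j *\<^sub>R e j) = 1"
    "\<forall>i<k. b (u i) (\<Sum>j<Suc k. c j *\<^sub>R e j) = 0" by blast
  define w where "w = (\<Sum>j<Suc k. c j *\<^sub>R e j)"
  have "w \<in> V" unfolding w_def using e by (intro comb_in_V) (auto simp: orthonormal_family_def)
  then have "\<mu> k * b w w \<le> a w w"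
    using u c unfolding eigen_family_def w_def by blast
  then show ?thesis using le[of c] c(1) by (simp add: w_def)
qed

lemma eigen_family_mono:
  assumes "eigen_family a b V k u \<mu>" "i \<le> j" "j < k"
  shows "\<mu> i \<le> \<mu> j"
proof -
  have "\<forall>i'<i. b (u i') (u j) = 0" and 1: "b (u j) (u j) = 1" "u j \<in> V" "a (u j) (u j) = \<mu> j * b (u j) (u j)"
    using assms by (auto simp: eigen_family_def orthonormal_family_def)
  then have "\<mu> i * b (u j) (u j) \<le> a (u j) (u j)"
    using assms unfolding eigen_family_def by (meson le_less_trans)
  then show ?thesis using 1 by simp
qed

end

text \<open>Eigenvectors that are orthonormal for \<open>b\<close> are orthogonal for
  \<open>a\<close>, so both forms are diagonal on their span. This yields the upper bound on a trial
  space that min-max asks for.\<close>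

lemma orthonormal_eigen_comb_le:
  assumes "semi_inner a" "semi_inner b" "subspace V"
    and e: "orthonormal_family b V k e"
    and eig: "\<And>i v. i < k \<Longrightarrow> v \<in> V \<Longrightarrow> a (e i) v = \<nu> i * b (e i) v"
    and le: "\<And>i. i < k \<Longrightarrow> \<nu> i \<le> M"
  shows "a (\<Sum>j<k. c j *\<^sub>R e j) (\<Sum>j<k. c j *\<^sub>R e j) \<le> M * b (\<Sum>j<k. c j *\<^sub>R e j) (\<Sum>j<k. c j *\<^sub>R e j)"
proof -
  interpret A: semi_inner a by fact
  interpret B: semi_inner b by fact
  have "a (\<Sum>j<k. c j *\<^sub>R e j) (\<Sum>j<k. c j *\<^sub>R e j)
      = (\<Sum>i<k. \<Sum>j<k. c i * c j * a (e i) (e j))"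
    unfolding A.sum_left unfolding A.sum_right
    by (simp add: A.bilinear_simps mult.assoc mult.left_commute)
  also have "\<dots> = (\<Sum>i<k. \<Sum>j<k. if i = j then \<nu> i * c i * c j else 0)"
    using e eig by (intro sum.cong refl) (auto simp: orthonormal_family_def)
  also have "\<dots> = (\<Sum>i<k. \<nu> i * (c i)\<^sup>2)" by (simp add: power2_eq_square mult.assoc)
  also have "\<dots> \<le> (\<Sum>i<k. M * (c i)\<^sup>2)" using le by (intro sum_mono mult_right_mono) auto
  also have "\<dots> = M * b (\<Sum>j<k. c j *\<^sub>R e j) (\<Sum>j<k. c j *\<^sub>R e j)"
    by (simp add: B.orthonormal_family_comb[OF e] sum_distrib_left)
  finally show ?thesis .
qed

section \<open>Differentiability of a simple eigenvalue\<close>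

text \<open>Compactness yields limits along subsequences only. As they all equal \<open>D\<close>,
  the full sequence converges: otherwise the infinitely many indices at distance at least
  \<open>e\<close> from \<open>D\<close> would enumerate a subsequence refuting the
  assumption.\<close>

lemma LIMSEQ_subsubseqI:
  fixes y :: "nat \<Rightarrow> real"
  assumes "\<And>r. strict_mono r \<Longrightarrow> \<exists>r'. strict_mono (r' :: nat \<Rightarrow> nat) \<and> (\<lambda>n. y (r (r' n))) \<longlonglongrightarrow> D"
  shows "y \<longlonglongrightarrow> D"
proof (rule ccontr)
  assume "\<not> y \<longlonglongrightarrow> D"
  then obtain e where e: "e > 0" "\<forall>N. \<exists>n\<ge>N. e \<le> dist (y n) D"
    unfolding LIMSEQ_def by (meson not_less)
  then have "infinite {n. e \<le> dist (y n) D}"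
    by (auto simp: infinite_nat_iff_unbounded_le)
  then obtain r :: "nat \<Rightarrow> nat" where r: "strict_mono r" "\<And>n. r n \<in> {n. e \<le> dist (y n) D}"
    using infinite_enumerate by blast
  from assms[OF r(1)] obtain r' :: "nat \<Rightarrow> nat" where "(\<lambda>n. y (r (r' n))) \<longlonglongrightarrow> D" by blast
  then obtain n where "dist (y (r (r' n))) D < e" using e(1) unfolding LIMSEQ_def by blast
  then show False using r(2)[of "r' n"] by simp
qed

locale form_family =
  D1: semi_inner d1 + D2: semi_inner d2 + P: compact_form_pair "\<lambda>x y. d1 x y + d2 x y" b V
  for d1 d2 b :: "'a::real_vector \<Rightarrow> 'a \<Rightarrow> real" and V
begin

lemma compact_form_pair_weighted:
  assumes "0 < p" "0 < q"
  shows "compact_form_pair (\<lambda>x y. p * d1 x y + q * d2 x y) b V"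
proof -
  \<comment> \<open>The entry 1 is the weight of \<open>b\<close>, so that \<open>m\<close> and
    \<open>M\<close> compare the full squared norms, mass included.\<close>
  define m where "m = min 1 (min p q)"
  define M where "M = max 1 (max p q)"
  have m: "m > 0" "m \<le> 1" "m \<le> p" "m \<le> q" using assms by (auto simp: m_def)
  have M: "M > 0" "1 \<le> M" "p \<le> M" "q \<le> M" by (auto simp: M_def)
  have low: "m * (d1 x x + d2 x x + b x x) \<le> p * d1 x x + q * d2 x x + b x x" for x
    using mult_right_mono[OF m(2) P.B.nonneg[of x]] mult_right_mono[OF m(3) D1.nonneg[of x]]
      mult_right_mono[OF m(4) D2.nonneg[of x]] by (simp add: algebra_simps)
  have up: "p * d1 x x + q * d2 x x + b x x \<le> M * (d1 x x + d2 x x + b x x)" for x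
    using mult_right_mono[OF M(2) P.B.nonneg[of x]] mult_right_mono[OF M(3) D1.nonneg[of x]]
      mult_right_mono[OF M(4) D2.nonneg[of x]] by (simp add: algebra_simps)
  interpret Q: semi_inner "\<lambda>x y. p * d1 x y + q * d2 x y"
    using assms by (intro semi_inner_lincomb D1.semi_inner_axioms D2.semi_inner_axioms) auto
  show ?thesis
  proof (unfold_locales)
    show "subspace V" by (rule P.subspace_V)
    show "b v v = 0" if "v \<in> V" "p * d1 v v + q * d2 v v = 0" for v
    proof -
      have "p * d1 v v = 0" "q * d2 v v = 0"
        using that(2) assms D1.nonneg[of v] D2.nonneg[of v]
        by (auto simp: add_nonneg_eq_0_iff)
      then show ?thesis using that assms by (intro P.definite) auto
    qed
    show "\<exists>r::nat \<Rightarrow> nat. strict_mono r \<and> (\<forall>e>0. \<exists>N::nat. \<forall>m\<ge>N. \<forall>n\<ge>N.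
        b (x (r m) - x (r n)) (x (r m) - x (r n)) < e)"
      if x: "\<And>n. x n \<in> V" "\<And>n. p * d1 (x n) (x n) + q * d2 (x n) (x n) + b (x n) (x n) \<le> C" for x C
    proof -
      have "d1 (x n) (x n) + d2 (x n) (x n) + b (x n) (x n) \<le> C / m" for n
        using order_trans[OF low x(2)[of n]] m(1) by (simp add: field_simps)
      from P.compact[of x, OF x(1) this] show ?thesis .
    qed
    show "\<exists>v\<in>V. (\<lambda>n. p * d1 (x n - v) (x n - v) + q * d2 (x n - v) (x n - v) + b (x n - v) (x n - v)) \<longlonglongrightarrow> 0"
      if x: "\<And>n. x n \<in> V" "\<forall>e>0. \<exists>N::nat. \<forall>m\<ge>N. \<forall>n\<ge>N. p * d1 (x m - x n) (x m - x n)
        + q * d2 (x m - x n) (x m - x n) + b (x m - x n) (x m - x n) < e" for x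
    proof -
      have "\<forall>e>0. \<exists>N::nat. \<forall>i\<ge>N. \<forall>j\<ge>N. d1 (x i - x j) (x i - x j)
        + d2 (x i - x j) (x i - x j) + b (x i - x j) (x i - x j) < e"
      proof (intro allI impI)
        fix e :: real assume "e > 0"
        then obtain N where N: "\<forall>i\<ge>N. \<forall>j\<ge>N. p * d1 (x i - x j) (x i - x j)
          + q * d2 (x i - x j) (x i - x j) + b (x i - x j) (x i - x j) < m * e"
          using x(2) m(1) by (metis mult_pos_pos)
        have "d1 (x i - x j) (x i - x j) + d2 (x i - x j) (x i - x j) + b (x i - x j) (x i - x j) < e"
          if "i \<ge> N" "j \<ge> N" for i j
          using le_less_trans[OF low, of "x i - x j" "m * e"] N that m(1) by simp
        then show "\<exists>N. \<forall>i\<ge>N. \<forall>j\<ge>N. d1 (x i - x j) (x i - x j)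
          + d2 (x i - x j) (x i - x j) + b (x i - x j) (x i - x j) < e" by blast
      qed
      from P.complete[of x, OF x(1) this] obtain v where v: "v \<in> V"
        "(\<lambda>n. d1 (x n - v) (x n - v) + d2 (x n - v) (x n - v) + b (x n - v) (x n - v)) \<longlonglongrightarrow> 0" by blast
      have "(\<lambda>n. p * d1 (x n - v) (x n - v) + q * d2 (x n - v) (x n - v) + b (x n - v) (x n - v)) \<longlonglongrightarrow> 0"
      proof (rule tendsto_sandwich[OF _ _ tendsto_const])
        show "(\<lambda>n. M * (d1 (x n - v) (x n - v) + d2 (x n - v) (x n - v) + b (x n - v) (x n - v))) \<longlonglongrightarrow> 0"
          using tendsto_mult_left[OF v(2), of M] by simp
        show "\<forall>\<^sub>F n in sequentially. 0 \<le> p * d1 (x n - v) (x n - v) + q * d2 (x n - v) (x n - v) + b (x n - v) (x n - v)"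
          using assms D1.nonneg D2.nonneg P.B.nonneg by (intro always_eventually allI add_nonneg_nonneg) auto
      qed (use up in auto)
      then show ?thesis using v(1) by blast
    qed
    show "\<exists>e. orthonormal_family b V k e" for k by (rule P.infinite_dim)
  qed
qed

text \<open>The first form is at most \<open>max (p / p') (q / q')\<close> times the second, and the
  span of the primed eigenvectors is an admissible trial space for the min-max bound.\<close>

lemma eigen_family_compare:
  assumes "0 < p" "0 < q" "0 < p'" "0 < q'"
    and u: "eigen_family (\<lambda>x y. p * d1 x y + q * d2 x y) b V (Suc k) u \<mu>"
    and u': "eigen_family (\<lambda>x y. p' * d1 x y + q' * d2 x y) b V (Suc k) u' \<mu>'"
  shows "\<mu> k \<le> max (p / p') (q / q') * \<mu>' k"
proof -
  interpret A: compact_form_pair "\<lambda>x y. p * d1 x y + q * d2 x y" b V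
    using assms by (intro compact_form_pair_weighted)
  interpret A': compact_form_pair "\<lambda>x y. p' * d1 x y + q' * d2 x y" b V
    using assms by (intro compact_form_pair_weighted)
  define \<rho> where "\<rho> = max (p / p') (q / q')"
  have \<rho>: "0 < \<rho>" "p \<le> \<rho> * p'" "q \<le> \<rho> * q'"
    using assms by (auto simp: \<rho>_def less_max_iff_disj pos_divide_le_eq[symmetric])
  have on: "orthonormal_family b V (Suc k) u'" using u' by (simp add: eigen_family_def)
  have "\<mu> k \<le> \<rho> * \<mu>' k"
  proof (rule A.eigen_family_minmax_lower[OF u on])
    fix c
    let ?w = "\<Sum>j<Suc k. c j *\<^sub>R u' j"
    have "p * d1 ?w ?w + q * d2 ?w ?w \<le> (\<rho> * p') * d1 ?w ?w + (\<rho> * q') * d2 ?w ?w"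
      using \<rho> D1.nonneg D2.nonneg by (intro add_mono mult_right_mono) auto
    also have "\<dots> = \<rho> * (p' * d1 ?w ?w + q' * d2 ?w ?w)" by (simp add: algebra_simps)
    also have "\<dots> \<le> \<rho> * (\<mu>' k * b ?w ?w)"
    proof (rule mult_left_mono)
      show "p' * d1 ?w ?w + q' * d2 ?w ?w \<le> \<mu>' k * b ?w ?w"
      proof (rule orthonormal_eigen_comb_le[where a="\<lambda>x y. p' * d1 x y + q' * d2 x y" and b=b and V=V and \<nu>=\<mu>'])
        show "\<mu>' i \<le> \<mu>' k" if "i < Suc k" for i
          using A'.eigen_family_mono[OF u', of i k] that by simp
      qed (use u' A'.A.semi_inner_axioms P.B.semi_inner_axioms P.subspace_V in \<open>auto simp: eigen_family_def\<close>)
    qed (use \<rho> in simp)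
    finally show "p * d1 ?w ?w + q * d2 ?w ?w \<le> \<rho> * \<mu>' k * b ?w ?w" by (simp add: mult.assoc)
  qed
  then show ?thesis by (simp add: \<rho>_def)
qed

text \<open>Simplicity at \<open>\<theta>\<close> is phrased as: an eigenvector orthogonal to
  \<open>w\<close> is null. It identifies each limit of eigenvectors at nearby parameters as a
  multiple of \<open>w\<close>, whichever eigenvectors the families there provide.\<close>

theorem simple_eigenvalue_has_derivative:
  fixes f g ev :: "real \<Rightarrow> real"
  assumes "open J" "\<theta> \<in> J"
    and pos: "\<And>t. t \<in> J \<Longrightarrow> 0 < f t" "\<And>t. t \<in> J \<Longrightarrow> 0 < g t"
    and fam: "\<And>t. t \<in> J \<Longrightarrow> \<exists>u \<mu>. eigen_family (\<lambda>x y. f t * d1 x y + g t * d2 x y) b V (Suc k) u \<mu> \<and> ev t = \<mu> k"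
    and f': "(f has_real_derivative f') (at \<theta>)" and g': "(g has_real_derivative g') (at \<theta>)"
    and w: "w \<in> V" "b w w \<noteq> 0" "\<And>v. v \<in> V \<Longrightarrow> f \<theta> * d1 w v + g \<theta> * d2 w v = ev \<theta> * b w v"
    and simple: "\<And>z. z \<in> V \<Longrightarrow> (\<And>v. v \<in> V \<Longrightarrow> f \<theta> * d1 z v + g \<theta> * d2 z v = ev \<theta> * b z v) \<Longrightarrow>
       b z w = 0 \<Longrightarrow> b z z = 0"
  shows "(ev has_real_derivative (f' * d1 w w + g' * d2 w w) / b w w) (at \<theta>)"
proof -
  let ?A = "\<lambda>x y. f \<theta> * d1 x y + g \<theta> * d2 x y"
  have p\<theta>: "0 < f \<theta>" "0 < g \<theta>" using pos \<open>\<theta> \<in> J\<close> by auto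
  interpret A: compact_form_pair ?A b V by (rule compact_form_pair_weighted[OF p\<theta>])
  let ?D = "(f' * d1 w w + g' * d2 w w) / b w w"
  let ?q = "\<lambda>t. (ev t - ev \<theta>) / (t - \<theta>)"
  have ev_pos: "0 < ev t" if "t \<in> J" for t using fam[OF that] by (auto simp: eigen_family_def)
  have upper: "ev t \<le> max (f t / f \<theta>) (g t / g \<theta>) * ev \<theta>"
    and lower: "ev \<theta> \<le> max (f \<theta> / f t) (g \<theta> / g t) * ev t" if "t \<in> J" for t
  proof -
    obtain u \<mu> where u: "eigen_family (\<lambda>x y. f t * d1 x y + g t * d2 x y) b V (Suc k) u \<mu>" "ev t = \<mu> k"
      using fam[OF \<open>t \<in> J\<close>] by blast
    obtain u' \<mu>' where u': "eigen_family (\<lambda>x y. f \<theta> * d1 x y + g \<theta> * d2 x y) b V (Suc k) u' \<mu>'" "ev \<theta> = \<mu>' k"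
      using fam[OF \<open>\<theta> \<in> J\<close>] by blast
    show "ev t \<le> max (f t / f \<theta>) (g t / g \<theta>) * ev \<theta>"
      using eigen_family_compare[OF _ _ _ _ u(1) u'(1)] pos that p\<theta> u(2) u'(2) by simp
    show "ev \<theta> \<le> max (f \<theta> / f t) (g \<theta> / g t) * ev t"
      using eigen_family_compare[OF _ _ _ _ u'(1) u(1)] pos that p\<theta> u(2) u'(2) by simp
  qed
  have core: "\<exists>r. strict_mono (r :: nat \<Rightarrow> nat) \<and> (\<lambda>n. ?q (X (r n))) \<longlonglongrightarrow> ?D"
    if X: "\<And>n. X n \<in> J" "\<And>n. X n \<noteq> \<theta>" "X \<longlonglongrightarrow> \<theta>" for X
  proof -
    have fX: "(\<lambda>n. f (X n)) \<longlonglongrightarrow> f \<theta>" and gX: "(\<lambda>n. g (X n)) \<longlonglongrightarrow> g \<theta>"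
      using isCont_tendsto_compose[OF DERIV_isCont[OF f'] X(3)]
        isCont_tendsto_compose[OF DERIV_isCont[OF g'] X(3)] by auto
    \<comment> \<open>Bounds the form at \<open>\<theta>\<close> by the form at \<open>X n\<close>.
      It tends to 1, which gives both the lower half of the continuity of \<open>ev\<close> and
      bounded energy of the eigenvectors \<open>u n\<close>.\<close>
    define \<sigma> where "\<sigma> n = max (f \<theta> / f (X n)) (g \<theta> / g (X n))" for n
    have \<sigma>: "\<sigma> \<longlonglongrightarrow> max (f \<theta> / f \<theta>) (g \<theta> / g \<theta>)"
      unfolding \<sigma>_def using p\<theta> by (intro tendsto_intros fX gX) auto
    then have \<sigma>1: "\<sigma> \<longlonglongrightarrow> 1" using p\<theta> by simp
    have \<sigma>pos: "0 < \<sigma> n" for n using pos[OF X(1)] p\<theta> by (auto simp: \<sigma>_def less_max_iff_disj)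
    have evX: "(\<lambda>n. ev (X n)) \<longlonglongrightarrow> ev \<theta>"
    proof (rule tendsto_sandwich)
      show "(\<lambda>n. ev \<theta> / \<sigma> n) \<longlonglongrightarrow> ev \<theta>" using tendsto_divide[OF tendsto_const \<sigma>1, of "ev \<theta>"] by simp
      have "(\<lambda>n. max (f (X n) / f \<theta>) (g (X n) / g \<theta>) * ev \<theta>) \<longlonglongrightarrow> max (f \<theta> / f \<theta>) (g \<theta> / g \<theta>) * ev \<theta>"
        using p\<theta> by (intro tendsto_intros fX gX) auto
      then show "(\<lambda>n. max (f (X n) / f \<theta>) (g (X n) / g \<theta>) * ev \<theta>) \<longlonglongrightarrow> ev \<theta>" using p\<theta> by simp
      show "\<forall>\<^sub>F n in sequentially. ev \<theta> / \<sigma> n \<le> ev (X n)"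
        using lower[OF X(1)] \<sigma>pos by (auto simp: field_simps \<sigma>_def[symmetric])
      show "\<forall>\<^sub>F n in sequentially. ev (X n) \<le> max (f (X n) / f \<theta>) (g (X n) / g \<theta>) * ev \<theta>"
        using upper[OF X(1)] by auto
    qed
    have "\<exists>u\<in>V. b u u = 1 \<and> (\<forall>v\<in>V. f (X n) * d1 u v + g (X n) * d2 u v = ev (X n) * b u v)" for n
    proof -
      obtain u \<mu> where u: "eigen_family (\<lambda>x y. f (X n) * d1 x y + g (X n) * d2 x y) b V (Suc k) u \<mu>" "ev (X n) = \<mu> k"
        using fam[OF X(1)[of n]] by blast
      then show ?thesis unfolding eigen_family_def orthonormal_family_def by (intro bexI[of _ "u k"]) auto
    qed
    then obtain u where u: "\<And>n. u n \<in> V" "\<And>n. b (u n) (u n) = 1"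
      "\<And>n v. v \<in> V \<Longrightarrow> f (X n) * d1 (u n) v + g (X n) * d2 (u n) v = ev (X n) * b (u n) v" by metis
    have Au: "?A (u n) (u n) \<le> \<sigma> n * ev (X n)" for n
    proof -
      have s: "f \<theta> \<le> \<sigma> n * f (X n)" "g \<theta> \<le> \<sigma> n * g (X n)"
        using pos[OF X(1)[of n]] by (auto simp: \<sigma>_def pos_divide_le_eq[symmetric])
      have "?A (u n) (u n) \<le> (\<sigma> n * f (X n)) * d1 (u n) (u n) + (\<sigma> n * g (X n)) * d2 (u n) (u n)"
        using s D1.nonneg D2.nonneg by (intro add_mono mult_right_mono) auto
      also have "\<dots> = \<sigma> n * (f (X n) * d1 (u n) (u n) + g (X n) * d2 (u n) (u n))" by (simp add: algebra_simps)
      finally show ?thesis using u(3)[OF u(1), of n n] u(2) by simp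
    qed
    have "Bseq (\<lambda>n. \<sigma> n * ev (X n))"
      using tendsto_mult[OF \<sigma>1 evX] by (intro convergent_imp_Bseq) (auto simp: convergent_def)
    then obtain C where C: "\<And>n. norm (\<sigma> n * ev (X n)) \<le> C" by (auto simp: Bseq_def)
    have AC: "?A (u n) (u n) \<le> C" for n using Au[of n] C[of n] by simp
    then have "?A (u n) (u n) + b (u n) (u n) \<le> C + 1" for n using u(2)[of n] by (smt (verit))
    from A.compact[of u, OF u(1) this] obtain r where r: "strict_mono r"
      "\<forall>e>0. \<exists>N::nat. \<forall>m\<ge>N. \<forall>n\<ge>N. b (u (r m) - u (r n)) (u (r m) - u (r n)) < e"
      by (elim exE conjE)
    define y where "y n = u (r n)" for n
    define Z where "Z n = X (r n)" for n
    have y: "y n \<in> V" "b (y n) (y n) = 1" "?A (y n) (y n) \<le> C" for n using u AC by (auto simp: y_def)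
    have yeig: "f (Z n) * d1 (y n) v + g (Z n) * d2 (y n) v = ev (Z n) * b (y n) v" if "v \<in> V" for n v
      using u(3)[OF that] by (simp add: y_def Z_def)
    have Z: "Z n \<in> J" "Z n \<noteq> \<theta>" for n using X by (auto simp: Z_def)
    have fZ: "(\<lambda>n. f (Z n)) \<longlonglongrightarrow> f \<theta>" and gZ: "(\<lambda>n. g (Z n)) \<longlonglongrightarrow> g \<theta>"
      and evZ: "(\<lambda>n. ev (Z n)) \<longlonglongrightarrow> ev \<theta>" and Zlim: "Z \<longlonglongrightarrow> \<theta>"
      unfolding Z_def using LIMSEQ_subseq_LIMSEQ[OF fX r(1)] LIMSEQ_subseq_LIMSEQ[OF gX r(1)]
        LIMSEQ_subseq_LIMSEQ[OF evX r(1)] LIMSEQ_subseq_LIMSEQ[OF X(3) r(1)] by (auto simp: o_def)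
    define C1 where "C1 = C / f \<theta> + C / g \<theta>"
    have "0 \<le> C" using y(3)[of 0] A.A.nonneg[of "y 0"] by simp
    have dC: "d1 (y n) (y n) \<le> C1" "d2 (y n) (y n) \<le> C1" for n
    proof -
      have "f \<theta> * d1 (y n) (y n) \<le> C" "g \<theta> * d2 (y n) (y n) \<le> C"
        using y(3)[of n] mult_nonneg_nonneg[OF less_imp_le[OF p\<theta>(1)] D1.nonneg[of "y n"]]
          mult_nonneg_nonneg[OF less_imp_le[OF p\<theta>(2)] D2.nonneg[of "y n"]] by linarith+
      then have "d1 (y n) (y n) \<le> C / f \<theta>" "d2 (y n) (y n) \<le> C / g \<theta>"
        using p\<theta> by (auto simp: field_simps)
      moreover have "0 \<le> C / f \<theta>" "0 \<le> C / g \<theta>" using \<open>0 \<le> C\<close> p\<theta> by auto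
      ultimately show "d1 (y n) (y n) \<le> C1" "d2 (y n) (y n) \<le> C1" by (auto simp: C1_def)
    qed
    have "0 \<le> C1" using dC(1)[of 0] D1.nonneg[of "y 0"] by linarith
    have dCC: "\<bar>d1 (y m) (y n)\<bar> \<le> C1" "\<bar>d2 (y m) (y n)\<bar> \<le> C1" for m n
    proof -
      have "sqrt (d1 (y m) (y m)) * sqrt (d1 (y n) (y n)) \<le> sqrt C1 * sqrt C1"
           "sqrt (d2 (y m) (y m)) * sqrt (d2 (y n) (y n)) \<le> sqrt C1 * sqrt C1"
        using dC D1.nonneg D2.nonneg \<open>0 \<le> C1\<close> by (intro mult_mono; simp)+
      then show "\<bar>d1 (y m) (y n)\<bar> \<le> C1" "\<bar>d2 (y m) (y n)\<bar> \<le> C1"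
        using D1.Cauchy_Schwarz_sqrt[of "y m" "y n"] D2.Cauchy_Schwarz_sqrt[of "y m" "y n"] \<open>0 \<le> C1\<close>
        by simp_all
    qed
    define \<epsilon> where "\<epsilon> n = \<bar>f \<theta> - f (Z n)\<bar> + \<bar>g \<theta> - g (Z n)\<bar>" for n
    have "\<epsilon> \<longlonglongrightarrow> \<bar>f \<theta> - f \<theta>\<bar> + \<bar>g \<theta> - g \<theta>\<bar>" unfolding \<epsilon>_def by (intro tendsto_intros fZ gZ)
    then have \<epsilon>: "\<epsilon> \<longlonglongrightarrow> 0" by simp
    have "Bseq (\<lambda>n. ev (Z n))" using evZ by (intro convergent_imp_Bseq) (auto simp: convergent_def)
    then obtain L where L: "L > 0" "\<And>n. \<bar>ev (Z n)\<bar> \<le> L" by (auto simp: Bseq_def)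
    \<comment> \<open>The equation at \<open>Z m\<close>, tested with a difference, turns an energy
      pairing into a \<open>b\<close>-pairing; replacing the coefficients at \<open>Z m\<close> by
      those at \<open>\<theta>\<close> costs a multiple of \<open>\<epsilon> m\<close>. Hence
      eigenvectors that are Cauchy for \<open>b\<close> are Cauchy in energy.\<close>
    have one: "?A (y m) (y i - y j) \<le> L * sqrt (b (y i - y j) (y i - y j)) + 2 * C1 * \<epsilon> m"
      "- ?A (y m) (y i - y j) \<le> L * sqrt (b (y i - y j) (y i - y j)) + 2 * C1 * \<epsilon> m" for m i j
    proof -
      let ?z = "y i - y j"
      have zV: "?z \<in> V" using y by (intro subspace_diff P.subspace_V)
      have "?A (y m) ?z = ev (Z m) * b (y m) ?z + ((f \<theta> - f (Z m)) * d1 (y m) ?z + (g \<theta> - g (Z m)) * d2 (y m) ?z)"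
        using yeig[OF zV, of m] by (simp add: algebra_simps)
      moreover have "\<bar>ev (Z m) * b (y m) ?z\<bar> \<le> L * sqrt (b ?z ?z)"
        unfolding abs_mult using L P.B.Cauchy_Schwarz_sqrt[of "y m" ?z] y(2) by (intro mult_mono) auto
      moreover have "\<bar>(f \<theta> - f (Z m)) * d1 (y m) ?z\<bar> \<le> \<bar>f \<theta> - f (Z m)\<bar> * (2 * C1)"
        unfolding abs_mult using dCC[of m i] dCC[of m j]
        by (intro mult_left_mono) (auto simp: D1.diff_right)
      moreover have "\<bar>(g \<theta> - g (Z m)) * d2 (y m) ?z\<bar> \<le> \<bar>g \<theta> - g (Z m)\<bar> * (2 * C1)"
        unfolding abs_mult using dCC[of m i] dCC[of m j]
        by (intro mult_left_mono) (auto simp: D2.diff_right)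
      moreover have "2 * C1 * \<epsilon> m = \<bar>f \<theta> - f (Z m)\<bar> * (2 * C1) + \<bar>g \<theta> - g (Z m)\<bar> * (2 * C1)"
        by (simp add: \<epsilon>_def algebra_simps)
      ultimately show "?A (y m) ?z \<le> L * sqrt (b ?z ?z) + 2 * C1 * \<epsilon> m"
        "- ?A (y m) ?z \<le> L * sqrt (b ?z ?z) + 2 * C1 * \<epsilon> m" by linarith+
    qed
    have cauchy: "\<forall>e>0. \<exists>N. \<forall>m\<ge>N. \<forall>n\<ge>N. ?A (y m - y n) (y m - y n) + b (y m - y n) (y m - y n) < e"
    proof (intro allI impI)
      fix e :: real assume e: "e > 0"
      \<comment> \<open>A bound \<open>s^2\<close> on the squared \<open>b\<close>-distance gives
        \<open>s\<close> for its root. As \<open>s <= 1\<close>, the root and square terms together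
        stay below \<open>(2 * L + 1) * s\<close>, at most a quarter of \<open>e\<close>; each of
        the two \<open>\<epsilon>\<close> terms takes at most another quarter.\<close>
      define s where "s = min 1 (e / (4 * (2 * L + 1)))"
      have s: "0 < s" "s \<le> 1" "(2 * L + 1) * s \<le> e / 4"
      proof -
        have "s \<le> e / (4 * (2 * L + 1))" by (simp add: s_def)
        then show "(2 * L + 1) * s \<le> e / 4" using L(1) by (simp add: field_simps)
      qed (use e L in \<open>auto simp: s_def\<close>)
      have "0 < s\<^sup>2" using s by simp
      with r(2) obtain N1 where N1: "\<forall>m\<ge>N1. \<forall>n\<ge>N1. b (y m - y n) (y m - y n) < s\<^sup>2"
        unfolding y_def by blast
      have "0 < e / (8 * (C1 + 1))" using e \<open>0 \<le> C1\<close> by simp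
      from LIMSEQ_D[OF \<epsilon> this] obtain N2 where N2: "\<forall>n\<ge>N2. \<bar>\<epsilon> n\<bar> < e / (8 * (C1 + 1))" by auto
      have "?A (y m - y n) (y m - y n) + b (y m - y n) (y m - y n) < e"
        if mn: "m \<ge> max N1 N2" "n \<ge> max N1 N2" for m n
      proof -
        let ?z = "y m - y n"
        have bz: "b ?z ?z < s\<^sup>2" using N1 mn by simp
        have sq: "sqrt (b ?z ?z) \<le> s" using bz s by (simp add: real_le_lsqrt)
        have eps: "2 * C1 * \<epsilon> i \<le> e / 4" if "i \<ge> N2" for i
        proof -
          have "2 * C1 * \<epsilon> i \<le> 2 * (C1 + 1) * (e / (8 * (C1 + 1)))"
            using N2[rule_format, OF that] \<open>0 \<le> C1\<close> by (intro mult_mono) (auto simp: \<epsilon>_def)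
          also have "\<dots> = e / 4" using \<open>0 \<le> C1\<close> by (simp add: field_simps)
          finally show ?thesis .
        qed
        have "?A ?z ?z = ?A (y m) ?z - ?A (y n) ?z" by (rule A.A.diff_left)
        also have "\<dots> \<le> 2 * L * sqrt (b ?z ?z) + 2 * C1 * \<epsilon> m + 2 * C1 * \<epsilon> n"
          using one(1)[of m m n] one(2)[of n m n] by simp
        finally have "?A ?z ?z + b ?z ?z \<le> 2 * L * sqrt (b ?z ?z) + b ?z ?z + 2 * C1 * \<epsilon> m + 2 * C1 * \<epsilon> n" by simp
        also have "\<dots> \<le> 2 * L * s + s + e / 4 + e / 4"
        proof -
          have "2 * L * sqrt (b ?z ?z) \<le> 2 * L * s" using sq L(1) by simp
          moreover have "s\<^sup>2 \<le> s" using s by (simp add: power2_eq_square mult_left_le)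
          ultimately show ?thesis using eps[of m] eps[of n] mn bz by simp
        qed
        also have "\<dots> < e" using s(3) e by (simp add: algebra_simps)
        finally show ?thesis .
      qed
      then show "\<exists>N. \<forall>m\<ge>N. \<forall>n\<ge>N. ?A (y m - y n) (y m - y n) + b (y m - y n) (y m - y n) < e" by blast
    qed
    from A.complete[of y, OF y(1) this] obtain v where v: "v \<in> V"
      "(\<lambda>n. ?A (y n - v) (y n - v) + b (y n - v) (y n - v)) \<longlonglongrightarrow> 0" by blast
    have vA: "(\<lambda>n. ?A (y n - v) (y n - v)) \<longlonglongrightarrow> 0" and vb: "(\<lambda>n. b (y n - v) (y n - v)) \<longlonglongrightarrow> 0"
      using A.A.nonneg P.B.nonneg by (auto intro!: tendsto_sandwich[OF _ _ tendsto_const v(2)] always_eventually)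
    have v1: "(\<lambda>n. d1 (y n - v) (y n - v)) \<longlonglongrightarrow> 0"
    proof (rule tendsto_sandwich[OF _ _ tendsto_const])
      show "(\<lambda>n. ?A (y n - v) (y n - v) / f \<theta>) \<longlonglongrightarrow> 0" using tendsto_divide[OF vA tendsto_const, of "f \<theta>"] p\<theta> by simp
    qed (use p\<theta> D1.nonneg D2.nonneg in \<open>auto simp: field_simps\<close>)
    have v2: "(\<lambda>n. d2 (y n - v) (y n - v)) \<longlonglongrightarrow> 0"
    proof (rule tendsto_sandwich[OF _ _ tendsto_const])
      show "(\<lambda>n. ?A (y n - v) (y n - v) / g \<theta>) \<longlonglongrightarrow> 0" using tendsto_divide[OF vA tendsto_const, of "g \<theta>"] p\<theta> by simp
    qed (use p\<theta> D1.nonneg D2.nonneg in \<open>auto simp: field_simps\<close>)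
    note lim = D1.tendsto_left[OF v1] D2.tendsto_left[OF v2] P.B.tendsto_left[OF vb]
    have bv: "b v v = 1" using P.B.tendsto_norm[OF vb] y(2) by (simp add: LIMSEQ_const_iff)
    have veig: "?A v z = ev \<theta> * b v z" if "z \<in> V" for z
    proof (rule LIMSEQ_unique)
      show "(\<lambda>n. f (Z n) * d1 (y n) z + g (Z n) * d2 (y n) z) \<longlonglongrightarrow> ?A v z"
        by (intro tendsto_intros fZ gZ lim)
      show "(\<lambda>n. f (Z n) * d1 (y n) z + g (Z n) * d2 (y n) z) \<longlonglongrightarrow> ev \<theta> * b v z"
        unfolding yeig[OF that] by (intro tendsto_intros evZ lim)
    qed
    \<comment> \<open>The coefficient of \<open>w\<close> in the limit \<open>v\<close>; the
      remainder \<open>z\<close> is an eigenvector orthogonal to \<open>w\<close>, hence null by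
      simplicity.\<close>
    define \<gamma> where "\<gamma> = b v w / b w w"
    define z where "z = v - \<gamma> *\<^sub>R w"
    have zV: "z \<in> V" unfolding z_def by (intro subspace_diff subspace_scale P.subspace_V v w)
    have zeig: "?A z x = ev \<theta> * b z x" if "x \<in> V" for x
      using veig[OF that] w(3)[OF that]
      by (simp add: z_def D1.bilinear_simps D2.bilinear_simps P.B.bilinear_simps algebra_simps)
        (metis distrib_left mult.left_commute)
    have "b z w = 0" using w(2) by (simp add: z_def \<gamma>_def P.B.bilinear_simps)
    from simple[OF zV zeig this] have bz: "b z z = 0" .
    have "?A z z = 0" using zeig[OF zV] bz by simp
    then have dz: "d1 z z = 0" "d2 z z = 0"
      using p\<theta> D1.nonneg[of z] D2.nonneg[of z] by (auto simp: add_nonneg_eq_0_iff)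
    have "d1 z w = 0" "d2 z w = 0" "b z v = 0"
      using D1.Cauchy_Schwarz[of z w] D2.Cauchy_Schwarz[of z w] P.B.Cauchy_Schwarz[of z v] dz bz by auto
    then have dv: "d1 v w = \<gamma> * d1 w w" "d2 v w = \<gamma> * d2 w w" and "b v v = \<gamma> * b w v"
      by (auto simp: z_def D1.bilinear_simps D2.bilinear_simps P.B.bilinear_simps)
    then have \<gamma>0: "\<gamma> \<noteq> 0" using bv by auto
    have bvw: "b v w = \<gamma> * b w w" using w(2) by (simp add: \<gamma>_def)
    \<comment> \<open>The equation at \<open>Z n\<close> tested with \<open>w\<close>, minus the
      equation at \<open>\<theta>\<close> tested with \<open>y n\<close>: by symmetry only
      differences of coefficients and of eigenvalues remain.\<close>
    have quot: "((f (Z n) - f \<theta>) / (Z n - \<theta>)) * d1 (y n) w + ((g (Z n) - g \<theta>) / (Z n - \<theta>)) * d2 (y n) w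
        = ?q (Z n) * b (y n) w" for n
    proof -
      have "(f (Z n) - f \<theta>) * d1 (y n) w + (g (Z n) - g \<theta>) * d2 (y n) w = (ev (Z n) - ev \<theta>) * b (y n) w"
        using yeig[OF w(1), of n] w(3)[OF y(1), of n]
        by (simp add: D1.commute[of w "y n"] D2.commute[of w "y n"] P.B.commute[of w "y n"] algebra_simps)
      then show ?thesis by (simp flip: add_divide_distrib)
    qed
    have fq: "(\<lambda>n. (f (Z n) - f \<theta>) / (Z n - \<theta>)) \<longlonglongrightarrow> f'" and gq: "(\<lambda>n. (g (Z n) - g \<theta>) / (Z n - \<theta>)) \<longlonglongrightarrow> g'"
      using f' g' Z(2) Zlim unfolding has_field_derivative_iff tendsto_at_iff_sequentially
      by (auto simp: o_def)
    have "(\<lambda>n. (((f (Z n) - f \<theta>) / (Z n - \<theta>)) * d1 (y n) w + ((g (Z n) - g \<theta>) / (Z n - \<theta>)) * d2 (y n) w) / b (y n) w)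
       \<longlonglongrightarrow> (f' * d1 v w + g' * d2 v w) / b v w"
      using \<gamma>0 w(2) by (intro tendsto_intros fq gq lim) (simp add: bvw)
    moreover have "(f' * d1 v w + g' * d2 v w) / b v w = ?D"
      using \<gamma>0 w(2) by (simp add: dv bvw field_simps)
    ultimately have "(\<lambda>n. ?q (Z n) * b (y n) w / b (y n) w) \<longlonglongrightarrow> ?D" unfolding quot by simp
    \<comment> \<open>The pairing \<open>b (y n) w\<close> may vanish for small \<open>n\<close>;
      its limit \<open>\<gamma> * b w w\<close> is nonzero, so it can be cancelled
      eventually.\<close>
    moreover have "\<forall>\<^sub>F n in sequentially. ?q (Z n) * b (y n) w / b (y n) w = ?q (Z n)"
    proof -
      have "b v w \<noteq> 0" using bvw \<gamma>0 w(2) by simp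
      from tendsto_imp_eventually_ne[OF lim(3) this] show ?thesis by eventually_elim simp
    qed
    ultimately have "(\<lambda>n. ?q (Z n)) \<longlonglongrightarrow> ?D" by (rule Lim_transform_eventually)
    then show ?thesis using r(1) unfolding Z_def by blast
  qed
  show ?thesis
    unfolding has_field_derivative_iff tendsto_at_iff_sequentially
  proof (intro allI impI)
    fix X :: "nat \<Rightarrow> real" assume X: "\<forall>i. X i \<in> UNIV - {\<theta>}" "X \<longlonglongrightarrow> \<theta>"
    show "(?q \<circ> X) \<longlonglongrightarrow> ?D"
    proof (rule LIMSEQ_subsubseqI)
      fix r :: "nat \<Rightarrow> nat" assume r: "strict_mono r"
      have Xr: "(X \<circ> r) \<longlonglongrightarrow> \<theta>" by (rule LIMSEQ_subseq_LIMSEQ[OF X(2) r])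
      \<comment> \<open>Only a tail of the sequence is known to lie in \<open>J\<close>, hence the
        shift by \<open>N\<close>.\<close>
      from topological_tendstoD[OF this \<open>open J\<close> \<open>\<theta> \<in> J\<close>] obtain N where N: "\<And>n. n \<ge> N \<Longrightarrow> X (r n) \<in> J"
        by (auto simp: eventually_sequentially)
      obtain r' where r': "strict_mono (r' :: nat \<Rightarrow> nat)" "(\<lambda>n. ?q (X (r (r' n + N)))) \<longlonglongrightarrow> ?D"
        using core[of "\<lambda>n. X (r (n + N))"] N X LIMSEQ_ignore_initial_segment[OF Xr, of N]
        by (auto simp: o_def)
      show "\<exists>r'. strict_mono (r' :: nat \<Rightarrow> nat) \<and> (\<lambda>n. (?q \<circ> X) (r (r' n))) \<longlonglongrightarrow> ?D"
        using r' by (intro exI[of _ "\<lambda>n. r' n + N"]) (auto simp: strict_mono_def o_def)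
    qed
  qed
qed

end

section \<open>Square-integrable functions\<close>

text \<open>Squared distances avoid roots at the price of a factor 2 in each triangle inequality;
  most numerical constants in the estimates below accumulate from these factors.\<close>

abbreviation sqd :: "pt set \<Rightarrow> (pt \<Rightarrow> real) \<Rightarrow> (pt \<Rightarrow> real) \<Rightarrow> real" where
  "sqd T u v \<equiv> ip T (\<lambda>z. u z - v z) (\<lambda>z. u z - v z)"

lemma L2_mult_integrable:
  assumes "L2 T u" "L2 T v"
  shows "integrable (lebesgue_on T) (\<lambda>z. u z * v z)"
proof (rule Bochner_Integration.integrable_bound)
  have [measurable]: "u \<in> borel_measurable (lebesgue_on T)" "v \<in> borel_measurable (lebesgue_on T)"
    using assms by (auto simp: L2_def)
  show "integrable (lebesgue_on T) (\<lambda>z. (u z)\<^sup>2 + (v z)\<^sup>2)"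
    using assms by (auto simp: L2_def)
  show "(\<lambda>z. u z * v z) \<in> borel_measurable (lebesgue_on T)" by measurable
  have "\<bar>x * y\<bar> \<le> x\<^sup>2 + y\<^sup>2" for x y :: real
    using zero_le_power2[of "x - y"] zero_le_power2[of "x + y"]
    by (simp add: abs_le_iff power2_diff power2_sum)
  then show "AE z in lebesgue_on T. norm (u z * v z) \<le> norm ((u z)\<^sup>2 + (v z)\<^sup>2)" by auto
qed

lemma L2_add: "L2 T u \<Longrightarrow> L2 T v \<Longrightarrow> L2 T (\<lambda>z. u z + v z)"
  using L2_mult_integrable[of T u v] by (auto simp: L2_def power2_sum mult.assoc)

lemma L2_cmult: "L2 T u \<Longrightarrow> L2 T (\<lambda>z. c * u z)"
  by (auto simp: L2_def power_mult_distrib)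

lemma L2_zero: "L2 T (\<lambda>z. 0)"
  by (auto simp: L2_def)

lemma L2_diff: "L2 T u \<Longrightarrow> L2 T v \<Longrightarrow> L2 T (\<lambda>z. u z - v z)"
  using L2_add[of T u "\<lambda>z. (-1) * v z"] L2_cmult[of T v "-1"] by simp

lemma L2_divide: "L2 T u \<Longrightarrow> L2 T (\<lambda>z. u z / c)"
  using L2_cmult[of T u "1/c"] by simp

lemmas L2_intros = L2_add L2_cmult L2_diff L2_zero L2_divide

lemma ip_commute: "ip T u v = ip T v u"
  by (simp add: ip_def mult.commute)

lemma ip_add_right: "L2 T u \<Longrightarrow> L2 T v \<Longrightarrow> L2 T w \<Longrightarrow> ip T u (\<lambda>z. v z + w z) = ip T u v + ip T u w"
  using L2_mult_integrable[of T u v] L2_mult_integrable[of T u w] by (simp add: ip_def distrib_left)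

lemma ip_diff_right: "L2 T u \<Longrightarrow> L2 T v \<Longrightarrow> L2 T w \<Longrightarrow> ip T u (\<lambda>z. v z - w z) = ip T u v - ip T u w"
  using L2_mult_integrable[of T u v] L2_mult_integrable[of T u w] by (simp add: ip_def right_diff_distrib)

lemma ip_cmult_right: "ip T u (\<lambda>z. c * v z) = c * ip T u v"
  unfolding ip_def by (subst integral_mult_right_zero[symmetric]) (simp add: mult.left_commute)

lemma ip_add_left: "L2 T u \<Longrightarrow> L2 T v \<Longrightarrow> L2 T w \<Longrightarrow> ip T (\<lambda>z. v z + w z) u = ip T v u + ip T w u"
  using ip_add_right[of T u v w] by (simp only: ip_commute[of T u "\<lambda>z. v z + w z"] ip_commute[of T u v] ip_commute[of T u w])

lemma ip_diff_left: "L2 T u \<Longrightarrow> L2 T v \<Longrightarrow> L2 T w \<Longrightarrow> ip T (\<lambda>z. v z - w z) u = ip T v u - ip T w u"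
  using ip_diff_right[of T u v w] by (simp only: ip_commute[of T u "\<lambda>z. v z - w z"] ip_commute[of T u v] ip_commute[of T u w])

lemma ip_cmult_left: "ip T (\<lambda>z. c * v z) u = c * ip T v u"
  by (simp only: ip_commute[of T "\<lambda>z. c * v z" u] ip_commute[of T v u] ip_cmult_right)

lemma ip_zero [simp]: "ip T (\<lambda>z. 0) u = 0" "ip T u (\<lambda>z. 0) = 0"
  by (simp_all add: ip_def)

lemma ip_nonneg [simp]: "0 \<le> ip T u u"
  by (simp add: ip_def)

lemmas ip_simps = ip_add_right ip_diff_right ip_cmult_right ip_add_left ip_diff_left ip_cmult_left L2_intros

lemma ip_Cauchy_Schwarz:
  assumes "L2 T u" "L2 T v"
  shows "(ip T u v)\<^sup>2 \<le> ip T u u * ip T v v"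
proof (rule discriminant_le)
  fix t :: real
  have "0 \<le> ip T (\<lambda>z. u z - t * v z) (\<lambda>z. u z - t * v z)" by simp
  also have "\<dots> = ip T u u - 2 * t * ip T u v + t\<^sup>2 * ip T v v"
    using assms by (simp add: ip_simps ip_commute[of T v u] power2_eq_square algebra_simps)
  finally show "0 \<le> ip T u u - 2 * t * ip T u v + t\<^sup>2 * ip T v v" .
qed simp

lemma ip_add_le:
  assumes "L2 T u" "L2 T v"
  shows "ip T (\<lambda>z. u z + v z) (\<lambda>z. u z + v z) \<le> 2 * ip T u u + 2 * ip T v v"
proof -
  have "0 \<le> sqd T u v" by simp
  then show ?thesis using assms by (simp add: ip_simps ip_commute[of T v u])
qed

lemma ip_diff_triangle:
  assumes "L2 T u" "L2 T v" "L2 T w"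
  shows "sqd T u w
    \<le> 2 * sqd T u v + 2 * sqd T v w"
  using ip_add_le[of T "\<lambda>z. u z - v z" "\<lambda>z. v z - w z"] assms by (simp add: L2_intros)

lemma ip_diff_commute:
  "sqd T u v = sqd T v u"
  unfolding ip_def by (rule Bochner_Integration.integral_cong) (auto simp: algebra_simps)

lemma ip_tendsto:
  assumes "\<And>n. L2 T (f n)" "L2 T g" "L2 T v"
    and "(\<lambda>n. sqd T (f n) g) \<longlonglongrightarrow> 0"
  shows "(\<lambda>n. ip T (f n) v) \<longlonglongrightarrow> ip T g v"
proof -
  have "(\<lambda>n. ip T (\<lambda>z. f n z - g z) v) \<longlonglongrightarrow> 0"
  proof (rule tendsto_rabs_zero_cancel, rule tendsto_sandwich[OF _ _ tendsto_const])
    show "(\<lambda>n. sqrt (sqd T (f n) g) * sqrt (ip T v v)) \<longlonglongrightarrow> 0"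
      using tendsto_mult_right[OF tendsto_real_sqrt[OF assms(4)], of "sqrt (ip T v v)"] by simp
    show "\<forall>\<^sub>F n in sequentially. \<bar>ip T (\<lambda>z. f n z - g z) v\<bar>
        \<le> sqrt (sqd T (f n) g) * sqrt (ip T v v)"
      using real_sqrt_le_mono[OF ip_Cauchy_Schwarz] assms
      by (intro always_eventually allI) (simp add: L2_intros real_sqrt_mult)
  qed auto
  then have "(\<lambda>n. ip T (\<lambda>z. f n z - g z) v + ip T g v) \<longlonglongrightarrow> 0 + ip T g v"
    by (intro tendsto_intros)
  then show ?thesis using assms by (simp add: ip_simps)
qed

lemma AE_zero_if_ip_zero:
  assumes "L2 T u" "ip T u u = 0"
  shows "AE z in lebesgue_on T. u z = 0"
proof -
  have "AE z in lebesgue_on T. (u z)\<^sup>2 = 0"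
    using assms by (subst integral_nonneg_eq_0_iff_AE[symmetric]) (auto simp: L2_def ip_def power2_eq_square)
  then show ?thesis by auto
qed

lemma lebesgue_on_measurable_continuous:
  fixes f :: "pt \<Rightarrow> real"
  assumes "compact T" "continuous_on T f"
  shows "f \<in> borel_measurable (lebesgue_on T)"
  using assms by (intro continuous_imp_measurable_on_sets_lebesgue)
    (auto intro: borel_compact simp: lmeasurable_compact fmeasurableD)

lemma integrable_bounded_compact:
  fixes f :: "pt \<Rightarrow> real"
  assumes "compact T" "f \<in> borel_measurable (lebesgue_on T)" "\<And>z. z \<in> T \<Longrightarrow> \<bar>f z\<bar> \<le> B"
  shows "integrable (lebesgue_on T) f"
proof -
  interpret finite_measure "lebesgue_on T"
    using assms by (intro finite_measure_lebesgue_on lmeasurable_compact)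
  show ?thesis using assms by (intro integrable_const_bound[where B=B]) auto
qed

lemma L2_bounded:
  fixes f :: "pt \<Rightarrow> real"
  assumes "compact T" "f \<in> borel_measurable (lebesgue_on T)" "\<And>z. z \<in> T \<Longrightarrow> \<bar>f z\<bar> \<le> B"
  shows "L2 T f"
  unfolding L2_def
proof
  show "f \<in> borel_measurable (lebesgue_on T)" by fact
  show "integrable (lebesgue_on T) (\<lambda>z. (f z)\<^sup>2)"
  proof (rule integrable_bounded_compact[OF \<open>compact T\<close>])
    show "(\<lambda>z. (f z)\<^sup>2) \<in> borel_measurable (lebesgue_on T)" using assms(2) by measurable
    show "\<bar>(f z)\<^sup>2\<bar> \<le> B\<^sup>2" if "z \<in> T" for z
      using power_mono[OF assms(3)[OF that], of 2] by simp
  qed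
qed

lemma continuous_bounded_on_compact:
  fixes f :: "pt \<Rightarrow> real"
  assumes "compact T" "continuous_on T f"
  obtains B where "0 < B" "\<And>z. z \<in> T \<Longrightarrow> \<bar>f z\<bar> \<le> B"
  using compact_imp_bounded[OF compact_continuous_image[OF assms(2,1)]]
  by (auto simp: bounded_pos)

lemma L2_continuous:
  fixes f :: "pt \<Rightarrow> real"
  assumes "compact T" "continuous_on T f"
  shows "L2 T f"
proof -
  obtain B where "\<And>z. z \<in> T \<Longrightarrow> \<bar>f z\<bar> \<le> B" using continuous_bounded_on_compact[OF assms] by metis
  then show ?thesis using assms by (intro L2_bounded lebesgue_on_measurable_continuous)
qed

lemma L2_const: "compact T \<Longrightarrow> L2 T (\<lambda>z. c)"
  by (rule L2_continuous) auto

lemma ip_le_bound: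
  assumes "compact T" "L2 T u" "L2 T v" "\<And>z. z \<in> T \<Longrightarrow> \<bar>u z\<bar> \<le> e" "\<And>z. z \<in> T \<Longrightarrow> \<bar>v z\<bar> \<le> e'" 
  shows "\<bar>ip T u v\<bar> \<le> e * e' * measure lebesgue T"
proof -
  have "\<bar>ip T u v\<bar> \<le> (\<integral>z. \<bar>u z * v z\<bar> \<partial>lebesgue_on T)"
    unfolding ip_def by (rule integral_abs_bound)
  also have "\<dots> \<le> (\<integral>z. e * e' \<partial>lebesgue_on T)"
  proof (rule integral_mono)
    show "integrable (lebesgue_on T) (\<lambda>z. \<bar>u z * v z\<bar>)"
      using L2_mult_integrable[OF assms(2,3)] by auto
    show "integrable (lebesgue_on T) (\<lambda>z. e * e')"
      using assms(1) by (intro integrable_bounded_compact[where B="\<bar>e * e'\<bar>"]) auto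
    show "\<bar>u z * v z\<bar> \<le> e * e'" if "z \<in> space (lebesgue_on T)" for z
      unfolding abs_mult using that assms(4,5)[of z] by (intro mult_mono) auto
  qed
  also have "\<dots> = e * e' * measure lebesgue T"
    using assms(1) by (simp add: measure_restrict_space lmeasurable_compact fmeasurableD)
  finally show ?thesis .
qed

section \<open>Completeness of L2 and density of continuous functions\<close>

lemma L1_le_L2:
  assumes "compact T" "L2 T u"
  shows "(\<integral>z. \<bar>u z\<bar> \<partial>lebesgue_on T)\<^sup>2 \<le> ip T u u * measure lebesgue T"
proof -
  have a: "L2 T (\<lambda>z. \<bar>u z\<bar>)" using assms(2) by (auto simp: L2_def)
  have "(ip T (\<lambda>z. \<bar>u z\<bar>) (\<lambda>z. 1))\<^sup>2 \<le> ip T (\<lambda>z. \<bar>u z\<bar>) (\<lambda>z. \<bar>u z\<bar>) * ip T (\<lambda>z. 1) (\<lambda>z. 1)"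
    by (rule ip_Cauchy_Schwarz[OF a L2_const[OF assms(1)]])
  also have "ip T (\<lambda>z. 1) (\<lambda>z. 1) = measure lebesgue T"
    using assms(1) by (simp add: ip_def measure_restrict_space lmeasurable_compact fmeasurableD)
  also have "ip T (\<lambda>z. \<bar>u z\<bar>) (\<lambda>z. \<bar>u z\<bar>) = ip T u u" by (simp add: ip_def)
  finally show ?thesis by (simp add: ip_def)
qed

text \<open>Since \<open>T\<close> has finite measure, a sequence that is Cauchy in L2 is Cauchy in
  L1 and has a subsequence converging almost everywhere. Fatou's lemma then bounds the L2 distance
  to the pointwise limit.\<close>

theorem L2_complete:
  assumes "compact T" and f: "\<And>n. L2 T (f n)"
    and cauchy: "\<forall>e>0. \<exists>N::nat. \<forall>m\<ge>N. \<forall>n\<ge>N. sqd T (f m) (f n) < e"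
  shows "\<exists>g. L2 T g \<and> (\<lambda>n. sqd T (f n) g) \<longlonglongrightarrow> 0"
proof -
  let ?M = "lebesgue_on T"
  have [measurable]: "f n \<in> borel_measurable ?M" for n using f by (simp add: L2_def)
  have int: "integrable ?M (f n)" for n
    using L2_mult_integrable[OF f L2_const[OF \<open>compact T\<close>, of 1], of n] by simp
  define c where "c = measure lebesgue T + 1"
  have c: "c > 0" by (simp add: c_def add_nonneg_pos)
  have "\<exists>N. \<forall>i\<ge>N. \<forall>j\<ge>N. (LINT x|?M. norm (f i x - f j x)) < e" if "e > 0" for e
  proof -
    obtain N where N: "\<forall>m\<ge>N. \<forall>n\<ge>N. sqd T (f m) (f n) < e\<^sup>2 / c"
      using cauchy \<open>e > 0\<close> c by (metis divide_pos_pos zero_less_power)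
    have "(LINT x|?M. norm (f i x - f j x)) < e" if "i \<ge> N" "j \<ge> N" for i j
    proof -
      have "(LINT x|?M. \<bar>f i x - f j x\<bar>)\<^sup>2 \<le> sqd T (f i) (f j) * measure lebesgue T"
        using f by (intro L1_le_L2 \<open>compact T\<close> L2_diff)
      also have "\<dots> \<le> sqd T (f i) (f j) * c"
        by (intro mult_left_mono) (auto simp: c_def)
      also have "\<dots> < (e\<^sup>2 / c) * c" using N that c by (intro mult_strict_right_mono) auto
      finally have "(LINT x|?M. \<bar>f i x - f j x\<bar>)\<^sup>2 < e\<^sup>2" using c by simp
      then show ?thesis using \<open>e > 0\<close> by (simp add: power_less_imp_less_base)
    qed
    then show ?thesis by blast
  qed
  from cauchy_L1_AE_cauchy_subseq[OF int this] obtain r where r: "strict_mono r"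
    "AE x in ?M. Cauchy (\<lambda>i. f (r i) x)" by blast
  define g where "g x = lim (\<lambda>i. f (r i) x)" for x
  have [measurable]: "g \<in> borel_measurable ?M" unfolding g_def by measurable
  have lim: "AE x in ?M. (\<lambda>i. f (r i) x) \<longlonglongrightarrow> g x"
    using r(2) by eventually_elim (simp add: g_def Cauchy_convergent convergent_LIMSEQ_iff[symmetric])
  have bound: "(\<integral>\<^sup>+x. ennreal ((f n x - g x)\<^sup>2) \<partial>?M) \<le> ennreal e"
    if N: "\<forall>m\<ge>N. \<forall>n\<ge>N. sqd T (f m) (f n) < e" and "n \<ge> N" for N e n
  proof -
    have "(\<integral>\<^sup>+x. ennreal ((f n x - g x)\<^sup>2) \<partial>?M) = (\<integral>\<^sup>+x. liminf (\<lambda>i. ennreal ((f n x - f (r i) x)\<^sup>2)) \<partial>?M)"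
    proof (rule nn_integral_cong_AE, use lim in eventually_elim)
      fix x assume "(\<lambda>i. f (r i) x) \<longlonglongrightarrow> g x"
      then have "(\<lambda>i. ennreal ((f n x - f (r i) x)\<^sup>2)) \<longlonglongrightarrow> ennreal ((f n x - g x)\<^sup>2)"
        by (intro tendsto_intros)
      from lim_imp_Liminf[OF _ this]
      show "ennreal ((f n x - g x)\<^sup>2) = liminf (\<lambda>i. ennreal ((f n x - f (r i) x)\<^sup>2))"
        by simp
    qed
    also have "\<dots> \<le> liminf (\<lambda>i. \<integral>\<^sup>+x. ennreal ((f n x - f (r i) x)\<^sup>2) \<partial>?M)"
      by (rule nn_integral_liminf) measurable
    also have "\<dots> \<le> ennreal e"
    proof (rule order_trans[OF Liminf_le_Limsup Limsup_bounded], simp, rule eventually_sequentiallyI[of N])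
      fix i assume "i \<ge> N"
      then have "r i \<ge> N" using seq_suble[OF r(1), of i] by simp
      have "(\<integral>\<^sup>+x. ennreal ((f n x - f (r i) x)\<^sup>2) \<partial>?M) = ennreal (sqd T (f n) (f (r i)))"
        using L2_diff[OF f f, of n "r i"] unfolding ip_def L2_def power2_eq_square
        by (intro nn_integral_eq_integral) auto
      also have "\<dots> \<le> ennreal e" using N \<open>r i \<ge> N\<close> \<open>n \<ge> N\<close> by (intro ennreal_leI) (auto intro: less_imp_le)
      finally show "(\<integral>\<^sup>+x. ennreal ((f n x - f (r i) x)\<^sup>2) \<partial>?M) \<le> ennreal e" .
    qed
    finally show ?thesis .
  qed
  \<comment> \<open>Finiteness of the integral in \<open>bound\<close> makes \<open>f n - g\<close>
    square integrable for a suitable \<open>n\<close>; \<open>g\<close> is then a difference of two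
    L2 functions.\<close>
  have L2d: "L2 T (\<lambda>z. f n z - g z)" if "\<exists>e. \<forall>m\<ge>n. \<forall>n'\<ge>n. sqd T (f m) (f n') < e" for n
  proof -
    from that obtain e where "\<forall>m\<ge>n. \<forall>n'\<ge>n. sqd T (f m) (f n') < e" by blast
    from bound[OF this order_refl] have "(\<integral>\<^sup>+x. ennreal ((f n x - g x)\<^sup>2) \<partial>?M) < \<infinity>"
      using ennreal_less_top[of e] by (metis infinity_ennreal_def le_less_trans)
    then show ?thesis unfolding L2_def by (auto intro!: integrableI_nonneg)
  qed
  have L2g: "L2 T g"
  proof -
    obtain N where "\<forall>m\<ge>N. \<forall>n\<ge>N. sqd T (f m) (f n) < 1"
      using cauchy zero_less_one by blast
    then have "L2 T (\<lambda>z. f N z - g z)" by (blast intro: L2d)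
    from L2_diff[OF f[of N] this] show ?thesis by simp
  qed
  have "(\<lambda>n. sqd T (f n) g) \<longlonglongrightarrow> 0"
  proof (rule LIMSEQ_I)
    fix e :: real assume "e > 0"
    then obtain N where N: "\<forall>m\<ge>N. \<forall>n\<ge>N. sqd T (f m) (f n) < e / 2"
      using cauchy by (meson half_gt_zero)
    have "sqd T (f n) g \<le> e / 2" if "n \<ge> N" for n
    proof -
      have "(\<integral>\<^sup>+x. ennreal ((f n x - g x)\<^sup>2) \<partial>?M) = ennreal (sqd T (f n) g)"
        using L2_diff[OF f L2g, of n] unfolding ip_def L2_def power2_eq_square
        by (intro nn_integral_eq_integral) auto
      then show ?thesis using bound[OF N that] \<open>e > 0\<close> by simp
    qed
    then have "sqd T (f n) g < e" if "n \<ge> N" for n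
      using \<open>e > 0\<close> that by fastforce
    then show "\<exists>no. \<forall>n\<ge>no. norm (sqd T (f n) g - 0) < e"
      by (intro exI[of _ N]) auto
  qed
  then show ?thesis using L2g by blast
qed

text \<open>A measurable function is an almost-everywhere limit of continuous ones; truncating these
  at \<open>B\<close> keeps them continuous and provides the constant majorant for dominated
  convergence.\<close>

lemma L2_continuous_dense_bounded:
  fixes f :: "pt \<Rightarrow> real"
  assumes "compact T" and f: "f \<in> borel_measurable (lebesgue_on T)" "\<And>z. \<bar>f z\<bar> \<le> B" and "e > 0"
  shows "\<exists>g. continuous_on UNIV g \<and> sqd T f g < e"
proof -
  have Ts: "T \<in> sets lebesgue" using \<open>compact T\<close> by (simp add: lmeasurable_compact fmeasurableD)
  have "f measurable_on T" using f(1) Ts by (simp add: measurable_on_iff_borel_measurable)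
  then obtain N g where N: "negligible N" and g: "\<And>n. continuous_on UNIV (g n)"
    "\<And>z. z \<notin> N \<Longrightarrow> (\<lambda>n. g n z) \<longlonglongrightarrow> (if z \<in> T then f z else 0)"
    unfolding measurable_on_def by blast
  define h where "h n z = max (- B) (min B (g n z))" for n :: nat and z
  have h: "continuous_on UNIV (h n)" for n unfolding h_def using g(1) by (intro continuous_intros)
  have B: "0 \<le> B" using f(2)[of 0] by simp
  have hB: "\<bar>h n z\<bar> \<le> B" for n z using B by (auto simp: h_def)
  have [measurable]: "h n \<in> borel_measurable (lebesgue_on T)" for n
    using \<open>compact T\<close> continuous_on_subset[OF h] by (intro lebesgue_on_measurable_continuous) auto
  note f(1)[measurable]
  have AE: "AE z in lebesgue_on T. (\<lambda>n. (f z - h n z) * (f z - h n z)) \<longlonglongrightarrow> 0"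
  proof -
    have "AE z in lebesgue_on T. z \<notin> N"
    proof -
      have "AE z in lebesgue. z \<notin> N" using N by (simp add: negligible_iff_null_sets AE_not_in)
      then show ?thesis using Ts by (auto simp: AE_restrict_space_iff elim: eventually_mono)
    qed
    moreover have "AE z in lebesgue_on T. z \<in> T" by (rule AE_I2) simp
    ultimately show ?thesis
    proof eventually_elim
      fix z assume z: "z \<notin> N" "z \<in> T"
      have "(\<lambda>n. g n z) \<longlonglongrightarrow> f z" using g(2)[OF z(1)] z(2) by simp
      then have "(\<lambda>n. h n z) \<longlonglongrightarrow> max (- B) (min B (f z))"
        unfolding h_def by (intro tendsto_intros)
      moreover have "max (- B) (min B (f z)) = f z" using f(2)[of z] by auto
      ultimately have "(\<lambda>n. h n z) \<longlonglongrightarrow> f z" by metis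
      then have "(\<lambda>n. (f z - h n z) * (f z - h n z)) \<longlonglongrightarrow> (f z - f z) * (f z - f z)"
        by (intro tendsto_intros)
      then show "(\<lambda>n. (f z - h n z) * (f z - h n z)) \<longlonglongrightarrow> 0" by simp
    qed
  qed
  have "(\<lambda>n. \<integral>z. (f z - h n z) * (f z - h n z) \<partial>lebesgue_on T) \<longlonglongrightarrow> (\<integral>z. 0 \<partial>lebesgue_on T)"
  proof (rule integral_dominated_convergence[where w="\<lambda>z. (2 * B) * (2 * B)"])
    show "integrable (lebesgue_on T) (\<lambda>z. (2 * B) * (2 * B))"
      using \<open>compact T\<close> by (intro integrable_bounded_compact[where B="(2 * B) * (2 * B)"]) auto
    show "AE z in lebesgue_on T. norm ((f z - h n z) * (f z - h n z)) \<le> 2 * B * (2 * B)" for n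
    proof (rule AE_I2)
      fix z
      have "\<bar>f z - h n z\<bar> \<le> 2 * B" using f(2)[of z] hB[of n z] by linarith
      then show "norm ((f z - h n z) * (f z - h n z)) \<le> 2 * B * (2 * B)"
        unfolding real_norm_def abs_mult by (intro mult_mono) auto
    qed
  qed (use AE in auto)
  then have "(\<lambda>n. sqd T f (h n)) \<longlonglongrightarrow> 0" by (simp add: ip_def)
  from LIMSEQ_D[OF this \<open>e > 0\<close>] obtain n where "sqd T f (h n) < e"
    by auto
  then show ?thesis using h by blast
qed

text \<open>Truncations at height \<open>n\<close> converge in L2, with the square of
  \<open>f\<close> as majorant; this reduces the claim to bounded functions.\<close>

lemma L2_continuous_dense:
  assumes "compact T" "L2 T f" and "e > 0"
  shows "\<exists>g. continuous_on UNIV g \<and> sqd T f g < e"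
proof -
  have fm[measurable]: "f \<in> borel_measurable (lebesgue_on T)" and f2: "integrable (lebesgue_on T) (\<lambda>z. (f z)\<^sup>2)"
    using assms by (auto simp: L2_def)
  define h where "h n z = max (- real n) (min (real n) (f z))" for n :: nat and z
  have hm[measurable]: "h n \<in> borel_measurable (lebesgue_on T)" for n unfolding h_def by measurable
  have hn: "\<bar>h n z\<bar> \<le> real n" for n z by (auto simp: h_def)
  have L2h: "L2 T (h n)" for n using hn hm by (intro L2_bounded[OF \<open>compact T\<close>])
  have "(\<lambda>n. \<integral>z. (f z - h n z) * (f z - h n z) \<partial>lebesgue_on T) \<longlonglongrightarrow> (\<integral>z. 0 \<partial>lebesgue_on T)"
  proof (rule integral_dominated_convergence[where w="\<lambda>z. (f z)\<^sup>2"])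
    show "AE z in lebesgue_on T. norm ((f z - h n z) * (f z - h n z)) \<le> (f z)\<^sup>2" for n
    proof (rule AE_I2)
      fix z
      have "\<bar>f z - h n z\<bar> \<le> \<bar>f z\<bar>" by (auto simp: h_def max_def min_def abs_if split: if_splits)
      then show "norm ((f z - h n z) * (f z - h n z)) \<le> (f z)\<^sup>2"
        unfolding abs_le_square_iff by (simp add: power2_eq_square)
    qed
    show "AE z in lebesgue_on T. (\<lambda>n. (f z - h n z) * (f z - h n z)) \<longlonglongrightarrow> 0"
    proof (rule AE_I2)
      fix z
      obtain N :: nat where N: "\<bar>f z\<bar> \<le> real N" using real_arch_simple by blast
      show "(\<lambda>n. (f z - h n z) * (f z - h n z)) \<longlonglongrightarrow> 0"
        by (rule tendsto_eventually, rule eventually_sequentiallyI[of N])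
          (use N in \<open>auto simp: h_def max_def min_def\<close>)
    qed
  qed (use f2 in auto)
  then have "(\<lambda>n. sqd T f (h n)) \<longlonglongrightarrow> 0" by (simp add: ip_def)
  from LIMSEQ_D[OF this, of "e/4"] \<open>e > 0\<close> obtain n where n: "sqd T f (h n) < e / 4"
    by auto
  obtain g where g: "continuous_on UNIV g" "sqd T (h n) g < e / 4"
    using L2_continuous_dense_bounded[OF \<open>compact T\<close> hm hn, of "e/4"] \<open>e > 0\<close> by auto
  have "L2 T g" using \<open>compact T\<close> continuous_on_subset[OF g(1)] by (intro L2_continuous) auto
  from ip_diff_triangle[OF assms(2) L2h this, of n] n g show ?thesis by (intro exI[of _ g]) auto
qed

section \<open>The averaging operator on a convex set\<close>

lemma nn_integral_lborel_scale:
  fixes f :: "pt \<Rightarrow> ennreal"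
  assumes [measurable]: "f \<in> borel_measurable borel" and "c \<noteq> 0"
  shows "(\<integral>\<^sup>+x. f x \<partial>lborel) = ennreal (c\<^sup>2) * (\<integral>\<^sup>+x. f (t + c *\<^sub>R x) \<partial>lborel)"
  by (subst lborel_affine[OF \<open>c \<noteq> 0\<close>, of t])
    (simp add: nn_integral_density nn_integral_distr nn_integral_cmult power2_eq_square)

lemma nn_integral_lebesgue_on_borel:
  fixes f :: "pt \<Rightarrow> ennreal"
  assumes [measurable]: "f \<in> borel_measurable borel" "T \<in> sets borel"
  shows "(\<integral>\<^sup>+x. f x \<partial>lebesgue_on T) = (\<integral>\<^sup>+x. f x * indicator T x \<partial>lborel)"
  by (simp add: nn_integral_restrict_space nn_integral_completion)

lemma C1_fun_continuous: "C1_fun w wx wy \<Longrightarrow> continuous_on A w"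
  unfolding C1_fun_def by (meson continuous_at_imp_continuous_on has_derivative_continuous)

text \<open>Total mass 1 makes constants fixed points of averaging. Compact support in the interior,
  with convexity, puts the points \<open>(1 - e) z + e y\<close> with \<open>y\<close> in
  \<open>S\<close> and \<open>0 < e <= 1\<close> into the interior even for \<open>z\<close> on the
  boundary; so the kernel attached to any point of \<open>T\<close> is an admissible test
  function.\<close>

locale averaging =
  fixes T S :: "pt set" and k kx ky :: "pt \<Rightarrow> real"
  assumes compact_T: "compact T" and convex_T: "convex T"
    and C1_k: "C1_fun k kx ky"
    and k_nonneg: "0 \<le> k z"
    and k_supp: "z \<notin> S \<Longrightarrow> k z = 0" "z \<notin> S \<Longrightarrow> kx z = 0" "z \<notin> S \<Longrightarrow> ky z = 0"
    and compact_S: "compact S" and S_interior: "S \<subseteq> interior T"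
    and k_integral: "(\<integral>\<^sup>+z. ennreal (k z) \<partial>lborel) = 1"
begin

lemma k_cont [continuous_intros]: "continuous_on A k"
  using C1_k by (rule C1_fun_continuous)

lemma kx_cont: "continuous_on UNIV kx" and ky_cont: "continuous_on UNIV ky"
  using C1_k by (auto simp: C1_fun_def)

lemma k_deriv: "(k has_derivative (\<lambda>h. kx z * fst h + ky z * snd h)) (at z)"
  using C1_k unfolding C1_fun_def by blast

lemma k_measurable [measurable]: "k \<in> borel_measurable borel" "kx \<in> borel_measurable borel"
    "ky \<in> borel_measurable borel"
  using k_cont kx_cont ky_cont by (auto intro: borel_measurable_continuous_onI)

lemma T_borel [measurable]: "T \<in> sets borel"
  using compact_T by (rule borel_compact)

definition bnd :: real where
  "bnd = (SOME B. 0 < B \<and> (\<forall>z. \<bar>k z\<bar> \<le> B \<and> \<bar>kx z\<bar> \<le> B \<and> \<bar>ky z\<bar> \<le> B))"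

lemma bnd: "0 < bnd" "\<bar>k z\<bar> \<le> bnd" "\<bar>kx z\<bar> \<le> bnd" "\<bar>ky z\<bar> \<le> bnd"
proof -
  obtain B1 B2 B3 where B: "0 < B1" "\<And>z. z \<in> S \<Longrightarrow> \<bar>k z\<bar> \<le> B1" "0 < B2" "\<And>z. z \<in> S \<Longrightarrow> \<bar>kx z\<bar> \<le> B2"
    "0 < B3" "\<And>z. z \<in> S \<Longrightarrow> \<bar>ky z\<bar> \<le> B3"
    using continuous_bounded_on_compact[OF compact_S] k_cont continuous_on_subset[OF kx_cont]
      continuous_on_subset[OF ky_cont] by (metis subset_UNIV)
  have "0 < B1 + B2 + B3 \<and> (\<forall>z. \<bar>k z\<bar> \<le> B1 + B2 + B3 \<and> \<bar>kx z\<bar> \<le> B1 + B2 + B3 \<and> \<bar>ky z\<bar> \<le> B1 + B2 + B3)"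
  proof (intro conjI allI)
    fix z
    show "\<bar>k z\<bar> \<le> B1 + B2 + B3" "\<bar>kx z\<bar> \<le> B1 + B2 + B3" "\<bar>ky z\<bar> \<le> B1 + B2 + B3"
      using B(1,3,5) B(2,4,6)[of z] k_supp[of z] by (cases "z \<in> S"; simp)+
  qed (use B in auto)
  then have "0 < bnd \<and> (\<forall>z. \<bar>k z\<bar> \<le> bnd \<and> \<bar>kx z\<bar> \<le> bnd \<and> \<bar>ky z\<bar> \<le> bnd)"
    unfolding bnd_def by (rule someI)
  then show "0 < bnd" "\<bar>k z\<bar> \<le> bnd" "\<bar>kx z\<bar> \<le> bnd" "\<bar>ky z\<bar> \<le> bnd" by blast+
qed

lemma grad_bound: "\<bar>kx z * fst h + ky z * snd h\<bar> \<le> 2 * bnd * norm h"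
proof -
  have h: "\<bar>fst h\<bar> \<le> norm h" "\<bar>snd h\<bar> \<le> norm h"
    using norm_fst_le[of "fst h" "snd h"] norm_snd_le[of "snd h" "fst h"] by simp_all
  have "\<bar>kx z * fst h\<bar> \<le> bnd * norm h" "\<bar>ky z * snd h\<bar> \<le> bnd * norm h"
    unfolding abs_mult by (intro mult_mono h bnd; use bnd(1) in simp)+
  then show ?thesis by linarith
qed

lemma k_lipschitz: "\<bar>k z - k w\<bar> \<le> 2 * bnd * norm (z - w)"
proof -
  have "norm (k z - k w) \<le> 2 * bnd * norm (z - w)"
  proof (rule differentiable_bound[of UNIV k "\<lambda>z h. kx z * fst h + ky z * snd h"])
    show "onorm (\<lambda>h. kx z * fst h + ky z * snd h) \<le> 2 * bnd" for z
      using bnd(1) grad_bound by (intro onorm_bound) auto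
  qed (auto intro: k_deriv)
  then show ?thesis by simp
qed

text \<open>With \<open>\<zeta> = (1 - e) z + e y\<close>, i.e. \<open>y = arg e z \<zeta>\<close>, the average of \<open>f ((1 - e) z + e y)\<close> against \<open>k y\<close>
  is an integral over \<open>\<zeta> \<in> T\<close>; in this form it only sees the almost-everywhere class of \<open>f\<close> on \<open>T\<close>.\<close>

definition arg :: "real \<Rightarrow> pt \<Rightarrow> pt \<Rightarrow> pt" where
  "arg e z \<zeta> = (1 / e) *\<^sub>R (\<zeta> - (1 - e) *\<^sub>R z)"

definition kap :: "real \<Rightarrow> pt \<Rightarrow> pt \<Rightarrow> real" where
  "kap e z \<zeta> = k (arg e z \<zeta>) / e\<^sup>2"

definition avg :: "real \<Rightarrow> (pt \<Rightarrow> real) \<Rightarrow> pt \<Rightarrow> real" where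
  "avg e f z = ip T f (kap e z)"

lemma arg_cont: "continuous_on A (arg e z)"
  unfolding arg_def by (intro continuous_intros)

lemma kap_cont: "continuous_on A (kap e z)"
  unfolding kap_def divide_inverse
  by (intro continuous_on_mult_right continuous_on_compose2[OF k_cont[of UNIV] arg_cont]) auto

lemma kap_nonneg: "0 \<le> kap e z \<zeta>"
  by (simp add: kap_def k_nonneg)

lemma kap_bound: "\<bar>kap e z \<zeta>\<bar> \<le> bnd / e\<^sup>2"
  using divide_right_mono[OF bnd(2)[of "arg e z \<zeta>"], of "e\<^sup>2"] by (simp add: kap_def)

lemma L2_kap: "L2 T (kap e z)"
  by (rule L2_continuous[OF compact_T kap_cont])

lemma kap_measurable: "case_prod (kap e) \<in> borel_measurable borel"
proof (rule borel_measurable_continuous_onI)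
  have "continuous_on UNIV (\<lambda>p. k (arg e (fst p) (snd p)) / e\<^sup>2)"
    unfolding arg_def divide_inverse
    by (intro continuous_on_mult_right continuous_on_compose2[OF k_cont[of UNIV]] continuous_intros) auto
  then show "continuous_on UNIV (case_prod (kap e))" by (simp add: kap_def case_prod_beta')
qed

lemma kap_measurable1 [measurable]: "(\<lambda>z. kap e z \<zeta>) \<in> borel_measurable borel"
    "kap e z \<in> borel_measurable borel"
proof -
  have "continuous_on UNIV (\<lambda>z. kap e z \<zeta>)"
    unfolding kap_def arg_def divide_inverse
    by (intro continuous_on_mult_right continuous_on_compose2[OF k_cont[of UNIV]] continuous_intros) auto
  then show "(\<lambda>z. kap e z \<zeta>) \<in> borel_measurable borel" by (rule borel_measurable_continuous_onI)
  show "kap e z \<in> borel_measurable borel" by (rule borel_measurable_continuous_onI[OF kap_cont])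
qed

lemma kap_supp:
  assumes "z \<in> T" "0 < e" "e \<le> 1" "kap e z \<zeta> \<noteq> 0"
  shows "\<zeta> \<in> interior T" "\<exists>y\<in>S. \<zeta> = (1 - e) *\<^sub>R z + e *\<^sub>R y"
proof -
  have "arg e z \<zeta> \<in> S" using k_supp(1)[of "arg e z \<zeta>"] assms(4) by (auto simp: kap_def)
  moreover have eq: "\<zeta> = (1 - e) *\<^sub>R z + e *\<^sub>R arg e z \<zeta>" using assms by (simp add: arg_def)
  ultimately show "\<exists>y\<in>S. \<zeta> = (1 - e) *\<^sub>R z + e *\<^sub>R y" by blast
  have "z - e *\<^sub>R (z - arg e z \<zeta>) \<in> interior T"
    using \<open>arg e z \<zeta> \<in> S\<close> S_interior assms convex_T by (intro mem_interior_convex_shrink) auto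
  also have "z - e *\<^sub>R (z - arg e z \<zeta>) = \<zeta>" by (subst (2) eq) (simp add: algebra_simps)
  finally show "\<zeta> \<in> interior T" .
qed

lemma shrink_mem: "z \<in> T \<Longrightarrow> y \<in> T \<Longrightarrow> 0 \<le> e \<Longrightarrow> e \<le> 1 \<Longrightarrow> (1 - e) *\<^sub>R z + e *\<^sub>R y \<in> T"
  using convex_T by (simp add: convex_alt)

lemma nn_integral_kap:
  assumes "0 < e"
  shows "(\<integral>\<^sup>+\<zeta>. ennreal (kap e z \<zeta>) \<partial>lborel) = 1"
proof -
  have "1 = (\<integral>\<^sup>+\<zeta>. ennreal (k \<zeta>) \<partial>lborel)" by (simp add: k_integral)
  also have "\<dots> = ennreal ((1/e)\<^sup>2) * (\<integral>\<^sup>+\<zeta>. ennreal (k (- ((1-e)/e) *\<^sub>R z + (1/e) *\<^sub>R \<zeta>)) \<partial>lborel)"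
    using assms by (intro nn_integral_lborel_scale) auto
  also have "\<dots> = (\<integral>\<^sup>+\<zeta>. ennreal ((1/e)\<^sup>2) * ennreal (k (- ((1-e)/e) *\<^sub>R z + (1/e) *\<^sub>R \<zeta>)) \<partial>lborel)"
    by (rule nn_integral_cmult[symmetric]) measurable
  also have "\<dots> = (\<integral>\<^sup>+\<zeta>. ennreal (kap e z \<zeta>) \<partial>lborel)"
  proof (rule nn_integral_cong)
    fix \<zeta>
    have "- ((1-e)/e) *\<^sub>R z + (1/e) *\<^sub>R \<zeta> = arg e z \<zeta>"
      by (simp add: arg_def scaleR_diff_right)
    then show "ennreal ((1/e)\<^sup>2) * ennreal (k (- ((1-e)/e) *\<^sub>R z + (1/e) *\<^sub>R \<zeta>)) = ennreal (kap e z \<zeta>)"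
      using k_nonneg by (simp add: kap_def ennreal_mult[symmetric] power_divide)
  qed
  finally show ?thesis by simp
qed

text \<open>In its second variable the kernel has mass 1; in the first one the substitution has
  Jacobian \<open>((1 - e) / e)^2\<close>, so the mass is \<open>1 / (1 - e)^2\<close>, at most 4.
  The factor 4 of \<open>avg_bound\<close> comes from here.\<close>

lemma nn_integral_kap_left:
  assumes "0 < e" "e \<le> 1/2"
  shows "(\<integral>\<^sup>+z. ennreal (kap e z \<zeta>) \<partial>lborel) \<le> 4"
proof -
  define c where "c = - ((1 - e) / e)"
  have c: "c \<noteq> 0" using assms by (auto simp: c_def)
  have "1 = (\<integral>\<^sup>+z. ennreal (k z) \<partial>lborel)" by (simp add: k_integral)
  also have "\<dots> = ennreal (c\<^sup>2) * (\<integral>\<^sup>+z. ennreal (k ((1/e) *\<^sub>R \<zeta> + c *\<^sub>R z)) \<partial>lborel)"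
    using c by (intro nn_integral_lborel_scale) auto
  finally have 1: "1 = ennreal (c\<^sup>2) * (\<integral>\<^sup>+z. ennreal (k ((1/e) *\<^sub>R \<zeta> + c *\<^sub>R z)) \<partial>lborel)" .
  have "(\<integral>\<^sup>+z. ennreal (kap e z \<zeta>) \<partial>lborel) = (\<integral>\<^sup>+z. ennreal (1/e\<^sup>2) * ennreal (k ((1/e) *\<^sub>R \<zeta> + c *\<^sub>R z)) \<partial>lborel)"
  proof (rule nn_integral_cong)
    fix z
    have "(1/e) *\<^sub>R \<zeta> + c *\<^sub>R z = arg e z \<zeta>"
      by (simp add: arg_def scaleR_diff_right c_def)
    then show "ennreal (kap e z \<zeta>) = ennreal (1/e\<^sup>2) * ennreal (k ((1/e) *\<^sub>R \<zeta> + c *\<^sub>R z))"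
      using k_nonneg by (simp add: kap_def ennreal_mult[symmetric])
  qed
  also have "\<dots> = ennreal (1/e\<^sup>2) * (\<integral>\<^sup>+z. ennreal (k ((1/e) *\<^sub>R \<zeta> + c *\<^sub>R z)) \<partial>lborel)"
    by (rule nn_integral_cmult) measurable
  also have "\<dots> \<le> ennreal (4 * c\<^sup>2) * (\<integral>\<^sup>+z. ennreal (k ((1/e) *\<^sub>R \<zeta> + c *\<^sub>R z)) \<partial>lborel)"
  proof (intro mult_right_mono ennreal_leI)
    have "1 / 4 \<le> (1 - e)\<^sup>2" using power_mono[of "1/2" "1 - e" 2] assms by (simp add: power2_eq_square)
    then show "1 / e\<^sup>2 \<le> 4 * c\<^sup>2" using assms by (simp add: c_def power_divide field_simps)
  qed simp
  also have "\<dots> = 4 * (ennreal (c\<^sup>2) * (\<integral>\<^sup>+z. ennreal (k ((1/e) *\<^sub>R \<zeta> + c *\<^sub>R z)) \<partial>lborel))"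
    by (simp add: ennreal_mult mult.assoc)
  also have "\<dots> = 4" using 1 by simp
  finally show ?thesis .
qed

lemma ip_one_kap:
  assumes "z \<in> T" "0 < e" "e \<le> 1"
  shows "ip T (\<lambda>_. 1) (kap e z) = 1"
proof -
  have int: "integrable (lebesgue_on T) (kap e z)"
    using L2_mult_integrable[OF L2_const[OF compact_T, of 1] L2_kap[of e z]] by simp
  have "ennreal (ip T (\<lambda>_. 1) (kap e z)) = (\<integral>\<^sup>+\<zeta>. ennreal (kap e z \<zeta>) \<partial>lebesgue_on T)"
    unfolding ip_def using int kap_nonneg by (simp add: nn_integral_eq_integral)
  also have "\<dots> = (\<integral>\<^sup>+\<zeta>. ennreal (kap e z \<zeta>) * indicator T \<zeta> \<partial>lborel)"
    by (rule nn_integral_lebesgue_on_borel) measurable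
  also have "\<dots> = (\<integral>\<^sup>+\<zeta>. ennreal (kap e z \<zeta>) \<partial>lborel)"
  proof (rule nn_integral_cong)
    fix \<zeta> show "ennreal (kap e z \<zeta>) * indicator T \<zeta> = ennreal (kap e z \<zeta>)"
      using kap_supp(1)[OF assms, of \<zeta>] interior_subset[of T] by (cases "kap e z \<zeta> = 0") auto
  qed
  also have "\<dots> = 1" by (rule nn_integral_kap[OF assms(2)])
  finally show ?thesis by (simp add: ennreal_eq_1)
qed

section \<open>Smoothness of averages\<close>

lemma kernel_integral_continuous:
  fixes f g :: "pt \<Rightarrow> real"
  assumes f: "integrable (lebesgue_on T) f" and g: "continuous_on UNIV g" "\<And>z. \<bar>g z\<bar> \<le> B"
  shows "continuous_on UNIV (\<lambda>z. \<integral>\<zeta>. f \<zeta> * g (arg e z \<zeta>) \<partial>lebesgue_on T)"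
proof (rule continuous_on_sequentiallyI)
  fix X :: "nat \<Rightarrow> pt" and z assume X: "X \<longlonglongrightarrow> z"
  have [measurable]: "f \<in> borel_measurable (lebesgue_on T)" using f by auto
  have m: "(\<lambda>\<zeta>. g (arg e z \<zeta>)) \<in> borel_measurable (lebesgue_on T)" for z
    by (intro lebesgue_on_measurable_continuous compact_T continuous_on_compose2[OF g(1)] arg_cont) auto
  show "(\<lambda>n. \<integral>\<zeta>. f \<zeta> * g (arg e (X n) \<zeta>) \<partial>lebesgue_on T) \<longlonglongrightarrow> (\<integral>\<zeta>. f \<zeta> * g (arg e z \<zeta>) \<partial>lebesgue_on T)"
  proof (rule integral_dominated_convergence[where w="\<lambda>\<zeta>. B * \<bar>f \<zeta>\<bar>"])
    show "integrable (lebesgue_on T) (\<lambda>\<zeta>. B * \<bar>f \<zeta>\<bar>)" using f by auto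
    show "AE \<zeta> in lebesgue_on T. (\<lambda>n. f \<zeta> * g (arg e (X n) \<zeta>)) \<longlonglongrightarrow> f \<zeta> * g (arg e z \<zeta>)"
    proof (rule AE_I2)
      fix \<zeta>
      have "(\<lambda>n. arg e (X n) \<zeta>) \<longlonglongrightarrow> arg e z \<zeta>" unfolding arg_def by (intro tendsto_intros X)
      then have "(\<lambda>n. g (arg e (X n) \<zeta>)) \<longlonglongrightarrow> g (arg e z \<zeta>)"
        using g(1) by (intro continuous_on_tendsto_compose[OF g(1)]) auto
      then show "(\<lambda>n. f \<zeta> * g (arg e (X n) \<zeta>)) \<longlonglongrightarrow> f \<zeta> * g (arg e z \<zeta>)" by (intro tendsto_intros)
    qed
    show "AE \<zeta> in lebesgue_on T. norm (f \<zeta> * g (arg e (X n) \<zeta>)) \<le> B * \<bar>f \<zeta>\<bar>" for n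
      by (rule AE_I2) (use mult_left_mono[OF g(2) abs_ge_zero] in \<open>simp add: abs_mult mult.commute\<close>)
  qed (use m in measurable)
qed

text \<open>Differentiating \<open>kap e z \<zeta>\<close> in \<open>z\<close> gives
  \<open>- (1 - e) / e\<close> by the chain rule, next to the factor \<open>1 / e^2\<close> already
  present; \<open>g\<close> stands for \<open>kx\<close> or \<open>ky\<close>.\<close>

definition avg_grad :: "(pt \<Rightarrow> real) \<Rightarrow> real \<Rightarrow> (pt \<Rightarrow> real) \<Rightarrow> pt \<Rightarrow> real" where
  "avg_grad g e f z = - ((1 - e) / e ^ 3) * ip T f (\<lambda>\<zeta>. g (arg e z \<zeta>))"

text \<open>Differentiation under the integral: the difference quotients of \<open>k\<close> are
  bounded by its Lipschitz constant, so dominated convergence applies to the remainder along every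
  sequence.\<close>

lemma avg_C1:
  assumes e: "0 < e" "e < 1" and f: "L2 T f"
  shows "C1_fun (avg e f) (avg_grad kx e f) (avg_grad ky e f)"
proof -
  let ?M = "lebesgue_on T"
  have fi: "integrable ?M f"
    using L2_mult_integrable[OF f L2_const[OF compact_T, of 1]] by simp
  have [measurable]: "f \<in> borel_measurable ?M" using fi by auto
  have cont: "continuous_on UNIV (\<lambda>z. \<integral>\<zeta>. f \<zeta> * kx (arg e z \<zeta>) \<partial>?M)"
    "continuous_on UNIV (\<lambda>z. \<integral>\<zeta>. f \<zeta> * ky (arg e z \<zeta>) \<partial>?M)"
    using kernel_integral_continuous[OF fi kx_cont bnd(3)] kernel_integral_continuous[OF fi ky_cont bnd(4)] by auto
  define c where "c = (1 - e) / e"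
  have c: "c > 0" using e by (simp add: c_def)
  have m: "(\<lambda>\<zeta>. g (arg e z \<zeta>)) \<in> borel_measurable ?M" if "continuous_on UNIV g" for g :: "pt \<Rightarrow> real" and z
    by (intro lebesgue_on_measurable_continuous compact_T continuous_on_compose2[OF that] arg_cont) auto
  note mk[measurable] = m[OF k_cont] m[OF kx_cont] m[OF ky_cont]
  have I: "integrable ?M (\<lambda>\<zeta>. f \<zeta> * g (arg e z \<zeta>))" if "continuous_on UNIV g" "\<And>z. \<bar>g z\<bar> \<le> bnd" for g z
  proof (rule Bochner_Integration.integrable_bound)
    show "integrable ?M (\<lambda>\<zeta>. bnd * f \<zeta>)" using fi by simp
    show "AE \<zeta> in ?M. norm (f \<zeta> * g (arg e z \<zeta>)) \<le> norm (bnd * f \<zeta>)"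
      by (rule AE_I2) (use mult_left_mono[OF that(2) abs_ge_zero] bnd(1) in \<open>simp add: abs_mult mult.commute\<close>)
  qed (use m[OF that(1)] in measurable)
  have argd: "arg e (z + h) \<zeta> = arg e z \<zeta> + (- c) *\<^sub>R h" for z h \<zeta>
    by (simp add: arg_def c_def scaleR_right_distrib scaleR_right_diff_distrib)
  define D where "D z h = - c * ((\<integral>\<zeta>. f \<zeta> * kx (arg e z \<zeta>) \<partial>?M) * fst h + (\<integral>\<zeta>. f \<zeta> * ky (arg e z \<zeta>) \<partial>?M) * snd h)"
    for z h
  have der: "((\<lambda>z. \<integral>\<zeta>. f \<zeta> * k (arg e z \<zeta>) \<partial>?M) has_derivative D z) (at z)" for z
    unfolding has_derivative_at
  proof
    show "bounded_linear (D z)" unfolding D_def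
      by (intro bounded_linear_const_mult bounded_linear_add bounded_linear_const_mult bounded_linear_fst bounded_linear_snd)
    \<comment> \<open>The first-order remainder of \<open>k\<close> for the increment
      \<open>- c * h\<close>, divided by the norm of \<open>h\<close>; at \<open>h = 0\<close>
      division by zero makes it 0, so the uniform bound holds there too.\<close>
    define R where "R h \<zeta> = (k (arg e z \<zeta> + (- c) *\<^sub>R h) - k (arg e z \<zeta>)
       - (kx (arg e z \<zeta>) * fst ((- c) *\<^sub>R h) + ky (arg e z \<zeta>) * snd ((- c) *\<^sub>R h))) / norm h" for h \<zeta>
    have Rm[measurable]: "R h \<in> borel_measurable ?M" for h
    proof -
      have "(\<lambda>\<zeta>. k (arg e z \<zeta> + (- c) *\<^sub>R h)) = (\<lambda>\<zeta>. k (arg e (z + h) \<zeta>))" by (simp add: argd)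
      then have [measurable]: "(\<lambda>\<zeta>. k (arg e z \<zeta> + (- c) *\<^sub>R h)) \<in> borel_measurable ?M" using mk(1)[of "z + h"] by simp
      show ?thesis unfolding R_def by measurable
    qed
    have Rb: "\<bar>R h \<zeta>\<bar> \<le> 4 * bnd * c" for h \<zeta>
    proof (cases "h = 0")
      case False
      have 1: "\<bar>k (arg e z \<zeta> + (- c) *\<^sub>R h) - k (arg e z \<zeta>)\<bar> \<le> 2 * bnd * (c * norm h)"
        using k_lipschitz[of "arg e z \<zeta> + (- c) *\<^sub>R h" "arg e z \<zeta>"] c by simp
      have 2: "\<bar>kx (arg e z \<zeta>) * fst ((- c) *\<^sub>R h) + ky (arg e z \<zeta>) * snd ((- c) *\<^sub>R h)\<bar> \<le> 2 * bnd * (c * norm h)"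
        using grad_bound[of "arg e z \<zeta>" "(- c) *\<^sub>R h"] c by simp
      have "\<bar>R h \<zeta>\<bar> = \<bar>k (arg e z \<zeta> + (- c) *\<^sub>R h) - k (arg e z \<zeta>)
       - (kx (arg e z \<zeta>) * fst ((- c) *\<^sub>R h) + ky (arg e z \<zeta>) * snd ((- c) *\<^sub>R h))\<bar> / norm h"
        unfolding R_def by simp
      also have "\<dots> \<le> (4 * bnd * c * norm h) / norm h"
        using 1 2 by (intro divide_right_mono norm_ge_zero) linarith
      finally show ?thesis using False by simp
    qed (use bnd(1) c in \<open>simp add: R_def\<close>)
    have eq: "((\<integral>\<zeta>. f \<zeta> * k (arg e (z + h) \<zeta>) \<partial>?M) - (\<integral>\<zeta>. f \<zeta> * k (arg e z \<zeta>) \<partial>?M) - D z h) / norm h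
       = (\<integral>\<zeta>. f \<zeta> * R h \<zeta> \<partial>?M)" for h
    proof -
      have "(\<integral>\<zeta>. f \<zeta> * R h \<zeta> \<partial>?M) = (\<integral>\<zeta>. (f \<zeta> * k (arg e (z + h) \<zeta>) - f \<zeta> * k (arg e z \<zeta>)
          - (- c * fst h * (f \<zeta> * kx (arg e z \<zeta>)) + (- c * snd h) * (f \<zeta> * ky (arg e z \<zeta>)))) / norm h \<partial>?M)"
        unfolding R_def argd by (rule Bochner_Integration.integral_cong) (simp_all add: algebra_simps)
      also have "\<dots> = ((\<integral>\<zeta>. f \<zeta> * k (arg e (z + h) \<zeta>) \<partial>?M) - (\<integral>\<zeta>. f \<zeta> * k (arg e z \<zeta>) \<partial>?M)
          - (- c * fst h * (\<integral>\<zeta>. f \<zeta> * kx (arg e z \<zeta>) \<partial>?M) + (- c * snd h) * (\<integral>\<zeta>. f \<zeta> * ky (arg e z \<zeta>) \<partial>?M))) / norm h"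
        using I[OF k_cont bnd(2)] I[OF kx_cont bnd(3)] I[OF ky_cont bnd(4)] by simp
      finally show ?thesis by (simp add: D_def algebra_simps)
    qed
    have "((\<lambda>h. \<integral>\<zeta>. f \<zeta> * R h \<zeta> \<partial>?M) \<longlongrightarrow> 0) (at 0)"
      unfolding tendsto_at_iff_sequentially
    proof (intro allI impI)
      fix X :: "nat \<Rightarrow> pt" assume X: "\<forall>i. X i \<in> UNIV - {0}" "X \<longlonglongrightarrow> 0"
      have "(\<lambda>n. \<integral>\<zeta>. f \<zeta> * R (X n) \<zeta> \<partial>?M) \<longlonglongrightarrow> (\<integral>\<zeta>. 0 \<partial>?M)"
      proof (rule integral_dominated_convergence[where w="\<lambda>\<zeta>. 4 * bnd * c * \<bar>f \<zeta>\<bar>"])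
        show "integrable ?M (\<lambda>\<zeta>. 4 * bnd * c * \<bar>f \<zeta>\<bar>)" using fi by auto
        show "AE \<zeta> in ?M. (\<lambda>n. f \<zeta> * R (X n) \<zeta>) \<longlonglongrightarrow> 0"
        proof (rule AE_I2)
          fix \<zeta>
          let ?q = "arg e z \<zeta>"
          define Y where "Y n = (- c) *\<^sub>R X n" for n
          have Y0: "Y \<longlonglongrightarrow> 0" unfolding Y_def using tendsto_scaleR[OF tendsto_const X(2), of "- c"] by simp
          have Yn: "Y i \<in> UNIV - {0}" for i using X(1) c by (auto simp: Y_def)
          have "((\<lambda>h. norm (k (?q + h) - k ?q - (kx ?q * fst h + ky ?q * snd h)) / norm h) \<longlongrightarrow> 0) (at 0)"
            using k_deriv[of ?q] unfolding has_derivative_at by blast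
          then have "(\<lambda>n. norm (k (?q + Y n) - k ?q - (kx ?q * fst (Y n) + ky ?q * snd (Y n))) / norm (Y n)) \<longlonglongrightarrow> 0"
            unfolding tendsto_at_iff_sequentially using Y0 Yn by (auto simp: o_def)
          then have "(\<lambda>n. c * (norm (k (?q + Y n) - k ?q - (kx ?q * fst (Y n) + ky ?q * snd (Y n))) / norm (Y n))) \<longlonglongrightarrow> 0"
            using tendsto_mult_right_zero by blast
          moreover have "c * (norm (k (?q + Y n) - k ?q - (kx ?q * fst (Y n) + ky ?q * snd (Y n))) / norm (Y n)) = \<bar>R (X n) \<zeta>\<bar>" for n
            using c X(1) by (simp add: R_def Y_def)
          ultimately have "(\<lambda>n. \<bar>R (X n) \<zeta>\<bar>) \<longlonglongrightarrow> 0" by simp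
          then have "(\<lambda>n. R (X n) \<zeta>) \<longlonglongrightarrow> 0" by (rule tendsto_rabs_zero_cancel)
          then show "(\<lambda>n. f \<zeta> * R (X n) \<zeta>) \<longlonglongrightarrow> 0" by (rule tendsto_mult_right_zero)
        qed
        show "AE \<zeta> in ?M. norm (f \<zeta> * R (X n) \<zeta>) \<le> 4 * bnd * c * \<bar>f \<zeta>\<bar>" for n
        proof (rule AE_I2)
          fix \<zeta> show "norm (f \<zeta> * R (X n) \<zeta>) \<le> 4 * bnd * c * \<bar>f \<zeta>\<bar>"
            using mult_right_mono[OF Rb[of "X n" \<zeta>] abs_ge_zero[of "f \<zeta>"]] by (simp add: abs_mult mult.commute)
        qed
      qed measurable
      then show "((\<lambda>h. \<integral>\<zeta>. f \<zeta> * R h \<zeta> \<partial>?M) \<circ> X) \<longlonglongrightarrow> 0" by (simp add: o_def)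
    qed
    then have "((\<lambda>h. norm (\<integral>\<zeta>. f \<zeta> * R h \<zeta> \<partial>?M)) \<longlongrightarrow> 0) (at 0)" by (rule tendsto_norm_zero)
    then show "((\<lambda>h. norm ((\<integral>\<zeta>. f \<zeta> * k (arg e (z + h) \<zeta>) \<partial>?M) - (\<integral>\<zeta>. f \<zeta> * k (arg e z \<zeta>) \<partial>?M) - D z h) / norm h)
        \<longlongrightarrow> 0) (at 0)"
      by (simp flip: eq)
  qed
  have avg_eq: "avg e f = (\<lambda>z. (1 / e\<^sup>2) *\<^sub>R (\<integral>\<zeta>. f \<zeta> * k (arg e z \<zeta>) \<partial>?M))"
    by (simp add: avg_def ip_def kap_def fun_eq_iff)
  have g_eq: "avg_grad g e f z = - (c / e\<^sup>2) * (\<integral>\<zeta>. f \<zeta> * g (arg e z \<zeta>) \<partial>?M)" for g z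
    by (simp add: avg_grad_def ip_def c_def power2_eq_square power3_eq_cube mult.assoc)
  show ?thesis
    unfolding C1_fun_def
  proof (intro conjI allI)
    fix z
    have "(avg e f has_derivative (\<lambda>h. (1 / e\<^sup>2) *\<^sub>R D z h)) (at z)"
      unfolding avg_eq by (rule has_derivative_scaleR_right[OF der])
    then show "(avg e f has_derivative (\<lambda>h. avg_grad kx e f z * fst h + avg_grad ky e f z * snd h)) (at z)"
      by (simp add: D_def g_eq algebra_simps add_divide_distrib)
  next
    have g_fun: "avg_grad g e f = (\<lambda>z. - (c / e\<^sup>2) * (\<integral>\<zeta>. f \<zeta> * g (arg e z \<zeta>) \<partial>?M))" for g
      by (rule ext) (rule g_eq)
    show "continuous_on UNIV (avg_grad kx e f)" "continuous_on UNIV (avg_grad ky e f)"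
      unfolding g_fun by (intro continuous_on_mult_left cont)+
  qed
qed

lemma avg_diff:
  assumes "L2 T f" "L2 T g"
  shows "avg e (\<lambda>z. f z - g z) z = avg e f z - avg e g z"
  unfolding avg_def using assms L2_kap by (simp add: ip_diff_left)

text \<open>As a function of \<open>\<zeta>\<close> the kernel is a test function whose gradient
  carries the factor \<open>1 / e\<close>, whereas its gradient in \<open>z\<close> carries
  \<open>- (1 - e) / e\<close>. Integration by parts in \<open>\<zeta>\<close> therefore moves the
  derivative onto \<open>u\<close> with the factor \<open>1 - e\<close>.\<close>

lemma avg_weak_grad:
  assumes wg: "weak_grad T u ux uy" and "z \<in> T" and e: "0 < e" "e < 1"
  shows "avg_grad kx e u z = (1 - e) * avg e ux z" "avg_grad ky e u z = (1 - e) * avg e uy z"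
proof -
  define \<phi> where "\<phi> \<zeta> = k (arg e z \<zeta>)" for \<zeta>
  define \<phi>x where "\<phi>x \<zeta> = (1 / e) * kx (arg e z \<zeta>)" for \<zeta>
  define \<phi>y where "\<phi>y \<zeta> = (1 / e) * ky (arg e z \<zeta>)" for \<zeta>
  have C1: "C1_fun \<phi> \<phi>x \<phi>y"
    unfolding C1_fun_def
  proof (intro conjI allI)
    fix \<zeta>
    have "(arg e z has_derivative (\<lambda>h. (1 / e) *\<^sub>R h)) (at \<zeta>)"
      unfolding arg_def by (auto intro!: derivative_eq_intros)
    from diff_chain_at[OF this k_deriv[of "arg e z \<zeta>"]]
    show "(\<phi> has_derivative (\<lambda>h. \<phi>x \<zeta> * fst h + \<phi>y \<zeta> * snd h)) (at \<zeta>)"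
      by (simp add: o_def \<phi>_def[abs_def] \<phi>x_def \<phi>y_def algebra_simps)
    show "continuous_on UNIV \<phi>x" "continuous_on UNIV \<phi>y"
      unfolding \<phi>x_def \<phi>y_def
      by (intro continuous_intros continuous_on_compose2[OF kx_cont] continuous_on_compose2[OF ky_cont] arg_cont; simp)+
  qed
  define Q where "Q = (\<lambda>y. (1 - e) *\<^sub>R z + e *\<^sub>R y) ` S"
  have "compact Q" unfolding Q_def by (intro compact_continuous_image compact_S continuous_intros)
  have supp: "{\<zeta>. \<phi> \<zeta> \<noteq> 0} \<subseteq> Q \<inter> interior T"
  proof
    fix \<zeta> assume "\<zeta> \<in> {\<zeta>. \<phi> \<zeta> \<noteq> 0}"
    then have "kap e z \<zeta> \<noteq> 0" using e by (simp add: \<phi>_def kap_def)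
    from kap_supp[OF \<open>z \<in> T\<close> e(1) _ this] e show "\<zeta> \<in> Q \<inter> interior T" by (auto simp: Q_def)
  qed
  have QT: "Q \<subseteq> interior T"
  proof
    fix \<zeta> assume "\<zeta> \<in> Q"
    then obtain y where y: "y \<in> S" "\<zeta> = (1 - e) *\<^sub>R z + e *\<^sub>R y" by (auto simp: Q_def)
    have "z - e *\<^sub>R (z - y) \<in> interior T"
      using y S_interior \<open>z \<in> T\<close> e convex_T by (intro mem_interior_convex_shrink) auto
    also have "z - e *\<^sub>R (z - y) = \<zeta>" using y by (simp add: algebra_simps)
    finally show "\<zeta> \<in> interior T" .
  qed
  have cl: "closure {\<zeta>. \<phi> \<zeta> \<noteq> 0} \<subseteq> Q"
    using supp compact_imp_closed[OF \<open>compact Q\<close>] by (intro closure_minimal) auto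
  have "compact (closure {\<zeta>. \<phi> \<zeta> \<noteq> 0})"
    using cl \<open>compact Q\<close> by (metis closed_closure compact_Int_closed inf.absorb_iff2)
  then have ibp: "ip T u \<phi>x = - ip T ux \<phi>" "ip T u \<phi>y = - ip T uy \<phi>"
    using wg C1 cl QT unfolding weak_grad_def by blast+
  have "ip T f (kap e z) = ip T f \<phi> / e\<^sup>2" for f
    using ip_cmult_right[of T f "1/e\<^sup>2" \<phi>] by (simp add: kap_def[abs_def] \<phi>_def[abs_def])
  moreover have "ip T u (\<lambda>\<zeta>. kx (arg e z \<zeta>)) = e * ip T u \<phi>x" "ip T u (\<lambda>\<zeta>. ky (arg e z \<zeta>)) = e * ip T u \<phi>y"
    using e by (simp_all only: \<phi>x_def[abs_def] \<phi>y_def[abs_def] ip_cmult_right) auto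
  ultimately show "avg_grad kx e u z = (1 - e) * avg e ux z" "avg_grad ky e u z = (1 - e) * avg e uy z"
    using e unfolding avg_grad_def avg_def by (simp_all add: ibp power2_eq_square power3_eq_cube)
qed

section \<open>Boundedness of averaging on L2\<close>

lemma L2_mult_sqrt_kap:
  assumes "L2 T f"
  shows "L2 T (\<lambda>\<zeta>. f \<zeta> * sqrt (kap e z \<zeta>))"
proof -
  have [measurable]: "f \<in> borel_measurable (lebesgue_on T)" "kap e z \<in> borel_measurable (lebesgue_on T)"
    using assms L2_kap by (auto simp: L2_def)
  have "integrable (lebesgue_on T) (\<lambda>\<zeta>. (f \<zeta> * sqrt (kap e z \<zeta>))\<^sup>2)"
  proof (rule Bochner_Integration.integrable_bound)
    show "integrable (lebesgue_on T) (\<lambda>\<zeta>. (bnd / e\<^sup>2) * (f \<zeta>)\<^sup>2)" using assms by (auto simp: L2_def)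
    show "AE \<zeta> in lebesgue_on T. norm ((f \<zeta> * sqrt (kap e z \<zeta>))\<^sup>2) \<le> norm (bnd / e\<^sup>2 * (f \<zeta>)\<^sup>2)"
    proof (rule AE_I2)
      fix \<zeta>
      have "kap e z \<zeta> * (f \<zeta>)\<^sup>2 \<le> (bnd / e\<^sup>2) * (f \<zeta>)\<^sup>2"
        using kap_bound[of e z \<zeta>] by (intro mult_right_mono) auto
      then show "norm ((f \<zeta> * sqrt (kap e z \<zeta>))\<^sup>2) \<le> norm (bnd / e\<^sup>2 * (f \<zeta>)\<^sup>2)"
        using kap_nonneg bnd(1) by (simp add: power_mult_distrib mult.commute)
    qed
  qed measurable
  then show ?thesis unfolding L2_def by auto
qed

text \<open>Jensen's inequality for the probability density \<open>kap e z\<close>, obtained from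
  Cauchy-Schwarz by splitting the kernel into two square roots.\<close>

lemma avg_square_le:
  assumes "z \<in> T" "0 < e" "e \<le> 1" "L2 T f"
  shows "(avg e f z)\<^sup>2 \<le> (\<integral>\<zeta>. (f \<zeta>)\<^sup>2 * kap e z \<zeta> \<partial>lebesgue_on T)"
    "integrable (lebesgue_on T) (\<lambda>\<zeta>. (f \<zeta>)\<^sup>2 * kap e z \<zeta>)"
proof -
  let ?s = "\<lambda>\<zeta>. sqrt (kap e z \<zeta>)"
  have s: "L2 T ?s" using L2_mult_sqrt_kap[OF L2_const[OF compact_T, of 1], of e z] by simp
  have fs: "L2 T (\<lambda>\<zeta>. f \<zeta> * ?s \<zeta>)" by (rule L2_mult_sqrt_kap[OF assms(4)])
  have 1: "avg e f z = ip T (\<lambda>\<zeta>. f \<zeta> * ?s \<zeta>) ?s"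
    using kap_nonneg by (simp add: avg_def ip_def mult.assoc)
  have 2: "ip T ?s ?s = 1" using ip_one_kap[OF assms(1-3)] kap_nonneg by (simp add: ip_def)
  have 3: "ip T (\<lambda>\<zeta>. f \<zeta> * ?s \<zeta>) (\<lambda>\<zeta>. f \<zeta> * ?s \<zeta>) = (\<integral>\<zeta>. (f \<zeta>)\<^sup>2 * kap e z \<zeta> \<partial>lebesgue_on T)"
    unfolding ip_def using kap_nonneg
    by (intro Bochner_Integration.integral_cong) (auto simp: power2_eq_square algebra_simps)
  show "(avg e f z)\<^sup>2 \<le> (\<integral>\<zeta>. (f \<zeta>)\<^sup>2 * kap e z \<zeta> \<partial>lebesgue_on T)"
    using ip_Cauchy_Schwarz[OF fs s] by (simp add: 1 2 3)
  show "integrable (lebesgue_on T) (\<lambda>\<zeta>. (f \<zeta>)\<^sup>2 * kap e z \<zeta>)"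
    using fs kap_nonneg by (simp add: L2_def power_mult_distrib)
qed

lemma L2_avg:
  assumes "0 < e" "e < 1" "L2 T f"
  shows "L2 T (avg e f)"
  by (rule L2_continuous[OF compact_T C1_fun_continuous[OF avg_C1[OF assms]]])

lemma ip_eq_nn_integral:
  assumes "L2 T f"
  shows "ennreal (ip T f f) = (\<integral>\<^sup>+z. ennreal ((f z)\<^sup>2) \<partial>lebesgue_on T)"
  using assms unfolding ip_def L2_def power2_eq_square by (intro nn_integral_eq_integral[symmetric]) auto

text \<open>Schur test: Jensen pointwise in \<open>z\<close>, exchange of the integrals, then the
  bound 4 for the mass of the kernel in \<open>z\<close>.\<close>

lemma avg_bound:
  assumes "0 < e" "e \<le> 1/2" and f: "L2 T f"
  shows "ip T (avg e f) (avg e f) \<le> 4 * ip T f f"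
proof -
  let ?M = "lebesgue_on T"
  interpret M: finite_measure ?M
    using compact_T by (intro finite_measure_lebesgue_on lmeasurable_compact)
  interpret MM: pair_sigma_finite ?M ?M ..
  have cm: "(\<lambda>z. ennreal (c * kap e z \<zeta>)) \<in> borel_measurable borel" for c \<zeta> by measurable
  have [measurable]: "f \<in> borel_measurable ?M" using f by (simp add: L2_def)
  \<comment> \<open>The factors are completed measures; joint measurability of the kernel is
    obtained by factoring through the Borel product.\<close>
  have idm[measurable]: "(\<lambda>x. x) \<in> ?M \<rightarrow>\<^sub>M borel" using id_borel_measurable_lebesgue_on[of T] by (simp add: id_def)
  have pm: "(\<lambda>p. (fst p, snd p)) \<in> ?M \<Otimes>\<^sub>M ?M \<rightarrow>\<^sub>M borel \<Otimes>\<^sub>M borel" by measurable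
  have km[measurable]: "(\<lambda>p. kap e (fst p) (snd p)) \<in> borel_measurable (?M \<Otimes>\<^sub>M ?M)"
  proof -
    have "case_prod (kap e) \<in> borel_measurable (borel \<Otimes>\<^sub>M borel)" using kap_measurable by (simp only: borel_prod)
    from measurable_compose[OF pm this] show ?thesis by simp
  qed
  have jm: "(\<lambda>(z, \<zeta>). ennreal ((f \<zeta>)\<^sup>2 * kap e z \<zeta>)) \<in> borel_measurable (?M \<Otimes>\<^sub>M ?M)"
    unfolding case_prod_beta' by measurable
  have "ennreal (ip T (avg e f) (avg e f)) = (\<integral>\<^sup>+z. ennreal ((avg e f z)\<^sup>2) \<partial>?M)"
    using assms by (intro ip_eq_nn_integral L2_avg) auto
  also have "\<dots> \<le> (\<integral>\<^sup>+z. \<integral>\<^sup>+\<zeta>. ennreal ((f \<zeta>)\<^sup>2 * kap e z \<zeta>) \<partial>?M \<partial>?M)"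
  proof (rule nn_integral_mono)
    fix z assume "z \<in> space ?M"
    then have z: "z \<in> T" by simp
    have "ennreal ((avg e f z)\<^sup>2) \<le> ennreal (\<integral>\<zeta>. (f \<zeta>)\<^sup>2 * kap e z \<zeta> \<partial>?M)"
      using avg_square_le(1)[OF z _ _ f, of e] assms by (intro ennreal_leI) auto
    also have "\<dots> = (\<integral>\<^sup>+\<zeta>. ennreal ((f \<zeta>)\<^sup>2 * kap e z \<zeta>) \<partial>?M)"
      using avg_square_le(2)[OF z _ _ f, of e] assms kap_nonneg by (intro nn_integral_eq_integral[symmetric]) auto
    finally show "ennreal ((avg e f z)\<^sup>2) \<le> (\<integral>\<^sup>+\<zeta>. ennreal ((f \<zeta>)\<^sup>2 * kap e z \<zeta>) \<partial>?M)" .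
  qed
  also have "\<dots> = (\<integral>\<^sup>+\<zeta>. \<integral>\<^sup>+z. ennreal ((f \<zeta>)\<^sup>2 * kap e z \<zeta>) \<partial>?M \<partial>?M)"
    by (rule MM.Fubini'[OF jm, symmetric])
  also have "\<dots> \<le> (\<integral>\<^sup>+\<zeta>. 4 * ennreal ((f \<zeta>)\<^sup>2) \<partial>?M)"
  proof (rule nn_integral_mono)
    fix \<zeta>
    define c where "c = (f \<zeta>)\<^sup>2"
    have "(\<integral>\<^sup>+z. ennreal (c * kap e z \<zeta>) \<partial>?M) = (\<integral>\<^sup>+z. ennreal (c * kap e z \<zeta>) * indicator T z \<partial>lborel)"
      by (rule nn_integral_lebesgue_on_borel[OF cm T_borel])
    also have "\<dots> \<le> (\<integral>\<^sup>+z. ennreal (c) * ennreal (kap e z \<zeta>) \<partial>lborel)"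
      by (rule nn_integral_mono) (auto simp: indicator_def ennreal_mult kap_nonneg c_def)
    also have "\<dots> = ennreal (c) * (\<integral>\<^sup>+z. ennreal (kap e z \<zeta>) \<partial>lborel)"
      using cm[of 1 \<zeta>] by (intro nn_integral_cmult) simp
    also have "\<dots> \<le> ennreal (c) * 4"
      using nn_integral_kap_left[OF assms(1,2)] by (intro mult_left_mono) auto
    finally show "(\<integral>\<^sup>+z. ennreal ((f \<zeta>)\<^sup>2 * kap e z \<zeta>) \<partial>?M) \<le> 4 * ennreal ((f \<zeta>)\<^sup>2)" by (simp add: mult.commute c_def)
  qed
  also have "\<dots> = 4 * (\<integral>\<^sup>+\<zeta>. ennreal ((f \<zeta>)\<^sup>2) \<partial>?M)" by (rule nn_integral_cmult) measurable
  also have "\<dots> = 4 * ennreal (ip T f f)" by (simp add: ip_eq_nn_integral[OF f])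
  also have "\<dots> = ennreal (4 * ip T f f)" by (simp add: ennreal_mult)
  finally show ?thesis by (simp add: ennreal_le_iff)
qed

section \<open>Convergence of averages and density of C1 functions\<close>

definition diam :: real where "diam = diameter T"

lemma diam: "0 \<le> diam" "z \<in> T \<Longrightarrow> y \<in> T \<Longrightarrow> norm (z - y) \<le> diam"
  using diameter_bounded_bound[OF compact_imp_bounded[OF compact_T]] diameter_ge_0[OF compact_imp_bounded[OF compact_T]]
  by (auto simp: diam_def dist_norm)

lemma avg_diff_const:
  assumes "z \<in> T" "0 < e" "e \<le> 1" "L2 T f"
  shows "avg e (\<lambda>\<zeta>. f \<zeta> - c) z = avg e f z - c"
proof -
  have "avg e (\<lambda>\<zeta>. c) z = c" using ip_cmult_left[of T c "\<lambda>_. 1" "kap e z"] ip_one_kap[OF assms(1-3)] by (simp add: avg_def)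
  then show ?thesis using avg_diff[OF assms(4) L2_const[OF compact_T, of c], of e z] by simp
qed

text \<open>The kernel at \<open>z\<close> only sees points within \<open>e * diam\<close> of
  \<open>z\<close>, so uniform continuity of \<open>g\<close> controls the oscillation being
  averaged.\<close>

lemma avg_uniform:
  assumes g: "continuous_on T g" and "r > 0"
  shows "\<exists>d>0. \<forall>e. 0 < e \<and> e \<le> d \<longrightarrow> (\<forall>z\<in>T. \<bar>avg e g z - g z\<bar> \<le> r)"
proof -
  from compact_uniformly_continuous[OF g compact_T] \<open>r > 0\<close> obtain d0 where d0: "d0 > 0"
    "\<And>z z'. z \<in> T \<Longrightarrow> z' \<in> T \<Longrightarrow> dist z' z < d0 \<Longrightarrow> dist (g z') (g z) < r"
    unfolding uniformly_continuous_on_def by metis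
  define d where "d = min 1 (d0 / (diam + 1))"
  have "d > 0" using d0(1) diam(1) by (auto simp: d_def)
  have "\<bar>avg e g z - g z\<bar> \<le> r" if e: "0 < e" "e \<le> d" and z: "z \<in> T" for e z
  proof -
    have e1: "e \<le> 1" "e * diam < d0"
    proof -
      have "e * diam \<le> d0 / (diam + 1) * diam" using e diam(1) by (intro mult_right_mono) (auto simp: d_def)
      also have "\<dots> < d0" using d0(1) diam(1) by (simp add: field_simps)
      finally show "e * diam < d0" .
    qed (use e in \<open>simp add: d_def\<close>)
    have L2g: "L2 T g" by (rule L2_continuous[OF compact_T g])
    have L2d: "L2 T (\<lambda>\<zeta>. g \<zeta> - g z)" by (intro L2_diff L2g L2_const compact_T)
    have "\<bar>avg e g z - g z\<bar> = \<bar>\<integral>\<zeta>. (g \<zeta> - g z) * kap e z \<zeta> \<partial>lebesgue_on T\<bar>"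
      using avg_diff_const[OF z e(1) e1(1) L2g, of "g z"] by (simp add: avg_def ip_def)
    also have "\<dots> \<le> (\<integral>\<zeta>. \<bar>(g \<zeta> - g z) * kap e z \<zeta>\<bar> \<partial>lebesgue_on T)" by (rule integral_abs_bound)
    also have "\<dots> \<le> (\<integral>\<zeta>. r * kap e z \<zeta> \<partial>lebesgue_on T)"
    proof (rule integral_mono)
      show "integrable (lebesgue_on T) (\<lambda>\<zeta>. \<bar>(g \<zeta> - g z) * kap e z \<zeta>\<bar>)"
        using L2_mult_integrable[OF L2d L2_kap] by auto
      show "integrable (lebesgue_on T) (\<lambda>\<zeta>. r * kap e z \<zeta>)"
        using L2_mult_integrable[OF L2_const[OF compact_T] L2_kap] by auto
      fix \<zeta> assume "\<zeta> \<in> space (lebesgue_on T)"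
      then have \<zeta>: "\<zeta> \<in> T" by simp
      show "\<bar>(g \<zeta> - g z) * kap e z \<zeta>\<bar> \<le> r * kap e z \<zeta>"
      proof (cases "kap e z \<zeta> = 0")
        case False
        from kap_supp(2)[OF z e(1) e1(1) False] obtain y where y: "y \<in> S" "\<zeta> = (1 - e) *\<^sub>R z + e *\<^sub>R y" by blast
        have "\<zeta> - z = e *\<^sub>R (y - z)" using y by (simp add: algebra_simps)
        then have "dist \<zeta> z = e * norm (y - z)" using e by (simp add: dist_norm)
        also have "\<dots> \<le> e * diam" using y z e S_interior interior_subset[of T] by (intro mult_left_mono diam) auto
        finally have "dist (g \<zeta>) (g z) < r" using d0(2)[OF z \<zeta>] e1(2) by simp
        then show ?thesis unfolding abs_mult using kap_nonneg[of e z \<zeta>]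
          by (simp add: dist_real_def mult_right_mono)
      qed simp
    qed
    also have "\<dots> = r" using ip_one_kap[OF z e(1) e1(1)] by (simp add: ip_def)
    finally show ?thesis .
  qed
  then show ?thesis using \<open>d > 0\<close> by blast
qed

lemma avg_tendsto:
  assumes f: "L2 T f" and "r > 0"
  shows "\<exists>d>0. \<forall>e. 0 < e \<and> e \<le> d \<longrightarrow> sqd T (avg e f) f < r"
proof -
  \<comment> \<open>Comparison through a continuous \<open>g\<close>: two triangle inequalities and
    the bound 4 for averaging give 8 r/24 + 4 r/16 + 4 r/24, that is 3 r/4.\<close>
  obtain g where g: "continuous_on UNIV g" "sqd T f g < r / 24"
    using L2_continuous_dense[OF compact_T f, of "r/24"] \<open>r > 0\<close> by auto
  have gT: "continuous_on T g" using g(1) by (rule continuous_on_subset) simp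
  have L2g: "L2 T g" by (rule L2_continuous[OF compact_T gT])
  define m where "m = measure lebesgue T + 1"
  have m: "m > 0" by (simp add: m_def add_nonneg_pos)
  define q where "q = sqrt (r / (16 * m))"
  have q: "q > 0" "q * q = r / (16 * m)" using m \<open>r > 0\<close> by (auto simp: q_def)
  obtain d where d: "d > 0" "\<And>e z. 0 < e \<Longrightarrow> e \<le> d \<Longrightarrow> z \<in> T \<Longrightarrow> \<bar>avg e g z - g z\<bar> \<le> q"
    using avg_uniform[OF gT q(1)] by blast
  have "sqd T (avg e f) f < r" if e: "0 < e" "e \<le> min d (1/2)" for e
  proof -
    have e1: "e < 1" "e \<le> 1/2" "e \<le> d" using e by auto
    note L = L2_avg[OF e(1) e1(1) f] L2_avg[OF e(1) e1(1) L2g] f L2g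
    have "sqd T (avg e f) f
      \<le> 2 * sqd T (avg e f) (avg e g)
       + 2 * sqd T (avg e g) f"
      by (intro ip_diff_triangle L)
    also have "sqd T (avg e f) (avg e g) \<le> 4 * sqd T f g"
      using avg_bound[OF e(1) e1(2) L2_diff[OF f L2g]] by (simp add: avg_diff[OF f L2g, abs_def])
    also have "sqd T (avg e g) f
      \<le> 2 * sqd T (avg e g) g + 2 * sqd T g f"
      by (intro ip_diff_triangle L)
    also have "sqd T (avg e g) g \<le> q * q * measure lebesgue T"
      using ip_le_bound[OF compact_T L2_diff[OF L(2,4)] L2_diff[OF L(2,4)] d(2)[OF e(1) e1(3)] d(2)[OF e(1) e1(3)]]
      by simp
    also have "q * q * measure lebesgue T \<le> r / 16"
    proof -
      have "q * q * measure lebesgue T \<le> q * q * m" by (intro mult_left_mono) (auto simp: m_def)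
      also have "\<dots> = r / 16" using m by (simp add: q(2))
      finally show ?thesis .
    qed
    also have "sqd T g f = sqd T f g" by (rule ip_diff_commute)
    finally show ?thesis using g(2) \<open>r > 0\<close> by simp
  qed
  then show ?thesis using d(1) by (intro exI[of _ "min d (1/2)"]) auto
qed

text \<open>The averages themselves are the approximants: on \<open>T\<close> their gradient is
  \<open>1 - e\<close> times the average of the weak gradient, so it converges to the latter as
  \<open>e\<close> tends to 0.\<close>

theorem C1_dense:
  assumes wg: "weak_grad T u ux uy" and "r > 0"
  shows "\<exists>w wx wy. C1_fun w wx wy \<and> h1dist2 T u ux uy w wx wy < r"
proof -
  have L: "L2 T u" "L2 T ux" "L2 T uy" using wg by (auto simp: weak_grad_def)
  have "r / 16 > 0" using \<open>r > 0\<close> by simp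
  obtain d0 where d0: "d0 > 0"
    "\<And>e. 0 < e \<Longrightarrow> e \<le> d0 \<Longrightarrow> sqd T (avg e u) u < r / 16"
    using avg_tendsto[OF L(1) \<open>r / 16 > 0\<close>] by blast
  obtain d1 where d1: "d1 > 0"
    "\<And>e. 0 < e \<Longrightarrow> e \<le> d1 \<Longrightarrow> sqd T (avg e ux) ux < r / 16"
    using avg_tendsto[OF L(2) \<open>r / 16 > 0\<close>] by blast
  obtain d2 where d2: "d2 > 0"
    "\<And>e. 0 < e \<Longrightarrow> e \<le> d2 \<Longrightarrow> sqd T (avg e uy) uy < r / 16"
    using avg_tendsto[OF L(3) \<open>r / 16 > 0\<close>] by blast
  define N where "N = ip T ux ux + ip T uy uy + 1"
  have N: "N > 0" by (simp add: N_def add_nonneg_pos)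
  \<comment> \<open>The last bound, with \<open>e <= 1\<close>, makes the error
    \<open>8 * (e * e) * N\<close> caused by the factor \<open>1 - e\<close> at most
    \<open>r / 8\<close>.\<close>
  define e where "e = min (min (min d0 d1) (min d2 (1/2))) (r / (64 * N))"
  have "e \<le> 1/2" by (simp add: e_def min_le_iff_disj)
  then have e: "0 < e" "e \<le> d0" "e \<le> d1" "e \<le> d2" "e \<le> 1/2" "e < 1" "e \<le> r / (64 * N)"
    using d0(1) d1(1) d2(1) N \<open>r > 0\<close> by (simp_all add: e_def min_le_iff_disj)
  have "e * e \<le> 1 * (r / (64 * N))" using e by (intro mult_mono) auto
  then have eN: "8 * (e * e) * N \<le> r / 8" using N by (simp add: field_simps)
  have part: "sqd T v (avg_grad g e u) \<le> r / 8 + 8 * (e * e) * ip T v v"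
    if v: "L2 T v" "sqd T (avg e v) v < r / 16"
      and g: "\<And>z. z \<in> T \<Longrightarrow> avg_grad g e u z = (1 - e) * avg e v z" for v g
  proof -
    have La: "L2 T (avg e v)" by (rule L2_avg[OF e(1,6) v(1)])
    have "sqd T v (avg_grad g e u)
       = ip T (\<lambda>z. (v z - avg e v z) + e * avg e v z) (\<lambda>z. (v z - avg e v z) + e * avg e v z)"
      unfolding ip_def by (rule Bochner_Integration.integral_cong) (auto simp: g algebra_simps)
    also have "\<dots> \<le> 2 * sqd T v (avg e v)
        + 2 * ip T (\<lambda>z. e * avg e v z) (\<lambda>z. e * avg e v z)"
      by (intro ip_add_le L2_intros v La)
    also have "ip T (\<lambda>z. e * avg e v z) (\<lambda>z. e * avg e v z) = e * e * ip T (avg e v) (avg e v)"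
      by (simp add: ip_cmult_left ip_cmult_right)
    also have "e * e * ip T (avg e v) (avg e v) \<le> e * e * (4 * ip T v v)"
      by (intro mult_left_mono avg_bound v e) auto
    also have "sqd T v (avg e v) = sqd T (avg e v) v"
      by (rule ip_diff_commute)
    finally show ?thesis using v(2) by simp
  qed
  have "h1dist2 T u ux uy (avg e u) (avg_grad kx e u) (avg_grad ky e u)
     \<le> r / 16 + (r / 8 + 8 * (e * e) * ip T ux ux) + (r / 8 + 8 * (e * e) * ip T uy uy)"
    unfolding h1dist2_def
    using part[OF L(2) d1(2)[OF e(1,3)] avg_weak_grad(1)[OF wg _ e(1,6)]]
      part[OF L(3) d2(2)[OF e(1,4)] avg_weak_grad(2)[OF wg _ e(1,6)]] d0(2)[OF e(1,2)]
      ip_diff_commute[of T u "avg e u"] by simp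
  also have "\<dots> \<le> r / 16 + r / 8 + r / 8 + 8 * (e * e) * N"
    by (simp add: N_def algebra_simps)
  also have "\<dots> < r" using eN \<open>r > 0\<close> by simp
  finally show ?thesis using avg_C1[OF e(1,6) L(1)] by blast
qed

text \<open>Uniqueness of weak gradients: if \<open>u\<close> vanishes almost everywhere, then
  \<open>avg_grad\<close> of \<open>u\<close> vanishes, hence so do the averages of
  \<open>ux\<close> and \<open>uy\<close> at every point of \<open>T\<close>; but these averages
  converge to \<open>ux\<close> and \<open>uy\<close>.\<close>

lemma weak_grad_zero:
  assumes wg: "weak_grad T u ux uy" and u0: "ip T u u = 0"
  shows "ip T ux ux = 0" "ip T uy uy = 0"
proof -
  have L: "L2 T u" "L2 T ux" "L2 T uy" using wg by (auto simp: weak_grad_def)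
  have z: "ip T v v = 0" if v: "L2 T v" and g: "continuous_on UNIV g"
    "\<And>e z. z \<in> T \<Longrightarrow> 0 < e \<Longrightarrow> e < 1 \<Longrightarrow> avg_grad g e u z = (1 - e) * avg e v z" for v g
  proof -
    have av: "avg e v z = 0" if "z \<in> T" "0 < e" "e < 1" for e z
    proof -
      have "L2 T (\<lambda>\<zeta>. g (arg e z \<zeta>))"
        by (intro L2_continuous compact_T continuous_on_compose2[OF g(1)] arg_cont) auto
      then have "ip T u (\<lambda>\<zeta>. g (arg e z \<zeta>)) = 0"
        using ip_Cauchy_Schwarz[OF L(1), of "\<lambda>\<zeta>. g (arg e z \<zeta>)"] u0 by simp
      then show ?thesis using g(2)[OF that] that by (simp add: avg_grad_def)
    qed
    have "ip T v v < r" if "r > 0" for r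
    proof -
      obtain d where d: "d > 0" "\<And>e. 0 < e \<Longrightarrow> e \<le> d \<Longrightarrow> sqd T (avg e v) v < r"
        using avg_tendsto[OF v \<open>r > 0\<close>] by blast
      define e where "e = min d (1/2)"
      have e: "0 < e" "e \<le> d" "e < 1" using d(1) by (auto simp: e_def)
      have "sqd T (avg e v) v = ip T v v"
        unfolding ip_def by (rule Bochner_Integration.integral_cong) (auto simp: av e)
      then show ?thesis using d(2)[OF e(1,2)] by simp
    qed
    then show ?thesis using ip_nonneg[of T v] by (meson less_irrefl not_less order.not_eq_order_implies_strict)
  qed
  show "ip T ux ux = 0" "ip T uy uy = 0"
    using z[OF L(2) kx_cont avg_weak_grad(1)[OF wg]] z[OF L(3) ky_cont avg_weak_grad(2)[OF wg]] by auto
qed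

end

section \<open>Rate of approximation by averages in terms of the gradient\<close>

lemma abs_diff_le_nn_integral:
  fixes p p' :: "real \<Rightarrow> real"
  assumes p: "\<And>t. (p has_real_derivative p' t) (at t)" "continuous_on UNIV p'"
  shows "ennreal \<bar>p 1 - p 0\<bar> \<le> (\<integral>\<^sup>+t. ennreal \<bar>p' t\<bar> * indicator {0..1} t \<partial>lborel)"
proof -
  have c: "isCont p' t" for t using p(2) by (simp add: continuous_on_eq_continuous_at)
  have int: "has_bochner_integral lborel (\<lambda>t. p' t * indicator {0..1} t) (p 1 - p 0)"
    using p(1) c by (intro has_bochner_integral_FTC_Icc_real) auto
  have "ennreal \<bar>p 1 - p 0\<bar> = ennreal (norm (\<integral>t. p' t * indicator {0..1} t \<partial>lborel))"
    using int by (simp add: has_bochner_integral_integral_eq)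
  also have "\<dots> \<le> (\<integral>\<^sup>+t. norm (p' t * indicator {0..1} t) \<partial>lborel)"
    using int by (intro integral_norm_bound_ennreal) (auto simp: has_bochner_integral_iff)
  also have "\<dots> = (\<integral>\<^sup>+t. ennreal \<bar>p' t\<bar> * indicator {0..1} t \<partial>lborel)"
    by (rule nn_integral_cong) (auto simp: indicator_def)
  finally show ?thesis .
qed

lemma square_diff_le_nn_integral:
  fixes p p' :: "real \<Rightarrow> real"
  assumes p: "\<And>t. (p has_real_derivative p' t) (at t)" "continuous_on UNIV p'"
  shows "ennreal ((p 1 - p 0)\<^sup>2) \<le> (\<integral>\<^sup>+t. ennreal ((p' t)\<^sup>2) * indicator {0..1} t \<partial>lborel)"
proof -
  have [measurable]: "p' \<in> borel_measurable borel" using p(2) by (rule borel_measurable_continuous_onI)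
  have ind: "(indicator {0..1::real} t :: ennreal)\<^sup>2 = indicator {0..1} t" for t
    by (auto simp: indicator_def)
  have "ennreal ((p 1 - p 0)\<^sup>2) = (ennreal \<bar>p 1 - p 0\<bar>)\<^sup>2"
    by (simp add: ennreal_power)
  also have "\<dots> \<le> (\<integral>\<^sup>+t. ennreal \<bar>p' t\<bar> * indicator {0..1} t \<partial>lborel)\<^sup>2"
    by (intro power_mono abs_diff_le_nn_integral p) auto
  \<comment> \<open>The indicator is idempotent; writing it twice lets Cauchy-Schwarz split off the
    unit length of the interval.\<close>
  also have "\<dots> = (\<integral>\<^sup>+t. (ennreal \<bar>p' t\<bar> * indicator {0..1} t) * indicator {0..1} t \<partial>lborel)\<^sup>2"
    by (intro arg_cong[where f="\<lambda>x. x\<^sup>2"] nn_integral_cong) (auto simp: indicator_def)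
  also have "\<dots> \<le> (\<integral>\<^sup>+t. (ennreal \<bar>p' t\<bar> * indicator {0..1} t)\<^sup>2 \<partial>lborel)
      * (\<integral>\<^sup>+t. (indicator {0..1} t)\<^sup>2 \<partial>(lborel :: real measure))"
    by (rule Cauchy_Schwarz_nn_integral) auto
  also have "\<dots> = (\<integral>\<^sup>+t. ennreal ((p' t)\<^sup>2) * indicator {0..1} t \<partial>lborel)"
    unfolding power_mult_distrib ind by (simp add: ennreal_power)
  finally show ?thesis .
qed

lemma C1_fun_line_derivative:
  assumes "C1_fun w wx wy"
  shows "((\<lambda>t. w (z + t *\<^sub>R d)) has_real_derivative
      (wx (z + t *\<^sub>R d) * fst d + wy (z + t *\<^sub>R d) * snd d)) (at t)"
proof -
  have 1: "((\<lambda>t. z + t *\<^sub>R d) has_derivative (\<lambda>h. h *\<^sub>R d)) (at t)"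
    by (auto intro!: derivative_eq_intros)
  have "(w has_derivative (\<lambda>h. wx (z + t *\<^sub>R d) * fst h + wy (z + t *\<^sub>R d) * snd h)) (at (z + t *\<^sub>R d))"
    using assms unfolding C1_fun_def by blast
  from diff_chain_at[OF 1 this] show ?thesis
    unfolding has_field_derivative_def o_def
    by (rule has_derivative_eq_rhs) (auto simp: fun_eq_iff algebra_simps)
qed

lemma C1_fun_line_continuous:
  assumes "C1_fun w wx wy"
  shows "continuous_on A (\<lambda>t. wx (z + t *\<^sub>R d))" "continuous_on A (\<lambda>t. wy (z + t *\<^sub>R d))"
  using assms unfolding C1_fun_def
  by (auto intro!: continuous_on_compose2[of UNIV wx] continuous_on_compose2[of UNIV wy] continuous_intros)

lemma C1_segment_square_le:
  assumes w: "C1_fun w wx wy"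
  defines "G \<equiv> \<lambda>x. (wx x)\<^sup>2 + (wy x)\<^sup>2"
  shows "ennreal ((w (z + d) - w z)\<^sup>2) \<le> ennreal ((norm d)\<^sup>2) * (\<integral>\<^sup>+t. ennreal (G (z + t *\<^sub>R d)) * indicator {0..1} t \<partial>lborel)"
proof -
  let ?p' = "\<lambda>t. wx (z + t *\<^sub>R d) * fst d + wy (z + t *\<^sub>R d) * snd d"
  have cw: "continuous_on UNIV wx" "continuous_on UNIV wy" using w by (auto simp: C1_fun_def)
  then have [measurable]: "wx \<in> borel_measurable borel" "wy \<in> borel_measurable borel"
    by (auto intro: borel_measurable_continuous_onI)
  have "ennreal ((w (z + d) - w z)\<^sup>2) \<le> (\<integral>\<^sup>+t. ennreal ((?p' t)\<^sup>2) * indicator {0..1} t \<partial>lborel)"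
    using square_diff_le_nn_integral[of "\<lambda>t. w (z + t *\<^sub>R d)" ?p'] C1_fun_line_derivative[OF w]
      C1_fun_line_continuous[OF w] by (simp add: continuous_intros)
  also have "\<dots> \<le> (\<integral>\<^sup>+t. ennreal ((norm d)\<^sup>2) * (ennreal (G (z + t *\<^sub>R d)) * indicator {0..1} t) \<partial>lborel)"
  proof (rule nn_integral_mono)
    fix t
    let ?a = "wx (z + t *\<^sub>R d)" and ?b = "wy (z + t *\<^sub>R d)"
    \<comment> \<open>Cauchy-Schwarz in the plane, from the square of a determinant.\<close>
    have "(?p' t)\<^sup>2 \<le> (?a\<^sup>2 + ?b\<^sup>2) * ((fst d)\<^sup>2 + (snd d)\<^sup>2)"
      using zero_le_power2[of "?a * snd d - ?b * fst d"] by (simp add: power2_eq_square algebra_simps)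
    also have "\<dots> = (norm d)\<^sup>2 * G (z + t *\<^sub>R d)"
      by (simp add: G_def norm_prod_def mult.commute)
    finally have "ennreal ((?p' t)\<^sup>2) \<le> ennreal ((norm d)\<^sup>2 * G (z + t *\<^sub>R d))" by (rule ennreal_leI)
    also have "\<dots> = ennreal ((norm d)\<^sup>2) * ennreal (G (z + t *\<^sub>R d))"
      by (rule ennreal_mult) (auto simp: G_def)
    finally have "ennreal ((?p' t)\<^sup>2) \<le> ennreal ((norm d)\<^sup>2) * ennreal (G (z + t *\<^sub>R d))" .
    then show "ennreal ((?p' t)\<^sup>2) * indicator {0..1} t
       \<le> ennreal ((norm d)\<^sup>2) * (ennreal (G (z + t *\<^sub>R d)) * indicator {0..1} t)"
      by (auto simp: indicator_def)
  qed
  also have "\<dots> = ennreal ((norm d)\<^sup>2) * (\<integral>\<^sup>+t. ennreal (G (z + t *\<^sub>R d)) * indicator {0..1} t \<partial>lborel)"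
    unfolding G_def by (rule nn_integral_cmult) measurable
  finally show ?thesis .
qed

context averaging
begin

lemma L2_C1:
  assumes "C1_fun w wx wy"
  shows "L2 T w" "L2 T wx" "L2 T wy"
  using assms C1_fun_continuous[OF assms]
  by (auto simp: C1_fun_def intro!: L2_continuous[OF compact_T] elim: continuous_on_subset)

text \<open>A Poincare-type estimate: \<open>w \<zeta> - w z\<close> is the integral of a derivative
  along a segment of length at most \<open>e * diam\<close>. After exchanging the integrals, moving
  \<open>z\<close> towards a fixed \<open>y\<close> by a fraction at most 1/2 costs a factor at most
  4 in area.\<close>

lemma avg_approx_C1:
  assumes w: "C1_fun w wx wy" and e: "0 < e" "e \<le> 1/2"
  shows "sqd T (avg e w) w \<le> 4 * (e * diam)\<^sup>2 * (ip T wx wx + ip T wy wy)"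
proof -
  define G where "G x = (wx x)\<^sup>2 + (wy x)\<^sup>2" for x
  note L = L2_C1[OF w]
  have cw: "continuous_on UNIV wx" "continuous_on UNIV wy" using w by (auto simp: C1_fun_def)
  then have [measurable]: "wx \<in> borel_measurable borel" "wy \<in> borel_measurable borel" "w \<in> borel_measurable borel"
    using C1_fun_continuous[OF w] by (auto intro: borel_measurable_continuous_onI)
  have Gm[measurable]: "G \<in> borel_measurable borel" unfolding G_def by measurable
  define J where "J = (\<integral>\<^sup>+x. ennreal (G x) * indicator T x \<partial>lborel)"
  have J: "J = ennreal (ip T wx wx + ip T wy wy)"
  proof -
    have "J = (\<integral>\<^sup>+x. ennreal (G x) \<partial>lebesgue_on T)" unfolding J_def
      by (rule nn_integral_lebesgue_on_borel[symmetric]) measurable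
    also have "\<dots> = ennreal (\<integral>x. G x \<partial>lebesgue_on T)"
      using L unfolding G_def L2_def by (intro nn_integral_eq_integral) auto
    also have "(\<integral>x. G x \<partial>lebesgue_on T) = ip T wx wx + ip T wy wy"
      using L unfolding G_def ip_def L2_def power2_eq_square by simp
    finally show ?thesis .
  qed
  define C where "C = (e * diam)\<^sup>2"
  define F where "F z y = (\<integral>\<^sup>+\<tau>. ennreal (G (z + \<tau> *\<^sub>R (e *\<^sub>R (y - z)))) * indicator {0..1} \<tau> \<partial>lborel)" for z y
  have point: "ennreal ((avg e w z - w z)\<^sup>2) \<le> ennreal C * (\<integral>\<^sup>+y. ennreal (k y) * F z y \<partial>lborel)" if z: "z \<in> T" for z
  proof -
    let ?f = "\<lambda>\<zeta>. w \<zeta> - w z"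
    have L2f: "L2 T ?f" by (intro L2_diff L L2_const compact_T)
    have e1: "e \<le> 1" using e by simp
    have "ennreal ((avg e w z - w z)\<^sup>2) = ennreal ((avg e ?f z)\<^sup>2)"
      using avg_diff_const[OF z e(1) e1 L(1), of "w z"] by simp
    also have "\<dots> \<le> ennreal (\<integral>\<zeta>. (?f \<zeta>)\<^sup>2 * kap e z \<zeta> \<partial>lebesgue_on T)"
      by (intro ennreal_leI avg_square_le(1) z e e1 L2f)
    also have "\<dots> = (\<integral>\<^sup>+\<zeta>. ennreal ((?f \<zeta>)\<^sup>2 * kap e z \<zeta>) \<partial>lebesgue_on T)"
      using avg_square_le(2)[OF z e(1) e1 L2f] kap_nonneg by (intro nn_integral_eq_integral[symmetric]) auto
    also have "\<dots> = (\<integral>\<^sup>+\<zeta>. ennreal ((?f \<zeta>)\<^sup>2 * kap e z \<zeta>) * indicator T \<zeta> \<partial>lborel)"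
      by (rule nn_integral_lebesgue_on_borel) measurable
    also have "\<dots> \<le> (\<integral>\<^sup>+\<zeta>. ennreal ((?f \<zeta>)\<^sup>2 * kap e z \<zeta>) \<partial>lborel)"
      by (rule nn_integral_mono) (auto simp: indicator_def)
    \<comment> \<open>Back to the variable \<open>y\<close>: the Jacobian \<open>e^2\<close> will
      cancel the normalisation of \<open>kap\<close>.\<close>
    also have "\<dots> = ennreal (e\<^sup>2) * (\<integral>\<^sup>+y. ennreal ((?f ((1 - e) *\<^sub>R z + e *\<^sub>R y))\<^sup>2 * kap e z ((1 - e) *\<^sub>R z + e *\<^sub>R y)) \<partial>lborel)"
      using e by (intro nn_integral_lborel_scale) auto
    also have "\<dots> = (\<integral>\<^sup>+y. ennreal (e\<^sup>2) * ennreal ((?f ((1 - e) *\<^sub>R z + e *\<^sub>R y))\<^sup>2 * kap e z ((1 - e) *\<^sub>R z + e *\<^sub>R y)) \<partial>lborel)"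
      by (rule nn_integral_cmult[symmetric]) measurable
    also have "\<dots> \<le> (\<integral>\<^sup>+y. ennreal C * (ennreal (k y) * F z y) \<partial>lborel)"
    proof (rule nn_integral_mono)
      fix y
      have "arg e z ((1 - e) *\<^sub>R z + e *\<^sub>R y) = y" using e by (simp add: arg_def)
      then have kk: "kap e z ((1 - e) *\<^sub>R z + e *\<^sub>R y) = k y / e\<^sup>2" by (simp add: kap_def)
      have zz: "(1 - e) *\<^sub>R z + e *\<^sub>R y = z + e *\<^sub>R (y - z)" by (simp add: algebra_simps)
      have "ennreal (e\<^sup>2) * ennreal ((?f ((1 - e) *\<^sub>R z + e *\<^sub>R y))\<^sup>2 * kap e z ((1 - e) *\<^sub>R z + e *\<^sub>R y))
         = ennreal (k y) * ennreal ((w (z + e *\<^sub>R (y - z)) - w z)\<^sup>2)"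
        unfolding kk unfolding zz using e k_nonneg by (simp add: ennreal_mult[symmetric])
      also have "\<dots> \<le> ennreal (k y) * (ennreal C * F z y)"
      proof (cases "k y = 0")
        case False
        then have y: "y \<in> T" using k_supp(1)[of y] S_interior interior_subset[of T] by auto
        have "norm (e *\<^sub>R (y - z)) \<le> e * diam" using diam(2)[OF y z] e by simp
        then have "(norm (e *\<^sub>R (y - z)))\<^sup>2 \<le> C" unfolding C_def by (intro power_mono) auto
        then have "ennreal ((norm (e *\<^sub>R (y - z)))\<^sup>2) * F z y \<le> ennreal C * F z y"
          by (intro mult_right_mono ennreal_leI) auto
        moreover have "ennreal ((w (z + e *\<^sub>R (y - z)) - w z)\<^sup>2) \<le> ennreal ((norm (e *\<^sub>R (y - z)))\<^sup>2) * F z y"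
          unfolding F_def G_def by (rule C1_segment_square_le[OF w])
        ultimately show ?thesis by (intro mult_left_mono) (auto intro: order_trans)
      qed simp
      finally show "ennreal (e\<^sup>2) * ennreal ((?f ((1 - e) *\<^sub>R z + e *\<^sub>R y))\<^sup>2 * kap e z ((1 - e) *\<^sub>R z + e *\<^sub>R y))
         \<le> ennreal C * (ennreal (k y) * F z y)" by (simp add: mult.left_commute)
    qed
    also have "\<dots> = ennreal C * (\<integral>\<^sup>+y. ennreal (k y) * F z y \<partial>lborel)"
      unfolding F_def by (rule nn_integral_cmult) measurable
    finally show ?thesis .
  qed
  have Fm[measurable]: "case_prod F \<in> borel_measurable (lborel \<Otimes>\<^sub>M lborel)"
    unfolding F_def by measurable
  have inner: "(\<integral>\<^sup>+z. F z y * indicator T z \<partial>lborel) \<le> 4 * J" if y: "y \<in> T" for y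
  proof -
    have "(\<integral>\<^sup>+z. F z y * indicator T z \<partial>lborel)
      = (\<integral>\<^sup>+z. \<integral>\<^sup>+\<tau>. ennreal (G (z + \<tau> *\<^sub>R (e *\<^sub>R (y - z)))) * indicator {0..1} \<tau> * indicator T z \<partial>lborel \<partial>lborel)"
      unfolding F_def by (intro nn_integral_cong nn_integral_multc[symmetric]) measurable
    also have "\<dots> = (\<integral>\<^sup>+\<tau>. \<integral>\<^sup>+z. ennreal (G (z + \<tau> *\<^sub>R (e *\<^sub>R (y - z)))) * indicator {0..1} \<tau> * indicator T z \<partial>lborel \<partial>lborel)"
      by (rule lborel_pair.Fubini'[symmetric]) measurable
    also have "\<dots> \<le> (\<integral>\<^sup>+\<tau>. (4 * J) * indicator {0..1} \<tau> \<partial>(lborel :: real measure))"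
    proof (rule nn_integral_mono)
      fix \<tau> :: real
      show "(\<integral>\<^sup>+z. ennreal (G (z + \<tau> *\<^sub>R (e *\<^sub>R (y - z)))) * indicator {0..1} \<tau> * indicator T z \<partial>lborel) \<le> (4 * J) * indicator {0..1} \<tau>"
      proof (cases "\<tau> \<in> {0..1}")
        case True
        \<comment> \<open>The fraction by which \<open>z\<close> moves towards \<open>y\<close>. As
          \<open>s <= 1/2\<close>, this contraction has Jacobian \<open>(1 - s)^2\<close>, at least
          1/4, and convexity keeps its image in \<open>T\<close>.\<close>
        define s where "s = \<tau> * e"
        have "s \<le> 1 * e" unfolding s_def using True e by (intro mult_right_mono) auto
        then have s: "0 \<le> s" "s \<le> 1/2" using True e by (linarith | simp add: s_def)+
        have pt: "z + \<tau> *\<^sub>R (e *\<^sub>R (y - z)) = s *\<^sub>R y + (1 - s) *\<^sub>R z" for z by (simp add: s_def algebra_simps)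
        let ?X = "\<integral>\<^sup>+z. ennreal (G (s *\<^sub>R y + (1 - s) *\<^sub>R z)) * indicator T (s *\<^sub>R y + (1 - s) *\<^sub>R z) \<partial>lborel"
        have "(\<integral>\<^sup>+z. ennreal (G (z + \<tau> *\<^sub>R (e *\<^sub>R (y - z)))) * indicator {0..1} \<tau> * indicator T z \<partial>lborel) \<le> ?X"
        proof (rule nn_integral_mono)
          fix z
          show "ennreal (G (z + \<tau> *\<^sub>R (e *\<^sub>R (y - z)))) * indicator {0..1} \<tau> * indicator T z
            \<le> ennreal (G (s *\<^sub>R y + (1 - s) *\<^sub>R z)) * indicator T (s *\<^sub>R y + (1 - s) *\<^sub>R z)"
            using shrink_mem[of z y s] y s unfolding pt by (auto simp: indicator_def add.commute)
        qed
        also have "\<dots> \<le> ennreal (4 * (1 - s)\<^sup>2) * ?X"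
        proof -
          have "1 / 4 \<le> (1 - s)\<^sup>2" using power_mono[of "1/2" "1 - s" 2] s by (simp add: power2_eq_square)
          then have "ennreal 1 * ?X \<le> ennreal (4 * (1 - s)\<^sup>2) * ?X" by (intro mult_right_mono ennreal_leI) auto
          then show ?thesis by simp
        qed
        also have "\<dots> = 4 * (ennreal ((1 - s)\<^sup>2) * ?X)" by (simp add: ennreal_mult mult.assoc)
        also have "ennreal ((1 - s)\<^sup>2) * ?X = J"
          unfolding J_def using s by (intro nn_integral_lborel_scale[symmetric]) auto
        finally show ?thesis using True by simp
      qed simp
    qed
    also have "\<dots> = 4 * J" by (simp add: nn_integral_cmult)
    finally show ?thesis .
  qed
  have L2d: "L2 T (\<lambda>z. avg e w z - w z)" using e by (intro L2_diff L2_avg L) auto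
  have Fm2[measurable]: "(\<lambda>z. \<integral>\<^sup>+y. ennreal (k y) * F z y \<partial>lborel) \<in> borel_measurable borel"
  proof -
    have "(\<lambda>z. \<integral>\<^sup>+y. ennreal (k y) * F z y \<partial>lborel) \<in> borel_measurable (lborel :: pt measure)"
      by (rule lborel.borel_measurable_nn_integral) measurable
    then show ?thesis by simp
  qed
  have "ennreal (sqd T (avg e w) w) = (\<integral>\<^sup>+z. ennreal ((avg e w z - w z)\<^sup>2) \<partial>lebesgue_on T)"
    by (rule ip_eq_nn_integral[OF L2d])
  also have "\<dots> \<le> (\<integral>\<^sup>+z. ennreal C * (\<integral>\<^sup>+y. ennreal (k y) * F z y \<partial>lborel) \<partial>lebesgue_on T)"
    using point by (intro nn_integral_mono) auto
  also have "\<dots> = (\<integral>\<^sup>+z. ennreal C * (\<integral>\<^sup>+y. ennreal (k y) * F z y \<partial>lborel) * indicator T z \<partial>lborel)"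
    by (rule nn_integral_lebesgue_on_borel) measurable
  also have "\<dots> = ennreal C * (\<integral>\<^sup>+z. (\<integral>\<^sup>+y. ennreal (k y) * F z y \<partial>lborel) * indicator T z \<partial>lborel)"
    unfolding mult.assoc by (rule nn_integral_cmult) measurable
  also have "(\<integral>\<^sup>+z. (\<integral>\<^sup>+y. ennreal (k y) * F z y \<partial>lborel) * indicator T z \<partial>lborel)
     = (\<integral>\<^sup>+z. \<integral>\<^sup>+y. ennreal (k y) * F z y * indicator T z \<partial>lborel \<partial>lborel)"
    by (intro nn_integral_cong nn_integral_multc[symmetric]) measurable
  also have "\<dots> = (\<integral>\<^sup>+y. \<integral>\<^sup>+z. ennreal (k y) * F z y * indicator T z \<partial>lborel \<partial>lborel)"
    by (rule lborel_pair.Fubini'[symmetric]) measurable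
  also have "\<dots> = (\<integral>\<^sup>+y. ennreal (k y) * (\<integral>\<^sup>+z. F z y * indicator T z \<partial>lborel) \<partial>lborel)"
    unfolding mult.assoc by (intro nn_integral_cong nn_integral_cmult) measurable
  also have "\<dots> \<le> (\<integral>\<^sup>+y. ennreal (k y) * (4 * J) \<partial>lborel)"
  proof (rule nn_integral_mono)
    fix y show "ennreal (k y) * (\<integral>\<^sup>+z. F z y * indicator T z \<partial>lborel) \<le> ennreal (k y) * (4 * J)"
    proof (cases "k y = 0")
      case False
      then have "y \<in> T" using k_supp(1)[of y] S_interior interior_subset[of T] by auto
      then show ?thesis by (intro mult_left_mono inner) auto
    qed simp
  qed
  also have "\<dots> = 4 * J" by (simp add: nn_integral_multc k_integral)
  finally have "ennreal (sqd T (avg e w) w) \<le> ennreal C * (4 * J)"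
    by (simp add: mult_left_mono)
  also have "\<dots> = ennreal (4 * C * (ip T wx wx + ip T wy wy))"
  proof -
    have "ennreal C * (4 * ennreal N) = ennreal (4 * C * N)" if "0 \<le> N" for N
      using that by (simp add: ennreal_mult C_def mult.assoc mult.left_commute)
    then show ?thesis unfolding J by (simp del: ennreal_plus)
  qed
  finally show ?thesis by (simp add: ennreal_le_iff C_def)
qed

text \<open>Density extends the rate to H1. The constant 32 is 4 from two triangle inequalities, 4
  from the C1 case and 2 from replacing the gradient of \<open>w\<close> by that of
  \<open>u\<close>.\<close>

lemma avg_approx:
  assumes wg: "weak_grad T u ux uy" and e: "0 < e" "e \<le> 1/2"
  shows "sqd T (avg e u) u \<le> 32 * (e * diam)\<^sup>2 * (ip T ux ux + ip T uy uy)"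
proof (rule field_le_epsilon)
  fix r :: real assume "r > 0"
  have L: "L2 T u" "L2 T ux" "L2 T uy" using wg by (auto simp: weak_grad_def)
  define c where "c = (e * diam)\<^sup>2"
  have "0 \<le> c" by (simp add: c_def)
  \<comment> \<open>The errors caused by the distance from \<open>u\<close> to \<open>w\<close> add
    up to \<open>(12 + 32 * c) * q\<close>: 8 + 4 from the values, 32 c from the gradients.\<close>
  define q where "q = r / (12 + 32 * c)"
  have q: "q > 0" "(12 + 32 * c) * q = r" using \<open>r > 0\<close> \<open>0 \<le> c\<close> by (auto simp: q_def)
  obtain w wx wy where w: "C1_fun w wx wy" "h1dist2 T u ux uy w wx wy < q"
    using C1_dense[OF wg q(1)] by blast
  note Lw = L2_C1[OF w(1)]
  have e1: "e < 1" using e by simp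
  note La = L2_avg[OF e(1) e1 L(1)] L2_avg[OF e(1) e1 Lw(1)]
  have close: "sqd T u w < q" "sqd T ux wx < q"
    "sqd T uy wy < q"
    "sqd T ux wx + sqd T uy wy < q"
    using w(2) ip_nonneg[of T "\<lambda>z. u z - w z"] ip_nonneg[of T "\<lambda>z. ux z - wx z"] ip_nonneg[of T "\<lambda>z. uy z - wy z"]
    unfolding h1dist2_def by linarith+
  have gx: "ip T wx wx \<le> 2 * ip T ux ux + 2 * sqd T ux wx"
    using ip_diff_triangle[OF Lw(2) L(2) L2_zero] ip_diff_commute[of T wx ux] by simp
  have gy: "ip T wy wy \<le> 2 * ip T uy uy + 2 * sqd T uy wy"
    using ip_diff_triangle[OF Lw(3) L(3) L2_zero] ip_diff_commute[of T wy uy] by simp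
  have "sqd T (avg e u) u
      \<le> 2 * sqd T (avg e u) (avg e w)
       + 2 * sqd T (avg e w) u"
    by (intro ip_diff_triangle L La)
  also have "sqd T (avg e u) (avg e w) \<le> 4 * sqd T u w"
    using avg_bound[OF e L2_diff[OF L(1) Lw(1)]] by (simp add: avg_diff[OF L(1) Lw(1), abs_def])
  also have "sqd T (avg e w) u
      \<le> 2 * sqd T (avg e w) w + 2 * sqd T w u"
    by (intro ip_diff_triangle L Lw La)
  also have "sqd T w u = sqd T u w" by (rule ip_diff_commute)
  also have "sqd T (avg e w) w \<le> 4 * c * (ip T wx wx + ip T wy wy)"
    unfolding c_def by (rule avg_approx_C1[OF w(1) e])
  also have "4 * c * (ip T wx wx + ip T wy wy) \<le> 4 * c * (2 * (ip T ux ux + ip T uy uy) + 2 * q)"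
    using gx gy close \<open>0 \<le> c\<close> by (intro mult_left_mono) auto
  finally have "sqd T (avg e u) u
     \<le> 12 * sqd T u w + 32 * c * (ip T ux ux + ip T uy uy) + 32 * c * q"
    using mult_nonneg_nonneg[OF \<open>0 \<le> c\<close> less_imp_le[OF q(1)]]
      mult_nonneg_nonneg[OF \<open>0 \<le> c\<close> add_nonneg_nonneg[OF ip_nonneg[of T ux] ip_nonneg[of T uy]]]
    by (simp add: algebra_simps)
  also have "\<dots> \<le> 32 * c * (ip T ux ux + ip T uy uy) + (12 + 32 * c) * q"
    using close(1) by (simp add: algebra_simps)
  finally show "sqd T (avg e u) u \<le> 32 * (e * diam)\<^sup>2 * (ip T ux ux + ip T uy uy) + r"
    using q(2) by (simp add: c_def)
qed

text \<open>At \<open>e = 1/2\<close> the rate estimate says that \<open>u\<close> equals its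
  average almost everywhere, and this average is a C1 function with zero gradient on a convex
  set.\<close>

lemma zero_gradient_const:
  assumes wg: "weak_grad T u ux uy" and "ip T ux ux = 0" "ip T uy uy = 0"
  shows "\<exists>c. ip T (\<lambda>z. u z - c) (\<lambda>z. u z - c) = 0"
proof -
  have L: "L2 T u" "L2 T ux" "L2 T uy" using wg by (auto simp: weak_grad_def)
  let ?e = "1/2 :: real"
  have "sqd T (avg ?e u) u \<le> 0"
    using avg_approx[OF wg, of ?e] assms by simp
  then have 0: "sqd T (avg ?e u) u = 0" using ip_nonneg by (metis antisym)
  have "\<exists>c. \<forall>z\<in>T. avg ?e u z = c"
  proof (rule has_derivative_zero_constant[OF convex_T])
    fix z assume z: "z \<in> T"
    have "avg ?e ux z = 0" "avg ?e uy z = 0"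
      using ip_Cauchy_Schwarz[OF L(2) L2_kap, of ?e z] ip_Cauchy_Schwarz[OF L(3) L2_kap, of ?e z] assms
      by (auto simp: avg_def)
    then have "avg_grad kx ?e u z = 0" "avg_grad ky ?e u z = 0"
      using avg_weak_grad[OF wg z, of ?e] by auto
    moreover have "(avg ?e u has_derivative (\<lambda>h. avg_grad kx ?e u z * fst h + avg_grad ky ?e u z * snd h)) (at z)"
    proof -
      have "C1_fun (avg ?e u) (avg_grad kx ?e u) (avg_grad ky ?e u)" by (rule avg_C1) (auto intro: L)
      then show ?thesis unfolding C1_fun_def by blast
    qed
    ultimately show "(avg ?e u has_derivative (\<lambda>h. 0)) (at z within T)" by (simp add: has_derivative_at_withinI)
  qed
  then obtain c where c: "\<forall>z\<in>T. avg ?e u z = c" by blast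
  have "sqd T (avg ?e u) u = ip T (\<lambda>z. c - u z) (\<lambda>z. c - u z)"
    unfolding ip_def by (rule Bochner_Integration.integral_cong) (use c in auto)
  then show ?thesis using 0 ip_diff_commute[of T u "\<lambda>_. c"] by auto
qed

section \<open>Rellich compactness\<close>

lemma avg_lipschitz:
  assumes e: "0 < e" "e < 1" and f: "L2 T f"
  shows "(avg e f z - avg e f z')\<^sup>2 \<le> ip T f f * ((2 * bnd / e ^ 3) * norm (z - z'))\<^sup>2 * measure lebesgue T"
proof -
  define d where "d \<zeta> = kap e z \<zeta> - kap e z' \<zeta>" for \<zeta>
  have Ld: "L2 T d" unfolding d_def by (intro L2_diff L2_kap)
  have db: "\<bar>d \<zeta>\<bar> \<le> (2 * bnd / e ^ 3) * norm (z - z')" for \<zeta>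
  proof -
    have "arg e z \<zeta> - arg e z' \<zeta> = (- ((1 - e) / e)) *\<^sub>R (z - z')"
      by (simp add: arg_def scaleR_right_diff_distrib)
    then have "norm (arg e z \<zeta> - arg e z' \<zeta>) = ((1 - e) / e) * norm (z - z')" using e by simp
    also have "\<dots> \<le> (1 / e) * norm (z - z')" using e by (intro mult_right_mono divide_right_mono) auto
    finally have "norm (arg e z \<zeta> - arg e z' \<zeta>) \<le> (1 / e) * norm (z - z')" .
    then have "2 * bnd * norm (arg e z \<zeta> - arg e z' \<zeta>) \<le> 2 * bnd * ((1 / e) * norm (z - z'))"
      using bnd(1) by (intro mult_left_mono) auto
    with k_lipschitz[of "arg e z \<zeta>" "arg e z' \<zeta>"]
    have "\<bar>k (arg e z \<zeta>) - k (arg e z' \<zeta>)\<bar> \<le> 2 * bnd * ((1 / e) * norm (z - z'))" by linarith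
    then have "\<bar>k (arg e z \<zeta>) - k (arg e z' \<zeta>)\<bar> / e\<^sup>2 \<le> 2 * bnd * ((1 / e) * norm (z - z')) / e\<^sup>2"
      by (intro divide_right_mono) auto
    moreover have "\<bar>d \<zeta>\<bar> = \<bar>k (arg e z \<zeta>) - k (arg e z' \<zeta>)\<bar> / e\<^sup>2"
      by (simp add: d_def kap_def flip: diff_divide_distrib)
    ultimately show ?thesis by (simp add: power2_eq_square power3_eq_cube mult.assoc)
  qed
  have "avg e f z - avg e f z' = ip T f d"
    unfolding avg_def d_def using f L2_kap by (simp add: ip_diff_right)
  then have "(avg e f z - avg e f z')\<^sup>2 \<le> ip T f f * ip T d d" using ip_Cauchy_Schwarz[OF f Ld] by simp
  also have "ip T d d \<le> ((2 * bnd / e ^ 3) * norm (z - z'))\<^sup>2 * measure lebesgue T"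
    using ip_le_bound[OF compact_T Ld Ld db db] by (simp add: power2_eq_square)
  finally show ?thesis by (simp add: mult_left_mono mult.assoc)
qed

lemma avg_sup_bound:
  assumes f: "L2 T f"
  shows "(avg e f z)\<^sup>2 \<le> ip T f f * (bnd / e\<^sup>2)\<^sup>2 * measure lebesgue T"
proof -
  have "(avg e f z)\<^sup>2 \<le> ip T f f * ip T (kap e z) (kap e z)"
    unfolding avg_def by (rule ip_Cauchy_Schwarz[OF f L2_kap])
  also have "ip T (kap e z) (kap e z) \<le> (bnd / e\<^sup>2)\<^sup>2 * measure lebesgue T"
    using ip_le_bound[OF compact_T L2_kap L2_kap kap_bound kap_bound, of e z e z] by (simp add: power2_eq_square)
  finally show ?thesis by (simp add: mult_left_mono mult.assoc)
qed

text \<open>For fixed \<open>e\<close> the averages of an L2-bounded sequence are uniformly bounded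
  and equi-Lipschitz, so Arzela-Ascoli applies; dropping finitely many terms leaves all pairs within
  \<open>r\<close>.\<close>

lemma avg_compact:
  assumes e: "0 < e" "e < 1" and f: "\<And>n. L2 T (f n)" "\<And>n. ip T (f n) (f n) \<le> C" and "r > 0"
  shows "\<exists>s. strict_mono (s :: nat \<Rightarrow> nat) \<and> (\<forall>m n. \<forall>z\<in>T. \<bar>avg e (f (s m)) z - avg e (f (s n)) z\<bar> \<le> r)"
proof -
  define \<mu> where "\<mu> = measure lebesgue T"
  have C: "0 \<le> C" using f(2)[of 0] ip_nonneg[of T "f 0"] by linarith
  have mu: "0 \<le> \<mu>" by (simp add: \<mu>_def)
  define K where "K = sqrt (C * (2 * bnd / e ^ 3)\<^sup>2 * \<mu>)"
  have K: "0 \<le> K" using C mu by (simp add: K_def)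
  have lip: "\<bar>avg e (f n) z - avg e (f n) z'\<bar> \<le> K * norm (z - z')" for n z z'
  proof -
    have "(avg e (f n) z - avg e (f n) z')\<^sup>2 \<le> ip T (f n) (f n) * ((2 * bnd / e ^ 3) * norm (z - z'))\<^sup>2 * \<mu>"
      unfolding \<mu>_def by (rule avg_lipschitz[OF e f(1)])
    also have "\<dots> \<le> C * ((2 * bnd / e ^ 3) * norm (z - z'))\<^sup>2 * \<mu>"
      using f(2) mu by (intro mult_right_mono) auto
    also have "\<dots> = (C * (2 * bnd / e ^ 3)\<^sup>2 * \<mu>) * (norm (z - z'))\<^sup>2"
      by (simp only: power_mult_distrib mult_ac)
    also have "\<dots> = (K * norm (z - z'))\<^sup>2" using C mu by (simp add: K_def power_mult_distrib)
    finally show ?thesis using K by (metis abs_le_square_iff abs_of_nonneg mult_nonneg_nonneg norm_ge_zero)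
  qed
  define B where "B = sqrt (C * (bnd / e\<^sup>2)\<^sup>2 * \<mu>)"
  have B: "0 \<le> B" using C mu by (simp add: B_def)
  have bound: "\<bar>avg e (f n) z\<bar> \<le> B" for n z
  proof -
    have "(avg e (f n) z)\<^sup>2 \<le> ip T (f n) (f n) * (bnd / e\<^sup>2)\<^sup>2 * \<mu>"
      unfolding \<mu>_def by (rule avg_sup_bound[OF f(1)])
    also have "\<dots> \<le> C * (bnd / e\<^sup>2)\<^sup>2 * \<mu>" using f(2) mu by (intro mult_right_mono) auto
    also have "\<dots> = B\<^sup>2" using C mu by (simp add: B_def)
    finally show ?thesis using B by (metis abs_le_square_iff abs_of_nonneg)
  qed
  obtain g s where gs: "strict_mono (s :: nat \<Rightarrow> nat)"
    "\<And>d. 0 < d \<Longrightarrow> \<exists>N. \<forall>n z. n \<ge> N \<and> z \<in> T \<longrightarrow> norm (avg e (f (s n)) z - g z) < d"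
  proof (rule Arzela_Ascoli[OF compact_T, of "\<lambda>n. avg e (f n)" B])
    show "norm (avg e (f n) z) \<le> B" for n z using bound by simp
    show "\<exists>d>0. \<forall>n y. y \<in> T \<and> norm (x - y) < d \<longrightarrow> norm (avg e (f n) x - avg e (f n) y) < \<epsilon>"
      if "x \<in> T" "0 < \<epsilon>" for x \<epsilon>
    proof (intro exI[of _ "\<epsilon> / (K + 1)"] conjI allI impI)
      show "0 < \<epsilon> / (K + 1)" using that K by simp
      fix n y assume y: "y \<in> T \<and> norm (x - y) < \<epsilon> / (K + 1)"
      have "norm (avg e (f n) x - avg e (f n) y) \<le> (K + 1) * norm (x - y)"
        using lip[of n x y] norm_ge_zero[of "x - y"] unfolding distrib_right mult_1 real_norm_def by linarith
      also have "\<dots> < \<epsilon>" using y K by (simp add: field_simps)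
      finally show "norm (avg e (f n) x - avg e (f n) y) < \<epsilon>" .
    qed
  qed blast
  obtain N where N: "\<And>n z. n \<ge> N \<Longrightarrow> z \<in> T \<Longrightarrow> norm (avg e (f (s n)) z - g z) < r / 2"
    using gs(2)[of "r/2"] \<open>r > 0\<close> by auto
  have "\<bar>avg e (f (s (m + N))) z - avg e (f (s (n + N))) z\<bar> \<le> r" if "z \<in> T" for m n z
    using N[OF le_add2 that, of m] N[OF le_add2 that, of n] unfolding real_norm_def by linarith
  moreover have "strict_mono (\<lambda>n. s (n + N))" using gs(1) by (simp add: strict_mono_def)
  ultimately show ?thesis by (intro exI[of _ "\<lambda>n. s (n + N)"]) auto
qed

text \<open>The rate estimate is uniform in \<open>n\<close>: for one small \<open>e\<close> all
  functions are close to their averages, and these have a nearly constant subsequence. The triangle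
  inequalities sum to 10 r/16.\<close>

lemma rellich_step:
  assumes wg: "\<And>n. weak_grad T (u n) (ux n) (uy n)"
    and C: "\<And>n. ip T (u n) (u n) + ip T (ux n) (ux n) + ip T (uy n) (uy n) \<le> C" and "r > 0"
  shows "\<exists>s. strict_mono (s :: nat \<Rightarrow> nat) \<and>
    (\<forall>m n. sqd T (u (s m)) (u (s n)) < r)"
proof -
  have L: "L2 T (u n)" for n using wg by (auto simp: weak_grad_def)
  have uC: "ip T (u n) (u n) \<le> C" "ip T (ux n) (ux n) + ip T (uy n) (uy n) \<le> C" for n
    using C[of n] ip_nonneg[of T "u n"] ip_nonneg[of T "ux n"] ip_nonneg[of T "uy n"] by linarith+
  have C0: "0 \<le> C" using uC(1)[of 0] ip_nonneg[of T "u 0"] by linarith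
  define D where "D = 32 * diam\<^sup>2 * C + 1"
  have D: "D > 0" using C0 by (simp add: D_def add_nonneg_pos)
  define e where "e = min (1/2) (r / (16 * D))"
  have e: "0 < e" "e \<le> 1/2" "e < 1" using \<open>r > 0\<close> D by (auto simp: e_def min_def)
  have app: "sqd T (avg e (u n)) (u n) \<le> r / 16" for n
  proof -
    have "sqd T (avg e (u n)) (u n) \<le> 32 * (e * diam)\<^sup>2 * (ip T (ux n) (ux n) + ip T (uy n) (uy n))"
      by (rule avg_approx[OF wg e(1,2)])
    also have "\<dots> \<le> 32 * (e * diam)\<^sup>2 * C" using uC by (intro mult_left_mono) auto
    also have "\<dots> = (e * e) * (32 * diam\<^sup>2 * C)" by (simp add: power2_eq_square)
    also have "\<dots> \<le> (1 * (r / (16 * D))) * D"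
      using e C0 D \<open>r > 0\<close> by (intro mult_mono) (auto simp: e_def D_def)
    also have "\<dots> = r / 16" using D by simp
    finally show ?thesis .
  qed
  define \<mu> where "\<mu> = measure lebesgue T + 1"
  have mu: "\<mu> > 0" by (simp add: \<mu>_def add_nonneg_pos)
  define q where "q = sqrt (r / (16 * \<mu>))"
  have q: "q > 0" "q * q = r / (16 * \<mu>)" using mu \<open>r > 0\<close> by (auto simp: q_def)
  from avg_compact[of e u C q, OF e(1,3) L uC(1) q(1)] obtain s :: "nat \<Rightarrow> nat" where s: "strict_mono s"
    "\<And>m n z. z \<in> T \<Longrightarrow> \<bar>avg e (u (s m)) z - avg e (u (s n)) z\<bar> \<le> q" by blast
  have "sqd T (u (s m)) (u (s n)) < r" for m n
  proof -
    note La = L2_avg[OF e(1,3) L]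
    have "sqd T (u (s m)) (u (s n))
      \<le> 2 * sqd T (u (s m)) (avg e (u (s m)))
       + 2 * sqd T (avg e (u (s m))) (u (s n))"
      by (intro ip_diff_triangle L La)
    also have "sqd T (avg e (u (s m))) (u (s n))
      \<le> 2 * sqd T (avg e (u (s m))) (avg e (u (s n)))
       + 2 * sqd T (avg e (u (s n))) (u (s n))"
      by (intro ip_diff_triangle L La)
    also have "sqd T (avg e (u (s m))) (avg e (u (s n)))
       \<le> q * q * measure lebesgue T"
      using ip_le_bound[OF compact_T L2_diff[OF La La] L2_diff[OF La La] s(2)[of _ m n] s(2)[of _ m n]] by simp
    also have "q * q * measure lebesgue T \<le> r / 16"
    proof -
      have "q * q * measure lebesgue T \<le> q * q * \<mu>" by (intro mult_left_mono) (auto simp: \<mu>_def)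
      also have "\<dots> = r / 16" using mu by (simp add: q(2))
      finally show ?thesis .
    qed
    also have "sqd T (u (s m)) (avg e (u (s m)))
       = sqd T (avg e (u (s m))) (u (s m))" by (rule ip_diff_commute)
    finally show ?thesis using app[of "s m"] app[of "s n"] \<open>r > 0\<close> by simp
  qed
  then show ?thesis using s(1) by blast
qed

text \<open>A diagonal sequence over the tolerances \<open>inverse (real (Suc j))\<close>. Property
  \<open>P\<close> bounds all pairs of a subsequence, so further subsequences inherit it, as the
  diagonal construction requires.\<close>

theorem rellich:
  assumes wg: "\<And>n. weak_grad T (u n) (ux n) (uy n)"
    and C: "\<And>n. ip T (u n) (u n) + ip T (ux n) (ux n) + ip T (uy n) (uy n) \<le> C"
  shows "\<exists>s. strict_mono (s :: nat \<Rightarrow> nat) \<and> (\<forall>e>0. \<exists>N. \<forall>m\<ge>N. \<forall>n\<ge>N.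
    sqd T (u (s m)) (u (s n)) < e)"
proof -
  define P where "P j s \<longleftrightarrow> (\<forall>m n. sqd T (u (s m)) (u (s n)) < inverse (real (Suc j)))"
    for j and s :: "nat \<Rightarrow> nat"
  have PD: "sqd T (u (s m)) (u (s n)) < inverse (real (Suc j))"
    if "P j s" for j s m n using that by (simp add: P_def)
  interpret subseqs P
  proof
    fix j and s :: "nat \<Rightarrow> nat" assume "strict_mono s"
    show "\<exists>r'. strict_mono r' \<and> P j (s \<circ> r')"
      using rellich_step[of "\<lambda>n. u (s n)" "\<lambda>n. ux (s n)" "\<lambda>n. uy (s n)" C "inverse (real (Suc j))", OF wg C]
      by (auto simp: P_def)
  qed
  have "\<exists>N. \<forall>m\<ge>N. \<forall>n\<ge>N. sqd T (u (diagseq m)) (u (diagseq n)) < e"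
    if "e > 0" for e :: real
  proof -
    obtain j where j: "inverse (real (Suc j)) < e" using reals_Archimedean[OF \<open>e > 0\<close>] by blast
    have P: "P j (diagseq \<circ> ((+) (Suc j)))" by (rule diagseq_holds) (simp add: P_def)
    have "sqd T (u (diagseq m)) (u (diagseq n)) < e"
      if "m \<ge> Suc j" "n \<ge> Suc j" for m n
    proof -
      have "(diagseq \<circ> ((+) (Suc j))) (m - Suc j) = diagseq m" "(diagseq \<circ> ((+) (Suc j))) (n - Suc j) = diagseq n"
        using that by auto
      then have "sqd T (u (diagseq m)) (u (diagseq n)) < inverse (real (Suc j))"
        using PD[OF P, of "m - Suc j" "n - Suc j"] by (simp only:)
      then show ?thesis using j by linarith
    qed
    then show ?thesis by blast
  qed
  then show ?thesis using subseq_diagseq by blast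
qed

end

section \<open>Test functions\<close>

text \<open>The delicate point is the kink at 0, where the difference quotient is bounded by the
  modulus of the increment.\<close>

lemma has_real_derivative_pos_part_square:
  "((\<lambda>s. (max 0 s)\<^sup>2) has_real_derivative 2 * max 0 s) (at s)" for s :: real
proof -
  consider "s > 0" | "s < 0" | "s = 0" by linarith
  then show ?thesis
  proof cases
    case 1
    have "((\<lambda>s. s\<^sup>2) has_real_derivative 2 * max 0 s) (at s)"
      using 1 by (auto intro!: derivative_eq_intros)
    then show ?thesis
      by (rule has_field_derivative_transform_within_open[of _ _ _ "{0<..}"]) (use 1 in auto)
  next
    case 2
    have "((\<lambda>s. 0) has_real_derivative 2 * max 0 s) (at s)" using 2 by auto
    then show ?thesis
      by (rule has_field_derivative_transform_within_open[of _ _ _ "{..<0}"]) (use 2 in auto)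
  next
    case 3
    have "((\<lambda>h. (max 0 h)\<^sup>2 / h) \<longlongrightarrow> 0) (at (0::real))"
    proof (rule Lim_null_comparison)
      show "\<forall>\<^sub>F h in at 0. norm ((max 0 h)\<^sup>2 / h) \<le> \<bar>h\<bar>"
        by (rule always_eventually) (auto simp: max_def power2_eq_square)
      show "((\<lambda>h::real. \<bar>h\<bar>) \<longlongrightarrow> 0) (at 0)" by (rule tendsto_eq_intros | simp)+
    qed
    then show ?thesis using 3 by (simp add: has_field_derivative_iff)
  qed
qed

text \<open>Squaring the positive part of a concave parabola gives a compactly supported function
  with an elementary derivative and exactly the C1 regularity asked of test functions.\<close>

definition hat :: "real \<Rightarrow> real \<Rightarrow> real \<Rightarrow> real" where
  "hat l r x = (max 0 ((x - l) * (r - x)))\<^sup>2"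

definition hat' :: "real \<Rightarrow> real \<Rightarrow> real \<Rightarrow> real" where
  "hat' l r x = 2 * max 0 ((x - l) * (r - x)) * (l + r - 2 * x)"

lemma hat_deriv: "(hat l r has_real_derivative hat' l r x) (at x)"
proof -
  have "((\<lambda>x. (x - l) * (r - x)) has_real_derivative (l + r - 2 * x)) (at x)"
    by (auto intro!: derivative_eq_intros simp: algebra_simps)
  from DERIV_chain[OF has_real_derivative_pos_part_square this]
  show ?thesis by (simp add: hat_def[abs_def] hat'_def o_def)
qed

lemma hat_zero: "l \<le> r \<Longrightarrow> x \<notin> {l..r} \<Longrightarrow> hat l r x = 0" "l \<le> r \<Longrightarrow> x \<notin> {l..r} \<Longrightarrow> hat' l r x = 0"
proof -
  have "(x - l) * (r - x) \<le> 0" if "l \<le> r" "x \<notin> {l..r}"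
    using that by (auto simp: mult_le_0_iff)
  then show "l \<le> r \<Longrightarrow> x \<notin> {l..r} \<Longrightarrow> hat l r x = 0" "l \<le> r \<Longrightarrow> x \<notin> {l..r} \<Longrightarrow> hat' l r x = 0"
    by (auto simp: hat_def hat'_def max_def)
qed

lemma hat_nonneg: "0 \<le> hat l r x"
  by (simp add: hat_def)

lemma hat_pos: "l < x \<Longrightarrow> x < r \<Longrightarrow> 0 < hat l r x"
  by (simp add: hat_def)

lemma hat_cont: "continuous_on A (hat l r)" "continuous_on A (hat' l r)"
  unfolding hat_def hat'_def by (intro continuous_intros)+

definition bump :: "real \<Rightarrow> real \<Rightarrow> real \<Rightarrow> real \<Rightarrow> pt \<Rightarrow> real" where
  "bump l r m n z = hat l r (fst z) * hat m n (snd z)"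

definition bumpx :: "real \<Rightarrow> real \<Rightarrow> real \<Rightarrow> real \<Rightarrow> pt \<Rightarrow> real" where
  "bumpx l r m n z = hat' l r (fst z) * hat m n (snd z)"

definition bumpy :: "real \<Rightarrow> real \<Rightarrow> real \<Rightarrow> real \<Rightarrow> pt \<Rightarrow> real" where
  "bumpy l r m n z = hat l r (fst z) * hat' m n (snd z)"

lemma C1_bump: "C1_fun (bump l r m n) (bumpx l r m n) (bumpy l r m n)"
  unfolding C1_fun_def
proof (intro conjI allI)
  fix z :: pt
  have 1: "((\<lambda>z. hat l r (fst z)) has_derivative (\<lambda>h. hat' l r (fst z) * fst h)) (at z)"
    using diff_chain_at[of fst fst z "hat l r" "\<lambda>h. hat' l r (fst z) * h"] hat_deriv[of l r "fst z"]
      bounded_linear_imp_has_derivative[OF bounded_linear_fst]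
    by (auto simp: o_def has_field_derivative_def)
  have 2: "((\<lambda>z. hat m n (snd z)) has_derivative (\<lambda>h. hat' m n (snd z) * snd h)) (at z)"
    using diff_chain_at[of snd snd z "hat m n" "\<lambda>h. hat' m n (snd z) * h"] hat_deriv[of m n "snd z"]
      bounded_linear_imp_has_derivative[OF bounded_linear_snd]
    by (auto simp: o_def has_field_derivative_def)
  show "(bump l r m n has_derivative (\<lambda>h. bumpx l r m n z * fst h + bumpy l r m n z * snd h)) (at z)"
    unfolding bump_def[abs_def] bumpx_def bumpy_def
    by (rule has_derivative_eq_rhs[OF has_derivative_mult[OF 1 2]]) (auto simp: algebra_simps)
  show "continuous_on UNIV (bumpx l r m n)" "continuous_on UNIV (bumpy l r m n)"
    unfolding bumpx_def[abs_def] bumpy_def[abs_def]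
    by (intro continuous_intros continuous_on_compose2[OF hat_cont(1)[of UNIV]]
      continuous_on_compose2[OF hat_cont(2)[of UNIV]]; simp)+
qed

lemma bump_zero:
  assumes "l \<le> r" "m \<le> n" "z \<notin> {l..r} \<times> {m..n}"
  shows "bump l r m n z = 0" "bumpx l r m n z = 0" "bumpy l r m n z = 0"
  using assms hat_zero[of l r "fst z"] hat_zero[of m n "snd z"]
  by (cases z; auto simp: bump_def bumpx_def bumpy_def)+

lemma bump_nonneg: "0 \<le> bump l r m n z"
  by (simp add: bump_def hat_nonneg)

text \<open>No value is computed: the integral is finite by compact support and nonzero because the
  function is positive on an open box of positive measure.\<close>

lemma bump_integral:
  assumes "l < r" "m < n"
  shows "\<exists>c>0. (\<integral>\<^sup>+z. ennreal (bump l r m n z) \<partial>lborel) = ennreal c"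
proof -
  let ?S = "{l..r} \<times> {m..n}"
  have cS: "compact ?S" by (intro compact_Times) auto
  have cont: "continuous_on A (bump l r m n)" for A by (rule C1_fun_continuous[OF C1_bump])
  have int: "integrable lborel (bump l r m n)"
  proof -
    have "integrable lborel (\<lambda>z. indicator ?S z *\<^sub>R bump l r m n z)"
      using borel_integrable_compact[OF cS cont] by (simp add: set_integrable_def)
    moreover have "(\<lambda>z. indicator ?S z *\<^sub>R bump l r m n z) = bump l r m n"
    proof
      fix z show "indicator ?S z *\<^sub>R bump l r m n z = bump l r m n z"
        using bump_zero(1)[of l r m n z] assms by (cases "z \<in> ?S") auto
    qed
    ultimately show ?thesis by simp
  qed
  have eq: "(\<integral>\<^sup>+z. ennreal (bump l r m n z) \<partial>lborel) = ennreal (integral\<^sup>L lborel (bump l r m n))"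
    using int bump_nonneg by (intro nn_integral_eq_integral) auto
  have "integral\<^sup>L lborel (bump l r m n) \<noteq> 0"
  proof
    assume "integral\<^sup>L lborel (bump l r m n) = 0"
    then have "AE z in lborel. bump l r m n z = 0"
      using int bump_nonneg by (subst (asm) integral_nonneg_eq_0_iff_AE) auto
    then have "AE z in lborel. z \<notin> box (l, m) (r, n)"
    proof eventually_elim
      fix z assume z: "bump l r m n z = 0"
      show "z \<notin> box (l, m) (r, n)"
      proof
        assume "z \<in> box (l, m) (r, n)"
        then have "l < fst z" "fst z < r" "m < snd z" "snd z < n"
          by (cases z; auto simp: box_def Basis_prod_def)+
        then show False using z hat_pos[of l "fst z" r] hat_pos[of m "snd z" n] by (simp add: bump_def)
      qed
    qed
    then have "emeasure lborel (box (l, m) (r, n)) = 0"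
      by (subst (asm) AE_iff_measurable[of "box (l, m) (r, n)"]) auto
    moreover have "emeasure lborel (box (l, m) (r, n)) = ennreal ((r - l) * (n - m))"
      using assms by (subst emeasure_lborel_box) (auto simp: Basis_prod_def prod.union_disjoint prod.reindex inj_on_def)
    ultimately show False using assms by simp
  qed
  then have "0 < integral\<^sup>L lborel (bump l r m n)"
    using Bochner_Integration.integral_nonneg[of lborel "bump l r m n"] bump_nonneg by (simp add: less_le)
  then show ?thesis using eq by blast
qed

section \<open>The reference triangle\<close>

abbreviation Kref :: "pt \<times> pt \<times> pt" where "Kref \<equiv> ((0, 0), (1, 0), (0, 1))"

abbreviation K :: "pt set" where "K \<equiv> tri Kref"

lemma K_eq: "K = {z. 0 \<le> fst z \<and> 0 \<le> snd z \<and> fst z + snd z \<le> 1}"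
proof (intro set_eqI iffI)
  fix z :: pt assume "z \<in> K"
  then obtain u v w :: real where "0 \<le> u" "0 \<le> v" "0 \<le> w" "u + v + w = 1"
    "z = u *\<^sub>R (0,0) + v *\<^sub>R (1,0) + w *\<^sub>R (0,1)"
    unfolding tri_def convex_hull_3 by auto
  then show "z \<in> {z. 0 \<le> fst z \<and> 0 \<le> snd z \<and> fst z + snd z \<le> 1}" by auto
next
  fix z :: pt assume "z \<in> {z. 0 \<le> fst z \<and> 0 \<le> snd z \<and> fst z + snd z \<le> 1}"
  then show "z \<in> K" unfolding tri_def fst_conv snd_conv convex_hull_3
    by (intro CollectI exI[of _ "1 - fst z - snd z"] exI[of _ "fst z"] exI[of _ "snd z"])
      (auto simp: prod_eq_iff)
qed

lemma compact_tri: "compact (tri V)"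
  unfolding tri_def by (rule compact_convex_hull) auto

lemma convex_tri: "convex (tri V)"
  unfolding tri_def by (rule convex_convex_hull)

lemma rectangle_interior_K:
  assumes "0 < l" "0 < m" "r + n < 1"
  shows "{l..r} \<times> {m..n} \<subseteq> interior K"
proof -
  have "{z. 0 < fst z} \<inter> {z. 0 < snd z} \<inter> {z::pt. fst z + snd z < 1} \<subseteq> interior K"
    by (rule interior_maximal) (auto simp: K_eq intro!: open_Int open_Collect_less continuous_intros)
  then show ?thesis using assms by (force)
qed

definition kcst :: real where
  "kcst = (SOME c. c > 0 \<and> (\<integral>\<^sup>+z. ennreal (bump (1/8) (3/8) (1/8) (3/8) z) \<partial>lborel) = ennreal c)"

lemma kcst: "kcst > 0" "(\<integral>\<^sup>+z. ennreal (bump (1/8) (3/8) (1/8) (3/8) z) \<partial>lborel) = ennreal kcst"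
  using someI_ex[OF bump_integral[of "1/8" "3/8" "1/8" "3/8", unfolded Bex_def]] by (auto simp: kcst_def)

text \<open>The box of side 1/4 lies in the open triangle because 1/8 is positive and 3/8 + 3/8 is
  less than 1.\<close>

interpretation K: averaging K "{1/8..3/8} \<times> {1/8..3/8}"
  "\<lambda>z. bump (1/8) (3/8) (1/8) (3/8) z / kcst" "\<lambda>z. bumpx (1/8) (3/8) (1/8) (3/8) z / kcst"
  "\<lambda>z. bumpy (1/8) (3/8) (1/8) (3/8) z / kcst"
proof
  show "compact K" "convex K" by (rule compact_tri convex_tri)+
  let ?b = "bump (1/8) (3/8) (1/8) (3/8)" and ?bx = "bumpx (1/8) (3/8) (1/8) (3/8)" and ?by = "bumpy (1/8) (3/8) (1/8) (3/8)"
  show "C1_fun (\<lambda>z. ?b z / kcst) (\<lambda>z. ?bx z / kcst) (\<lambda>z. ?by z / kcst)"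
  proof -
    have C: "(?b has_derivative (\<lambda>h. ?bx z * fst h + ?by z * snd h)) (at z)" "continuous_on UNIV ?bx" "continuous_on UNIV ?by" for z
      using C1_bump unfolding C1_fun_def by blast+
    show ?thesis unfolding C1_fun_def
    proof (intro conjI allI)
      fix z
      show "((\<lambda>z. ?b z / kcst) has_derivative (\<lambda>h. ?bx z / kcst * fst h + ?by z / kcst * snd h)) (at z)"
        by (rule has_derivative_eq_rhs[OF has_derivative_mult_left[OF C(1), of "1/kcst", simplified]])
          (auto simp: fun_eq_iff add_divide_distrib)
    qed (use C kcst(1) in \<open>auto intro!: continuous_intros\<close>)
  qed
  show "(\<integral>\<^sup>+z. ennreal (?b z / kcst) \<partial>lborel) = 1"
  proof -
    have [measurable]: "?b \<in> borel_measurable borel"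
      by (rule borel_measurable_continuous_onI[OF C1_fun_continuous[OF C1_bump]])
    have "(\<integral>\<^sup>+z. ennreal (?b z / kcst) \<partial>lborel) = (\<integral>\<^sup>+z. ennreal (1 / kcst) * ennreal (?b z) \<partial>lborel)"
      using kcst(1) bump_nonneg by (intro nn_integral_cong) (simp add: ennreal_mult[symmetric])
    also have "\<dots> = ennreal (1 / kcst) * ennreal kcst"
      by (subst nn_integral_cmult) (auto simp: kcst(2))
    also have "\<dots> = 1" using kcst(1) by (simp add: ennreal_mult[symmetric])
    finally show ?thesis .
  qed
qed (use kcst(1) bump_nonneg bump_zero rectangle_interior_K in \<open>auto intro!: compact_Times\<close>)

section \<open>Continuously differentiable functions and traces\<close>

lemma C1_grad_outside_support:
  assumes g: "C1_fun g gx gy" and z: "z \<notin> closure {z. g z \<noteq> 0}"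
  shows "gx z = 0" "gy z = 0"
proof -
  have "((\<lambda>z. 0) has_derivative (\<lambda>h. gx z * fst h + gy z * snd h)) (at z)"
  proof (rule has_derivative_transform_within_open)
    show "(g has_derivative (\<lambda>h. gx z * fst h + gy z * snd h)) (at z)" using g unfolding C1_fun_def by blast
    show "open (- closure {z. g z \<noteq> 0})" by (intro open_Compl closed_closure)
    show "z \<in> - closure {z. g z \<noteq> 0}" using z by simp
    show "g x = 0" if "x \<in> - closure {z. g z \<noteq> 0}" for x using that closure_subset[of "{z. g z \<noteq> 0}"] by auto
  qed
  then have "(\<lambda>h. gx z * fst h + gy z * snd h) = (\<lambda>h. 0)"
    by (rule has_derivative_unique) (rule has_derivative_const)
  then have "gx z * fst h + gy z * snd h = 0" for h by metis
  from this[of "(1, 0)"] this[of "(0, 1)"] show "gx z = 0" "gy z = 0" by auto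
qed

lemma C1_fun_mult:
  assumes "C1_fun f fx fy" "C1_fun g gx gy"
  shows "C1_fun (\<lambda>z. f z * g z) (\<lambda>z. fx z * g z + f z * gx z) (\<lambda>z. fy z * g z + f z * gy z)"
  unfolding C1_fun_def
proof (intro conjI allI)
  fix z
  have "(f has_derivative (\<lambda>h. fx z * fst h + fy z * snd h)) (at z)"
    "(g has_derivative (\<lambda>h. gx z * fst h + gy z * snd h)) (at z)" using assms unfolding C1_fun_def by blast+
  from has_derivative_mult[OF this]
  show "((\<lambda>z. f z * g z) has_derivative (\<lambda>h. (fx z * g z + f z * gx z) * fst h + (fy z * g z + f z * gy z) * snd h)) (at z)"
    by (rule has_derivative_eq_rhs) (auto simp: algebra_simps)
  have "continuous_on UNIV f" "continuous_on UNIV g" using assms by (auto intro: C1_fun_continuous)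
  then show "continuous_on UNIV (\<lambda>z. fx z * g z + f z * gx z)" "continuous_on UNIV (\<lambda>z. fy z * g z + f z * gy z)"
    using assms by (auto simp: C1_fun_def intro!: continuous_intros)
qed

section \<open>Integration by parts for C1 functions\<close>

lemma integrable_compact_support:
  fixes f :: "pt \<Rightarrow> real"
  assumes "continuous_on UNIV f" "compact Q" "\<And>z. z \<notin> Q \<Longrightarrow> f z = 0"
  shows "integrable lborel f"
proof -
  have "integrable lborel (\<lambda>z. indicator Q z *\<^sub>R f z)"
    using borel_integrable_compact[OF assms(2) continuous_on_subset[OF assms(1)]] by (simp add: set_integrable_def)
  moreover have "(\<lambda>z. indicator Q z *\<^sub>R f z) = f" using assms(3) by (auto simp: fun_eq_iff indicator_def)
  ultimately show ?thesis by simp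
qed

lemma FTC_compact_support:
  fixes p p' :: "real \<Rightarrow> real"
  assumes "\<And>t. (p has_real_derivative p' t) (at t)" "continuous_on UNIV p'" "0 \<le> B"
    and "\<And>t. B \<le> \<bar>t\<bar> \<Longrightarrow> p t = 0" "\<And>t. B \<le> \<bar>t\<bar> \<Longrightarrow> p' t = 0"
  shows "(\<integral>t. p' t \<partial>lborel) = 0"
proof -
  have "has_bochner_integral lborel (\<lambda>t. p' t * indicator {- B..B} t) (p B - p (- B))"
    using assms by (intro has_bochner_integral_FTC_Icc_real) (auto simp: continuous_on_eq_continuous_at)
  moreover have "(\<lambda>t. p' t * indicator {- B..B} t) = p'"
  proof
    fix t show "p' t * indicator {- B..B} t = p' t"
      using assms(5)[of t] by (cases "t \<in> {- B..B}") auto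
  qed
  ultimately show ?thesis using assms(3,4) by (simp add: has_bochner_integral_iff)
qed

text \<open>Fubini and the one-dimensional fundamental theorem on each line parallel to an axis;
  beyond the bound \<open>B\<close> everything vanishes.\<close>

lemma integral_partial_zero:
  assumes g: "C1_fun g gx gy" and Q: "compact Q" "closure {z. g z \<noteq> 0} \<subseteq> Q"
  shows "(\<integral>z. gx z \<partial>lborel) = 0" "(\<integral>z. gy z \<partial>lborel) = 0"
proof -
  obtain B0 where B0: "\<And>z. z \<in> Q \<Longrightarrow> norm z \<le> B0" using compact_imp_bounded[OF Q(1)] by (auto simp: bounded_iff)
  define B where "B = \<bar>B0\<bar> + 1"
  have B0': "0 \<le> B" by (simp add: B_def)
  have B: "norm z < B" if "z \<in> Q" for z using B0[OF that] by (simp add: B_def)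
  have out: "g z = 0" "gx z = 0" "gy z = 0" if "z \<notin> Q" for z
    using that Q(2) closure_subset[of "{z. g z \<noteq> 0}"] C1_grad_outside_support[OF g, of z] by auto
  have outx: "(t, y) \<notin> Q" "(y, t) \<notin> Q" if "B \<le> \<bar>t\<bar>" for t y
    using B[of "(t, y)"] B[of "(y, t)"] norm_fst_le[of t y] norm_snd_le[of t y] that by fastforce+
  have c: "continuous_on UNIV gx" "continuous_on UNIV gy" using g by (auto simp: C1_fun_def)
  have ix: "integrable (lborel \<Otimes>\<^sub>M lborel) (\<lambda>(x, y). gx (x, y))" "integrable (lborel \<Otimes>\<^sub>M lborel) (\<lambda>(x, y). gy (x, y))"
    using integrable_compact_support[OF c(1) Q(1) out(2)] integrable_compact_support[OF c(2) Q(1) out(3)]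
    by (simp_all add: lborel_prod)
  have x0: "(\<integral>x. gx (x, y) \<partial>lborel) = 0" for y
  proof (rule FTC_compact_support[of "\<lambda>x. g (x, y)" _ B])
    show "((\<lambda>x. g (x, y)) has_real_derivative gx (t, y)) (at t)" for t
      using C1_fun_line_derivative[OF g, of "(0, y)" "(1, 0)" t] by simp
    show "continuous_on UNIV (\<lambda>t. gx (t, y))"
      using C1_fun_line_continuous(1)[OF g, of UNIV "(0, y)" "(1, 0)"] by simp
  qed (use B0' outx out in auto)
  have y0: "(\<integral>y. gy (x, y) \<partial>lborel) = 0" for x
  proof (rule FTC_compact_support[of "\<lambda>y. g (x, y)" _ B])
    show "((\<lambda>y. g (x, y)) has_real_derivative gy (x, t)) (at t)" for t
      using C1_fun_line_derivative[OF g, of "(x, 0)" "(0, 1)" t] by simp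
    show "continuous_on UNIV (\<lambda>t. gy (x, t))"
      using C1_fun_line_continuous(2)[OF g, of UNIV "(x, 0)" "(0, 1)"] by simp
  qed (use B0' outx out in auto)
  show "(\<integral>z. gx z \<partial>lborel) = 0"
    using lborel_pair.integral_snd[OF ix(1)] by (simp add: x0 lborel_prod)
  show "(\<integral>z. gy z \<partial>lborel) = 0"
    using lborel_pair.integral_fst[OF ix(2)] by (simp add: y0 lborel_prod)
qed

lemma integral_lebesgue_on_borel:
  fixes f :: "pt \<Rightarrow> real"
  assumes [measurable]: "f \<in> borel_measurable borel" "T \<in> sets borel"
  shows "(\<integral>z. f z \<partial>lebesgue_on T) = (\<integral>z. indicator T z * f z \<partial>lborel)"
proof -
  have "(\<integral>z. f z \<partial>lebesgue_on T) = (\<integral>z. indicator T z *\<^sub>R f z \<partial>lebesgue)"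
    by (rule integral_restrict_space) auto
  also have "\<dots> = (\<integral>z. indicator T z *\<^sub>R f z \<partial>lborel)"
    by (rule integral_completion) measurable
  finally show ?thesis by simp
qed

text \<open>The product of \<open>w\<close> with a test function is C1 on the whole plane with
  compact support inside \<open>T\<close>, so its partial derivatives have integral zero; the
  product rule turns this into integration by parts.\<close>

lemma C1_weak_grad:
  assumes "compact T" and w: "C1_fun w wx wy"
  shows "weak_grad T w wx wy"
  unfolding weak_grad_def
proof (intro conjI allI impI)
  have cw: "continuous_on A w" "continuous_on UNIV wx" "continuous_on UNIV wy" for A
    using w C1_fun_continuous[OF w] by (auto simp: C1_fun_def)
  then show L: "L2 T w" "L2 T wx" "L2 T wy"
    using \<open>compact T\<close> by (auto intro!: L2_continuous elim: continuous_on_subset)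
  fix \<phi> \<phi>x \<phi>y
  assume "C1_fun \<phi> \<phi>x \<phi>y \<and> compact (closure {z. \<phi> z \<noteq> 0}) \<and> closure {z. \<phi> z \<noteq> 0} \<subseteq> interior T"
  then have \<phi>: "C1_fun \<phi> \<phi>x \<phi>y" and cpt: "compact (closure {z. \<phi> z \<noteq> 0})" and supp: "closure {z. \<phi> z \<noteq> 0} \<subseteq> interior T"
    by auto
  have c\<phi>: "continuous_on A \<phi>" "continuous_on UNIV \<phi>x" "continuous_on UNIV \<phi>y" for A
    using \<phi> C1_fun_continuous[OF \<phi>] by (auto simp: C1_fun_def)
  then have L\<phi>: "L2 T \<phi>" "L2 T \<phi>x" "L2 T \<phi>y"
    using \<open>compact T\<close> by (auto intro!: L2_continuous elim: continuous_on_subset)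
  have [measurable]: "T \<in> sets borel" using \<open>compact T\<close> by (rule borel_compact)
  note C1 = C1_fun_mult[OF w \<phi>]
  have "{z. w z * \<phi> z \<noteq> 0} \<subseteq> {z. \<phi> z \<noteq> 0}" by auto
  then have sub: "closure {z. w z * \<phi> z \<noteq> 0} \<subseteq> closure {z. \<phi> z \<noteq> 0}" by (rule closure_mono)
  have out: "\<phi> z = 0" "\<phi>x z = 0" "\<phi>y z = 0" if "z \<notin> T" for z
    using that supp interior_subset[of T] closure_subset[of "{z. \<phi> z \<noteq> 0}"] C1_grad_outside_support[OF \<phi>, of z] by auto
  have ext: "(\<integral>z. h z \<partial>lebesgue_on T) = (\<integral>z. h z \<partial>lborel)"
    if "continuous_on UNIV h" "\<And>z. z \<notin> T \<Longrightarrow> h z = 0" for h :: "pt \<Rightarrow> real"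
  proof -
    have "(\<lambda>z. indicator T z * h z) = h" using that(2) by (auto simp: fun_eq_iff indicator_def)
    then show ?thesis using integral_lebesgue_on_borel[of h T] borel_measurable_continuous_onI[OF that(1)] by simp
  qed
  have "ip T wx \<phi> + ip T w \<phi>x = (\<integral>z. wx z * \<phi> z + w z * \<phi>x z \<partial>lebesgue_on T)"
    using L2_mult_integrable[OF L(2) L\<phi>(1)] L2_mult_integrable[OF L(1) L\<phi>(2)] by (simp add: ip_def)
  also have "\<dots> = (\<integral>z. wx z * \<phi> z + w z * \<phi>x z \<partial>lborel)"
    using cw c\<phi> out by (intro ext) (auto intro!: continuous_intros)
  also have "\<dots> = 0" by (rule integral_partial_zero(1)[OF C1 cpt sub])
  finally show "ip T w \<phi>x = - ip T wx \<phi>" by simp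
  have "ip T wy \<phi> + ip T w \<phi>y = (\<integral>z. wy z * \<phi> z + w z * \<phi>y z \<partial>lebesgue_on T)"
    using L2_mult_integrable[OF L(3) L\<phi>(1)] L2_mult_integrable[OF L(1) L\<phi>(3)] by (simp add: ip_def)
  also have "\<dots> = (\<integral>z. wy z * \<phi> z + w z * \<phi>y z \<partial>lborel)"
    using cw c\<phi> out by (intro ext) (auto intro!: continuous_intros)
  also have "\<dots> = 0" by (rule integral_partial_zero(2)[OF C1 cpt sub])
  finally show "ip T w \<phi>y = - ip T wy \<phi>" by simp
qed

section \<open>Trace inequality on the three edges\<close>

definition cyc :: "pt \<Rightarrow> pt" where
  "cyc z = (1 - fst z - snd z, fst z)"

lemma cyc_measurable [measurable]: "cyc \<in> borel_measurable borel"
  by (intro borel_measurable_continuous_onI) (auto simp: cyc_def[abs_def] intro!: continuous_intros)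

text \<open>The affine map \<open>cyc\<close> permutes the vertices, (0,0) to (1,0) to (0,1) to
  (0,0), and has determinant 1; it serves to reduce every edge to the bottom one. Invariance of area
  is a reflection with translation in one variable followed by an exchange of the variables.\<close>

lemma nn_integral_cyc:
  fixes f :: "pt \<Rightarrow> ennreal"
  assumes [measurable]: "f \<in> borel_measurable borel"
  shows "(\<integral>\<^sup>+z. f (cyc z) \<partial>lborel) = (\<integral>\<^sup>+z. f z \<partial>lborel)"
proof -
  have fm[measurable]: "f \<in> borel_measurable (borel \<Otimes>\<^sub>M borel)" using assms by (simp only: borel_prod)
  have gm: "(\<lambda>z. f (cyc z)) \<in> borel_measurable (lborel \<Otimes>\<^sub>M lborel)" by (simp add: lborel_prod)
  have fm': "f \<in> borel_measurable (lborel \<Otimes>\<^sub>M lborel)" by (simp add: lborel_prod)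
  have "(\<integral>\<^sup>+z. f (cyc z) \<partial>lborel) = (\<integral>\<^sup>+z. f (cyc z) \<partial>(lborel \<Otimes>\<^sub>M lborel))" by (simp only: lborel_prod)
  also have "\<dots> = (\<integral>\<^sup>+x. \<integral>\<^sup>+y. f (1 - x - y, x) \<partial>lborel \<partial>lborel)"
    using lborel.nn_integral_fst[OF gm] by (simp add: cyc_def)
  also have "\<dots> = (\<integral>\<^sup>+x. \<integral>\<^sup>+y. f (y, x) \<partial>lborel \<partial>lborel)"
  proof (rule nn_integral_cong)
    fix x :: real
    have "(\<integral>\<^sup>+y. f (y, x) \<partial>lborel) = ennreal \<bar>- 1\<bar> * (\<integral>\<^sup>+y. f ((1 - x) + (- 1) * y, x) \<partial>lborel)"
      by (rule nn_integral_real_affine) measurable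
    then show "(\<integral>\<^sup>+y. f (1 - x - y, x) \<partial>lborel) = (\<integral>\<^sup>+y. f (y, x) \<partial>lborel)" by simp
  qed
  also have "\<dots> = (\<integral>\<^sup>+z. f z \<partial>(lborel \<Otimes>\<^sub>M lborel))"
    by (rule lborel_pair.nn_integral_snd[OF fm'])
  finally show ?thesis by (simp only: lborel_prod)
qed

lemma distr_cyc: "distr lborel borel cyc = lborel"
proof (rule measure_eqI)
  fix A assume "A \<in> sets (distr lborel borel cyc)"
  then have [measurable]: "A \<in> sets borel" by simp
  have "emeasure (distr lborel borel cyc) A = (\<integral>\<^sup>+z. indicator A z \<partial>distr lborel borel cyc)" by simp
  also have "\<dots> = (\<integral>\<^sup>+z. indicator A (cyc z) \<partial>lborel)" by (rule nn_integral_distr) measurable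
  also have "\<dots> = emeasure lborel A" by (subst nn_integral_cyc) auto
  finally show "emeasure (distr lborel borel cyc) A = emeasure lborel A" .
qed simp

lemma K_borel [measurable]: "K \<in> sets borel"
  by (rule borel_compact[OF compact_tri])

lemma ip_cyc:
  assumes "continuous_on UNIV f" "continuous_on UNIV g"
  shows "ip K (\<lambda>z. f (cyc z)) (\<lambda>z. g (cyc z)) = ip K f g"
proof -
  have [measurable]: "f \<in> borel_measurable borel" "g \<in> borel_measurable borel"
    using assms by (auto intro: borel_measurable_continuous_onI)
  have ind: "indicator K (cyc z) = (indicator K z :: real)" for z
    by (auto simp: indicator_def K_eq cyc_def)
  have "ip K f g = (\<integral>z. indicator K z * (f z * g z) \<partial>lborel)"
    unfolding ip_def by (rule integral_lebesgue_on_borel) measurable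
  also have "\<dots> = (\<integral>z. indicator K z * (f z * g z) \<partial>(distr lborel borel cyc))" by (simp add: distr_cyc)
  also have "\<dots> = (\<integral>z. indicator K (cyc z) * (f (cyc z) * g (cyc z)) \<partial>lborel)"
    by (rule integral_distr) measurable
  also have "\<dots> = ip K (\<lambda>z. f (cyc z)) (\<lambda>z. g (cyc z))"
    unfolding ip_def ind by (rule integral_lebesgue_on_borel[symmetric]) measurable
  finally show ?thesis by simp
qed

lemma C1_cyc:
  assumes w: "C1_fun w wx wy"
  shows "C1_fun (\<lambda>z. w (cyc z)) (\<lambda>z. wy (cyc z) - wx (cyc z)) (\<lambda>z. - wx (cyc z))"
  unfolding C1_fun_def
proof (intro conjI allI)
  fix z
  have 1: "(cyc has_derivative (\<lambda>h. (- fst h - snd h, fst h))) (at z)"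
    unfolding cyc_def[abs_def] by (auto intro!: derivative_eq_intros)
  have "(w has_derivative (\<lambda>h. wx (cyc z) * fst h + wy (cyc z) * snd h)) (at (cyc z))"
    using w unfolding C1_fun_def by blast
  from diff_chain_at[OF 1 this]
  show "((\<lambda>z. w (cyc z)) has_derivative (\<lambda>h. (wy (cyc z) - wx (cyc z)) * fst h + - wx (cyc z) * snd h)) (at z)"
    unfolding o_def by (rule has_derivative_eq_rhs) (auto simp: algebra_simps)
  have c: "continuous_on UNIV cyc" by (auto simp: cyc_def[abs_def] intro!: continuous_intros)
  have "continuous_on UNIV wx" "continuous_on UNIV wy" using w by (auto simp: C1_fun_def)
  then show "continuous_on UNIV (\<lambda>z. wy (cyc z) - wx (cyc z))" "continuous_on UNIV (\<lambda>z. - wx (cyc z))"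
    by (auto intro!: continuous_intros continuous_on_compose2[OF _ c])
qed

text \<open>The map (x,t) to (x (1 - t), t) collapses the unit square onto the triangle with
  Jacobian \<open>1 - t\<close>. The slice \<open>t = 1\<close>, where the substitution degenerates,
  contributes nothing since the integrand carries that factor.\<close>

lemma nn_integral_duffy_le:
  fixes G :: "pt \<Rightarrow> real"
  assumes [measurable]: "G \<in> borel_measurable borel" and G: "\<And>z. 0 \<le> G z"
  shows "(\<integral>\<^sup>+x. (\<integral>\<^sup>+t. ennreal ((1 - t) * G (x * (1 - t), t)) * indicator {0..1} t \<partial>lborel) * indicator {0..1} x \<partial>lborel)
     \<le> (\<integral>\<^sup>+z. ennreal (G z) * indicator K z \<partial>lborel)"
proof -
  have Gm[measurable]: "G \<in> borel_measurable (borel \<Otimes>\<^sub>M borel)" using assms by (simp only: borel_prod)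
  have "(\<integral>\<^sup>+x. (\<integral>\<^sup>+t. ennreal ((1 - t) * G (x * (1 - t), t)) * indicator {0..1} t \<partial>lborel) * indicator {0..1} x \<partial>lborel)
    = (\<integral>\<^sup>+x. \<integral>\<^sup>+t. ennreal ((1 - t) * G (x * (1 - t), t)) * indicator {0..1} t * indicator {0..1} x \<partial>lborel \<partial>lborel)"
    by (intro nn_integral_cong nn_integral_multc[symmetric]) measurable
  also have "\<dots> = (\<integral>\<^sup>+t. \<integral>\<^sup>+x. ennreal ((1 - t) * G (x * (1 - t), t)) * indicator {0..1} t * indicator {0..1} x \<partial>lborel \<partial>lborel)"
    by (rule lborel_pair.Fubini'[symmetric]) measurable
  also have "\<dots> \<le> (\<integral>\<^sup>+t. \<integral>\<^sup>+x. ennreal (G (x, t)) * indicator K (x, t) \<partial>lborel \<partial>lborel)"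
  proof (rule nn_integral_mono)
    fix t :: real
    show "(\<integral>\<^sup>+x. ennreal ((1 - t) * G (x * (1 - t), t)) * indicator {0..1} t * indicator {0..1} x \<partial>lborel)
      \<le> (\<integral>\<^sup>+x. ennreal (G (x, t)) * indicator K (x, t) \<partial>lborel)"
    proof (cases "0 \<le> t \<and> t < 1")
      case True
      have "(\<integral>\<^sup>+x. ennreal ((1 - t) * G (x * (1 - t), t)) * indicator {0..1} t * indicator {0..1} x \<partial>lborel)
        = (\<integral>\<^sup>+x. ennreal (1 - t) * (ennreal (G (0 + (1 - t) * x, t)) * indicator {0..1} x) \<partial>lborel)"
        using True G by (intro nn_integral_cong) (auto simp: ennreal_mult mult.commute mult.left_commute indicator_def)
      also have "\<dots> = ennreal (1 - t) * (\<integral>\<^sup>+x. ennreal (G (0 + (1 - t) * x, t)) * indicator {0..1} x \<partial>lborel)"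
        by (rule nn_integral_cmult) measurable
      also have "\<dots> \<le> ennreal (1 - t) * (\<integral>\<^sup>+x. ennreal (G (0 + (1 - t) * x, t)) * indicator K (0 + (1 - t) * x, t) \<partial>lborel)"
      proof (rule mult_left_mono, rule nn_integral_mono)
        fix x :: real
        have "(0 + (1 - t) * x, t) \<in> K" if "x \<in> {0..1}"
        proof -
          define y where "y = (1 - t) * x"
          have "y \<le> 1 - t" "0 \<le> y" unfolding y_def using mult_left_mono[of x 1 "1 - t"] that True by auto
          then show ?thesis using True by (simp add: K_eq y_def[symmetric])
        qed
        then show "ennreal (G (0 + (1 - t) * x, t)) * indicator {0..1} x \<le> ennreal (G (0 + (1 - t) * x, t)) * indicator K (0 + (1 - t) * x, t)"
          by (auto simp: indicator_def)
      qed simp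
      also have "\<dots> = (\<integral>\<^sup>+x. ennreal (G (x, t)) * indicator K (x, t) \<partial>lborel)"
      proof -
        have "(\<integral>\<^sup>+x. ennreal (G (x, t)) * indicator K (x, t) \<partial>lborel)
          = \<bar>1 - t\<bar> * (\<integral>\<^sup>+x. ennreal (G (0 + (1 - t) * x, t)) * indicator K (0 + (1 - t) * x, t) \<partial>lborel)"
        proof (rule nn_integral_real_affine)
          have [measurable]: "K \<in> sets (borel \<Otimes>\<^sub>M borel)" using K_borel by (simp only: borel_prod)
          show "(\<lambda>x. ennreal (G (x, t)) * indicator K (x, t)) \<in> borel_measurable borel" by measurable
        qed (use True in simp)
        then show ?thesis using True by simp
      qed
      finally show ?thesis .
    next
      case False
      have "(\<integral>\<^sup>+x. ennreal ((1 - t) * G (x * (1 - t), t)) * indicator {0..1} t * indicator {0..1} x \<partial>lborel) = (\<integral>\<^sup>+x. 0 \<partial>(lborel :: real measure))"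
        using False by (intro nn_integral_cong) (auto simp: indicator_def)
      then show ?thesis by simp
    qed
  qed
  also have "\<dots> = (\<integral>\<^sup>+z. ennreal (G z) * indicator K z \<partial>(lborel \<Otimes>\<^sub>M lborel))"
    by (rule lborel_pair.nn_integral_snd) (simp add: lborel_prod)
  finally show ?thesis by (simp only: lborel_prod)
qed

lemma ennreal_integral_Icc:
  fixes f :: "real \<Rightarrow> real"
  assumes "continuous_on UNIV f" "\<And>t. 0 \<le> f t"
  shows "ennreal (\<integral>t. f t \<partial>lebesgue_on {0..1}) = (\<integral>\<^sup>+t. ennreal (f t) * indicator {0..1} t \<partial>lborel)"
proof -
  have [measurable]: "f \<in> borel_measurable borel" using assms(1) by (rule borel_measurable_continuous_onI)
  have int: "integrable lborel (\<lambda>t. indicator {0..1} t * f t)"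
    using borel_integrable_compact[of "{0..1::real}" f] continuous_on_subset[OF assms(1)] by (simp add: set_integrable_def)
  have "(\<integral>t. f t \<partial>lebesgue_on {0..1}) = (\<integral>t. indicator {0..1} t *\<^sub>R f t \<partial>lebesgue)"
    by (rule integral_restrict_space) auto
  also have "\<dots> = (\<integral>t. indicator {0..1} t * f t \<partial>lborel)"
    by (simp add: integral_completion)
  finally have "ennreal (\<integral>t. f t \<partial>lebesgue_on {0..1}) = (\<integral>\<^sup>+t. ennreal (indicator {0..1} t * f t) \<partial>lborel)"
    using int assms(2) by (simp add: nn_integral_eq_integral)
  also have "\<dots> = (\<integral>\<^sup>+t. ennreal (f t) * indicator {0..1} t \<partial>lborel)"
    by (intro nn_integral_cong) (auto simp: indicator_def)
  finally show ?thesis .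
qed

text \<open>Along the segments joining the bottom edge to the opposite vertex, the weight \<open>(1 - t)\<^sup>2\<close> kills the
  boundary term at the vertex and leaves one factor \<open>1 - t\<close>, the Jacobian of the collapsed coordinates.\<close>

lemma trace_bottom:
  assumes w: "C1_fun w wx wy"
  shows "(\<integral>t. (w (t, 0))\<^sup>2 \<partial>lebesgue_on {0..1}) \<le> 3 * (ip K w w + ip K wx wx + ip K wy wy)"
proof -
  \<comment> \<open>The 3 is 2 from differentiating the weight plus 1 from Young's inequality; each
    2 comes from squaring a sum of two terms in the derivative along the segment, where
    \<open>x\<close> is at most 1.\<close>
  define G where "G z = 3 * (w z)\<^sup>2 + 2 * (wx z)\<^sup>2 + 2 * (wy z)\<^sup>2" for z
  have cw: "continuous_on A w" "continuous_on UNIV wx" "continuous_on UNIV wy" for A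
    using w C1_fun_continuous[OF w] by (auto simp: C1_fun_def)
  have [measurable]: "w \<in> borel_measurable borel" "wx \<in> borel_measurable borel" "wy \<in> borel_measurable borel"
    using cw by (auto intro: borel_measurable_continuous_onI)
  have [measurable]: "G \<in> borel_measurable borel" unfolding G_def by measurable
  have G0: "0 \<le> G z" for z by (simp add: G_def)
  note L = K.L2_C1[OF w]
  have pt: "ennreal ((w (x, 0))\<^sup>2) \<le> (\<integral>\<^sup>+t. ennreal ((1 - t) * G (x * (1 - t), t)) * indicator {0..1} t \<partial>lborel)"
    if x: "x \<in> {0..1}" for x
  proof -
    define c where "c t = w ((x, 0) + t *\<^sub>R (- x, 1))" for t
    define c' where "c' t = wx ((x, 0) + t *\<^sub>R (- x, 1)) * (- x) + wy ((x, 0) + t *\<^sub>R (- x, 1))" for t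
    have path: "(x, 0) + t *\<^sub>R (- x, 1) = (x * (1 - t), t)" for t by (simp add: algebra_simps)
    have cd: "(c has_real_derivative c' t) (at t)" for t
      using C1_fun_line_derivative[OF w, of "(x, 0)" "(- x, 1)" t] by (simp add: c_def[abs_def] c'_def)
    have cc: "continuous_on UNIV c'" unfolding c'_def
      using C1_fun_line_continuous[OF w, of UNIV "(x, 0)" "(- x, 1)"] by (intro continuous_intros) auto
    have cc0: "continuous_on UNIV c" using cd by (meson DERIV_isCont continuous_at_imp_continuous_on)
    define p where "p t = (1 - t)\<^sup>2 * (c t)\<^sup>2" for t
    define p' where "p' t = - 2 * (1 - t) * (c t)\<^sup>2 + (1 - t)\<^sup>2 * (2 * c t * c' t)" for t
    have "(p has_real_derivative p' t) (at t)" for t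
      unfolding p_def[abs_def] p'_def by (auto intro!: derivative_eq_intros cd simp: power2_eq_square algebra_simps)
    moreover have "continuous_on UNIV p'" unfolding p'_def by (intro continuous_intros cc cc0)
    ultimately have "ennreal \<bar>p 1 - p 0\<bar> \<le> (\<integral>\<^sup>+t. ennreal \<bar>p' t\<bar> * indicator {0..1} t \<partial>lborel)"
      by (rule abs_diff_le_nn_integral)
    also have "\<dots> \<le> (\<integral>\<^sup>+t. ennreal ((1 - t) * G (x * (1 - t), t)) * indicator {0..1} t \<partial>lborel)"
    proof (rule nn_integral_mono)
      fix t :: real
      have "\<bar>p' t\<bar> \<le> (1 - t) * G (x * (1 - t), t)" if t: "t \<in> {0..1}"
      proof -
        let ?W = "w (x * (1 - t), t)" and ?X = "wx (x * (1 - t), t)" and ?Y = "wy (x * (1 - t), t)"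
        have c: "c t = ?W" "c' t = ?X * (- x) + ?Y" by (simp_all only: c_def c'_def path)
        have "(c' t)\<^sup>2 \<le> 2 * (x\<^sup>2 * ?X\<^sup>2) + 2 * ?Y\<^sup>2"
          unfolding c using zero_le_power2[of "x * ?X + ?Y"] by (simp add: power2_eq_square algebra_simps)
        also have "x\<^sup>2 * ?X\<^sup>2 \<le> 1 * ?X\<^sup>2" using x by (intro mult_right_mono) (auto simp: power_le_one)
        finally have c'2: "(c' t)\<^sup>2 \<le> 2 * ?X\<^sup>2 + 2 * ?Y\<^sup>2" by simp
        have cc: "\<bar>2 * c t * c' t\<bar> \<le> (c t)\<^sup>2 + (c' t)\<^sup>2"
          using zero_le_power2[of "c t - c' t"] zero_le_power2[of "c t + c' t"]
          by (simp add: abs_le_iff power2_diff power2_sum)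
        have "\<bar>p' t\<bar> \<le> \<bar>- 2 * (1 - t) * (c t)\<^sup>2\<bar> + \<bar>(1 - t)\<^sup>2 * (2 * c t * c' t)\<bar>"
          unfolding p'_def by (rule abs_triangle_ineq)
        also have "\<bar>- 2 * (1 - t) * (c t)\<^sup>2\<bar> = (1 - t) * (2 * (c t)\<^sup>2)" using t by (simp add: abs_mult)
        also have "\<bar>(1 - t)\<^sup>2 * (2 * c t * c' t)\<bar> = (1 - t)\<^sup>2 * \<bar>2 * c t * c' t\<bar>" by (simp add: abs_mult)
        also have "\<dots> \<le> (1 - t) * ((c t)\<^sup>2 + (c' t)\<^sup>2)"
          using t cc by (intro mult_mono) (auto simp: power2_eq_square mult_left_le)
        also have "(1 - t) * (2 * (c t)\<^sup>2) + (1 - t) * ((c t)\<^sup>2 + (c' t)\<^sup>2) = (1 - t) * (3 * (c t)\<^sup>2 + (c' t)\<^sup>2)"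
          by (simp add: algebra_simps)
        also have "\<dots> \<le> (1 - t) * G (x * (1 - t), t)"
          using t c'2 by (intro mult_left_mono) (auto simp: G_def c(1))
        finally show ?thesis by simp
      qed
      then show "ennreal \<bar>p' t\<bar> * indicator {0..1} t \<le> ennreal ((1 - t) * G (x * (1 - t), t)) * indicator {0..1} t"
        by (auto simp: indicator_def ennreal_leI)
    qed
    finally show ?thesis by (simp add: p_def c_def)
  qed
  have cont: "continuous_on UNIV (\<lambda>t. (w (t, 0))\<^sup>2)"
    by (intro continuous_intros continuous_on_compose2[OF cw(1)[of UNIV]]) auto
  have "ennreal (\<integral>t. (w (t, 0))\<^sup>2 \<partial>lebesgue_on {0..1}) = (\<integral>\<^sup>+t. ennreal ((w (t, 0))\<^sup>2) * indicator {0..1} t \<partial>lborel)"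
    by (rule ennreal_integral_Icc[OF cont]) simp
  also have "\<dots> \<le> (\<integral>\<^sup>+x. (\<integral>\<^sup>+t. ennreal ((1 - t) * G (x * (1 - t), t)) * indicator {0..1} t \<partial>lborel) * indicator {0..1} x \<partial>lborel)"
    using pt by (intro nn_integral_mono) (auto simp: indicator_def)
  also have "\<dots> \<le> (\<integral>\<^sup>+z. ennreal (G z) * indicator K z \<partial>lborel)"
    by (rule nn_integral_duffy_le) (auto simp: G0)
  also have "\<dots> = (\<integral>\<^sup>+z. ennreal (G z) \<partial>lebesgue_on K)"
    by (rule nn_integral_lebesgue_on_borel[symmetric]) measurable
  also have "\<dots> = ennreal (\<integral>z. G z \<partial>lebesgue_on K)"
    using L G0 unfolding G_def L2_def by (intro nn_integral_eq_integral) auto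
  also have "(\<integral>z. G z \<partial>lebesgue_on K) = 3 * ip K w w + 2 * ip K wx wx + 2 * ip K wy wy"
    using L unfolding G_def ip_def L2_def power2_eq_square by simp
  finally have "(\<integral>t. (w (t, 0))\<^sup>2 \<partial>lebesgue_on {0..1}) \<le> 3 * ip K w w + 2 * ip K wx wx + 2 * ip K wy wy"
    by (subst (asm) ennreal_le_iff) auto
  also have "\<dots> \<le> 3 * (ip K w w + ip K wx wx + ip K wy wy)" by simp
  finally show ?thesis .
qed

text \<open>Composition with \<open>cyc\<close> turns the gradient into
  \<open>(wy - wx, - wx)\<close>, whose squared length is at most 3 wx^2 + 2 wy^2; so each rotation
  costs at most a factor 3 in the squared H1 norm.\<close>

lemma trace_edge:
  assumes "C1_fun w wx wy"
  shows "(\<integral>t. (w ((cyc ^^ j) (t, 0)))\<^sup>2 \<partial>lebesgue_on {0..1}) \<le> 3 ^ Suc j * (ip K w w + ip K wx wx + ip K wy wy)"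
  using assms
proof (induction j arbitrary: w wx wy)
  case 0
  then show ?case using trace_bottom[OF 0] by simp
next
  case (Suc j)
  note w = Suc.prems
  have cw: "continuous_on A w" "continuous_on UNIV wx" "continuous_on UNIV wy" for A
    using w C1_fun_continuous[OF w] by (auto simp: C1_fun_def)
  have cc: "continuous_on UNIV cyc" by (auto simp: cyc_def[abs_def] intro!: continuous_intros)
  have L: "L2 K (\<lambda>z. wx (cyc z))" "L2 K (\<lambda>z. wy (cyc z))"
    by (intro L2_continuous compact_tri continuous_on_subset[OF continuous_on_compose2[OF cw(2) cc]]
        continuous_on_subset[OF continuous_on_compose2[OF cw(3) cc]]; simp)+
  have "ip K (\<lambda>z. wy (cyc z) - wx (cyc z)) (\<lambda>z. wy (cyc z) - wx (cyc z)) \<le> 2 * ip K wy wy + 2 * ip K wx wx"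
    using ip_add_le[OF L(2) L2_cmult[OF L(1), of "-1"]] ip_cyc[OF cw(2,2)] ip_cyc[OF cw(3,3)]
    by (simp add: ip_cmult_left[of K "-1", simplified] ip_cmult_right[of K _ "-1", simplified])
  moreover have "ip K (\<lambda>z. - wx (cyc z)) (\<lambda>z. - wx (cyc z)) = ip K wx wx"
    using ip_cyc[OF cw(2,2)] by (simp add: ip_def)
  moreover have "ip K (\<lambda>z. w (cyc z)) (\<lambda>z. w (cyc z)) = ip K w w" by (rule ip_cyc[OF cw(1,1)])
  ultimately have H: "ip K (\<lambda>z. w (cyc z)) (\<lambda>z. w (cyc z))
      + ip K (\<lambda>z. wy (cyc z) - wx (cyc z)) (\<lambda>z. wy (cyc z) - wx (cyc z))
      + ip K (\<lambda>z. - wx (cyc z)) (\<lambda>z. - wx (cyc z)) \<le> 3 * (ip K w w + ip K wx wx + ip K wy wy)"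
  proof -
    have arith: "A \<le> 2 * y + 2 * x \<Longrightarrow> B = x \<Longrightarrow> C = v \<Longrightarrow> 0 \<le> v \<Longrightarrow> 0 \<le> y \<Longrightarrow> C + A + B \<le> 3 * (v + x + y)"
      for A B C v x y :: real by simp
    assume "ip K (\<lambda>z. wy (cyc z) - wx (cyc z)) (\<lambda>z. wy (cyc z) - wx (cyc z)) \<le> 2 * ip K wy wy + 2 * ip K wx wx"
      "ip K (\<lambda>z. - wx (cyc z)) (\<lambda>z. - wx (cyc z)) = ip K wx wx"
      "ip K (\<lambda>z. w (cyc z)) (\<lambda>z. w (cyc z)) = ip K w w"
    from arith[OF this ip_nonneg ip_nonneg] show ?thesis .
  qed
  have "(\<integral>t. (w ((cyc ^^ Suc j) (t, 0)))\<^sup>2 \<partial>lebesgue_on {0..1}) = (\<integral>t. (w (cyc ((cyc ^^ j) (t, 0))))\<^sup>2 \<partial>lebesgue_on {0..1})"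
    by simp
  also have "\<dots> \<le> 3 ^ Suc j * (ip K (\<lambda>z. w (cyc z)) (\<lambda>z. w (cyc z))
      + ip K (\<lambda>z. wy (cyc z) - wx (cyc z)) (\<lambda>z. wy (cyc z) - wx (cyc z))
      + ip K (\<lambda>z. - wx (cyc z)) (\<lambda>z. - wx (cyc z)))"
    by (rule Suc.IH[OF C1_cyc[OF w]])
  also have "\<dots> \<le> 3 ^ Suc j * (3 * (ip K w w + ip K wx wx + ip K wy wy))"
    using H by (intro mult_left_mono) auto
  also have "\<dots> = 3 ^ Suc (Suc j) * (ip K w w + ip K wx wx + ip K wy wy)" by (simp add: algebra_simps)
  finally show ?case .
qed

section \<open>The Sobolev space on the reference triangle\<close>

lemma C1_fun_add:
  assumes "C1_fun f fx fy" "C1_fun g gx gy"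
  shows "C1_fun (\<lambda>z. f z + g z) (\<lambda>z. fx z + gx z) (\<lambda>z. fy z + gy z)"
  unfolding C1_fun_def
proof (intro conjI allI)
  fix z
  have "(f has_derivative (\<lambda>h. fx z * fst h + fy z * snd h)) (at z)"
    "(g has_derivative (\<lambda>h. gx z * fst h + gy z * snd h)) (at z)" using assms unfolding C1_fun_def by blast+
  from has_derivative_add[OF this]
  show "((\<lambda>z. f z + g z) has_derivative (\<lambda>h. (fx z + gx z) * fst h + (fy z + gy z) * snd h)) (at z)"
    by (rule has_derivative_eq_rhs) (auto simp: algebra_simps)
qed (use assms in \<open>auto simp: C1_fun_def intro!: continuous_intros\<close>)

lemma C1_fun_const: "C1_fun (\<lambda>z. c) (\<lambda>z. 0) (\<lambda>z. 0)"
  by (auto simp: C1_fun_def)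

lemma C1_fun_cmult: "C1_fun f fx fy \<Longrightarrow> C1_fun (\<lambda>z. c * f z) (\<lambda>z. c * fx z) (\<lambda>z. c * fy z)"
  using C1_fun_mult[OF C1_fun_const[of c], of f fx fy] by simp

lemma C1_fun_L2:
  assumes "compact T" "C1_fun \<phi> \<phi>x \<phi>y"
  shows "L2 T \<phi>" "L2 T \<phi>x" "L2 T \<phi>y"
  using C1_weak_grad[OF assms] by (auto simp: weak_grad_def)

lemma weak_grad_add:
  assumes "compact T" "weak_grad T u ux uy" "weak_grad T v vx vy"
  shows "weak_grad T (\<lambda>z. u z + v z) (\<lambda>z. ux z + vx z) (\<lambda>z. uy z + vy z)"
  using assms C1_fun_L2[OF assms(1)] unfolding weak_grad_def by (auto simp: ip_simps)

lemma weak_grad_cmult: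
  assumes "weak_grad T u ux uy"
  shows "weak_grad T (\<lambda>z. c * u z) (\<lambda>z. c * ux z) (\<lambda>z. c * uy z)"
  using assms unfolding weak_grad_def by (auto simp: ip_cmult_left L2_cmult)

lemma weak_grad_0: "compact T \<Longrightarrow> weak_grad T (\<lambda>z. 0) (\<lambda>z. 0) (\<lambda>z. 0)"
  by (rule C1_weak_grad[OF _ C1_fun_const])

text \<open>Elements are representatives together with a chosen weak gradient, so the forms below are only
  positive semidefinite and no quotient is taken.\<close>

typedef h1 = "{(u, ux, uy). weak_grad K u ux uy}"
  by (rule exI[of _ "(\<lambda>z. 0, \<lambda>z. 0, \<lambda>z. 0)"]) (simp add: weak_grad_0 compact_tri)

definition hv :: "h1 \<Rightarrow> pt \<Rightarrow> real" where "hv U = fst (Rep_h1 U)"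
definition hx :: "h1 \<Rightarrow> pt \<Rightarrow> real" where "hx U = fst (snd (Rep_h1 U))"
definition hy :: "h1 \<Rightarrow> pt \<Rightarrow> real" where "hy U = snd (snd (Rep_h1 U))"
definition mk :: "(pt \<Rightarrow> real) \<Rightarrow> (pt \<Rightarrow> real) \<Rightarrow> (pt \<Rightarrow> real) \<Rightarrow> h1" where "mk u ux uy = Abs_h1 (u, ux, uy)"

lemma weak_grad_h1: "weak_grad K (hv U) (hx U) (hy U)"
  using Rep_h1[of U] by (auto simp: hv_def hx_def hy_def)

lemma mk_sel [simp]:
  assumes "weak_grad K u ux uy"
  shows "hv (mk u ux uy) = u" "hx (mk u ux uy) = ux" "hy (mk u ux uy) = uy"
  using assms by (simp_all add: mk_def hv_def hx_def hy_def Abs_h1_inverse)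

lemma h1_eqI: "hv U = hv W \<Longrightarrow> hx U = hx W \<Longrightarrow> hy U = hy W \<Longrightarrow> U = W"
  by (metis Rep_h1_inject hv_def hx_def hy_def prod.expand)

lemma L2_h1: "L2 K (hv U)" "L2 K (hx U)" "L2 K (hy U)"
  using weak_grad_h1[of U] by (auto simp: weak_grad_def)

instantiation h1 :: real_vector
begin

definition "0 = mk (\<lambda>z. 0) (\<lambda>z. 0) (\<lambda>z. 0)"
definition "U + W = mk (\<lambda>z. hv U z + hv W z) (\<lambda>z. hx U z + hx W z) (\<lambda>z. hy U z + hy W z)"
definition "c *\<^sub>R U = mk (\<lambda>z. c * hv U z) (\<lambda>z. c * hx U z) (\<lambda>z. c * hy U z)"
definition "- U = (-1) *\<^sub>R (U :: h1)"
definition "U - W = U + (- W :: h1)"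

lemma h1_zero_sel: "hv 0 = (\<lambda>z. 0)" "hx 0 = (\<lambda>z. 0)" "hy 0 = (\<lambda>z. 0)"
  unfolding zero_h1_def by (simp_all add: weak_grad_0 compact_tri)

lemma h1_add_sel: "hv (U + W) = (\<lambda>z. hv U z + hv W z)" "hx (U + W) = (\<lambda>z. hx U z + hx W z)" "hy (U + W) = (\<lambda>z. hy U z + hy W z)"
  unfolding plus_h1_def by (simp_all add: weak_grad_add weak_grad_h1 compact_tri)

lemma h1_scale_sel: "hv (c *\<^sub>R U) = (\<lambda>z. c * hv U z)" "hx (c *\<^sub>R U) = (\<lambda>z. c * hx U z)" "hy (c *\<^sub>R U) = (\<lambda>z. c * hy U z)"
  unfolding scaleR_h1_def by (simp_all add: weak_grad_cmult weak_grad_h1)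

lemma h1_uminus_sel: "hv (- U) = (\<lambda>z. - hv U z)" "hx (- U) = (\<lambda>z. - hx U z)" "hy (- U) = (\<lambda>z. - hy U z)"
  unfolding uminus_h1_def by (simp_all add: h1_scale_sel)

lemma h1_diff_sel: "hv (U - W) = (\<lambda>z. hv U z - hv W z)" "hx (U - W) = (\<lambda>z. hx U z - hx W z)" "hy (U - W) = (\<lambda>z. hy U z - hy W z)"
  unfolding minus_h1_def by (simp_all add: h1_add_sel h1_uminus_sel)

lemmas h1_sel = h1_zero_sel h1_add_sel h1_scale_sel h1_uminus_sel h1_diff_sel

instance
  by standard (rule h1_eqI; simp add: h1_sel fun_eq_iff algebra_simps)+

end

definition hb :: "h1 \<Rightarrow> h1 \<Rightarrow> real" where
  "hb U W = ip K (hv U) (hv W)"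

definition hd1 :: "h1 \<Rightarrow> h1 \<Rightarrow> real" where
  "hd1 U W = ip K (\<lambda>z. hx U z + hy U z) (\<lambda>z. hx W z + hy W z) / 2"

definition hd2 :: "h1 \<Rightarrow> h1 \<Rightarrow> real" where
  "hd2 U W = ip K (\<lambda>z. hx U z - hy U z) (\<lambda>z. hx W z - hy W z) / 2"

definition hh :: "h1 \<Rightarrow> h1 \<Rightarrow> real" where
  "hh U W = hd1 U W + hd2 U W + hb U W"

lemma semi_inner_hb: "semi_inner hb"
  by (rule semi_inner.intro; (intro linearI)?; simp add: hb_def h1_sel ip_simps L2_h1 ip_commute)

lemma semi_inner_hd1: "semi_inner hd1"
proof (rule semi_inner.intro)
  show "linear (hd1 U)" for U
  proof (rule linearI)
    show "hd1 U (W + W') = hd1 U W + hd1 U W'" for W W'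
      by (simp add: hd1_def h1_sel ip_simps L2_h1 field_simps)
    show "hd1 U (c *\<^sub>R W) = c *\<^sub>R hd1 U W" for c W
      using ip_cmult_right[of K "\<lambda>z. hx U z + hy U z" c "\<lambda>z. hx W z + hy W z"]
      by (simp add: hd1_def h1_sel distrib_left)
  qed
qed (simp_all add: hd1_def ip_commute)

lemma semi_inner_hd2: "semi_inner hd2"
proof (rule semi_inner.intro)
  show "linear (hd2 U)" for U
  proof (rule linearI)
    show "hd2 U (W + W') = hd2 U W + hd2 U W'" for W W'
      by (simp add: hd2_def h1_sel ip_simps L2_h1 field_simps)
    show "hd2 U (c *\<^sub>R W) = c *\<^sub>R hd2 U W" for c W
      using ip_cmult_right[of K "\<lambda>z. hx U z - hy U z" c "\<lambda>z. hx W z - hy W z"]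
      by (simp add: hd2_def h1_sel right_diff_distrib)
  qed
qed (simp_all add: hd2_def ip_commute)

interpretation hb: semi_inner hb by (rule semi_inner_hb)
interpretation hd1: semi_inner hd1 by (rule semi_inner_hd1)
interpretation hd2: semi_inner hd2 by (rule semi_inner_hd2)

lemma hd_sum: "hd1 U W + hd2 U W = ip K (hx U) (hx W) + ip K (hy U) (hy W)"
  by (simp add: hd1_def hd2_def ip_simps L2_h1 field_simps)

lemma hh_eq: "hh U W = ip K (hv U) (hv W) + ip K (hx U) (hx W) + ip K (hy U) (hy W)"
  by (simp add: hh_def hd_sum hb_def)

interpretation hh: semi_inner hh
proof -
  have "semi_inner (\<lambda>x y. 1 * (1 * hd1 x y + 1 * hd2 x y) + 1 * hb x y)"
    by (intro semi_inner_lincomb semi_inner_hd1 semi_inner_hd2 semi_inner_hb) auto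
  then show "semi_inner hh" by (simp add: hh_def[abs_def])
qed

lemma h1dist2_hh: "h1dist2 K (hv U) (hx U) (hy U) (hv W) (hx W) (hy W) = hh (U - W) (U - W)"
  by (simp add: h1dist2_def hh_eq h1_sel)

context semi_inner
begin

lemma triangle2: "b (x - z) (x - z) \<le> 2 * b (x - y) (x - y) + 2 * b (y - z) (y - z)"
proof -
  have "0 \<le> b ((x - y) - (y - z)) ((x - y) - (y - z))" by (rule nonneg)
  moreover have "x - z = (x - y) + (y - z)" by simp
  ultimately show ?thesis by (simp only: add_left add_right diff_left[of "x - y"] diff_right[of _ "x - y"])
qed

lemma diff_commute: "b (x - y) (x - y) = b (y - x) (y - x)"
  by (simp add: bilinear_simps)

lemma dist_cong:
  assumes "b (x - y) (x - y) = 0"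
  shows "b (x - z) (x - z) = b (y - z) (y - z)"
proof -
  have "b (x - y) v = 0" for v using Cauchy_Schwarz[of "x - y" v] assms by simp
  moreover have "x - z = (x - y) + (y - z)" by simp
  ultimately show ?thesis by (metis add_left add_right add_0 commute)
qed

end

definition CC :: "h1 set" where
  "CC = {W. C1_fun (hv W) (hx W) (hy W)}"

lemma mk_CC: "C1_fun w wx wy \<Longrightarrow> mk w wx wy \<in> CC" "C1_fun w wx wy \<Longrightarrow> weak_grad K w wx wy"
  using C1_weak_grad[OF compact_tri[of Kref], of w wx wy] by (auto simp: CC_def)

lemma CC_add: "U \<in> CC \<Longrightarrow> W \<in> CC \<Longrightarrow> U + W \<in> CC"
  by (simp add: CC_def h1_sel C1_fun_add)

lemma CC_scale: "U \<in> CC \<Longrightarrow> c *\<^sub>R U \<in> CC"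
  by (simp add: CC_def h1_sel C1_fun_cmult)

lemma CC_diff: "U \<in> CC \<Longrightarrow> W \<in> CC \<Longrightarrow> U - W \<in> CC"
  using CC_add[of U "(-1) *\<^sub>R W"] CC_scale[of W "-1"] by simp

lemma CC_dense: "r > 0 \<Longrightarrow> \<exists>W\<in>CC. hh (U - W) (U - W) < r"
proof -
  assume "r > 0"
  then obtain w wx wy where w: "C1_fun w wx wy" "h1dist2 K (hv U) (hx U) (hy U) w wx wy < r"
    using K.C1_dense[OF weak_grad_h1] by blast
  then show ?thesis using mk_CC[OF w(1)] h1dist2_hh[of U "mk w wx wy"] by (intro bexI[of _ "mk w wx wy"]) auto
qed

section \<open>Edge functionals and the closed subspace of the boundary condition\<close>

definition edge :: "nat \<Rightarrow> real \<Rightarrow> pt" where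
  "edge j t = (cyc ^^ j) (t, 0)"

definition edge_mean :: "nat \<Rightarrow> (pt \<Rightarrow> real) \<Rightarrow> real" where
  "edge_mean j w = (\<integral>t. w (edge j t) \<partial>lebesgue_on {0..1})"

lemma edge_cont: "continuous_on A (edge j)"
proof (induction j)
  case (Suc j)
  have "edge (Suc j) t = cyc (edge j t)" for t by (simp add: edge_def)
  then show ?case using Suc
    by (auto simp: cyc_def intro!: continuous_intros)
qed (auto simp: edge_def intro!: continuous_intros)

lemma edge_integrable:
  fixes w :: "pt \<Rightarrow> real"
  assumes "continuous_on UNIV w"
  shows "integrable (lebesgue_on {0..1}) (\<lambda>t. w (edge j t))"
proof -
  have "continuous_on {0..1} (\<lambda>t. w (edge j t))"
    by (rule continuous_on_compose2[OF assms edge_cont]) auto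
  then show ?thesis by (rule continuous_imp_integrable_real)
qed

lemma edge_mean_add:
  assumes "continuous_on UNIV v" "continuous_on UNIV w"
  shows "edge_mean j (\<lambda>z. v z + w z) = edge_mean j v + edge_mean j w"
  unfolding edge_mean_def using edge_integrable[OF assms(1)] edge_integrable[OF assms(2)] by simp

lemma edge_mean_cmult: "edge_mean j (\<lambda>z. c * w z) = c * edge_mean j w"
  by (simp add: edge_mean_def)

lemma edge_mean_nonneg: "(\<And>z. 0 \<le> w z) \<Longrightarrow> 0 \<le> edge_mean j w"
  by (simp add: edge_mean_def)

lemma edge_mean_const: "edge_mean j (\<lambda>z. c) = c"
  by (simp add: edge_mean_def measure_restrict_space)

text \<open>Nonnegativity of the variance over the edge, whose parameter interval has length
  1.\<close>

lemma edge_mean_square_le: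
  assumes "continuous_on UNIV w"
  shows "(edge_mean j w)\<^sup>2 \<le> edge_mean j (\<lambda>z. (w z)\<^sup>2)"
proof -
  define m where "m = edge_mean j w"
  have "0 \<le> edge_mean j (\<lambda>z. (w z - m)\<^sup>2)" by (rule edge_mean_nonneg) simp
  also have "(\<lambda>z. (w z - m)\<^sup>2) = (\<lambda>z. (w z)\<^sup>2 + ((- 2 * m) * w z + m\<^sup>2))"
    by (auto simp: power2_diff algebra_simps)
  also have "edge_mean j \<dots> = edge_mean j (\<lambda>z. (w z)\<^sup>2) - 2 * m * m + m\<^sup>2"
    using assms by (subst edge_mean_add edge_mean_cmult edge_mean_const | simp add: m_def continuous_intros)+
  finally show ?thesis by (simp add: m_def power2_eq_square)
qed

text \<open>Squares of the edge seminorms: they obey the parallelogram-type bound \<open>tau_add\<close> and the trace inequality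
  for both boundary conditions alike.\<close>

definition tau :: "bctype \<Rightarrow> nat \<Rightarrow> (pt \<Rightarrow> real) \<Rightarrow> real" where
  "tau bc j w = (case bc of Dirichlet \<Rightarrow> edge_mean j (\<lambda>z. (w z)\<^sup>2) | EdgeMean \<Rightarrow> (edge_mean j w)\<^sup>2)"

lemma tau_nonneg: "0 \<le> tau bc j w"
  by (simp add: tau_def edge_mean_nonneg split: bctype.split)

lemma tau_add:
  assumes "continuous_on UNIV v" "continuous_on UNIV w"
  shows "tau bc j (\<lambda>z. v z + w z) \<le> 2 * tau bc j v + 2 * tau bc j w"
proof -
  have sq: "(x + y)\<^sup>2 \<le> 2 * x\<^sup>2 + 2 * y\<^sup>2" for x y :: real
    using zero_le_power2[of "x - y"] by (simp add: power2_diff power2_sum)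
  have "edge_mean j (\<lambda>z. (v z + w z)\<^sup>2) \<le> edge_mean j (\<lambda>z. 2 * (v z)\<^sup>2 + 2 * (w z)\<^sup>2)"
    unfolding edge_mean_def using assms sq
    by (intro integral_mono edge_integrable[of "\<lambda>z. (v z + w z)\<^sup>2"] edge_integrable[of "\<lambda>z. 2 * (v z)\<^sup>2 + 2 * (w z)\<^sup>2"])
      (auto intro!: continuous_intros)
  also have "\<dots> = 2 * edge_mean j (\<lambda>z. (v z)\<^sup>2) + 2 * edge_mean j (\<lambda>z. (w z)\<^sup>2)"
    using assms by (subst edge_mean_add) (auto simp: edge_mean_cmult intro!: continuous_intros)
  finally show ?thesis
    using sq[of "edge_mean j v" "edge_mean j w"] assms by (simp add: tau_def edge_mean_add split: bctype.split)
qed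

lemma tau_cmult: "tau bc j (\<lambda>z. c * w z) = c\<^sup>2 * tau bc j w"
  by (simp add: tau_def power_mult_distrib edge_mean_cmult split: bctype.split)

lemma tau_const: "tau bc j (\<lambda>z. c) = c\<^sup>2"
  by (simp add: tau_def edge_mean_const split: bctype.split)

lemma hv_cont: "W \<in> CC \<Longrightarrow> continuous_on A (hv W)"
  by (auto simp: CC_def intro: C1_fun_continuous)

text \<open>Jensen reduces the mean over an edge to the L2 norm on it, so one trace inequality
  serves both boundary conditions.\<close>

lemma tau_trace: "W \<in> CC \<Longrightarrow> tau bc j (hv W) \<le> 3 ^ Suc j * hh W W"
proof -
  assume W: "W \<in> CC"
  have "edge_mean j (\<lambda>z. (hv W z)\<^sup>2) \<le> 3 ^ Suc j * hh W W"
    using trace_edge[of "hv W" "hx W" "hy W" j] W unfolding CC_def edge_mean_def edge_def hh_eq by simp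
  then show ?thesis
    using edge_mean_square_le[OF hv_cont[OF W], of j] unfolding tau_def by (auto split: bctype.split)
qed

definition tausum :: "bctype \<Rightarrow> h1 \<Rightarrow> real" where
  "tausum bc W = tau bc 0 (hv W) + tau bc 1 (hv W) + tau bc 2 (hv W)"

lemma tausum_nonneg: "0 \<le> tausum bc W"
  by (simp add: tausum_def tau_nonneg)

lemma tausum_add: "U \<in> CC \<Longrightarrow> W \<in> CC \<Longrightarrow> tausum bc (U + W) \<le> 2 * tausum bc U + 2 * tausum bc W"
  using tau_add[OF hv_cont hv_cont, of U W bc 0] tau_add[OF hv_cont hv_cont, of U W bc 1]
    tau_add[OF hv_cont hv_cont, of U W bc 2] by (simp add: tausum_def h1_sel)

lemma tausum_scale: "tausum bc (c *\<^sub>R U) = c\<^sup>2 * tausum bc U"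
  by (simp add: tausum_def h1_sel tau_cmult distrib_left)

text \<open>39 is 3 + 9 + 27, the trace constants of the three edges.\<close>

lemma tausum_trace: "W \<in> CC \<Longrightarrow> tausum bc W \<le> 39 * hh W W"
  using tau_trace[of W bc 0] tau_trace[of W bc 1] tau_trace[of W bc 2] by (simp add: tausum_def)

text \<open>The boundary condition as a closure, which makes linearity and closedness immediate and needs no trace operator.\<close>

definition Vset :: "bctype \<Rightarrow> h1 set" where
  "Vset bc = {U. \<forall>r>0. \<exists>W\<in>CC. hh (U - W) (U - W) < r \<and> tausum bc W < r}"

lemma subspace_Vset: "subspace (Vset bc)"
  unfolding subspace_def
proof (intro conjI ballI allI)
  have "0 \<in> CC" by (simp add: CC_def h1_sel C1_fun_const)
  moreover have "tausum bc 0 = 0" using tausum_scale[of bc 0 0] by simp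
  ultimately show "0 \<in> Vset bc"
    unfolding Vset_def using hh.scale_left[of 0 0 0] by (auto intro!: bexI[of _ 0])
next
  fix U U' assume U: "U \<in> Vset bc" and U': "U' \<in> Vset bc"
  show "U + U' \<in> Vset bc" unfolding Vset_def
  proof (intro CollectI allI impI)
    fix r :: real assume "r > 0"
    then have r: "r / 4 > 0" by simp
    obtain W where W: "W \<in> CC" "hh (U - W) (U - W) < r / 4" "tausum bc W < r / 4"
      using U r unfolding Vset_def by blast
    obtain W' where W': "W' \<in> CC" "hh (U' - W') (U' - W') < r / 4" "tausum bc W' < r / 4"
      using U' r unfolding Vset_def by blast
    have "hh ((U + U') - (W + W')) ((U + U') - (W + W')) \<le> 2 * hh (U - W) (U - W) + 2 * hh (U' - W') (U' - W')"
      using hh.triangle2[of "U - W" "W' - U'" 0] hh.diff_commute[of U' W'] by (simp add: algebra_simps)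
    then show "\<exists>W\<in>CC. hh (U + U' - W) (U + U' - W) < r \<and> tausum bc W < r"
      using W W' tausum_add[OF W(1) W'(1), of bc] by (intro bexI[of _ "W + W'"]) (auto intro: CC_add)
  qed
next
  fix c U assume U: "U \<in> Vset bc"
  show "c *\<^sub>R U \<in> Vset bc" unfolding Vset_def
  proof (intro CollectI allI impI)
    fix r :: real assume "r > 0"
    have c: "0 < c\<^sup>2 + 1" by (simp add: add_nonneg_pos)
    then have r: "r / (c\<^sup>2 + 1) > 0" using \<open>r > 0\<close> by simp
    obtain W where W: "W \<in> CC" "hh (U - W) (U - W) < r / (c\<^sup>2 + 1)" "tausum bc W < r / (c\<^sup>2 + 1)"
      using U r unfolding Vset_def by blast
    have bd: "c\<^sup>2 * x < r" if "x < r / (c\<^sup>2 + 1)" "0 \<le> x" for x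
    proof -
      have "c\<^sup>2 * x \<le> (c\<^sup>2 + 1) * x" using that by (intro mult_right_mono) auto
      also have "\<dots> < r" using that c by (simp add: field_simps)
      finally show ?thesis .
    qed
    have "hh (c *\<^sub>R U - c *\<^sub>R W) (c *\<^sub>R U - c *\<^sub>R W) = c\<^sup>2 * hh (U - W) (U - W)"
      by (simp add: hh.bilinear_simps power2_eq_square algebra_simps)
    then show "\<exists>W\<in>CC. hh (c *\<^sub>R U - W) (c *\<^sub>R U - W) < r \<and> tausum bc W < r"
      using W bd[OF W(2) hh.nonneg] bd[OF W(3) tausum_nonneg]
      by (intro bexI[of _ "c *\<^sub>R W"]) (auto intro: CC_scale simp: tausum_scale)
  qed
qed

lemma Vset_closed:
  assumes "\<And>n. X n \<in> Vset bc" "(\<lambda>n. hh (X n - U) (X n - U)) \<longlonglongrightarrow> 0"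
  shows "U \<in> Vset bc"
  unfolding Vset_def
proof (intro CollectI allI impI)
  fix r :: real assume "r > 0"
  then have r: "r / 4 > 0" by simp
  from LIMSEQ_D[OF assms(2) r] obtain n where n: "hh (X n - U) (X n - U) < r / 4" using hh.nonneg by auto
  obtain W where W: "W \<in> CC" "hh (X n - W) (X n - W) < r / 4" "tausum bc W < r / 4"
    using assms(1)[of n] r unfolding Vset_def by blast
  have "hh (U - W) (U - W) < r"
    using hh.triangle2[of U W "X n"] hh.diff_commute[of U "X n"] n W(2) by simp
  then show "\<exists>W\<in>CC. hh (U - W) (U - W) < r \<and> tausum bc W < r" using W \<open>r > 0\<close> by (intro bexI[of _ W]) auto
qed

text \<open>A vector without energy is almost everywhere a constant \<open>c\<close>, and a constant
  contributes \<open>c^2\<close> on each edge; approximants with small edge terms force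
  \<open>c = 0\<close>. This is what makes the eigenvalues positive.\<close>

lemma Vset_definite:
  assumes U: "U \<in> Vset bc" and 0: "hd1 U U + hd2 U U = 0"
  shows "hb U U = 0"
proof -
  have g: "ip K (hx U) (hx U) = 0" "ip K (hy U) (hy U) = 0"
    using 0 ip_nonneg[of K "hx U"] ip_nonneg[of K "hy U"] unfolding hd_sum by linarith+
  obtain c where c: "ip K (\<lambda>z. hv U z - c) (\<lambda>z. hv U z - c) = 0"
    using K.zero_gradient_const[OF weak_grad_h1 g] by blast
  define E where "E = mk (\<lambda>z. c) (\<lambda>z. 0) (\<lambda>z. 0)"
  have E: "E \<in> CC" "hv E = (\<lambda>z. c)" "hx E = (\<lambda>z. 0)" "hy E = (\<lambda>z. 0)"
    using mk_CC[OF C1_fun_const[of c]] by (auto simp: E_def)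
  have UE: "hh (U - E) (U - E) = 0" using c g by (simp add: hh_eq h1_sel E)
  \<comment> \<open>80 is twice 39 from the trace inequality plus 2 from the edge terms of
    \<open>W\<close>.\<close>
  have bound: "3 * c\<^sup>2 \<le> 80 * r" if r: "r > 0" for r
  proof -
    obtain W where W: "W \<in> CC" "hh (U - W) (U - W) < r" "tausum bc W < r"
      using U r unfolding Vset_def by blast
    have "hh (E - W) (E - W) < r" using hh.dist_cong[OF UE, of W] W(2) by simp
    then have "tausum bc (E - W) \<le> 39 * r" using tausum_trace[OF CC_diff[OF E(1) W(1)], of bc] by simp
    moreover have "tausum bc E \<le> 2 * tausum bc (E - W) + 2 * tausum bc W"
      using tausum_add[OF CC_diff[OF E(1) W(1)] W(1), of bc] by simp
    moreover have "tausum bc E = 3 * c\<^sup>2" by (simp add: tausum_def E tau_const)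
    ultimately show ?thesis using W(3) by simp
  qed
  have "3 * c\<^sup>2 \<le> 0"
  proof (rule field_le_epsilon)
    fix r :: real assume "0 < r"
    then show "3 * c\<^sup>2 \<le> 0 + r" using bound[of "r / 80"] by simp
  qed
  then have "c = 0" by simp
  then show ?thesis using c by (simp add: hb_def)
qed

section \<open>Compactness, completeness and infinite dimension of the subspace\<close>

lemma Vset_compact:
  assumes "\<And>n. hd1 (X n) (X n) + hd2 (X n) (X n) + hb (X n) (X n) \<le> C"
  shows "\<exists>r::nat \<Rightarrow> nat. strict_mono r \<and> (\<forall>e>0. \<exists>N::nat. \<forall>m\<ge>N. \<forall>n\<ge>N.
        hb (X (r m) - X (r n)) (X (r m) - X (r n)) < e)"
proof -
  have "ip K (hv (X n)) (hv (X n)) + ip K (hx (X n)) (hx (X n)) + ip K (hy (X n)) (hy (X n)) \<le> C" for n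
    using assms[of n] unfolding hd_sum hb_def by simp
  from K.rellich[of "\<lambda>n. hv (X n)" "\<lambda>n. hx (X n)" "\<lambda>n. hy (X n)", OF weak_grad_h1 this]
  show ?thesis by (simp add: hb_def h1_sel)
qed

text \<open>The value and the two derivatives converge separately in L2, and the
  integration-by-parts identities pass to the limit against each test function.\<close>

lemma h1_complete:
  assumes cauchy: "\<forall>e>0. \<exists>N::nat. \<forall>m\<ge>N. \<forall>n\<ge>N. hh (X m - X n) (X m - X n) < e"
  shows "\<exists>U. (\<lambda>n. hh (X n - U) (X n - U)) \<longlonglongrightarrow> 0"
proof -
  have comp: "\<exists>g. L2 K g \<and> (\<lambda>n. sqd K (f (X n)) g) \<longlonglongrightarrow> 0"
    if L: "\<And>U. L2 K (f U)" and le: "\<And>U W. sqd K (f U) (f W) \<le> hh (U - W) (U - W)"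
    for f :: "h1 \<Rightarrow> pt \<Rightarrow> real"
  proof (rule L2_complete[OF compact_tri L])
    show "\<forall>e>0. \<exists>N::nat. \<forall>m\<ge>N. \<forall>n\<ge>N. sqd K (f (X m)) (f (X n)) < e"
      using cauchy le by (meson le_less_trans)
  qed
  have le: "sqd K (hv U) (hv W) \<le> hh (U - W) (U - W)"
    "sqd K (hx U) (hx W) \<le> hh (U - W) (U - W)"
    "sqd K (hy U) (hy W) \<le> hh (U - W) (U - W)" for U W
    by (simp_all add: hh_eq h1_sel)
  obtain u where u: "L2 K u" "(\<lambda>n. sqd K (hv (X n)) u) \<longlonglongrightarrow> 0"
    using comp[of hv, OF L2_h1(1) le(1)] by blast
  obtain ux where ux: "L2 K ux" "(\<lambda>n. sqd K (hx (X n)) ux) \<longlonglongrightarrow> 0"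
    using comp[of hx, OF L2_h1(2) le(2)] by blast
  obtain uy where uy: "L2 K uy" "(\<lambda>n. sqd K (hy (X n)) uy) \<longlonglongrightarrow> 0"
    using comp[of hy, OF L2_h1(3) le(3)] by blast
  have wg: "weak_grad K u ux uy"
    unfolding weak_grad_def
  proof (intro conjI allI impI u(1) ux(1) uy(1))
    fix \<phi> \<phi>x \<phi>y
    assume \<phi>: "C1_fun \<phi> \<phi>x \<phi>y \<and> compact (closure {z. \<phi> z \<noteq> 0}) \<and> closure {z. \<phi> z \<noteq> 0} \<subseteq> interior K"
    then have L\<phi>: "L2 K \<phi>" "L2 K \<phi>x" "L2 K \<phi>y" using C1_fun_L2[OF compact_tri[of Kref]] by blast+
    have eq: "ip K (hv (X n)) \<phi>x = - ip K (hx (X n)) \<phi>" "ip K (hv (X n)) \<phi>y = - ip K (hy (X n)) \<phi>" for n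
      using weak_grad_h1[of "X n"] \<phi> unfolding weak_grad_def by blast+
    have "(\<lambda>n. ip K (hv (X n)) \<phi>x) \<longlonglongrightarrow> ip K u \<phi>x" by (rule ip_tendsto[OF L2_h1(1) u(1) L\<phi>(2) u(2)])
    moreover have "(\<lambda>n. - ip K (hx (X n)) \<phi>) \<longlonglongrightarrow> - ip K ux \<phi>" by (intro tendsto_intros ip_tendsto[OF L2_h1(2) ux(1) L\<phi>(1) ux(2)])
    ultimately show "ip K u \<phi>x = - ip K ux \<phi>" unfolding eq by (rule LIMSEQ_unique)
    have "(\<lambda>n. ip K (hv (X n)) \<phi>y) \<longlonglongrightarrow> ip K u \<phi>y" by (rule ip_tendsto[OF L2_h1(1) u(1) L\<phi>(3) u(2)])
    moreover have "(\<lambda>n. - ip K (hy (X n)) \<phi>) \<longlonglongrightarrow> - ip K uy \<phi>" by (intro tendsto_intros ip_tendsto[OF L2_h1(3) uy(1) L\<phi>(1) uy(2)])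
    ultimately show "ip K u \<phi>y = - ip K uy \<phi>" unfolding eq by (rule LIMSEQ_unique)
  qed
  have "(\<lambda>n. hh (X n - mk u ux uy) (X n - mk u ux uy)) \<longlonglongrightarrow> 0 + 0 + 0"
    unfolding hh_eq h1_sel mk_sel[OF wg] by (intro tendsto_intros u ux uy)
  then show ?thesis by auto
qed

lemma hat_support: "hat l r x \<noteq> 0 \<Longrightarrow> l \<le> r \<Longrightarrow> l < x \<and> x < r"
proof -
  assume "hat l r x \<noteq> 0" "l \<le> r"
  then have "0 < (x - l) * (r - x)" by (auto simp: hat_def max_def split: if_splits intro: less_le[THEN iffD2])
  then show ?thesis using \<open>l \<le> r\<close> by (auto simp: zero_less_mult_iff)
qed

text \<open>Bumps on vertical strips of the interior box: they vanish on the edges, so they satisfy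
  either boundary condition, and disjointness of the strips makes them orthogonal.\<close>

lemma Vset_infinite_dim: "\<exists>e. orthonormal_family hb (Vset bc) k e"
proof -
  \<comment> \<open>Cuts the interval from 1/8 to 3/8 into \<open>k + 1\<close> strips, so that the
    width is positive also for \<open>k = 0\<close>; the bumps sit on the first
    \<open>k\<close>.\<close>
  define l where "l i = 1/8 + real i / (4 * real (k + 1))" for i :: nat
  have l: "1/8 \<le> l i" "l i < l (Suc i)" for i by (auto simp: l_def divide_strict_right_mono)
  have lmono: "i \<le> j \<Longrightarrow> l i \<le> l j" for i j by (auto simp: l_def divide_right_mono)
  have lk: "l (Suc i) \<le> 3/8" if "i < k" for i using that by (auto simp: l_def field_simps)
  define B where "B i = mk (bump (l i) (l (Suc i)) (1/8) (3/8)) (bumpx (l i) (l (Suc i)) (1/8) (3/8)) (bumpy (l i) (l (Suc i)) (1/8) (3/8))" for i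
  have B: "B i \<in> CC" "hv (B i) = bump (l i) (l (Suc i)) (1/8) (3/8)" for i
    using mk_CC[OF C1_bump[of "l i" "l (Suc i)" "1/8" "3/8"]] by (auto simp: B_def)
  have edge0: "hv (B i) (edge j t) = 0" if "i < k" "j < 3" for i j t
  proof -
    have "edge j t \<notin> {l i..l (Suc i)} \<times> {1/8..3/8}"
    proof -
      have "j = 0 \<or> j = 1 \<or> j = 2" using that by auto
      then show ?thesis using l(1)[of i] lk[OF that(1)] by (auto simp: edge_def cyc_def numeral_2_eq_2)
    qed
    then show ?thesis unfolding B using l(2)[of i] by (intro bump_zero(1)) auto
  qed
  have BV: "B i \<in> Vset bc" if "i < k" for i
  proof -
    have "tau bc j (hv (B i)) = 0" if "j < 3" for j
      using edge0[OF \<open>i < k\<close> that] by (simp add: tau_def edge_mean_def split: bctype.split)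
    then have "tausum bc (B i) = 0" by (simp add: tausum_def)
    then show ?thesis unfolding Vset_def using B(1)[of i] hh.scale_left[of 0 0 0] by (auto intro!: bexI[of _ "B i"])
  qed
  have orth: "hb (B i) (B j) = 0" if "i < j" for i j
  proof -
    have "hv (B i) z * hv (B j) z = 0" for z
    proof (rule ccontr)
      assume "hv (B i) z * hv (B j) z \<noteq> 0"
      then have "hat (l i) (l (Suc i)) (fst z) \<noteq> 0" "hat (l j) (l (Suc j)) (fst z) \<noteq> 0" by (auto simp: B bump_def)
      then have "fst z < l (Suc i)" "l j < fst z" using hat_support l(2) by (meson less_imp_le)+
      then show False using lmono[of "Suc i" j] that by simp
    qed
    then have "(\<lambda>z. hv (B i) z * hv (B j) z) = (\<lambda>z. 0)" by (rule ext)
    then show ?thesis by (simp only: hb_def ip_def Bochner_Integration.integral_zero)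
  qed
  have pos: "hb (B i) (B i) > 0" if "i < k" for i
  proof -
    have "hb (B i) (B i) \<noteq> 0"
    proof
      assume "hb (B i) (B i) = 0"
      then have AE: "AE z in lebesgue_on K. hv (B i) z = 0" unfolding hb_def by (rule AE_zero_if_ip_zero[OF L2_h1(1)])
      obtain c where c: "c > 0" "(\<integral>\<^sup>+z. ennreal (hv (B i) z) \<partial>lborel) = ennreal c"
        using bump_integral[of "l i" "l (Suc i)" "1/8" "3/8"] l(2)[of i] by (auto simp: B)
      have [measurable]: "hv (B i) \<in> borel_measurable borel"
        by (rule borel_measurable_continuous_onI[OF hv_cont[OF B(1)]])
      have "{l i..l (Suc i)} \<times> {1/8..3/8} \<subseteq> interior K"
        using l(1)[of i] lk[OF that] by (intro rectangle_interior_K) auto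
      then have out: "hv (B i) z = 0" if "z \<notin> K" for z
        unfolding B using l(2)[of i] that interior_subset[of K] by (intro bump_zero(1)) auto
      have "ennreal c = (\<integral>\<^sup>+z. ennreal (hv (B i) z) * indicator K z \<partial>lborel)"
        unfolding c(2)[symmetric] using out by (intro nn_integral_cong) (auto simp: indicator_def)
      also have "\<dots> = (\<integral>\<^sup>+z. ennreal (hv (B i) z) \<partial>lebesgue_on K)"
        by (rule nn_integral_lebesgue_on_borel[symmetric]) measurable
      also have "\<dots> = (\<integral>\<^sup>+z. 0 \<partial>lebesgue_on K)"
        by (rule nn_integral_cong_AE) (use AE in auto)
      finally show False using c(1) by simp
    qed
    then show ?thesis using hb.nonneg[of "B i"] by simp
  qed
  define e where "e i = (1 / sqrt (hb (B i) (B i))) *\<^sub>R B i" for i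
  have "orthonormal_family hb (Vset bc) k e"
    unfolding orthonormal_family_def
  proof (intro conjI allI impI)
    show "e i \<in> Vset bc" if "i < k" for i
      unfolding e_def using BV[OF that] subspace_Vset by (intro subspace_scale)
    show "hb (e i) (e j) = (if i = j then 1 else 0)" if "i < k" "j < k" for i j
      using pos[OF that(1)] orth[of i j] orth[of j i] hb.commute[of "B i" "B j"]
      by (cases i j rule: linorder_cases) (auto simp: e_def hb.bilinear_simps)
  qed
  then show ?thesis by blast
qed

lemma compact_form_pair_Vset: "compact_form_pair (\<lambda>x y. hd1 x y + hd2 x y) hb (Vset bc)"
proof -
  have "semi_inner (\<lambda>x y. 1 * hd1 x y + 1 * hd2 x y)"
    by (intro semi_inner_lincomb semi_inner_hd1 semi_inner_hd2) auto
  then interpret d: semi_inner "\<lambda>x y. hd1 x y + hd2 x y" by simp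
  show ?thesis
  proof unfold_locales
    show "subspace (Vset bc)" by (rule subspace_Vset)
    show "hb v v = 0" if "v \<in> Vset bc" "hd1 v v + hd2 v v = 0" for v by (rule Vset_definite[OF that])
    show "\<exists>r::nat \<Rightarrow> nat. strict_mono r \<and> (\<forall>e>0. \<exists>N::nat. \<forall>m\<ge>N. \<forall>n\<ge>N. hb (x (r m) - x (r n)) (x (r m) - x (r n)) < e)"
      if "\<And>n. x n \<in> Vset bc" "\<And>n. hd1 (x n) (x n) + hd2 (x n) (x n) + hb (x n) (x n) \<le> C" for x C
      by (rule Vset_compact[OF that(2)])
    show "\<exists>v\<in>Vset bc. (\<lambda>n. hd1 (x n - v) (x n - v) + hd2 (x n - v) (x n - v) + hb (x n - v) (x n - v)) \<longlonglongrightarrow> 0"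
      if x: "\<And>n. x n \<in> Vset bc" "\<forall>e>0. \<exists>N::nat. \<forall>m\<ge>N. \<forall>n\<ge>N. hd1 (x m - x n) (x m - x n)
        + hd2 (x m - x n) (x m - x n) + hb (x m - x n) (x m - x n) < e" for x
    proof -
      obtain U where U: "(\<lambda>n. hh (x n - U) (x n - U)) \<longlonglongrightarrow> 0"
        using h1_complete[of x] x(2) unfolding hh_def by blast
      then show ?thesis using Vset_closed[OF x(1) U] unfolding hh_def by blast
    qed
    show "\<exists>e. orthonormal_family hb (Vset bc) k e" for k by (rule Vset_infinite_dim)
  qed
qed

lemma form_family_Vset: "form_family hd1 hd2 hb (Vset bc)"
  unfolding form_family_def using semi_inner_hd1 semi_inner_hd2 compact_form_pair_Vset by blast

section \<open>Boundary conditions on the reference triangle\<close>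

lemma seg_int_edge:
  "seg_int (0, 0) (1, 0) f = edge_mean 0 f * norm ((1, 0) - (0, 0) :: pt)"
  "seg_int (1, 0) (0, 1) f = edge_mean 1 f * norm ((0, 1) - (1, 0) :: pt)"
  "seg_int (0, 1) (0, 0) f = edge_mean 2 f * norm ((0, 0) - (0, 1) :: pt)"
proof -
  have "(0, 0) + t *\<^sub>R ((1, 0) - (0, 0)) = edge 0 t" "(1, 0) + t *\<^sub>R ((0, 1) - (1, 0)) = edge 1 t"
    "(0, 1) + t *\<^sub>R ((0, 0) - (0, 1)) = edge 2 t" for t :: real
    by (simp_all add: edge_def cyc_def numeral_2_eq_2)
  then show "seg_int (0, 0) (1, 0) f = edge_mean 0 f * norm ((1, 0) - (0, 0) :: pt)"
    "seg_int (1, 0) (0, 1) f = edge_mean 1 f * norm ((0, 1) - (1, 0) :: pt)"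
    "seg_int (0, 1) (0, 0) f = edge_mean 2 f * norm ((0, 0) - (0, 1) :: pt)"
    unfolding seg_int_def edge_mean_def by (simp_all only:)
qed

text \<open>By uniqueness of weak gradients, elements that differ only in the chosen gradient are at
  distance zero. This reconciles the definitions, which quantify over gradients, with elements of
  \<open>h1\<close>, which carry one.\<close>

lemma same_value_hh:
  assumes "hv U = hv W"
  shows "hh (U - W) (U - W) = 0"
proof -
  have 0: "ip K (hv (U - W)) (hv (U - W)) = 0" using assms by (simp add: h1_sel)
  from K.weak_grad_zero[OF weak_grad_h1 0] 0 show ?thesis by (simp add: hh_eq)
qed

definition approx :: "h1 \<Rightarrow> (nat \<Rightarrow> h1) \<Rightarrow> bool" where
  "approx U X \<longleftrightarrow> (\<forall>n. X n \<in> CC) \<and> (\<lambda>n. hh (U - X n) (U - X n)) \<longlonglongrightarrow> 0"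

text \<open>Both trace conditions have this shape, with \<open>\<sigma>\<close> the edge integral of
  the square or of the function itself. The gradient chosen on the left may be replaced by the one
  carried by \<open>U\<close>, the two being at distance zero.\<close>

lemma trace_condition_iff:
  "(\<exists>ux uy. weak_grad K (hv U) ux uy \<and>
      (\<forall>w wx wy. H1_approx K (hv U) ux uy w wx wy \<longrightarrow> (\<lambda>n. \<sigma> (w n)) \<longlonglongrightarrow> 0))
    \<longleftrightarrow> (\<forall>X. approx U X \<longrightarrow> (\<lambda>n. \<sigma> (hv (X n))) \<longlonglongrightarrow> (0 :: real))" (is "?L \<longleftrightarrow> ?R")
proof
  assume ?L
  then obtain ux uy where wg: "weak_grad K (hv U) ux uy"
    and lim: "\<And>w wx wy. H1_approx K (hv U) ux uy w wx wy \<Longrightarrow> (\<lambda>n. \<sigma> (w n)) \<longlonglongrightarrow> 0" by blast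
  let ?U = "mk (hv U) ux uy"
  have same: "hh (U - ?U) (U - ?U) = 0" using wg by (intro same_value_hh) simp
  show ?R
  proof (intro allI impI)
    fix X assume X: "approx U X"
    have "h1dist2 K (hv U) ux uy (hv (X n)) (hx (X n)) (hy (X n)) = hh (U - X n) (U - X n)" for n
      using h1dist2_hh[of ?U "X n"] hh.dist_cong[OF same, of "X n"] wg by simp
    then have "H1_approx K (hv U) ux uy (\<lambda>n. hv (X n)) (\<lambda>n. hx (X n)) (\<lambda>n. hy (X n))"
      using X unfolding H1_approx_def approx_def CC_def by simp
    then show "(\<lambda>n. \<sigma> (hv (X n))) \<longlonglongrightarrow> 0" by (rule lim)
  qed
next
  assume R: ?R
  show ?L
  proof (intro exI conjI allI impI)
    show "weak_grad K (hv U) (hx U) (hy U)" by (rule weak_grad_h1)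
    fix w wx wy assume a: "H1_approx K (hv U) (hx U) (hy U) w wx wy"
    define X where "X n = mk (w n) (wx n) (wy n)" for n
    have C: "C1_fun (w n) (wx n) (wy n)" for n using a by (simp add: H1_approx_def)
    have sel: "hv (X n) = w n" "hx (X n) = wx n" "hy (X n) = wy n" "X n \<in> CC" for n
      using mk_CC[OF C] by (auto simp: X_def)
    have "approx U X"
      using a h1dist2_hh[of U "X _"] unfolding approx_def H1_approx_def by (simp add: sel)
    then show "(\<lambda>n. \<sigma> (w n)) \<longlonglongrightarrow> 0" using R by (auto simp: sel)
  qed
qed

lemma tendsto_mult_pos_iff:
  fixes f :: "nat \<Rightarrow> real"
  assumes "c > 0"
  shows "(\<lambda>n. f n * c) \<longlonglongrightarrow> 0 \<longleftrightarrow> f \<longlonglongrightarrow> 0"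
  using tendsto_mult_right_iff[of c f 0 sequentially] assms by simp

lemma tendsto_square_zero_iff:
  fixes f :: "nat \<Rightarrow> real"
  shows "f \<longlonglongrightarrow> 0 \<longleftrightarrow> (\<lambda>n. (f n)\<^sup>2) \<longlonglongrightarrow> 0"
proof
  assume "f \<longlonglongrightarrow> 0"
  from tendsto_power[OF this, of 2] show "(\<lambda>n. (f n)\<^sup>2) \<longlonglongrightarrow> 0" by simp
next
  assume "(\<lambda>n. (f n)\<^sup>2) \<longlonglongrightarrow> 0"
  from tendsto_real_sqrt[OF this] show "f \<longlonglongrightarrow> 0" by (simp add: tendsto_rabs_zero_iff)
qed

text \<open>The edge length is a positive constant factor and squaring does not affect convergence
  to 0, so both definitional conditions become convergence of \<open>tau\<close>.\<close>

lemma edge_condition_iff: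
  assumes seg: "\<And>f. seg_int A B f = edge_mean j f * norm (B - A)" and "A \<noteq> B"
  shows "trace_zero K A B (hv U) \<longleftrightarrow> (\<forall>X. approx U X \<longrightarrow> (\<lambda>n. tau Dirichlet j (hv (X n))) \<longlonglongrightarrow> 0)"
    and "edge_int_zero K A B (hv U) \<longleftrightarrow> (\<forall>X. approx U X \<longrightarrow> (\<lambda>n. tau EdgeMean j (hv (X n))) \<longlonglongrightarrow> 0)"
proof -
  have n: "norm (B - A) > 0" using \<open>A \<noteq> B\<close> by simp
  show "trace_zero K A B (hv U) \<longleftrightarrow> (\<forall>X. approx U X \<longrightarrow> (\<lambda>n. tau Dirichlet j (hv (X n))) \<longlonglongrightarrow> 0)"
    unfolding trace_zero_def trace_condition_iff[of U "\<lambda>w. seg_int A B (\<lambda>z. (w z)\<^sup>2)"]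
    by (simp add: seg tendsto_mult_pos_iff[OF n] tau_def)
  show "edge_int_zero K A B (hv U) \<longleftrightarrow> (\<forall>X. approx U X \<longrightarrow> (\<lambda>n. tau EdgeMean j (hv (X n))) \<longlonglongrightarrow> 0)"
    unfolding edge_int_zero_def trace_condition_iff[of U "seg_int A B"]
    by (simp add: seg tendsto_mult_pos_iff[OF n] tau_def flip: tendsto_square_zero_iff)
qed

lemma tausum_tendsto_iff:
  "(\<lambda>n. tausum bc (X n)) \<longlonglongrightarrow> 0 \<longleftrightarrow> (\<lambda>n. tau bc 0 (hv (X n))) \<longlonglongrightarrow> 0
    \<and> (\<lambda>n. tau bc 1 (hv (X n))) \<longlonglongrightarrow> 0 \<and> (\<lambda>n. tau bc 2 (hv (X n))) \<longlonglongrightarrow> 0"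
proof
  assume l: "(\<lambda>n. tausum bc (X n)) \<longlonglongrightarrow> 0"
  have "tau bc 0 (hv (X n)) \<le> tausum bc (X n)" "tau bc 1 (hv (X n)) \<le> tausum bc (X n)"
    "tau bc 2 (hv (X n)) \<le> tausum bc (X n)" for n by (simp_all add: tausum_def tau_nonneg)
  then show "(\<lambda>n. tau bc 0 (hv (X n))) \<longlonglongrightarrow> 0 \<and> (\<lambda>n. tau bc 1 (hv (X n))) \<longlonglongrightarrow> 0 \<and> (\<lambda>n. tau bc 2 (hv (X n))) \<longlonglongrightarrow> 0"
    by (intro conjI; intro tendsto_sandwich[OF _ _ tendsto_const l]) (auto simp: tau_nonneg)
next
  assume "(\<lambda>n. tau bc 0 (hv (X n))) \<longlonglongrightarrow> 0 \<and> (\<lambda>n. tau bc 1 (hv (X n))) \<longlonglongrightarrow> 0 \<and> (\<lambda>n. tau bc 2 (hv (X n))) \<longlonglongrightarrow> 0"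
  then have "(\<lambda>n. tau bc 0 (hv (X n)) + tau bc 1 (hv (X n)) + tau bc 2 (hv (X n))) \<longlonglongrightarrow> 0 + 0 + 0"
    by (intro tendsto_add) auto
  then show "(\<lambda>n. tausum bc (X n)) \<longlonglongrightarrow> 0" by (simp add: tausum_def)
qed

text \<open>The trace inequality spreads small edge terms from one approximant near \<open>U\<close>
  to every approximating sequence. Conversely, density provides at least one such sequence, so the
  universal condition is not vacuous.\<close>

lemma Vset_iff_approx: "U \<in> Vset bc \<longleftrightarrow> (\<forall>X. approx U X \<longrightarrow> (\<lambda>n. tausum bc (X n)) \<longlonglongrightarrow> 0)"
proof
  assume U: "U \<in> Vset bc"
  show "\<forall>X. approx U X \<longrightarrow> (\<lambda>n. tausum bc (X n)) \<longlonglongrightarrow> 0"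
  proof (intro allI impI LIMSEQ_I)
    fix X and r :: real assume X: "approx U X" and "r > 0"
    \<comment> \<open>The estimates below add up to \<open>2 * 156 * q + 2 * q\<close>, less than
      \<open>400 * q\<close>; 156 is 4 times 39.\<close>
    define q where "q = r / 400"
    have q: "q > 0" using \<open>r > 0\<close> by (simp add: q_def)
    obtain W where W: "W \<in> CC" "hh (U - W) (U - W) < q" "tausum bc W < q" using U q unfolding Vset_def by blast
    from X have "(\<lambda>n. hh (U - X n) (U - X n)) \<longlonglongrightarrow> 0" by (simp add: approx_def)
    from LIMSEQ_D[OF this q] obtain N where N: "\<And>n. n \<ge> N \<Longrightarrow> hh (U - X n) (U - X n) < q" using hh.nonneg by auto
    have "tausum bc (X n) < r" if "n \<ge> N" for n
    proof -
      have Xn: "X n \<in> CC" using X by (simp add: approx_def)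
      have "hh (X n - W) (X n - W) \<le> 2 * hh (X n - U) (X n - U) + 2 * hh (U - W) (U - W)" by (rule hh.triangle2)
      then have "hh (X n - W) (X n - W) \<le> 4 * q" using N[OF that] W(2) hh.diff_commute[of "X n" U] by simp
      then have "tausum bc (X n - W) \<le> 156 * q" using tausum_trace[OF CC_diff[OF Xn W(1)], of bc] by simp
      moreover have "tausum bc (X n) \<le> 2 * tausum bc (X n - W) + 2 * tausum bc W"
        using tausum_add[OF CC_diff[OF Xn W(1)] W(1), of bc] by simp
      ultimately show ?thesis using W(3) \<open>r > 0\<close> by (simp add: q_def)
    qed
    then show "\<exists>no. \<forall>n\<ge>no. norm (tausum bc (X n) - 0) < r" by (intro exI[of _ N]) (simp add: tausum_nonneg)
  qed
next
  assume R: "\<forall>X. approx U X \<longrightarrow> (\<lambda>n. tausum bc (X n)) \<longlonglongrightarrow> 0"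
  have "\<forall>n. \<exists>W\<in>CC. hh (U - W) (U - W) < inverse (real (Suc n))" using CC_dense by simp
  then obtain X where X: "\<And>n. X n \<in> CC" "\<And>n. hh (U - X n) (U - X n) < inverse (real (Suc n))" by metis
  have lim: "(\<lambda>n. hh (U - X n) (U - X n)) \<longlonglongrightarrow> 0"
    by (rule tendsto_sandwich[OF _ _ tendsto_const LIMSEQ_inverse_real_of_nat];
        intro always_eventually allI hh.nonneg less_imp_le[OF X(2)])
  then have tl: "(\<lambda>n. tausum bc (X n)) \<longlonglongrightarrow> 0" using R X(1) by (simp add: approx_def)
  show "U \<in> Vset bc" unfolding Vset_def
  proof (intro CollectI allI impI)
    fix r :: real assume "r > 0"
    from LIMSEQ_D[OF lim this] obtain N1 where N1: "\<And>n. n \<ge> N1 \<Longrightarrow> hh (U - X n) (U - X n) < r" using hh.nonneg by auto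
    from LIMSEQ_D[OF tl \<open>r > 0\<close>] obtain N2 where N2: "\<And>n. n \<ge> N2 \<Longrightarrow> tausum bc (X n) < r" using tausum_nonneg by auto
    show "\<exists>W\<in>CC. hh (U - W) (U - W) < r \<and> tausum bc W < r"
      using X(1) N1[of "max N1 N2"] N2[of "max N1 N2"] by (intro bexI[of _ "X (max N1 N2)"]) auto
  qed
qed

lemma Vspace_Kref_iff: "Vspace bc Kref (hv U) \<longleftrightarrow> U \<in> Vset bc"
proof -
  have H1: "H1 K (hv U)" unfolding H1_def using weak_grad_h1 by blast
  note e0 = edge_condition_iff[OF seg_int_edge(1), of U]
    and e1 = edge_condition_iff[OF seg_int_edge(2), of U]
    and e2 = edge_condition_iff[OF seg_int_edge(3), of U]
  show ?thesis
  proof (cases bc)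
    case Dirichlet
    show ?thesis
      unfolding Vset_iff_approx tausum_tendsto_iff Vspace_def Let_def fst_conv snd_conv Dirichlet bctype.case
      using H1 e0(1) e1(1) e2(1) by simp blast
  next
    case EdgeMean
    show ?thesis
      unfolding Vset_iff_approx tausum_tendsto_iff Vspace_def Let_def fst_conv snd_conv EdgeMean bctype.case
      using H1 e0(2) e1(2) e2(2) by simp blast
  qed
qed

section \<open>Shear maps\<close>

text \<open>For \<open>b = cos \<theta>\<close> and \<open>d = sin \<theta>\<close> this carries the
  reference triangle to the one of angle \<theta>. The inverse is again of this form, so each
  transfer lemma serves both directions.\<close>

definition shear :: "real \<Rightarrow> real \<Rightarrow> pt \<Rightarrow> pt" where
  "shear b d z = (fst z + b * snd z, d * snd z)"

lemma shear_inverse: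
  assumes "d \<noteq> 0"
  shows "shear b d (shear (- b / d) (1 / d) z) = z" "shear (- b / d) (1 / d) (shear b d z) = z"
  using assms by (auto simp: shear_def prod_eq_iff)

lemma shear_linear: "linear (shear b d)"
  by (rule linearI) (auto simp: shear_def algebra_simps)

lemma shear_cont: "continuous_on A (shear b d)"
  unfolding shear_def[abs_def] by (intro continuous_intros)

lemma shear_measurable [measurable]: "shear b d \<in> borel_measurable borel"
  by (rule borel_measurable_continuous_onI[OF shear_cont])

text \<open>For fixed \<open>y\<close> a translation in \<open>x\<close>, then for fixed
  \<open>x\<close> a scaling in \<open>y\<close>; only the latter contributes to the
  Jacobian.\<close>

lemma nn_integral_shear:
  fixes f :: "pt \<Rightarrow> ennreal"
  assumes [measurable]: "f \<in> borel_measurable borel" and d: "d \<noteq> 0"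
  shows "(\<integral>\<^sup>+z. f z \<partial>lborel) = ennreal \<bar>d\<bar> * (\<integral>\<^sup>+z. f (shear b d z) \<partial>lborel)"
proof -
  have fm[measurable]: "f \<in> borel_measurable (borel \<Otimes>\<^sub>M borel)" using assms(1) by (simp only: borel_prod)
  have gm: "(\<lambda>z. f (shear b d z)) \<in> borel_measurable (lborel \<Otimes>\<^sub>M lborel)" by (simp add: lborel_prod)
  have fm': "f \<in> borel_measurable (lborel \<Otimes>\<^sub>M lborel)" by (simp add: lborel_prod)
  have "(\<integral>\<^sup>+z. f (shear b d z) \<partial>lborel) = (\<integral>\<^sup>+z. f (shear b d z) \<partial>(lborel \<Otimes>\<^sub>M lborel))" by (simp only: lborel_prod)
  also have "\<dots> = (\<integral>\<^sup>+y. \<integral>\<^sup>+x. f (x + b * y, d * y) \<partial>lborel \<partial>lborel)"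
    using lborel_pair.nn_integral_snd[OF gm] by (simp add: shear_def)
  also have "\<dots> = (\<integral>\<^sup>+y. \<integral>\<^sup>+x. f (x, d * y) \<partial>lborel \<partial>lborel)"
  proof (rule nn_integral_cong)
    fix y :: real
    have "(\<integral>\<^sup>+x. f (x, d * y) \<partial>lborel) = ennreal \<bar>1\<bar> * (\<integral>\<^sup>+x. f (b * y + 1 * x, d * y) \<partial>lborel)"
      by (rule nn_integral_real_affine) auto
    then show "(\<integral>\<^sup>+x. f (x + b * y, d * y) \<partial>lborel) = (\<integral>\<^sup>+x. f (x, d * y) \<partial>lborel)" by (simp add: add.commute)
  qed
  also have "\<dots> = (\<integral>\<^sup>+x. \<integral>\<^sup>+y. f (x, d * y) \<partial>lborel \<partial>lborel)"
    by (rule lborel_pair.Fubini') measurable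
  finally have "ennreal \<bar>d\<bar> * (\<integral>\<^sup>+z. f (shear b d z) \<partial>lborel) = (\<integral>\<^sup>+x. ennreal \<bar>d\<bar> * (\<integral>\<^sup>+y. f (x, d * y) \<partial>lborel) \<partial>lborel)"
    by (simp add: nn_integral_cmult)
  also have "\<dots> = (\<integral>\<^sup>+x. \<integral>\<^sup>+y. f (x, y) \<partial>lborel \<partial>lborel)"
  proof (rule nn_integral_cong)
    fix x :: real
    have "(\<integral>\<^sup>+y. f (x, y) \<partial>lborel) = ennreal \<bar>d\<bar> * (\<integral>\<^sup>+y. f (x, 0 + d * y) \<partial>lborel)"
      using d by (intro nn_integral_real_affine) auto
    then show "ennreal \<bar>d\<bar> * (\<integral>\<^sup>+y. f (x, d * y) \<partial>lborel) = (\<integral>\<^sup>+y. f (x, y) \<partial>lborel)" by simp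
  qed
  also have "\<dots> = (\<integral>\<^sup>+z. f z \<partial>(lborel \<Otimes>\<^sub>M lborel))"
    by (rule lborel.nn_integral_fst[OF fm'])
  finally show ?thesis by (simp only: lborel_prod)
qed

lemma lborel_shear:
  assumes "d \<noteq> 0"
  shows "lborel = density (distr lborel borel (shear b d)) (\<lambda>_. ennreal \<bar>d\<bar>)"
proof (rule measure_eqI)
  fix A :: "pt set" assume "A \<in> sets lborel"
  then have [measurable]: "A \<in> sets borel" by simp
  have "emeasure lborel A = (\<integral>\<^sup>+z. indicator A z \<partial>lborel)" by simp
  also have "\<dots> = ennreal \<bar>d\<bar> * (\<integral>\<^sup>+z. indicator A (shear b d z) \<partial>lborel)"
    by (rule nn_integral_shear) (use assms in auto)
  also have "(\<integral>\<^sup>+z. indicator A (shear b d z) \<partial>lborel) = emeasure (distr lborel borel (shear b d)) A"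
    by (subst nn_integral_distr[symmetric, of "shear b d" lborel borel "indicator A"]) auto
  finally show "emeasure lborel A = emeasure (density (distr lborel borel (shear b d)) (\<lambda>_. ennreal \<bar>d\<bar>)) A"
    by (simp add: emeasure_density nn_integral_cmult)
qed simp

text \<open>The functions in the definitions are only Lebesgue measurable, so the Borel change of
  variables has to be lifted to the completion; this works because a Borel set is null exactly when
  its preimage is.\<close>

lemma
  assumes d: "d \<noteq> 0"
  shows lebesgue_shear: "lebesgue = density (distr lebesgue lebesgue (shear b d)) (\<lambda>_. ennreal \<bar>d\<bar>)"
    and shear_lebesgue_measurable: "shear b d \<in> lebesgue \<rightarrow>\<^sub>M lebesgue"
proof -
  { fix A :: "pt set" assume A: "A \<in> sets borel"
    then have "emeasure lborel A = 0 \<longleftrightarrow> emeasure (density (distr lborel borel (shear b d)) (\<lambda>_. ennreal \<bar>d\<bar>)) A = 0"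
      using lborel_shear[OF d, of b] by simp
    also have "\<dots> \<longleftrightarrow> emeasure (distr lebesgue lborel (shear b d)) A = 0"
      using A d by (simp add: distr_completion emeasure_density nn_integral_cmult cong: distr_cong)
    finally have "emeasure lborel A = 0 \<longleftrightarrow> emeasure (distr lebesgue lborel (shear b d)) A = 0" . }
  then have eq: "null_sets lborel = null_sets (distr lebesgue lborel (shear b d))"
    by (auto simp: null_sets_def)
  show "shear b d \<in> lebesgue \<rightarrow>\<^sub>M lebesgue"
    by (simp add: completion.measurable_completion2 eq measurable_completion)
  have "lebesgue = completion (density (distr lborel borel (shear b d)) (\<lambda>_. ennreal \<bar>d\<bar>))"
    using lborel_shear[OF d, of b] by simp
  also have "\<dots> = density (completion (distr lebesgue lborel (shear b d))) (\<lambda>_. ennreal \<bar>d\<bar>)"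
    using d by (auto intro!: always_eventually completion_density_eq simp: distr_completion cong: distr_cong)
  also have "\<dots> = density (distr lebesgue lebesgue (shear b d)) (\<lambda>_. ennreal \<bar>d\<bar>)"
    by (subst completion.completion_distr_eq) (auto simp: eq measurable_completion)
  finally show "lebesgue = density (distr lebesgue lebesgue (shear b d)) (\<lambda>_. ennreal \<bar>d\<bar>)" .
qed

lemma shear_inj: "d \<noteq> 0 \<Longrightarrow> inj (shear b d)"
  by (metis injI shear_inverse(2))

lemma compact_shear_image: "compact T \<Longrightarrow> compact (shear b d ` T)"
  by (intro compact_continuous_image shear_cont)

text \<open>Extending \<open>g\<close> by zero reduces everything to the whole plane; injectivity of
  the shear turns the indicator of the image into that of \<open>T\<close>.\<close>

lemma
  fixes g :: "pt \<Rightarrow> real"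
  assumes d: "d \<noteq> 0" and T: "compact T" and g: "g \<in> borel_measurable (lebesgue_on (shear b d ` T))"
  shows shear_integral: "(\<integral>z. g z \<partial>lebesgue_on (shear b d ` T)) = \<bar>d\<bar> * (\<integral>z. g (shear b d z) \<partial>lebesgue_on T)"
    and shear_integrable: "integrable (lebesgue_on (shear b d ` T)) g \<Longrightarrow> integrable (lebesgue_on T) (\<lambda>z. g (shear b d z))"
    and shear_borel_measurable: "(\<lambda>z. g (shear b d z)) \<in> borel_measurable (lebesgue_on T)"
proof -
  let ?F = "shear b d" and ?h = "\<lambda>z. indicator (shear b d ` T) z *\<^sub>R g z"
  have Ts: "T \<in> sets lebesgue" "?F ` T \<in> sets lebesgue"
    using T compact_shear_image[OF T] by (auto simp: lmeasurable_compact fmeasurableD)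
  have Fm: "?F \<in> lebesgue \<rightarrow>\<^sub>M lebesgue" by (rule shear_lebesgue_measurable[OF d])
  have hm: "?h \<in> borel_measurable lebesgue"
    using g Ts by (subst (asm) borel_measurable_restrict_space_iff) auto
  have hF: "?h (?F z) = indicator T z *\<^sub>R g (?F z)" for z
    using inj_image_mem_iff[OF shear_inj[OF d]] by (auto simp: indicator_def)
  have hFm: "(\<lambda>z. ?h (?F z)) \<in> borel_measurable lebesgue" by (rule measurable_compose[OF Fm hm])
  show "(\<lambda>z. g (?F z)) \<in> borel_measurable (lebesgue_on T)"
    using hFm Ts unfolding hF by (subst borel_measurable_restrict_space_iff) auto
  have "(\<integral>z. g z \<partial>lebesgue_on (?F ` T)) = (\<integral>z. ?h z \<partial>lebesgue)"
    using Ts by (intro integral_restrict_space) auto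
  also have "\<dots> = (\<integral>z. ?h z \<partial>density (distr lebesgue lebesgue ?F) (\<lambda>_. ennreal \<bar>d\<bar>))"
    by (simp flip: lebesgue_shear[OF d])
  also have "\<dots> = (\<integral>z. \<bar>d\<bar> *\<^sub>R ?h z \<partial>distr lebesgue lebesgue ?F)"
    using hm by (intro integral_density) auto
  also have "\<dots> = (\<integral>z. \<bar>d\<bar> *\<^sub>R ?h (?F z) \<partial>lebesgue)"
    using hm Fm by (intro integral_distr) auto
  also have "\<dots> = \<bar>d\<bar> * (\<integral>z. g (?F z) \<partial>lebesgue_on T)"
    unfolding hF using Ts by (simp add: integral_restrict_space)
  finally show "(\<integral>z. g z \<partial>lebesgue_on (?F ` T)) = \<bar>d\<bar> * (\<integral>z. g (?F z) \<partial>lebesgue_on T)" .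
  assume "integrable (lebesgue_on (?F ` T)) g"
  then have "integrable lebesgue ?h" using Ts by (subst (asm) integrable_restrict_space) auto
  then have "integrable (density (distr lebesgue lebesgue ?F) (\<lambda>_. ennreal \<bar>d\<bar>)) ?h" by (simp flip: lebesgue_shear[OF d])
  then have "integrable (distr lebesgue lebesgue ?F) (\<lambda>z. \<bar>d\<bar> *\<^sub>R ?h z)"
    using hm by (subst (asm) integrable_density) auto
  then have "integrable lebesgue (\<lambda>z. \<bar>d\<bar> *\<^sub>R ?h (?F z))"
    using hm Fm by (subst (asm) integrable_distr_eq) auto
  then have "integrable lebesgue (\<lambda>z. indicator T z *\<^sub>R g (?F z))"
    unfolding hF using d by simp
  then show "integrable (lebesgue_on T) (\<lambda>z. g (?F z))" using Ts by (subst integrable_restrict_space) auto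
qed

lemma L2_shear:
  assumes "d \<noteq> 0" "compact T" "L2 (shear b d ` T) u"
  shows "L2 T (\<lambda>z. u (shear b d z))"
  using assms shear_borel_measurable[OF assms(1,2), of u b] shear_integrable[OF assms(1,2), of "\<lambda>z. (u z)\<^sup>2" b]
  unfolding L2_def by auto

lemma ip_shear:
  assumes "d \<noteq> 0" "compact T" "L2 (shear b d ` T) u" "L2 (shear b d ` T) v"
  shows "ip (shear b d ` T) u v = \<bar>d\<bar> * ip T (\<lambda>z. u (shear b d z)) (\<lambda>z. v (shear b d z))"
  unfolding ip_def using assms by (intro shear_integral) (auto simp: L2_def)

lemma C1_shear:
  assumes w: "C1_fun w wx wy"
  shows "C1_fun (\<lambda>z. w (shear b d z)) (\<lambda>z. wx (shear b d z)) (\<lambda>z. b * wx (shear b d z) + d * wy (shear b d z))"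
  unfolding C1_fun_def
proof (intro conjI allI)
  fix z
  have 1: "(shear b d has_derivative (\<lambda>h. (fst h + b * snd h, d * snd h))) (at z)"
    unfolding shear_def[abs_def] by (auto intro!: derivative_eq_intros)
  have "(w has_derivative (\<lambda>h. wx (shear b d z) * fst h + wy (shear b d z) * snd h)) (at (shear b d z))"
    using w unfolding C1_fun_def by blast
  from diff_chain_at[OF 1 this]
  show "((\<lambda>z. w (shear b d z)) has_derivative (\<lambda>h. wx (shear b d z) * fst h + (b * wx (shear b d z) + d * wy (shear b d z)) * snd h)) (at z)"
    unfolding o_def by (rule has_derivative_eq_rhs) (auto simp: algebra_simps)
  have "continuous_on UNIV wx" "continuous_on UNIV wy" using w by (auto simp: C1_fun_def)
  then show "continuous_on UNIV (\<lambda>z. wx (shear b d z))" "continuous_on UNIV (\<lambda>z. b * wx (shear b d z) + d * wy (shear b d z))"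
    by (auto intro!: continuous_intros continuous_on_compose2[OF _ shear_cont])
qed

text \<open>A test function on \<open>T\<close> composed with the inverse shear is a test function
  on the image. The Jacobian cancels from both sides, and solving the two resulting identities for
  the \<open>y\<close> part gives the chain rule.\<close>

lemma weak_grad_shear:
  assumes d: "d \<noteq> 0" and T: "compact T" and wg: "weak_grad (shear b d ` T) u ux uy"
  shows "weak_grad T (\<lambda>z. u (shear b d z)) (\<lambda>z. ux (shear b d z)) (\<lambda>z. b * ux (shear b d z) + d * uy (shear b d z))"
proof -
  let ?F = "shear b d" and ?G = "shear (- b / d) (1 / d)"
  note inv = shear_inverse[OF d, of b]
  have L: "L2 (?F ` T) u" "L2 (?F ` T) ux" "L2 (?F ` T) uy" using wg by (auto simp: weak_grad_def)
  note LF = L2_shear[OF d T L(1)] L2_shear[OF d T L(2)] L2_shear[OF d T L(3)]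
  have T': "compact (?F ` T)" by (rule compact_shear_image[OF T])
  show ?thesis unfolding weak_grad_def
  proof (intro conjI allI impI)
    show "L2 T (\<lambda>z. u (?F z))" "L2 T (\<lambda>z. ux (?F z))" "L2 T (\<lambda>z. b * ux (?F z) + d * uy (?F z))"
      by (intro LF L2_add L2_cmult)+
    fix \<phi> \<phi>x \<phi>y
    assume "C1_fun \<phi> \<phi>x \<phi>y \<and> compact (closure {z. \<phi> z \<noteq> 0}) \<and> closure {z. \<phi> z \<noteq> 0} \<subseteq> interior T"
    then have \<phi>: "C1_fun \<phi> \<phi>x \<phi>y" and cpt: "compact (closure {z. \<phi> z \<noteq> 0})" and sub: "closure {z. \<phi> z \<noteq> 0} \<subseteq> interior T" by auto
    define \<psi> where "\<psi> z = \<phi> (?G z)" for z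
    define \<psi>x where "\<psi>x z = \<phi>x (?G z)" for z
    define \<psi>y where "\<psi>y z = - b / d * \<phi>x (?G z) + 1 / d * \<phi>y (?G z)" for z
    have \<psi>: "C1_fun \<psi> \<psi>x \<psi>y" unfolding \<psi>_def[abs_def] \<psi>x_def[abs_def] \<psi>y_def[abs_def] by (rule C1_shear[OF \<phi>])
    define Q where "Q = ?F ` closure {z. \<phi> z \<noteq> 0}"
    have Q: "compact Q" unfolding Q_def by (rule compact_shear_image[OF cpt])
    have "{z. \<psi> z \<noteq> 0} \<subseteq> Q"
    proof
      fix z assume "z \<in> {z. \<psi> z \<noteq> 0}"
      then have "?G z \<in> closure {z. \<phi> z \<noteq> 0}" using closure_subset[of "{z. \<phi> z \<noteq> 0}"] by (auto simp: \<psi>_def)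
      then show "z \<in> Q" unfolding Q_def using inv(1)[of z] by (metis imageI)
    qed
    then have clQ: "closure {z. \<psi> z \<noteq> 0} \<subseteq> Q" using compact_imp_closed[OF Q] by (rule closure_minimal)
    have "open (?F ` interior T)"
    proof -
      have "?F ` interior T = ?G -` interior T" using inv by (auto simp: image_iff) metis
      then show ?thesis using open_vimage[OF open_interior shear_cont] by metis
    qed
    then have "?F ` interior T \<subseteq> interior (?F ` T)" by (intro interior_maximal image_mono interior_subset)
    then have Qi: "Q \<subseteq> interior (?F ` T)" unfolding Q_def using sub by blast
    have "compact (closure {z. \<psi> z \<noteq> 0})" using clQ Q by (metis closed_closure compact_Int_closed inf.absorb_iff2)
    then have ibp: "ip (?F ` T) u \<psi>x = - ip (?F ` T) ux \<psi>" "ip (?F ` T) u \<psi>y = - ip (?F ` T) uy \<psi>"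
      using wg \<psi> clQ Qi unfolding weak_grad_def by blast+
    have L\<psi>: "L2 (?F ` T) \<psi>" "L2 (?F ` T) \<psi>x" "L2 (?F ` T) \<psi>y" using C1_fun_L2[OF T' \<psi>] by auto
    note L\<phi> = C1_fun_L2[OF T \<phi>]
    have comp: "(\<lambda>z. \<psi> (?F z)) = \<phi>" "(\<lambda>z. \<psi>x (?F z)) = \<phi>x" "(\<lambda>z. \<psi>y (?F z)) = (\<lambda>z. - b / d * \<phi>x z + 1 / d * \<phi>y z)"
      by (simp_all only: \<psi>_def \<psi>x_def \<psi>y_def inv(2))
    have x: "\<bar>d\<bar> * ip T (\<lambda>z. u (?F z)) \<phi>x = - (\<bar>d\<bar> * ip T (\<lambda>z. ux (?F z)) \<phi>)"
      using ibp(1) ip_shear[OF d T L(1) L\<psi>(2)] ip_shear[OF d T L(2) L\<psi>(1)] by (simp add: comp)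
    have y: "\<bar>d\<bar> * ip T (\<lambda>z. u (?F z)) (\<lambda>z. - b / d * \<phi>x z + 1 / d * \<phi>y z) = - (\<bar>d\<bar> * ip T (\<lambda>z. uy (?F z)) \<phi>)"
      using ibp(2) ip_shear[OF d T L(1) L\<psi>(3)] ip_shear[OF d T L(3) L\<psi>(1)] by (simp add: comp)
    have cancel: "p = - q" if "\<bar>d\<bar> * p = - (\<bar>d\<bar> * q)" for p q
    proof -
      have "\<bar>d\<bar> * (p + q) = 0" using that by (simp only: distrib_left)
      then show ?thesis using d by simp
    qed
    show X: "ip T (\<lambda>z. u (?F z)) \<phi>x = - ip T (\<lambda>z. ux (?F z)) \<phi>" by (rule cancel[OF x])
    have "ip T (\<lambda>z. u (?F z)) (\<lambda>z. - b / d * \<phi>x z + 1 / d * \<phi>y z) = - ip T (\<lambda>z. uy (?F z)) \<phi>" by (rule cancel[OF y])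
    then have "- b / d * ip T (\<lambda>z. u (?F z)) \<phi>x + 1 / d * ip T (\<lambda>z. u (?F z)) \<phi>y = - ip T (\<lambda>z. uy (?F z)) \<phi>"
      by (subst (asm) ip_add_right[OF LF(1) L2_cmult[OF L\<phi>(2)] L2_cmult[OF L\<phi>(3)]]) (simp only: ip_cmult_right)
    then have "ip T (\<lambda>z. u (?F z)) \<phi>y = b * ip T (\<lambda>z. u (?F z)) \<phi>x - d * ip T (\<lambda>z. uy (?F z)) \<phi>"
      using d by (simp add: field_simps)
    also have "\<dots> = - ip T (\<lambda>z. b * ux (?F z) + d * uy (?F z)) \<phi>"
      unfolding X using LF L\<phi> by (simp add: ip_add_left ip_cmult_left L2_cmult)
    finally show "ip T (\<lambda>z. u (?F z)) \<phi>y = - ip T (\<lambda>z. b * ux (?F z) + d * uy (?F z)) \<phi>" .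
  qed
qed

lemma h1dist2_nonneg: "0 \<le> h1dist2 T u ux uy w wx wy"
  by (simp add: h1dist2_def)

lemma h1dist2_shear_le:
  assumes d: "d \<noteq> 0" and T: "compact T" and wg: "weak_grad (shear b d ` T) u ux uy" and w: "C1_fun w wx wy"
  shows "h1dist2 T (\<lambda>z. u (shear b d z)) (\<lambda>z. ux (shear b d z)) (\<lambda>z. b * ux (shear b d z) + d * uy (shear b d z))
      (\<lambda>z. w (shear b d z)) (\<lambda>z. wx (shear b d z)) (\<lambda>z. b * wx (shear b d z) + d * wy (shear b d z))
    \<le> ((1 + 2 * b\<^sup>2 + 2 * d\<^sup>2) / \<bar>d\<bar>) * h1dist2 (shear b d ` T) u ux uy w wx wy"
proof -
  let ?F = "shear b d"
  have T': "compact (?F ` T)" by (rule compact_shear_image[OF T])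
  have L: "L2 (?F ` T) (\<lambda>z. u z - w z)" "L2 (?F ` T) (\<lambda>z. ux z - wx z)" "L2 (?F ` T) (\<lambda>z. uy z - wy z)"
    using wg C1_fun_L2[OF T' w] by (auto simp: weak_grad_def intro!: L2_diff)
  define p where "p = ip T (\<lambda>z. u (?F z) - w (?F z)) (\<lambda>z. u (?F z) - w (?F z))"
  define q where "q = ip T (\<lambda>z. ux (?F z) - wx (?F z)) (\<lambda>z. ux (?F z) - wx (?F z))"
  define r where "r = ip T (\<lambda>z. uy (?F z) - wy (?F z)) (\<lambda>z. uy (?F z) - wy (?F z))"
  have nn: "0 \<le> p" "0 \<le> q" "0 \<le> r" by (auto simp: p_def q_def r_def)
  have e: "h1dist2 (?F ` T) u ux uy w wx wy = \<bar>d\<bar> * (p + q + r)"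
    unfolding h1dist2_def p_def q_def r_def ip_shear[OF d T L(1,1)] ip_shear[OF d T L(2,2)] ip_shear[OF d T L(3,3)]
    by (simp add: distrib_left)
  have "ip T (\<lambda>z. (b * ux (?F z) + d * uy (?F z)) - (b * wx (?F z) + d * wy (?F z)))
      (\<lambda>z. (b * ux (?F z) + d * uy (?F z)) - (b * wx (?F z) + d * wy (?F z)))
    = ip T (\<lambda>z. b * (ux (?F z) - wx (?F z)) + d * (uy (?F z) - wy (?F z))) (\<lambda>z. b * (ux (?F z) - wx (?F z)) + d * (uy (?F z) - wy (?F z)))"
    by (simp add: algebra_simps)
  also have "\<dots> \<le> 2 * ip T (\<lambda>z. b * (ux (?F z) - wx (?F z))) (\<lambda>z. b * (ux (?F z) - wx (?F z)))
     + 2 * ip T (\<lambda>z. d * (uy (?F z) - wy (?F z))) (\<lambda>z. d * (uy (?F z) - wy (?F z)))"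
    by (intro ip_add_le L2_cmult L2_shear[OF d T L(2)] L2_shear[OF d T L(3)])
  also have "\<dots> = 2 * b\<^sup>2 * q + 2 * d\<^sup>2 * r"
    unfolding q_def r_def ip_cmult_left ip_cmult_right by (simp add: power2_eq_square)
  finally have "h1dist2 T (\<lambda>z. u (?F z)) (\<lambda>z. ux (?F z)) (\<lambda>z. b * ux (?F z) + d * uy (?F z))
      (\<lambda>z. w (?F z)) (\<lambda>z. wx (?F z)) (\<lambda>z. b * wx (?F z) + d * wy (?F z)) \<le> p + q + (2 * b\<^sup>2 * q + 2 * d\<^sup>2 * r)"
    unfolding h1dist2_def p_def q_def by simp
  also have "\<dots> \<le> (1 + 2 * b\<^sup>2 + 2 * d\<^sup>2) * (p + q + r)"
    using nn mult_nonneg_nonneg[of "b\<^sup>2" p] mult_nonneg_nonneg[of "b\<^sup>2" r] mult_nonneg_nonneg[of "d\<^sup>2" p] mult_nonneg_nonneg[of "d\<^sup>2" q]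
    by (simp add: algebra_simps)
  also have "\<dots> = ((1 + 2 * b\<^sup>2 + 2 * d\<^sup>2) / \<bar>d\<bar>) * h1dist2 (?F ` T) u ux uy w wx wy" unfolding e using d by simp
  finally show ?thesis .
qed

text \<open>Approximating sequences on \<open>T\<close> correspond to those on the image through the
  inverse shear, with comparable H1 distances. The functional is abstract so as to treat both trace
  conditions at once; in the applications \<open>c\<close> is a ratio of edge lengths.\<close>

lemma trace_condition_shear:
  fixes \<sigma> \<sigma>' :: "(pt \<Rightarrow> real) \<Rightarrow> real"
  assumes d: "d \<noteq> 0" and T: "compact T"
    and \<sigma>: "\<And>w. \<sigma> w = c * \<sigma>' (\<lambda>z. w (shear (- b / d) (1 / d) z))"
    and ex: "\<exists>ux uy. weak_grad (shear b d ` T) u ux uy \<and>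
      (\<forall>w wx wy. H1_approx (shear b d ` T) u ux uy w wx wy \<longrightarrow> (\<lambda>n. \<sigma>' (w n)) \<longlonglongrightarrow> 0)"
  shows "\<exists>ux uy. weak_grad T (\<lambda>z. u (shear b d z)) ux uy \<and>
      (\<forall>w wx wy. H1_approx T (\<lambda>z. u (shear b d z)) ux uy w wx wy \<longrightarrow> (\<lambda>n. \<sigma> (w n)) \<longlonglongrightarrow> 0)"
proof -
  let ?F = "shear b d" and ?G = "shear (- b / d) (1 / d)"
  note inv = shear_inverse[OF d, of b]
  obtain ux uy where wg: "weak_grad (?F ` T) u ux uy"
    and lim: "\<And>w wx wy. H1_approx (?F ` T) u ux uy w wx wy \<Longrightarrow> (\<lambda>n. \<sigma>' (w n)) \<longlonglongrightarrow> 0" using ex by blast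
  let ?ux = "\<lambda>z. ux (?F z)" and ?uy = "\<lambda>z. b * ux (?F z) + d * uy (?F z)"
  have wgT: "weak_grad T (\<lambda>z. u (?F z)) ?ux ?uy" by (rule weak_grad_shear[OF d T wg])
  have GF: "?G ` (?F ` T) = T" by (simp only: image_image inv(2) image_ident)
  have T': "compact (?F ` T)" by (rule compact_shear_image[OF T])
  have d': "1 / d \<noteq> 0" using d by simp
  have "(\<lambda>n. \<sigma> (w n)) \<longlonglongrightarrow> 0" if a: "H1_approx T (\<lambda>z. u (?F z)) ?ux ?uy w wx wy" for w wx wy
  proof -
    have C: "C1_fun (w n) (wx n) (wy n)" for n using a by (simp add: H1_approx_def)
    have l: "(\<lambda>n. h1dist2 T (\<lambda>z. u (?F z)) ?ux ?uy (w n) (wx n) (wy n)) \<longlonglongrightarrow> 0" using a by (simp add: H1_approx_def)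
    let ?w = "\<lambda>n z. w n (?G z)" and ?wx = "\<lambda>n z. wx n (?G z)" and ?wy = "\<lambda>n z. - b / d * wx n (?G z) + 1 / d * wy n (?G z)"
    have uyeq: "- b / d * ux z + 1 / d * (b * ux z + d * uy z) = uy z" for z using d by (simp add: field_simps)
    have le: "h1dist2 (?F ` T) u ux uy (?w n) (?wx n) (?wy n)
       \<le> ((1 + 2 * (- b / d)\<^sup>2 + 2 * (1 / d)\<^sup>2) / \<bar>1 / d\<bar>) * h1dist2 T (\<lambda>z. u (?F z)) ?ux ?uy (w n) (wx n) (wy n)" for n
      using h1dist2_shear_le[OF d' T', of "- b / d" "\<lambda>z. u (?F z)" ?ux ?uy, unfolded GF, OF wgT C[of n]]
      unfolding inv(1) uyeq by simp
    have "(\<lambda>n. h1dist2 (?F ` T) u ux uy (?w n) (?wx n) (?wy n)) \<longlonglongrightarrow> 0"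
    proof (rule tendsto_sandwich[OF _ _ tendsto_const])
      show "(\<lambda>n. ((1 + 2 * (- b / d)\<^sup>2 + 2 * (1 / d)\<^sup>2) / \<bar>1 / d\<bar>) * h1dist2 T (\<lambda>z. u (?F z)) ?ux ?uy (w n) (wx n) (wy n)) \<longlonglongrightarrow> 0"
        by (rule tendsto_mult_right_zero[OF l])
    qed (intro always_eventually allI le h1dist2_nonneg)+
    then have "H1_approx (?F ` T) u ux uy ?w ?wx ?wy" unfolding H1_approx_def using C1_shear[OF C] by blast
    from tendsto_mult_right_zero[OF lim[OF this], of c] show ?thesis unfolding \<sigma> .
  qed
  then show ?thesis using wgT by blast
qed

lemma tri_shear: "tri (shear b d A, shear b d B, shear b d C) = shear b d ` tri (A, B, C)"
  unfolding tri_def fst_conv snd_conv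
  using convex_hull_linear_image[OF shear_linear, of b d "{A, B, C}"] by simp

text \<open>A linear map respects the parametrisation of segments, so only the length factor
  changes; for \<open>A = B\<close> both sides are 0.\<close>

lemma seg_int_shear:
  assumes d: "d \<noteq> 0"
  shows "seg_int A B f = (norm (B - A) / norm (shear b d B - shear b d A))
    * seg_int (shear b d A) (shear b d B) (\<lambda>z. f (shear (- b / d) (1 / d) z))"
proof (cases "A = B")
  case False
  then have "norm (shear b d B - shear b d A) \<noteq> 0" using inj_eq[OF shear_inj[OF d, of b]] by auto
  moreover have "shear (- b / d) (1 / d) (shear b d A + t *\<^sub>R (shear b d B - shear b d A)) = A + t *\<^sub>R (B - A)" for t
  proof -
    have "shear b d A + t *\<^sub>R (shear b d B - shear b d A) = shear b d (A + t *\<^sub>R (B - A))"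
      by (simp add: linear_add[OF shear_linear] linear_scale[OF shear_linear] linear_diff[OF shear_linear])
    then show ?thesis by (simp only: shear_inverse(2)[OF d])
  qed
  ultimately show ?thesis by (simp add: seg_int_def)
qed (simp add: seg_int_def)

lemma Vspace_shear:
  assumes d: "d \<noteq> 0" and V: "Vspace bc (shear b d A, shear b d B, shear b d C) u"
  shows "Vspace bc (A, B, C) (\<lambda>z. u (shear b d z))"
proof -
  let ?F = "shear b d" and ?T = "tri (A, B, C)"
  note T = compact_tri[of "(A, B, C)"]
  have H1: "H1 ?T (\<lambda>z. u (?F z))" if "H1 (?F ` ?T) u"
    using that weak_grad_shear[OF d T] unfolding H1_def by blast
  have tz: "trace_zero ?T P Q (\<lambda>z. u (?F z))" if "trace_zero (?F ` ?T) (?F P) (?F Q) u" for P Q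
    using that unfolding trace_zero_def
    by (rule trace_condition_shear[OF d T, rotated]) (rule seg_int_shear[OF d])
  have ez: "edge_int_zero ?T P Q (\<lambda>z. u (?F z))" if "edge_int_zero (?F ` ?T) (?F P) (?F Q) u" for P Q
    using that unfolding edge_int_zero_def
    by (rule trace_condition_shear[OF d T, rotated]) (rule seg_int_shear[OF d])
  show ?thesis
    using V H1 tz ez unfolding Vspace_def Let_def fst_conv snd_conv tri_shear by (cases bc) auto
qed

section \<open>Transfer of the eigenvalue problem\<close>

definition fw :: "real \<Rightarrow> pt \<Rightarrow> pt" where "fw \<theta> = shear (cos \<theta>) (sin \<theta>)"
definition bw :: "real \<Rightarrow> pt \<Rightarrow> pt" where "bw \<theta> = shear (- cos \<theta> / sin \<theta>) (1 / sin \<theta>)"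

definition pull :: "real \<Rightarrow> (pt \<Rightarrow> real) \<Rightarrow> (pt \<Rightarrow> real) \<Rightarrow> (pt \<Rightarrow> real) \<Rightarrow> h1" where
  "pull \<theta> u ux uy = mk (\<lambda>z. u (fw \<theta> z)) (\<lambda>z. ux (fw \<theta> z)) (\<lambda>z. cos \<theta> * ux (fw \<theta> z) + sin \<theta> * uy (fw \<theta> z))"

text \<open>The Dirichlet form of the triangle of angle \<open>\<theta>\<close>, pulled back to the reference triangle and divided by \<open>sin \<theta>\<close>.\<close>

definition form :: "real \<Rightarrow> h1 \<Rightarrow> h1 \<Rightarrow> real" where
  "form \<theta> U W = (1 / (1 + cos \<theta>)) * hd1 U W + (1 / (1 - cos \<theta>)) * hd2 U W"

text \<open>Elements with equal values differ by a null vector, and Cauchy-Schwarz makes every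
  pairing with a null vector vanish; so the choice of weak gradient is immaterial.\<close>

lemma same_value_forms:
  assumes "hv U = hv W"
  shows "hb U X = hb W X" "hd1 U X = hd1 W X" "hd2 U X = hd2 W X" "form \<theta> U X = form \<theta> W X"
proof -
  have "hd1 (U - W) (U - W) + hd2 (U - W) (U - W) + hb (U - W) (U - W) = 0" using same_value_hh[OF assms] by (simp add: hh_def)
  then have "hd1 (U - W) (U - W) = 0" "hd2 (U - W) (U - W) = 0"
    using hd1.nonneg[of "U - W"] hd2.nonneg[of "U - W"] hb.nonneg[of "U - W"] by linarith+
  then have "hd1 (U - W) X = 0" "hd2 (U - W) X = 0"
    using hd1.Cauchy_Schwarz[of "U - W" X] hd2.Cauchy_Schwarz[of "U - W" X] by auto
  then show "hd1 U X = hd1 W X" "hd2 U X = hd2 W X" by (simp_all add: hd1.diff_left hd2.diff_left)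
  then show "form \<theta> U X = form \<theta> W X" by (simp add: form_def)
  show "hb U X = hb W X" using assms by (simp add: hb_def)
qed

context
  fixes \<theta> :: real
  assumes \<theta>: "0 < \<theta>" "\<theta> < pi"
begin

lemma sin_pos: "0 < sin \<theta>"
  using \<theta> by (rule sin_gt_zero)

lemma cos_bounds: "0 < 1 + cos \<theta>" "0 < 1 - cos \<theta>"
proof -
  have "(cos \<theta>)\<^sup>2 < 1" using sin_pos sin_cos_squared_add[of \<theta>] zero_less_power[of "sin \<theta>" 2] by linarith
  then have "\<bar>cos \<theta>\<bar> < 1" by (simp add: abs_square_less_1)
  then show "0 < 1 + cos \<theta>" "0 < 1 - cos \<theta>" by auto
qed

lemma fw_bw: "fw \<theta> (bw \<theta> z) = z" "bw \<theta> (fw \<theta> z) = z"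
  unfolding fw_def bw_def using sin_pos by (intro shear_inverse; simp)+

lemma Ttheta_eq: "Ttheta \<theta> = (fw \<theta> (0,0), fw \<theta> (1,0), fw \<theta> (0,1))"
  by (simp add: Ttheta_def fw_def shear_def)

lemma tri_Ttheta: "tri (Ttheta \<theta>) = fw \<theta> ` K"
  unfolding Ttheta_eq unfolding fw_def by (rule tri_shear)

lemma K_bw: "K = bw \<theta> ` tri (Ttheta \<theta>)"
  by (simp add: tri_Ttheta image_image fw_bw)

lemma weak_grad_pull:
  assumes "weak_grad (tri (Ttheta \<theta>)) u ux uy"
  shows "weak_grad K (\<lambda>z. u (fw \<theta> z)) (\<lambda>z. ux (fw \<theta> z)) (\<lambda>z. cos \<theta> * ux (fw \<theta> z) + sin \<theta> * uy (fw \<theta> z))"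
  using assms sin_pos weak_grad_shear[of "sin \<theta>" K "cos \<theta>" u ux uy] compact_tri unfolding tri_Ttheta fw_def by simp

lemma pull_sel:
  assumes "weak_grad (tri (Ttheta \<theta>)) u ux uy"
  shows "hv (pull \<theta> u ux uy) = (\<lambda>z. u (fw \<theta> z))" "hx (pull \<theta> u ux uy) = (\<lambda>z. ux (fw \<theta> z))"
    "hy (pull \<theta> u ux uy) = (\<lambda>z. cos \<theta> * ux (fw \<theta> z) + sin \<theta> * uy (fw \<theta> z))"
  unfolding pull_def using mk_sel[OF weak_grad_pull[OF assms]] by auto

lemma weak_grad_push:
  "weak_grad (tri (Ttheta \<theta>)) (\<lambda>z. hv U (bw \<theta> z)) (\<lambda>z. hx U (bw \<theta> z))
     (\<lambda>z. - cos \<theta> / sin \<theta> * hx U (bw \<theta> z) + 1 / sin \<theta> * hy U (bw \<theta> z))"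
  using weak_grad_h1[of U] sin_pos
    weak_grad_shear[of "1 / sin \<theta>" "tri (Ttheta \<theta>)" "- cos \<theta> / sin \<theta>" "hv U" "hx U" "hy U", folded bw_def, folded K_bw]
    compact_tri by simp

lemma Vspace_pull:
  assumes "Vspace bc (Ttheta \<theta>) u"
  shows "Vspace bc Kref (\<lambda>z. u (fw \<theta> z))"
  using assms sin_pos unfolding Ttheta_eq unfolding fw_def by (intro Vspace_shear) auto

lemma Vspace_push:
  assumes "U \<in> Vset bc"
  shows "Vspace bc (Ttheta \<theta>) (\<lambda>z. hv U (bw \<theta> z))"
proof -
  have "Vspace bc (bw \<theta> (fw \<theta> (0,0)), bw \<theta> (fw \<theta> (1,0)), bw \<theta> (fw \<theta> (0,1))) (hv U)"
    using assms by (simp add: fw_bw Vspace_Kref_iff)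
  then show ?thesis unfolding Ttheta_eq unfolding bw_def using sin_pos by (intro Vspace_shear) auto
qed

lemma ip_Ttheta:
  assumes "L2 (tri (Ttheta \<theta>)) u" "L2 (tri (Ttheta \<theta>)) v"
  shows "ip (tri (Ttheta \<theta>)) u v = sin \<theta> * ip K (\<lambda>z. u (fw \<theta> z)) (\<lambda>z. v (fw \<theta> z))"
  using assms sin_pos ip_shear[of "sin \<theta>" K "cos \<theta>" u v] compact_tri unfolding tri_Ttheta fw_def by simp

lemma L2_fw: "L2 (tri (Ttheta \<theta>)) u \<Longrightarrow> L2 K (\<lambda>z. u (fw \<theta> z))"
  using sin_pos L2_shear[of "sin \<theta>" K "cos \<theta>" u] compact_tri unfolding tri_Ttheta fw_def by simp

lemma pull_hb:
  assumes "weak_grad (tri (Ttheta \<theta>)) u ux uy" "weak_grad (tri (Ttheta \<theta>)) v vx vy"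
  shows "ip (tri (Ttheta \<theta>)) u v = sin \<theta> * hb (pull \<theta> u ux uy) (pull \<theta> v vx vy)"
  using assms ip_Ttheta[of u v] by (simp add: hb_def pull_sel weak_grad_def)

text \<open>The pulled-back sum and difference of the derivatives are
  \<open>(1 + cos \<theta>) ux + sin \<theta> uy\<close> and
  \<open>(1 - cos \<theta>) ux - sin \<theta> uy\<close>. The two parts are kept apart because the
  derivative of the eigenvalue weights them differently.\<close>

lemma pull_hd:
  assumes "weak_grad (tri (Ttheta \<theta>)) u ux uy" "weak_grad (tri (Ttheta \<theta>)) v vx vy"
  defines "T \<equiv> tri (Ttheta \<theta>)"
  shows "2 * sin \<theta> * hd1 (pull \<theta> u ux uy) (pull \<theta> v vx vy) = (1 + cos \<theta>)\<^sup>2 * ip T ux vx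
      + (1 + cos \<theta>) * sin \<theta> * (ip T ux vy + ip T uy vx) + (sin \<theta>)\<^sup>2 * ip T uy vy"
    and "2 * sin \<theta> * hd2 (pull \<theta> u ux uy) (pull \<theta> v vx vy) = (1 - cos \<theta>)\<^sup>2 * ip T ux vx
      - (1 - cos \<theta>) * sin \<theta> * (ip T ux vy + ip T uy vx) + (sin \<theta>)\<^sup>2 * ip T uy vy"
proof -
  have L: "L2 T ux" "L2 T uy" "L2 T vx" "L2 T vy" using assms by (auto simp: weak_grad_def)
  note LK = L[unfolded T_def, THEN L2_fw]
  note I = ip_Ttheta[OF L(1)[unfolded T_def] L(3)[unfolded T_def]] ip_Ttheta[OF L(1)[unfolded T_def] L(4)[unfolded T_def]]
    ip_Ttheta[OF L(2)[unfolded T_def] L(3)[unfolded T_def]] ip_Ttheta[OF L(2)[unfolded T_def] L(4)[unfolded T_def]]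
  have e1: "(\<lambda>z. f (fw \<theta> z) + (cos \<theta> * f (fw \<theta> z) + sin \<theta> * g (fw \<theta> z))) = (\<lambda>z. (1 + cos \<theta>) * f (fw \<theta> z) + sin \<theta> * g (fw \<theta> z))" for f g :: "pt \<Rightarrow> real"
    by (auto simp: algebra_simps)
  have e2: "(\<lambda>z. f (fw \<theta> z) - (cos \<theta> * f (fw \<theta> z) + sin \<theta> * g (fw \<theta> z))) = (\<lambda>z. (1 - cos \<theta>) * f (fw \<theta> z) - sin \<theta> * g (fw \<theta> z))" for f g :: "pt \<Rightarrow> real"
    by (auto simp: algebra_simps)
  show "2 * sin \<theta> * hd1 (pull \<theta> u ux uy) (pull \<theta> v vx vy) = (1 + cos \<theta>)\<^sup>2 * ip T ux vx
      + (1 + cos \<theta>) * sin \<theta> * (ip T ux vy + ip T uy vx) + (sin \<theta>)\<^sup>2 * ip T uy vy"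
    unfolding hd1_def pull_sel[OF assms(1)] pull_sel[OF assms(2)] e1 T_def I using LK
    by (simp add: ip_add_left ip_add_right ip_cmult_left ip_cmult_right L2_cmult L2_add) (simp add: power2_eq_square algebra_simps)
  show "2 * sin \<theta> * hd2 (pull \<theta> u ux uy) (pull \<theta> v vx vy) = (1 - cos \<theta>)\<^sup>2 * ip T ux vx
      - (1 - cos \<theta>) * sin \<theta> * (ip T ux vy + ip T uy vx) + (sin \<theta>)\<^sup>2 * ip T uy vy"
    unfolding hd2_def pull_sel[OF assms(1)] pull_sel[OF assms(2)] e2 T_def I using LK
    by (simp add: ip_diff_left ip_diff_right ip_cmult_left ip_cmult_right L2_cmult L2_diff) (simp add: power2_eq_square algebra_simps)
qed

text \<open>With s^2 = (1 + c)(1 - c) each weighted part simplifies; the mixed terms cancel in the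
  sum and the coefficients 1 + c and 1 - c add up to 2.\<close>

lemma pull_form:
  assumes "weak_grad (tri (Ttheta \<theta>)) u ux uy" "weak_grad (tri (Ttheta \<theta>)) v vx vy"
  shows "ip (tri (Ttheta \<theta>)) ux vx + ip (tri (Ttheta \<theta>)) uy vy = sin \<theta> * form \<theta> (pull \<theta> u ux uy) (pull \<theta> v vx vy)"
proof -
  let ?U = "pull \<theta> u ux uy" and ?V = "pull \<theta> v vx vy"
  define P where "P = ip (tri (Ttheta \<theta>)) ux vx"
  define Q where "Q = ip (tri (Ttheta \<theta>)) ux vy + ip (tri (Ttheta \<theta>)) uy vx"
  define R where "R = ip (tri (Ttheta \<theta>)) uy vy"
  define s where "s = sin \<theta>"
  define c where "c = cos \<theta>"
  have sc: "s\<^sup>2 = (1 + c) * (1 - c)" using sin_cos_squared_add[of \<theta>] by (simp add: s_def c_def power2_eq_square algebra_simps)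
  have cb: "1 + c \<noteq> 0" "1 - c \<noteq> 0" using cos_bounds by (auto simp: c_def)
  have "2 * (s * form \<theta> ?U ?V) = (2 * s * hd1 ?U ?V) / (1 + c) + (2 * s * hd2 ?U ?V) / (1 - c)"
    by (simp add: form_def s_def c_def algebra_simps)
  also have "\<dots> = ((1 + c)\<^sup>2 * P + (1 + c) * s * Q + s\<^sup>2 * R) / (1 + c) + ((1 - c)\<^sup>2 * P - (1 - c) * s * Q + s\<^sup>2 * R) / (1 - c)"
    using pull_hd[OF assms] by (simp add: P_def Q_def R_def s_def c_def)
  also have "((1 + c)\<^sup>2 * P + (1 + c) * s * Q + s\<^sup>2 * R) / (1 + c) = (1 + c) * P + s * Q + (1 - c) * R"
    unfolding sc using cb by (simp add: field_simps power2_eq_square)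
  also have "((1 - c)\<^sup>2 * P - (1 - c) * s * Q + s\<^sup>2 * R) / (1 - c) = (1 - c) * P - s * Q + (1 + c) * R"
    unfolding sc using cb by (simp add: field_simps power2_eq_square)
  finally show ?thesis by (simp add: P_def R_def s_def algebra_simps)
qed

lemma pull_push:
  "hv (pull \<theta> (\<lambda>z. hv U (bw \<theta> z)) ux uy) = hv U" if "weak_grad (tri (Ttheta \<theta>)) (\<lambda>z. hv U (bw \<theta> z)) ux uy"
  using pull_sel(1)[OF that] by (simp add: fw_bw)

lemma eigenpair_pull:
  assumes ep: "eigenpair bc (Ttheta \<theta>) lam u" and wg: "weak_grad (tri (Ttheta \<theta>)) u ux uy"
  defines "U \<equiv> pull \<theta> u ux uy"
  shows "U \<in> Vset bc" "0 < lam" "\<And>W. W \<in> Vset bc \<Longrightarrow> form \<theta> U W = lam * hb U W"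
proof -
  let ?T = "tri (Ttheta \<theta>)"
  have V: "Vspace bc (Ttheta \<theta>) u" and "0 < lam"
    and eq: "\<And>v vx vy. Vspace bc (Ttheta \<theta>) v \<Longrightarrow> weak_grad ?T v vx vy \<Longrightarrow> ip ?T ux vx + ip ?T uy vy = lam * ip ?T u v"
    using ep wg unfolding eigenpair_def Let_def by blast+
  show "0 < lam" by fact
  show "U \<in> Vset bc" using Vspace_pull[OF V] pull_sel(1)[OF wg] Vspace_Kref_iff[of bc U] by (simp add: U_def)
  fix W assume W: "W \<in> Vset bc"
  note pw = weak_grad_push[of W]
  let ?W = "pull \<theta> (\<lambda>z. hv W (bw \<theta> z)) (\<lambda>z. hx W (bw \<theta> z)) (\<lambda>z. - cos \<theta> / sin \<theta> * hx W (bw \<theta> z) + 1 / sin \<theta> * hy W (bw \<theta> z))"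
  \<comment> \<open>Pulling back the pushed function returns the values of \<open>W\<close>, and the
    forms depend on nothing else.\<close>
  have same: "hv ?W = hv W" by (rule pull_push[OF pw])
  have "sin \<theta> * form \<theta> U ?W = lam * (sin \<theta> * hb U ?W)"
    unfolding U_def pull_form[OF wg pw, symmetric] pull_hb[OF wg pw, symmetric] by (rule eq[OF Vspace_push[OF W] pw])
  then have "form \<theta> U ?W = lam * hb U ?W" using sin_pos by simp
  moreover have "form \<theta> U ?W = form \<theta> U W" "hb U ?W = hb U W"
    using same_value_forms[OF same] hd1.commute[of U] hd2.commute[of U] hb.commute[of U] by (simp_all add: form_def)
  ultimately show "form \<theta> U W = lam * hb U W" by simp
qed

text \<open>\<open>eigenpair\<close> quantifies over all weak gradients of both functions; as the
  forms depend on values only, the equation for the gradient carried by \<open>U\<close>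
  suffices.\<close>

lemma eigenpair_push:
  assumes U: "U \<in> Vset bc" and "0 < lam" and nz: "hb U U \<noteq> 0"
    and eq: "\<And>W. W \<in> Vset bc \<Longrightarrow> form \<theta> U W = lam * hb U W"
  shows "eigenpair bc (Ttheta \<theta>) lam (\<lambda>z. hv U (bw \<theta> z))"
  unfolding eigenpair_def Let_def
proof (intro conjI allI impI)
  let ?T = "tri (Ttheta \<theta>)"
  note pu = weak_grad_push[of U]
  show "0 < lam" by fact
  show "Vspace bc (Ttheta \<theta>) (\<lambda>z. hv U (bw \<theta> z))" by (rule Vspace_push[OF U])
  show "ip ?T (\<lambda>z. hv U (bw \<theta> z)) (\<lambda>z. hv U (bw \<theta> z)) \<noteq> 0"
    unfolding pull_hb[OF pu pu] hb_def pull_push[OF pu] using nz sin_pos by (simp add: hb_def)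
  fix ux uy v vx vy
  assume "weak_grad ?T (\<lambda>z. hv U (bw \<theta> z)) ux uy \<and> Vspace bc (Ttheta \<theta>) v \<and> weak_grad ?T v vx vy"
  then have wu: "weak_grad ?T (\<lambda>z. hv U (bw \<theta> z)) ux uy" and V: "Vspace bc (Ttheta \<theta>) v" and wv: "weak_grad ?T v vx vy" by auto
  let ?U = "pull \<theta> (\<lambda>z. hv U (bw \<theta> z)) ux uy" and ?V = "pull \<theta> v vx vy"
  have "?V \<in> Vset bc" using Vspace_pull[OF V] pull_sel(1)[OF wv] Vspace_Kref_iff[of bc ?V] by simp
  from eq[OF this] have "form \<theta> ?U ?V = lam * hb ?U ?V"
    using same_value_forms[OF pull_push[OF wu]] by simp
  then show "ip ?T ux vx + ip ?T uy vy = lam * ip ?T (\<lambda>z. hv U (bw \<theta> z)) v"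
    using pull_form[OF wu wv] pull_hb[OF wu wv] by simp
qed

lemma ip_push: "ip (tri (Ttheta \<theta>)) (\<lambda>z. hv U (bw \<theta> z)) (\<lambda>z. hv W (bw \<theta> z)) = sin \<theta> * hb U W"
  using pull_hb[OF weak_grad_push[of U] weak_grad_push[of W]] unfolding hb_def pull_push[OF weak_grad_push] .

section \<open>Identification of the k-th eigenvalue and of simplicity\<close>

lemma semi_inner_form: "semi_inner (form \<theta>)"
  unfolding form_def[abs_def] using cos_bounds
  by (intro semi_inner_lincomb semi_inner_hd1 semi_inner_hd2) auto

lemma compact_form_pair_form: "compact_form_pair (form \<theta>) hb (Vset bc)"
  unfolding form_def[abs_def] using cos_bounds
  by (intro form_family.compact_form_pair_weighted[OF form_family_Vset]) auto

text \<open>\<open>eig\<close> counts from 1, families from 0. The pushed eigenvectors show that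
  \<open>\<mu> k\<close> belongs to the set of bounds; conversely, any competing orthonormal set of
  eigenfunctions pulls back to a trial space on which the Rayleigh quotient is at most
  \<open>m\<close>.\<close>

lemma eig_eq:
  assumes u: "eigen_family (form \<theta>) hb (Vset bc) (Suc k) u \<mu>"
  shows "eig bc (Ttheta \<theta>) (Suc k) = \<mu> k"
  unfolding eig_def
proof (rule cInf_eq_minimum)
  interpret A: compact_form_pair "form \<theta>" hb "Vset bc" by (rule compact_form_pair_form)
  let ?T = "tri (Ttheta \<theta>)"
  have on: "\<And>i. i < Suc k \<Longrightarrow> u i \<in> Vset bc" "\<And>i j. i < Suc k \<Longrightarrow> j < Suc k \<Longrightarrow> hb (u i) (u j) = (if i = j then 1 else 0)"
    and eg: "\<And>i. i < Suc k \<Longrightarrow> 0 < \<mu> i" "\<And>i W. i < Suc k \<Longrightarrow> W \<in> Vset bc \<Longrightarrow> form \<theta> (u i) W = \<mu> i * hb (u i) W"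
    using u by (auto simp: eigen_family_def orthonormal_family_def)
  \<comment> \<open>The mass form is scaled by \<open>sin \<theta>\<close> on passing to the
    triangle; this factor restores orthonormality.\<close>
  define c where "c = 1 / sqrt (sin \<theta>)"
  have c: "c * c * sin \<theta> = 1" "c \<noteq> 0" using sin_pos by (auto simp: c_def)
  define \<phi> where "\<phi> i = (\<lambda>z. hv (c *\<^sub>R u i) (bw \<theta> z))" for i
  have ip: "ip ?T (\<phi> i) (\<phi> j) = (if i = j then 1 else 0)" if "i < Suc k" "j < Suc k" for i j
    unfolding \<phi>_def ip_push using on(2)[OF that] c by (auto simp: hb.bilinear_simps algebra_simps)
  \<comment> \<open>\<open>eig\<close> asks for a set with a given number of elements;
    orthonormality makes the pushed functions pairwise distinct.\<close>
  have inj: "inj_on \<phi> {..<Suc k}"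
  proof (rule inj_onI)
    fix i j assume ij: "i \<in> {..<Suc k}" "j \<in> {..<Suc k}" "\<phi> i = \<phi> j"
    then have "ip ?T (\<phi> i) (\<phi> j) = 1" using ip[of j j] by simp
    then show "i = j" using ip[of i j] ij by (auto split: if_splits)
  qed
  have ep: "eigenpair bc (Ttheta \<theta>) (\<mu> i) (\<phi> i)" if "i < Suc k" for i
    unfolding \<phi>_def
  proof (rule eigenpair_push)
    show "c *\<^sub>R u i \<in> Vset bc" using on(1)[OF that] subspace_Vset by (intro subspace_scale)
    show "0 < \<mu> i" by (rule eg(1)[OF that])
    show "hb (c *\<^sub>R u i) (c *\<^sub>R u i) \<noteq> 0" using on(2)[OF that that] c by (simp add: hb.bilinear_simps)
    show "form \<theta> (c *\<^sub>R u i) W = \<mu> i * hb (c *\<^sub>R u i) W" if "W \<in> Vset bc" for W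
      using eg(2)[OF \<open>i < Suc k\<close> that] by (simp add: A.A.scale_left hb.scale_left)
  qed
  show "\<mu> k \<in> {\<mu>. \<exists>S. finite S \<and> card S = Suc k \<and> (\<forall>u\<in>S. \<exists>lam\<le>\<mu>. eigenpair bc (Ttheta \<theta>) lam u) \<and>
      (\<forall>u\<in>S. \<forall>v\<in>S. ip ?T u v = (if u = v then 1 else 0))}"
  proof (intro CollectI exI[of _ "\<phi> ` {..<Suc k}"] conjI ballI)
    show "finite (\<phi> ` {..<Suc k})" by simp
    show "card (\<phi> ` {..<Suc k}) = Suc k" using inj by (simp add: card_image)
    show "\<exists>lam\<le>\<mu> k. eigenpair bc (Ttheta \<theta>) lam v" if v: "v \<in> \<phi> ` {..<Suc k}" for v
    proof -
      obtain i where i: "i < Suc k" "v = \<phi> i" using v by auto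
      then have "\<mu> i \<le> \<mu> k" using A.eigen_family_mono[OF u, of i k] by simp
      then show ?thesis using ep[OF i(1)] i(2) by blast
    qed
    show "ip ?T v w = (if v = w then 1 else 0)" if "v \<in> \<phi> ` {..<Suc k}" "w \<in> \<phi> ` {..<Suc k}" for v w
      using that ip inj_onD[OF inj] by auto
  qed
next
  interpret A: compact_form_pair "form \<theta>" hb "Vset bc" by (rule compact_form_pair_form)
  let ?T = "tri (Ttheta \<theta>)"
  fix m assume "m \<in> {\<mu>. \<exists>S. finite S \<and> card S = Suc k \<and> (\<forall>u\<in>S. \<exists>lam\<le>\<mu>. eigenpair bc (Ttheta \<theta>) lam u) \<and>
      (\<forall>u\<in>S. \<forall>v\<in>S. ip ?T u v = (if u = v then 1 else 0))}"
  then obtain S where S: "finite S" "card S = Suc k" "\<forall>u\<in>S. \<exists>lam\<le>m. eigenpair bc (Ttheta \<theta>) lam u"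
    "\<forall>u\<in>S. \<forall>v\<in>S. ip ?T u v = (if u = v then 1 else 0)" by blast
  obtain h where h: "bij_betw h {..<Suc k} S"
    using S(1,2) by (metis card_lessThan finite_lessThan finite_same_card_bij)
  have hS: "h i \<in> S" if "i < Suc k" for i using h that by (auto simp: bij_betw_def)
  have hinj: "h i = h j \<longleftrightarrow> i = j" if "i < Suc k" "j < Suc k" for i j
    using h that by (auto simp: bij_betw_def inj_on_def)
  have "\<forall>i. \<exists>lam. i < Suc k \<longrightarrow> lam \<le> m \<and> eigenpair bc (Ttheta \<theta>) lam (h i)" using S(3) hS by blast
  then obtain \<nu> where \<nu>: "\<And>i. i < Suc k \<Longrightarrow> \<nu> i \<le> m" "\<And>i. i < Suc k \<Longrightarrow> eigenpair bc (Ttheta \<theta>) (\<nu> i) (h i)" by metis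
  have "\<forall>i. \<exists>g. i < Suc k \<longrightarrow> weak_grad ?T (h i) (fst g) (snd g)"
    using \<nu>(2) unfolding eigenpair_def Vspace_def Let_def H1_def by (metis fst_conv snd_conv)
  then obtain g where g: "\<And>i. i < Suc k \<Longrightarrow> weak_grad ?T (h i) (fst (g i)) (snd (g i))" by metis
  define e where "e i = sqrt (sin \<theta>) *\<^sub>R pull \<theta> (h i) (fst (g i)) (snd (g i))" for i
  have on: "orthonormal_family hb (Vset bc) (Suc k) e"
    unfolding orthonormal_family_def
  proof (intro conjI allI impI)
    show "e i \<in> Vset bc" if "i < Suc k" for i
      unfolding e_def using eigenpair_pull(1)[OF \<nu>(2)[OF that] g[OF that]] subspace_Vset by (intro subspace_scale)
    show "hb (e i) (e j) = (if i = j then 1 else 0)" if "i < Suc k" "j < Suc k" for i j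
    proof -
      have "hb (e i) (e j) = sin \<theta> * hb (pull \<theta> (h i) (fst (g i)) (snd (g i))) (pull \<theta> (h j) (fst (g j)) (snd (g j)))"
        using sin_pos by (simp add: e_def hb.bilinear_simps)
      also have "\<dots> = ip ?T (h i) (h j)" using pull_hb[OF g[OF that(1)] g[OF that(2)]] by simp
      also have "\<dots> = (if i = j then 1 else 0)" using S(4) hS[OF that(1)] hS[OF that(2)] hinj[OF that] by simp
      finally show ?thesis .
    qed
  qed
  show "\<mu> k \<le> m"
  proof (rule A.eigen_family_minmax_lower[OF u on])
    fix c
    show "form \<theta> (\<Sum>j<Suc k. c j *\<^sub>R e j) (\<Sum>j<Suc k. c j *\<^sub>R e j) \<le> m * hb (\<Sum>j<Suc k. c j *\<^sub>R e j) (\<Sum>j<Suc k. c j *\<^sub>R e j)"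
    proof (rule orthonormal_eigen_comb_le[OF semi_inner_form semi_inner_hb subspace_Vset on _ \<nu>(1)])
      fix i v assume i: "i < Suc k" and v: "v \<in> Vset bc"
      show "form \<theta> (e i) v = \<nu> i * hb (e i) v"
        using eigenpair_pull(3)[OF \<nu>(2)[OF i] g[OF i] v] by (simp add: e_def A.A.scale_left hb.scale_left)
    qed
  qed
qed

text \<open>If \<open>Z\<close> were not null, then \<open>Z\<close> and \<open>U\<close>,
  normalised and pushed to the triangle, would be two orthonormal eigenfunctions, which simplicity
  excludes.\<close>

lemma simple_eig_pull:
  assumes simple: "simple_eig bc (Ttheta \<theta>) lam" and U: "U \<in> Vset bc" "hb U U \<noteq> 0" "\<And>W. W \<in> Vset bc \<Longrightarrow> form \<theta> U W = lam * hb U W"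
    and Z: "Z \<in> Vset bc" "\<And>W. W \<in> Vset bc \<Longrightarrow> form \<theta> Z W = lam * hb Z W" and orth: "hb Z U = 0"
  shows "hb Z Z = 0"
proof (rule ccontr)
  assume nz: "hb Z Z \<noteq> 0"
  interpret A: semi_inner "form \<theta>" by (rule semi_inner_form)
  have "0 < lam" using simple by (auto simp: simple_eig_def eigenpair_def Let_def)
  have norm: "eigenpair bc (Ttheta \<theta>) lam (\<lambda>z. hv ((1 / sqrt (sin \<theta> * hb X X)) *\<^sub>R X) (bw \<theta> z))"
    "ip (tri (Ttheta \<theta>)) (\<lambda>z. hv ((1 / sqrt (sin \<theta> * hb X X)) *\<^sub>R X) (bw \<theta> z)) (\<lambda>z. hv ((1 / sqrt (sin \<theta> * hb X X)) *\<^sub>R X) (bw \<theta> z)) = 1"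
    if X: "X \<in> Vset bc" "hb X X \<noteq> 0" "\<And>W. W \<in> Vset bc \<Longrightarrow> form \<theta> X W = lam * hb X W" for X
  proof -
    have p: "0 < sin \<theta> * hb X X" using sin_pos X(2) hb.nonneg[of X] by (simp add: less_le)
    define c where "c = 1 / sqrt (sin \<theta> * hb X X)"
    have c: "c * c * (sin \<theta> * hb X X) = 1" "c \<noteq> 0" using p X(2) sin_pos by (auto simp: c_def)
    show "eigenpair bc (Ttheta \<theta>) lam (\<lambda>z. hv (c *\<^sub>R X) (bw \<theta> z))"
    proof (rule eigenpair_push)
      show "c *\<^sub>R X \<in> Vset bc" using X(1) subspace_Vset by (intro subspace_scale)
    qed (use X c \<open>0 < lam\<close> in \<open>auto simp: hb.bilinear_simps A.scale_left\<close>)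
    show "ip (tri (Ttheta \<theta>)) (\<lambda>z. hv (c *\<^sub>R X) (bw \<theta> z)) (\<lambda>z. hv (c *\<^sub>R X) (bw \<theta> z)) = 1"
      unfolding ip_push using c(1) by (simp only: hb.bilinear_simps mult_ac)
  qed
  have "ip (tri (Ttheta \<theta>)) (\<lambda>z. hv ((1 / sqrt (sin \<theta> * hb Z Z)) *\<^sub>R Z) (bw \<theta> z)) (\<lambda>z. hv ((1 / sqrt (sin \<theta> * hb U U)) *\<^sub>R U) (bw \<theta> z)) = 0"
    unfolding ip_push using orth by (simp add: hb.bilinear_simps)
  then show False
    using simple norm[OF Z(1) nz Z(2)] norm[OF U] unfolding simple_eig_def by blast
qed

end

theorem theorem3p6:
  fixes bc :: bctype and k :: nat and a b :: real
  assumes "1 \<le> k" and "0 \<le> a" and "a < b" and "b \<le> pi"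
    and "\<forall>\<theta>\<in>{a<..<b}. simple_eig bc (Ttheta \<theta>) (eig bc (Ttheta \<theta>) k)"
  shows "(\<forall>\<theta>\<in>{a<..<b}. (\<lambda>t. eig bc (Ttheta t) k) differentiable (at \<theta>)) \<and>
    (\<forall>\<theta>\<in>{a<..<b}. \<forall>u ux uy.
       eigenpair bc (Ttheta \<theta>) (eig bc (Ttheta \<theta>) k) u \<and>
       ip (tri (Ttheta \<theta>)) u u = 1 \<and> weak_grad (tri (Ttheta \<theta>)) u ux uy \<longrightarrow>
       ((\<lambda>t. eig bc (Ttheta t) k) has_real_derivative
          (- 2 * cot \<theta> * ip (tri (Ttheta \<theta>)) uy uy + 2 * ip (tri (Ttheta \<theta>)) ux uy)) (at \<theta>))"
proof -
  obtain k' where k': "k = Suc k'" using \<open>1 \<le> k\<close> by (cases k) auto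
  define ev where "ev t = eig bc (Ttheta t) k" for t
  interpret form_family hd1 hd2 hb "Vset bc" by (rule form_family_Vset)
  let ?f = "\<lambda>t. 1 / (1 + cos t)" and ?g = "\<lambda>t. 1 / (1 - cos t)"
  \<comment> \<open>Families exist for all angles between 0 and pi, so the abstract theorem is
    applied on that whole interval and simplicity enters only at the angle considered.\<close>
  have fam: "\<exists>u \<mu>. eigen_family (\<lambda>x y. ?f t * hd1 x y + ?g t * hd2 x y) hb (Vset bc) (Suc k') u \<mu> \<and> ev t = \<mu> k'"
    if t: "t \<in> {0<..<pi}" for t
  proof -
    from t have t': "0 < t" "t < pi" by auto
    interpret A: compact_form_pair "form t" hb "Vset bc" by (rule compact_form_pair_form[OF t'])
    obtain u \<mu> where u: "eigen_family (form t) hb (Vset bc) (Suc k') u \<mu>" using A.exists_eigen_family by blast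
    then show ?thesis using eig_eq[OF t' u] by (auto simp: ev_def k' form_def[abs_def])
  qed
  have core: "(ev has_real_derivative (- 2 * cot \<theta> * ip (tri (Ttheta \<theta>)) uy uy + 2 * ip (tri (Ttheta \<theta>)) ux uy)) (at \<theta>)"
    if \<theta>: "\<theta> \<in> {a<..<b}" and ep: "eigenpair bc (Ttheta \<theta>) (ev \<theta>) u" and u1: "ip (tri (Ttheta \<theta>)) u u = 1"
      and wg: "weak_grad (tri (Ttheta \<theta>)) u ux uy" for \<theta> u ux uy
  proof -
    have \<theta>': "0 < \<theta>" "\<theta> < pi" using \<theta> assms by auto
    define U where "U = pull \<theta> u ux uy"
    define s where "s = sin \<theta>"
    define c where "c = cos \<theta>"
    have s: "s > 0" using sin_pos[OF \<theta>'] by (simp add: s_def)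
    have cb: "1 + c > 0" "1 - c > 0" using cos_bounds[OF \<theta>'] by (auto simp: c_def)
    have sc: "s * s = (1 + c) * (1 - c)" using sin_cos_squared_add[of \<theta>] by (simp add: s_def c_def power2_eq_square algebra_simps)
    have hbU: "s * hb U U = 1" using pull_hb[OF \<theta>' wg wg] u1 by (simp add: U_def s_def)
    note UE = eigenpair_pull[OF \<theta>' ep wg, folded U_def]
    have simple: "simple_eig bc (Ttheta \<theta>) (ev \<theta>)" using assms(5) \<theta> by (auto simp: ev_def)
    have "(ev has_real_derivative ((s / (1 + c)\<^sup>2) * hd1 U U + (- s / (1 - c)\<^sup>2) * hd2 U U) / hb U U) (at \<theta>)"
    proof (rule simple_eigenvalue_has_derivative[where J="{0<..<pi}" and k=k' and f="?f" and g="?g"])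
      show "0 < ?f t" "0 < ?g t" if "t \<in> {0<..<pi}" for t using cos_bounds[of t] that by auto
      show "(?f has_real_derivative s / (1 + c)\<^sup>2) (at \<theta>)"
        using cb by (auto intro!: derivative_eq_intros simp: s_def c_def power2_eq_square)
      show "(?g has_real_derivative - s / (1 - c)\<^sup>2) (at \<theta>)"
        using cb by (auto intro!: derivative_eq_intros simp: s_def c_def power2_eq_square)
      show "U \<in> Vset bc" by (rule UE(1))
      show "hb U U \<noteq> 0" using hbU by auto
      show "?f \<theta> * hd1 U v + ?g \<theta> * hd2 U v = ev \<theta> * hb U v" if "v \<in> Vset bc" for v
        using UE(3)[OF that] by (simp add: form_def)
      show "hb z z = 0" if "z \<in> Vset bc" "\<And>v. v \<in> Vset bc \<Longrightarrow> ?f \<theta> * hd1 z v + ?g \<theta> * hd2 z v = ev \<theta> * hb z v" "hb z U = 0" for z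
      proof (rule simple_eig_pull[OF \<theta>' simple UE(1) _ UE(3) that(1) _ that(3)])
        show "hb U U \<noteq> 0" using hbU by auto
        show "form \<theta> z W = ev \<theta> * hb z W" if "W \<in> Vset bc" for W
          using \<open>\<And>v. v \<in> Vset bc \<Longrightarrow> ?f \<theta> * hd1 z v + ?g \<theta> * hd2 z v = ev \<theta> * hb z v\<close>[OF that] by (simp add: form_def)
      qed
    qed (use fam \<theta>' in auto)
    moreover have "((s / (1 + c)\<^sup>2) * hd1 U U + (- s / (1 - c)\<^sup>2) * hd2 U U) / hb U U
       = - 2 * cot \<theta> * ip (tri (Ttheta \<theta>)) uy uy + 2 * ip (tri (Ttheta \<theta>)) ux uy"
    proof -
      define P where "P = ip (tri (Ttheta \<theta>)) ux ux"
      define Q where "Q = ip (tri (Ttheta \<theta>)) ux uy"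
      define R where "R = ip (tri (Ttheta \<theta>)) uy uy"
      have h1: "2 * s * hd1 U U = (1 + c)\<^sup>2 * P + 2 * ((1 + c) * s * Q) + s\<^sup>2 * R"
        and h2: "2 * s * hd2 U U = (1 - c)\<^sup>2 * P - 2 * ((1 - c) * s * Q) + s\<^sup>2 * R"
        using pull_hd[OF \<theta>' wg wg] ip_commute[of _ uy ux] by (auto simp: U_def P_def Q_def R_def s_def c_def)
      \<comment> \<open>Both fractions are reduced with s^2 = (1 + c)(1 - c). The terms
        \<open>P\<close> then agree and cancel in the difference, which is why the energy of the
        x-derivative is absent from the formula.\<close>
      have x1: "2 * s * hd1 U U / (1 + c)\<^sup>2 = P + 2 * (s * Q) / (1 + c) + (1 - c) * R / (1 + c)"
        unfolding h1 power2_eq_square sc using cb by (simp add: field_simps)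
      have x2: "2 * s * hd2 U U / (1 - c)\<^sup>2 = P - 2 * (s * Q) / (1 - c) + (1 + c) * R / (1 - c)"
        unfolding h2 power2_eq_square sc using cb by (simp add: field_simps)
      have "hb U U = 1 / s" using hbU s by (simp add: field_simps)
      then have "((s / (1 + c)\<^sup>2) * hd1 U U + (- s / (1 - c)\<^sup>2) * hd2 U U) / hb U U
        = s / 2 * (2 * s * hd1 U U / (1 + c)\<^sup>2 - 2 * s * hd2 U U / (1 - c)\<^sup>2)"
        using s by (simp add: algebra_simps)
      also have "\<dots> = s / 2 * ((2 * (s * Q) / (1 + c) + 2 * (s * Q) / (1 - c)) + ((1 - c) * R / (1 + c) - (1 + c) * R / (1 - c)))"
        unfolding x1 x2 by simp
      also have "2 * (s * Q) / (1 + c) + 2 * (s * Q) / (1 - c) = 4 * s * Q / (s * s)"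
        unfolding sc using cb by (simp add: field_simps)
      also have "(1 - c) * R / (1 + c) - (1 + c) * R / (1 - c) = - 4 * c * R / (s * s)"
        unfolding sc using cb by (simp add: field_simps)
      also have "s / 2 * (4 * s * Q / (s * s) + - 4 * c * R / (s * s)) = - 2 * (c / s) * R + 2 * Q"
        using s by (simp add: field_simps)
      finally show ?thesis by (simp add: cot_def s_def c_def Q_def R_def)
    qed
    ultimately show ?thesis by simp
  qed
  \<comment> \<open>Differentiability is claimed without naming an eigenfunction, so a normalised
    one with an explicit weak gradient is produced first: pull back, rescale, push forward.\<close>
  have diff: "ev differentiable (at \<theta>)" if \<theta>: "\<theta> \<in> {a<..<b}" for \<theta>
  proof -
    have \<theta>': "0 < \<theta>" "\<theta> < pi" using \<theta> assms by auto
    interpret A: semi_inner "form \<theta>" by (rule semi_inner_form[OF \<theta>'])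
    obtain u where u: "eigenpair bc (Ttheta \<theta>) (ev \<theta>) u"
      using assms(5) \<theta> unfolding ev_def simple_eig_def by blast
    then obtain ux uy where wg: "weak_grad (tri (Ttheta \<theta>)) u ux uy"
      by (auto simp: eigenpair_def Vspace_def Let_def H1_def)
    note UE = eigenpair_pull[OF \<theta>' u wg]
    define U where "U = pull \<theta> u ux uy"
    have "ip (tri (Ttheta \<theta>)) u u \<noteq> 0" using u by (simp add: eigenpair_def Let_def)
    then have nz: "hb U U \<noteq> 0" using pull_hb[OF \<theta>' wg wg] by (auto simp: U_def)
    have p: "0 < sin \<theta> * hb U U" using sin_pos[OF \<theta>'] nz hb.nonneg[of U] by (simp add: less_le)
    define c where "c = 1 / sqrt (sin \<theta> * hb U U)"
    have c: "c * c * (sin \<theta> * hb U U) = 1" "c \<noteq> 0" using p nz sin_pos[OF \<theta>'] by (auto simp: c_def)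
    have "eigenpair bc (Ttheta \<theta>) (ev \<theta>) (\<lambda>z. hv (c *\<^sub>R U) (bw \<theta> z))"
    proof (rule eigenpair_push[OF \<theta>'])
      show "c *\<^sub>R U \<in> Vset bc" unfolding U_def using UE(1) subspace_Vset by (intro subspace_scale)
      show "form \<theta> (c *\<^sub>R U) W = ev \<theta> * hb (c *\<^sub>R U) W" if "W \<in> Vset bc" for W
        using UE(3)[OF that] by (simp add: U_def A.scale_left hb.scale_left)
    qed (use UE(2) nz c in \<open>auto simp: hb.bilinear_simps\<close>)
    moreover have "ip (tri (Ttheta \<theta>)) (\<lambda>z. hv (c *\<^sub>R U) (bw \<theta> z)) (\<lambda>z. hv (c *\<^sub>R U) (bw \<theta> z)) = 1"
      unfolding ip_push[OF \<theta>'] using c(1) by (simp only: hb.bilinear_simps mult_ac)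
    ultimately show ?thesis
      unfolding real_differentiable_def using core[OF \<theta> _ _ weak_grad_push[OF \<theta>', of "c *\<^sub>R U"]] by blast
  qed
  have ev: "ev = (\<lambda>t. eig bc (Ttheta t) k)" by (simp add: ev_def fun_eq_iff)
  show ?thesis using core diff unfolding ev by blast
qed

end
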